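(* Let $\epsilon_0$ be a real number such that $\frac{\sqrt5-1}{2}<\epsilon_0<1$ and let $F:\,]-\infty,1[\,\to\mathbb R$ be a measurable function such that for all real $x,y$ with $0<x<y<\epsilon_0$, $$2F(U_1)+2F(U_2)-F(U_3)+2F(U_4)+2F(U_5)-F(U_6)+2F(U_7)+2F(U_8)-F(U_9)=E_3(x,y),$$ where each $U_i$ is evaluated at $(x,y)$. - If $F$ is continuous at $0$, then there exists $a\in\mathbb R$ such that $F=\mathrm{Li}_3+a\left(\mathcal L_3-\tfrac29\mathrm{Li}_3(1)\right)$ on $]-\infty,1[$. - If $F$ is differentiable at $0$, then $F=\mathrm{Li}_3$ on $]-\infty,1[$.
   Context: The functions $U_i$ are $$U_1=x,\quad U_2=y,\quad U_3=\frac{x}{y},\quad U_4=\frac{1-y}{1-x},\quad U_5=\frac{x(1-y)}{y(1-x)},\quad U_6=xy,$$ $$U_7=\frac{x(1-y)}{x-1},\quad U_8=\frac{1-y}{y(x-1)},\quad U_9=\frac{x(1-y)^2}{y(1-x)^2},$$ and $$E_3(x,y)=2\,\mathrm{Li}_3(1)-\log(y)^2\log\left(\frac{1-y}{1-x}\right)+\frac{\pi^2}{3}\log(y)+\frac13\log(y)^3 .$$ $\mathrm{Li}_n$ is the $n$-th polylogarithm, $\mathrm{Li}_n(z)=\sum_{k\ge1}z^k/k^n$ for $|z|<1$, analytically continued (real-valued) to $]-\infty,1[$; $\mathrm{Li}_1(z)=-\log(1-z)$ and $\mathrm{Li}_3(1)=\sum_{k\ge1}1/k^3$. The function $\mathcal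 L_3$ is the single-valued version of the trilogarithm, $$\mathcal L_3(z)=\mathrm{Re}\left(\mathrm{Li}_3(z)-\log|z|\,\mathrm{Li}_2(z)+\tfrac13(\log|z|)^2\,\mathrm{Li}_1(z)\right),$$ extended by continuity with $\mathcal L_3(0)=0$; here it is restricted to $]-\infty,1[$. *)

theory Defs
  imports "HOL-Complex_Analysis.Complex_Analysis"
begin

definition slit_plane :: "complex set" where
  "slit_plane = - (of_real ` {1..})"

definition polylog_series :: "nat \<Rightarrow> complex \<Rightarrow> complex" where
  "polylog_series n z = (\<Sum>k. z ^ Suc k / of_nat (Suc k) ^ n)"

text \<open>
  The polylogarithm is the analytic continuation of its power series from the unit disc to the
  plane slit along the real half-line from 1 to infinity. Existence and uniqueness on the slit
  plane are proved below; the values chosen on the slit itself are unspecified.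
\<close>

definition polylog :: "nat \<Rightarrow> complex \<Rightarrow> complex" where
  "polylog n = (SOME g. g holomorphic_on slit_plane \<and>
                        (\<forall>z. norm z < 1 \<longrightarrow> g z = polylog_series n z))"

text \<open>
  On the real line, the value at 1 is the sum of the series (meaningful for n at least 2);
  arguments above 1 are outside the intended domain.
\<close>

definition Li :: "nat \<Rightarrow> real \<Rightarrow> real" where
  "Li n x = (if x = 1 then (\<Sum>k. 1 / real (Suc k) ^ n) else Re (polylog n (of_real x)))"

text \<open>
  The single-valued trilogarithm, given by its defining formula on the slit plane; its continuous
  extension across the slit is not needed here.
\<close>

definition sv_trilog :: "complex \<Rightarrow> real" where
  "sv_trilog z = (if z = 0 then 0
     else Re (polylog 3 z - of_real (ln (norm z)) * polylog 2 z
              + of_real ((ln (norm z))\<^sup>2 / 3) * polylog 1 z))"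

definition E3 :: "real \<Rightarrow> real \<Rightarrow> real" where
  "E3 x y = 2 * Li 3 1 - (ln y)\<^sup>2 * ln ((1 - y) / (1 - x)) + pi\<^sup>2 / 3 * ln y + (ln y) ^ 3 / 3"

lemma open_slit_plane: "open slit_plane"
proof -
  have "closed ((of_real :: real \<Rightarrow> complex) ` {1..})"
    by (intro closed_injective_linear_image) (auto intro!: bounded_linear.linear bounded_linear_of_real simp: inj_on_def)
  then show ?thesis by (simp add: slit_plane_def open_Compl)
qed

lemma slit_plane_scale:
  assumes "z \<in> slit_plane" "0 \<le> t" "t \<le> 1"
  shows "of_real t * z \<in> slit_plane"
proof (rule ccontr)
  assume "of_real t * z \<notin> slit_plane"
  then obtain r where r: "r \<ge> 1" "of_real t * z = of_real r"
    by (auto simp: slit_plane_def)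
  then have t: "t > 0" using assms by (cases "t = 0") auto
  then have "z = of_real (r / t)" using r by (auto simp: field_simps)
  moreover have "r / t \<ge> 1" using r t assms by (simp add: field_simps)
  ultimately show False using assms(1) unfolding slit_plane_def by blast
qed

lemma ball_subset_slit_plane: "ball 0 1 \<subseteq> slit_plane"
  by (auto simp: slit_plane_def)

lemma starlike_slit_plane: "starlike slit_plane"
  unfolding starlike_def
proof (intro bexI[of _ 0] ballI subsetI)
  show "0 \<in> slit_plane" by (auto simp: slit_plane_def)
next
  fix z w assume "z \<in> slit_plane" "w \<in> closed_segment 0 z"
  then show "w \<in> slit_plane"
    by (auto simp: closed_segment_def scaleR_conv_of_real intro: slit_plane_scale)
qed

definition polylog_coeff :: "nat \<Rightarrow> nat \<Rightarrow> complex" where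
  "polylog_coeff n k = (if k = 0 then 0 else 1 / of_nat k ^ n)"

lemma summable_polylog_coeff:
  assumes "norm z < 1"
  shows "summable (\<lambda>k. polylog_coeff n k * z ^ k)"
proof (rule summable_comparison_test[OF _ summable_geometric])
  have "norm (polylog_coeff n k) \<le> 1" for k
    by (auto simp: polylog_coeff_def norm_divide norm_power)
  then have "norm (polylog_coeff n k * z ^ k) \<le> norm z ^ k" for k
    by (simp add: norm_mult norm_power mult_left_le_one_le)
  then show "\<exists>N. \<forall>k\<ge>N. norm (polylog_coeff n k * z ^ k) \<le> norm z ^ k" by blast
qed (use assms in simp)

lemma polylog_series_coeff:
  assumes "norm z < 1"
  shows "polylog_series n z = (\<Sum>k. polylog_coeff n k * z ^ k)"
  using suminf_split_head[OF summable_polylog_coeff[OF assms, of n]]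
  by (simp add: polylog_series_def polylog_coeff_def)

lemma diffs_polylog_coeff:
  assumes "norm z < 1"
  shows "(\<Sum>k. polylog_coeff n k * z ^ k) = z * (\<Sum>k. diffs (polylog_coeff (Suc n)) k * z ^ k)"
proof -
  have e: "diffs (polylog_coeff (Suc n)) k = polylog_coeff n (Suc k)" for k
    by (simp add: diffs_def polylog_coeff_def del: of_nat_Suc)
  have "summable (\<lambda>k. diffs (polylog_coeff (Suc n)) k * z ^ k)"
    by (rule termdiff_converges[of _ 1]) (use assms summable_polylog_coeff in auto)
  then have "z * (\<Sum>k. diffs (polylog_coeff (Suc n)) k * z ^ k)
      = (\<Sum>k. polylog_coeff n (Suc k) * z ^ Suc k)"
    by (subst suminf_mult[symmetric]) (auto simp: e mult_ac)
  also have "\<dots> = (\<Sum>k. polylog_coeff n k * z ^ k)"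
    using suminf_split_head[OF summable_polylog_coeff[OF assms, of n]]
    by (simp add: polylog_coeff_def)
  finally show ?thesis by simp
qed

lemma polylog_continuation_exists:
  "\<exists>g. g holomorphic_on slit_plane \<and> (\<forall>z. norm z < 1 \<longrightarrow> g z = polylog_series n z)"
proof (induction n)
  case 0
  have "(\<lambda>z. z / (1 - z)) holomorphic_on slit_plane"
    by (intro holomorphic_intros) (auto simp: slit_plane_def image_iff dest!: bspec[of _ _ 1])
  moreover have "z / (1 - z) = polylog_series 0 z" if "norm z < 1" for z
    using that by (simp add: polylog_series_def suminf_mult suminf_geometric summable_geometric)
  ultimately show ?case by blast
next
  case (Suc n)
  then obtain g where g: "g holomorphic_on slit_plane"
    and gs: "\<And>z. norm z < 1 \<Longrightarrow> g z = polylog_series n z" by blast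
  define p where "p z = (\<Sum>k. polylog_coeff (Suc n) k * z ^ k)" for z
  define d where "d z = (\<Sum>k. diffs (polylog_coeff (Suc n)) k * z ^ k)" for z
  have dp: "(p has_field_derivative d z) (at z)" if "norm z < 1" for z
    unfolding p_def d_def using that summable_polylog_coeff by (intro termdiffs_strong') auto
  have "p holomorphic_on ball 0 1"
    using dp by (auto simp: holomorphic_on_open intro!: exI)
  then have "deriv p holomorphic_on ball 0 1" by (intro holomorphic_deriv) auto
  then have d: "d holomorphic_on ball 0 1"
    by (rule holomorphic_transform) (use dp in \<open>auto intro!: DERIV_imp_deriv\<close>)
  have gd: "g z = z * d z" if "norm z < 1" for z
    using gs[OF that] polylog_series_coeff[OF that, of n] diffs_polylog_coeff[OF that, of n]
    by (simp add: d_def)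
  define h where "h z = (if norm z < 1 then d z else g z / z)" for z
  have h1: "h holomorphic_on ball 0 1"
    using d by (rule holomorphic_transform) (auto simp: h_def)
  have "(\<lambda>z. g z / z) holomorphic_on (slit_plane - {0})"
    using g by (intro holomorphic_intros) (auto elim: holomorphic_on_subset)
  then have h2: "h holomorphic_on (slit_plane - {0})"
    by (rule holomorphic_transform) (auto simp: h_def gd)
  have "h holomorphic_on (ball 0 1 \<union> (slit_plane - {0}))"
    using h1 h2 open_slit_plane by (intro holomorphic_on_Un) auto
  moreover have "ball 0 1 \<union> (slit_plane - {0}) = slit_plane"
    using ball_subset_slit_plane by auto
  ultimately have h: "h holomorphic_on slit_plane" by simp
  obtain G where G: "\<And>z. z \<in> slit_plane \<Longrightarrow> (G has_field_derivative h z) (at z)"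
    using holomorphic_starlike_primitive[OF _ starlike_slit_plane open_slit_plane, of h "{}"] h
      holomorphic_on_imp_continuous_on[OF h] holomorphic_on_imp_differentiable_at[OF h open_slit_plane]
    by auto
  have "\<exists>c. \<forall>z\<in>ball 0 1. G z - p z = c"
  proof (rule has_field_derivative_zero_constant)
    fix z :: complex assume z: "z \<in> ball 0 1"
    have "((\<lambda>z. G z - p z) has_field_derivative (h z - d z)) (at z)"
      using z ball_subset_slit_plane by (intro DERIV_diff G dp) auto
    moreover have "h z - d z = 0" using z by (simp add: h_def)
    ultimately show "((\<lambda>z. G z - p z) has_field_derivative 0) (at z within ball 0 1)"
      by (metis has_field_derivative_at_within)
  qed simp
  then obtain c where c: "\<And>z. norm z < 1 \<Longrightarrow> G z - p z = c" by auto
  have "G holomorphic_on slit_plane"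
    using G open_slit_plane by (auto simp: holomorphic_on_open)
  then have "(\<lambda>z. G z - c) holomorphic_on slit_plane" by (intro holomorphic_intros)
  moreover have "G z - c = polylog_series (Suc n) z" if "norm z < 1" for z
    using c[OF that] polylog_series_coeff[OF that, of "Suc n"] by (simp add: p_def algebra_simps)
  ultimately show ?case by blast
qed

lemma holomorphic_polylog: "polylog n holomorphic_on slit_plane"
  and polylog_eq_series: "norm z < 1 \<Longrightarrow> polylog n z = polylog_series n z"
  using someI_ex[OF polylog_continuation_exists[of n]] by (auto simp: polylog_def)

lemma polylog_unique:
  assumes "g holomorphic_on slit_plane" "\<And>z. norm z < 1 \<Longrightarrow> g z = polylog_series n z"
    and "z \<in> slit_plane"
  shows "g z = polylog n z"
proof (rule analytic_continuation_open[of "ball 0 1" slit_plane g "polylog n"])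
  show "connected slit_plane" by (rule starlike_imp_connected[OF starlike_slit_plane])
qed (use assms open_slit_plane ball_subset_slit_plane holomorphic_polylog polylog_eq_series in auto)

lemma polylog_1:
  assumes "z \<in> slit_plane"
  shows "polylog 1 z = - Ln (1 - z)"
proof (rule polylog_unique[symmetric])
  show "(\<lambda>z. - Ln (1 - z)) holomorphic_on slit_plane"
  proof (intro holomorphic_intros)
    fix z assume z: "z \<in> slit_plane"
    show "1 - z \<notin> \<real>\<^sub>\<le>\<^sub>0"
    proof
      assume "1 - z \<in> \<real>\<^sub>\<le>\<^sub>0"
      then obtain r where r: "1 - z = of_real r" "r \<le> 0"
        by (auto elim!: nonpos_Reals_cases)
      then have "z = of_real (1 - r)" by (simp add: algebra_simps)
      moreover have "1 - r \<ge> 1" using r by simp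
      ultimately show False using z unfolding slit_plane_def by blast
    qed
  qed
  fix w :: complex assume w: "norm w < 1"
  have "(\<lambda>k. - (w ^ k / of_nat k)) = (\<lambda>k. - (polylog_coeff 1 k * w ^ k))"
    by (auto simp: polylog_coeff_def fun_eq_iff)
  then have "(\<lambda>k. - (polylog_coeff 1 k * w ^ k)) sums Ln (1 - w)"
    using Ln_series'[of "- w"] w by simp
  then have "(\<lambda>k. polylog_coeff 1 k * w ^ k) sums (- Ln (1 - w))"
    using sums_minus by fastforce
  then show "- Ln (1 - w) = polylog_series 1 w"
    using polylog_series_coeff[OF w, of 1] by (simp add: sums_unique)
qed fact

end

theory Submission imports Defs "HOL-Real_Asymp.Real_Asymp" begin

text \<open>
  Two solutions of the inhomogeneous equation differ by a solution \<open>g\<close> of \<open>kummer_sum g x y = 0\<close>.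
  One solution is \<open>Li 3\<close> (\<open>kummer_sum_Li3\<close>), and \<open>sv - 2/9 * Li 3 1\<close> solves the homogeneous equation
  (\<open>kummer_sum_sv\<close>); both facts follow by differentiating in \<open>x\<close> and evaluating at \<open>x \<rightarrow> 0\<close>. It remains to
  show that a measurable homogeneous solution which is continuous at 0 is a multiple of the latter.

  Regularity. For fixed \<open>x\<close>, every argument except \<open>x\<close> and \<open>y\<close> themselves has the form \<open>c x * v y\<close>.
  Integrating over \<open>y\<close> therefore writes \<open>g x\<close> as an average of dilates of \<open>g\<close>, and averages of dilates are
  smoother than \<open>g\<close>. On \<open>(0, e0)\<close> this turns measurability into continuity (\<open>isCont_left\<close>) and
  continuity into two derivatives (\<open>tame_g\<close>). Continuity and differentiability then spread to all
  \<open>t < 1\<close>, \<open>t \<noteq> 0\<close>, by solving the equation for one term at a time along suitable curves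
  (\<open>regular_everywhere\<close>).

  Boundary behaviour. Put \<open>f t = t * deriv g t\<close>. The limits \<open>x \<rightarrow> 0\<close> and \<open>x \<rightarrow> y\<close> of the equation are
  one-variable identities (\<open>reflection\<close>, \<open>duplication\<close>). The first-order terms on the diagonal involve
  the slope of \<open>g\<close> at 1, which exists and is 0 (\<open>slope_at_1_exists\<close>, \<open>slope_at_1\<close>); this gives
  \<open>inversion\<close>, and that \<open>g\<close> is odd at 0 up to \<open>o(x)\<close> (\<open>even_part_small\<close>).

  One free parameter. With \<open>q s = (g (exp s) - g 0) / exp s\<close>, the first-order expansion at \<open>x \<rightarrow> 0\<close> says
  that the second difference of \<open>q\<close> under the averaging operator \<open>mix y\<close> tends to
  \<open>2 * y * (1 - y) * (f y + f (1 - y))\<close>. For \<open>y = 1/2\<close> this is an ordinary second difference and forces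
  \<open>q s / s^2\<close> to converge, say to \<open>a\<close>; iterating \<open>mix y\<close> then shows that the limit for every \<open>y\<close> is
  \<open>2 * a * (entropy y)^2\<close> (\<open>reflection_defect\<close>). The function \<open>sv\<close> has a defect of just this form
  (\<open>theta_sv_reflection\<close>), so after subtracting a multiple of it \<open>f (1 - y) = - f y\<close>.

  Rigidity. For such an \<open>f\<close> the two partial derivatives of the equation become proportionalities between
  values of the five-term expression of the dilogarithm (\<open>five_term_relations\<close>). Its pentagon symmetry moves a
  maximum of its absolute value to a point where one of these proportionalities has a factor that
  contradicts maximality unless the maximum is 0 (\<open>five_term_eq_0\<close>). Hence \<open>f\<close> satisfies the five-term
  relation. Expanding that relation at 0 with the same averaging operators gives
  \<open>y * (1 - y) * deriv f y = - a * entropy y\<close>; since \<open>f\<close> vanishes at 0 and at 1/2, Rolle's theorem yields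
  \<open>a = 0\<close>, so \<open>f = 0\<close> and \<open>g = 0\<close> (\<open>vanishes\<close>).

  For the second claim it suffices that \<open>sv x / x\<close> is unbounded at 0 (\<open>sv_not_differentiable\<close>).
\<close>

section \<open>Dilations of a measurable function\<close>

lemma min1_triangle:
  fixes a b c d :: real
  assumes "\<bar>a\<bar> \<le> \<bar>b\<bar> + \<bar>c\<bar> + d"
  shows "min 1 \<bar>a\<bar> \<le> min 1 \<bar>b\<bar> + min 1 \<bar>c\<bar> + \<bar>d\<bar>"
  using assms by (auto simp: min_def abs_if)

text \<open>
  Truncation at 1 makes \<open>\<bar>g - k\<bar>\<close> integrable however large \<open>g\<close> is; the integral of \<open>min 1 \<bar>g - k\<bar>\<close> is the
  distance of convergence in measure. Since \<open>g\<close> is almost everywhere a limit of continuous functions, dominated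
  convergence makes this distance small.
\<close>
lemma approx_in_measure:
  fixes g :: "real \<Rightarrow> real"
  assumes g: "g \<in> borel_measurable (lebesgue_on {a..b})" and eps: "\<epsilon> > 0"
  obtains k where "continuous_on UNIV k"
    "(\<lambda>t. min 1 \<bar>g t - k t\<bar>) absolutely_integrable_on {a..b}"
    "integral {a..b} (\<lambda>t. min 1 \<bar>g t - k t\<bar>) < \<epsilon>"
proof -
  have ab: "{a..b} \<in> sets lebesgue" by simp
  have "g measurable_on {a..b}"
    using measurable_on_iff_borel_measurable[OF ab] g by blast
  then obtain N k where N: "negligible N" and k: "\<And>n. continuous_on UNIV (k n)"
    and lim: "\<And>x. x \<notin> N \<Longrightarrow> (\<lambda>n. k n x) \<longlonglongrightarrow> (if x \<in> {a..b} then g x else 0)"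
    unfolding measurable_on_def by blast
  define w where "w n t = min 1 \<bar>g t - k n t\<bar>" for n t
  have meas: "w n \<in> borel_measurable (lebesgue_on {a..b})" for n
  proof -
    have "k n \<in> borel_measurable (lebesgue_on {a..b})"
      by (rule continuous_imp_measurable_on_sets_lebesgue)
        (use continuous_on_subset[OF k] in auto)
    with g show ?thesis unfolding w_def by measurable
  qed
  have abs: "w n absolutely_integrable_on {a..b}" for n
    by (rule measurable_bounded_by_integrable_imp_absolutely_integrable[where g = "\<lambda>_. 1"])
      (use meas in \<open>auto simp: w_def\<close>)
  define u where "u n t = (if t \<in> N then 0 else w n t)" for n t
  have uw: "(u n has_integral i) {a..b} \<longleftrightarrow> (w n has_integral i) {a..b}" for n i
    by (rule has_integral_spike_eq[OF N]) (auto simp: u_def)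
  have int_u: "u n integrable_on {a..b}" for n
    using abs[of n] uw[of n] unfolding integrable_on_def absolutely_integrable_on_def by blast
  have eq: "integral {a..b} (u n) = integral {a..b} (w n)" for n
    using uw[of n] by (simp add: integral_def integrable_on_def)
  have "(\<lambda>n. integral {a..b} (u n)) \<longlonglongrightarrow> integral {a..b} (\<lambda>_. 0)"
  proof (rule dominated_convergence(2)[where h = "\<lambda>_. 1"])
    fix t assume t: "t \<in> {a..b}"
    show "(\<lambda>n. u n t) \<longlonglongrightarrow> 0"
    proof (cases "t \<in> N")
      case False
      then have "(\<lambda>n. k n t) \<longlonglongrightarrow> g t" using lim[OF False] t by simp
      then have "(\<lambda>n. min 1 \<bar>g t - k n t\<bar>) \<longlonglongrightarrow> min 1 \<bar>g t - g t\<bar>"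
        by (intro tendsto_intros)
      then show ?thesis using False by (simp add: u_def w_def)
    qed (simp add: u_def)
  qed (use int_u in \<open>auto simp: u_def w_def\<close>)
  then have "(\<lambda>n. integral {a..b} (w n)) \<longlonglongrightarrow> 0" by (simp add: eq)
  then have "\<forall>\<^sub>F n in sequentially. integral {a..b} (w n) < \<epsilon>"
    using eps by (rule order_tendstoD)
  then obtain n where "integral {a..b} (w n) < \<epsilon>"
    by (meson eventually_happens trivial_limit_sequentially)
  then show ?thesis using that[of "k n"] k abs[of n] by (simp add: w_def[abs_def])
qed

text \<open>
  Change of variables, where the Jacobian is bounded below by \<open>m\<close>.
\<close>
lemma integral_compose_le:
  fixes v v' w :: "real \<Rightarrow> real"
  assumes der: "\<And>y. y \<in> {\<alpha>..\<beta>} \<Longrightarrow> (v has_real_derivative v' y) (at y)"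
    and cont: "continuous_on {\<alpha>..\<beta>} v'" and inj: "inj_on v {\<alpha>..\<beta>}"
    and m: "m > 0" "\<And>y. y \<in> {\<alpha>..\<beta>} \<Longrightarrow> m \<le> \<bar>v' y\<bar>"
    and sub: "v ` {\<alpha>..\<beta>} \<subseteq> {a..b}"
    and w: "w absolutely_integrable_on {a..b}" and w0: "\<And>t. 0 \<le> w t"
  shows "(\<lambda>y. w (v y)) absolutely_integrable_on {\<alpha>..\<beta>}"
    and "integral {\<alpha>..\<beta>} (\<lambda>y. w (v y)) \<le> integral {a..b} w / m"
proof -
  have "continuous_on {\<alpha>..\<beta>} v"
    using der by (meson DERIV_continuous_on has_field_derivative_at_within)
  then have "compact (v ` {\<alpha>..\<beta>})" by (rule compact_continuous_image) simp
  then have meas: "v ` {\<alpha>..\<beta>} \<in> sets lebesgue" by (simp add: lmeasurable_compact fmeasurableD)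
  have wv: "w absolutely_integrable_on (v ` {\<alpha>..\<beta>})"
    using w meas sub by (rule set_integrable_subset)
  have cv: "(\<lambda>y. \<bar>v' y\<bar> * w (v y)) absolutely_integrable_on {\<alpha>..\<beta>} \<and>
      integral {\<alpha>..\<beta>} (\<lambda>y. \<bar>v' y\<bar> * w (v y)) = integral (v ` {\<alpha>..\<beta>}) w"
    by (subst has_absolute_integral_change_of_variables_1')
      (use der inj wv in \<open>auto intro: has_field_derivative_at_within\<close>)
  have v'0: "v' y \<noteq> 0" if "y \<in> {\<alpha>..\<beta>}" for y using m(1) m(2)[OF that] by auto
  have "(\<lambda>y. (1 / \<bar>v' y\<bar>) * (\<bar>v' y\<bar> * w (v y))) absolutely_integrable_on {\<alpha>..\<beta>}"
  proof (rule absolutely_integrable_bounded_measurable_product_real)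
    have c: "continuous_on {\<alpha>..\<beta>} (\<lambda>y. 1 / \<bar>v' y\<bar>)"
      using v'0 by (intro continuous_intros cont) auto
    then show "(\<lambda>y. 1 / \<bar>v' y\<bar>) \<in> borel_measurable (lebesgue_on {\<alpha>..\<beta>})"
      by (rule continuous_imp_measurable_on_sets_lebesgue) simp
    show "bounded ((\<lambda>y. 1 / \<bar>v' y\<bar>) ` {\<alpha>..\<beta>})"
      using c by (intro compact_imp_bounded compact_continuous_image) auto
  qed (use cv in auto)
  moreover have "(1 / \<bar>v' y\<bar>) * (\<bar>v' y\<bar> * w (v y)) = w (v y)" if "y \<in> {\<alpha>..\<beta>}" for y
    using v'0[OF that] by simp
  ultimately show ab: "(\<lambda>y. w (v y)) absolutely_integrable_on {\<alpha>..\<beta>}"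
    using set_integrable_cong[OF refl refl, of "{\<alpha>..\<beta>}" "\<lambda>y. (1 / \<bar>v' y\<bar>) * (\<bar>v' y\<bar> * w (v y))"
        "\<lambda>y. w (v y)" lebesgue] by blast
  have "m * integral {\<alpha>..\<beta>} (\<lambda>y. w (v y)) = integral {\<alpha>..\<beta>} (\<lambda>y. m * w (v y))" by simp
  also have "\<dots> \<le> integral {\<alpha>..\<beta>} (\<lambda>y. \<bar>v' y\<bar> * w (v y))"
  proof (rule integral_le)
    show "(\<lambda>y. m * w (v y)) integrable_on {\<alpha>..\<beta>}"
      using integrable_on_cmult_left[OF set_lebesgue_integral_eq_integral(1)[OF ab], of m] by simp
    show "(\<lambda>y. \<bar>v' y\<bar> * w (v y)) integrable_on {\<alpha>..\<beta>}"
      using cv set_lebesgue_integral_eq_integral(1) by blast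
  qed (use m w0 in \<open>auto intro!: mult_right_mono\<close>)
  also have "\<dots> = integral (v ` {\<alpha>..\<beta>}) w" using cv by blast
  also have "\<dots> \<le> integral {a..b} w"
    by (rule integral_subset_le[OF sub set_lebesgue_integral_eq_integral(1)[OF wv]
        set_lebesgue_integral_eq_integral(1)[OF w]]) (use w0 in blast)
  finally show "integral {\<alpha>..\<beta>} (\<lambda>y. w (v y)) \<le> integral {a..b} w / m"
    using m(1) by (simp add: field_simps)
qed

text \<open>
  For a continuous \<open>k\<close> in place of \<open>g\<close> the dilates converge uniformly. The two errors of that replacement are
  dilates of \<open>min 1 \<bar>g - k\<bar>\<close>, and \<open>integral_compose_le\<close> bounds their integrals uniformly for \<open>c\<close> near \<open>c0\<close>. The bound is
  phrased with a majorant \<open>w\<close> so that such estimates can be added before integrating.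
\<close>
lemma dilation_continuous_in_measure:
  fixes g v v' :: "real \<Rightarrow> real"
  assumes g: "g \<in> borel_measurable (lebesgue_on {..<1})" and eps: "\<epsilon> > 0"
    and der: "\<And>y. y \<in> {\<alpha>..\<beta>} \<Longrightarrow> (v has_real_derivative v' y) (at y)"
    and cont: "continuous_on {\<alpha>..\<beta>} v'" and inj: "inj_on v {\<alpha>..\<beta>}"
    and v'0: "\<And>y. y \<in> {\<alpha>..\<beta>} \<Longrightarrow> v' y \<noteq> 0"
    and c0: "c0 \<noteq> 0" "\<And>y. y \<in> {\<alpha>..\<beta>} \<Longrightarrow> c0 * v y < 1" and le: "\<alpha> < \<beta>"
  shows "\<forall>\<^sub>F c in at c0. \<exists>w. w integrable_on {\<alpha>..\<beta>} \<and> integral {\<alpha>..\<beta>} w < \<epsilon> \<and>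
           (\<forall>y\<in>{\<alpha>..\<beta>}. min 1 \<bar>g (c * v y) - g (c0 * v y)\<bar> \<le> w y)"
proof -
  have cv: "continuous_on {\<alpha>..\<beta>} v"
    using der by (meson DERIV_continuous_on has_field_derivative_at_within)
  have ne: "{\<alpha>..\<beta>} \<noteq> {}" using le by simp
  obtain ym where ym: "ym \<in> {\<alpha>..\<beta>}" "\<And>y. y \<in> {\<alpha>..\<beta>} \<Longrightarrow> c0 * v y \<le> c0 * v ym"
    using continuous_attains_sup[OF compact_Icc ne continuous_on_mult_left[OF cv, of c0]] by blast
  obtain yd where yd: "yd \<in> {\<alpha>..\<beta>}" "\<And>y. y \<in> {\<alpha>..\<beta>} \<Longrightarrow> \<bar>v' yd\<bar> \<le> \<bar>v' y\<bar>"
    using continuous_attains_inf[OF compact_Icc ne continuous_on_rabs[OF cont]] by blast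
  obtain B where B: "B > 0" "\<And>y. y \<in> {\<alpha>..\<beta>} \<Longrightarrow> \<bar>v y\<bar> \<le> B"
  proof -
    have "bounded (v ` {\<alpha>..\<beta>})" using cv by (intro compact_imp_bounded compact_continuous_image) auto
    then show thesis using that unfolding bounded_pos by auto
  qed
  define b where "b = (1 + c0 * v ym) / 2"
  have b: "b < 1" "c0 * v ym < b" using c0(2)[OF ym(1)] by (auto simp: b_def)
  define d where "d = \<bar>c0\<bar> / 2"
  have d: "d > 0" using c0 by (simp add: d_def)
  define m where "m = d * \<bar>v' yd\<bar>"
  have m: "m > 0" using d v'0[OF yd(1)] by (simp add: m_def)
  define a where "a = - (2 * \<bar>c0\<bar> * B)"
  have near: "\<forall>\<^sub>F c in at c0. \<bar>c\<bar> > d \<and> \<bar>c\<bar> < 2 * \<bar>c0\<bar> \<and> \<bar>c - c0\<bar> * B < b - c0 * v ym"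
  proof (intro eventually_conj)
    show "\<forall>\<^sub>F c in at c0. d < \<bar>c\<bar>" using c0
      by (intro order_tendstoD(1)[of _ "\<bar>c0\<bar>"] tendsto_intros) (auto simp: d_def)
    show "\<forall>\<^sub>F c in at c0. \<bar>c\<bar> < 2 * \<bar>c0\<bar>" using c0
      by (intro order_tendstoD(2)[of _ "\<bar>c0\<bar>"] tendsto_intros) (auto simp: d_def)
    have "((\<lambda>c. \<bar>c - c0\<bar> * B) \<longlongrightarrow> \<bar>c0 - c0\<bar> * B) (at c0)" by (intro tendsto_intros)
    then show "\<forall>\<^sub>F c in at c0. \<bar>c - c0\<bar> * B < b - c0 * v ym"
      by (rule order_tendstoD(2)) (use b in simp)
  qed
  have rng: "c * v y \<in> {a..b}" if "\<bar>c\<bar> < 2 * \<bar>c0\<bar>" "\<bar>c - c0\<bar> * B < b - c0 * v ym"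
    "y \<in> {\<alpha>..\<beta>}" for c y
  proof -
    have "\<bar>c * v y\<bar> \<le> 2 * \<bar>c0\<bar> * B" unfolding abs_mult
      by (rule mult_mono) (use that B(2)[OF that(3)] B(1) in auto)
    moreover have "c * v y = c0 * v y + (c - c0) * v y" by (simp add: algebra_simps)
    moreover have "(c - c0) * v y \<le> \<bar>c - c0\<bar> * B"
    proof -
      have "(c - c0) * v y \<le> \<bar>c - c0\<bar> * \<bar>v y\<bar>" unfolding abs_mult[symmetric] by (rule abs_ge_self)
      also have "\<dots> \<le> \<bar>c - c0\<bar> * B" using B(2)[OF that(3)] by (rule mult_left_mono) simp
      finally show ?thesis .
    qed
    ultimately show ?thesis using ym(2)[OF that(3)] that(2) unfolding a_def by auto
  qed
  have gm: "g \<in> borel_measurable (lebesgue_on {a..b})"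
    by (rule measurable_restrict_mono[OF g]) (use b in auto)
  define \<eta> where "\<eta> = \<epsilon> * m / 4"
  have eta: "\<eta> > 0" using eps m by (simp add: \<eta>_def)
  from approx_in_measure[OF gm eta] obtain k where k: "continuous_on UNIV k"
    and abs: "(\<lambda>t. min 1 \<bar>g t - k t\<bar>) absolutely_integrable_on {a..b}"
    and small: "integral {a..b} (\<lambda>t. min 1 \<bar>g t - k t\<bar>) < \<eta>" by blast
  define w0 where "w0 t = min 1 \<bar>g t - k t\<bar>" for t
  define L where "L = \<beta> - \<alpha>"
  have L: "L > 0" using le by (simp add: L_def)
  define \<delta> where "\<delta> = \<epsilon> / 4 / L"
  have del: "\<delta> > 0" using eps L by (simp add: \<delta>_def)
  have "uniformly_continuous_on {a..b} k"
    by (rule compact_uniformly_continuous) (use continuous_on_subset[OF k] in auto)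
  then obtain \<rho> where rho: "\<rho> > 0"
    "\<And>s t. s \<in> {a..b} \<Longrightarrow> t \<in> {a..b} \<Longrightarrow> dist s t < \<rho> \<Longrightarrow> dist (k s) (k t) < \<delta>"
    unfolding uniformly_continuous_on_def using del by meson
  have near2: "\<forall>\<^sub>F c in at c0. \<bar>c - c0\<bar> * B < \<rho>"
  proof -
    have "((\<lambda>c. \<bar>c - c0\<bar> * B) \<longlongrightarrow> \<bar>c0 - c0\<bar> * B) (at c0)" by (intro tendsto_intros)
    then show ?thesis by (rule order_tendstoD(2)) (use rho in simp)
  qed
  have comp: "(\<lambda>y. w0 (c * v y)) absolutely_integrable_on {\<alpha>..\<beta>}"
     "integral {\<alpha>..\<beta>} (\<lambda>y. w0 (c * v y)) \<le> integral {a..b} w0 / m"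
    if c: "\<bar>c\<bar> > d" "\<bar>c\<bar> < 2 * \<bar>c0\<bar>" "\<bar>c - c0\<bar> * B < b - c0 * v ym" for c
  proof -
    have 1: "((\<lambda>y. c * v y) has_real_derivative c * v' y) (at y)" if "y \<in> {\<alpha>..\<beta>}" for y
      using der[OF that] by (rule DERIV_cmult)
    have 2: "continuous_on {\<alpha>..\<beta>} (\<lambda>y. c * v' y)" using cont by (intro continuous_intros)
    have 3: "inj_on (\<lambda>y. c * v y) {\<alpha>..\<beta>}" using inj c d by (auto simp: inj_on_def)
    have 4: "m \<le> \<bar>c * v' y\<bar>" if "y \<in> {\<alpha>..\<beta>}" for y
      unfolding m_def abs_mult using yd(2)[OF that] c d by (intro mult_mono) auto
    have 5: "(\<lambda>y. c * v y) ` {\<alpha>..\<beta>} \<subseteq> {a..b}" using rng c by blast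
    have 6: "w0 absolutely_integrable_on {a..b}" using abs unfolding w0_def .
    have 7: "0 \<le> w0 t" for t by (simp add: w0_def)
    show "(\<lambda>y. w0 (c * v y)) absolutely_integrable_on {\<alpha>..\<beta>}"
     "integral {\<alpha>..\<beta>} (\<lambda>y. w0 (c * v y)) \<le> integral {a..b} w0 / m"
      using integral_compose_le[OF 1 2 3 m 4 5 6 7] by auto
  qed
  have c00: "\<bar>c0\<bar> > d" "\<bar>c0\<bar> < 2 * \<bar>c0\<bar>" "\<bar>c0 - c0\<bar> * B < b - c0 * v ym"
    using c0 b by (auto simp: d_def)
  from near near2 show ?thesis
  proof eventually_elim
    case (elim c)
    define w where "w y = w0 (c * v y) + w0 (c0 * v y) + \<bar>\<delta>\<bar>" for y
    have c: "\<bar>c\<bar> > d" "\<bar>c\<bar> < 2 * \<bar>c0\<bar>" "\<bar>c - c0\<bar> * B < b - c0 * v ym" using elim by auto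
    have i1: "(\<lambda>y. w0 (c * v y)) integrable_on {\<alpha>..\<beta>}" "(\<lambda>y. w0 (c0 * v y)) integrable_on {\<alpha>..\<beta>}"
      using comp(1)[OF c] comp(1)[OF c00] by (auto dest: set_lebesgue_integral_eq_integral(1))
    have iw: "w integrable_on {\<alpha>..\<beta>}" unfolding w_def by (rule integrable_add[OF integrable_add[OF i1] integrable_const_ivl])
    have "integral {\<alpha>..\<beta>} w = integral {\<alpha>..\<beta>} (\<lambda>y. w0 (c * v y) + w0 (c0 * v y)) + integral {\<alpha>..\<beta>} (\<lambda>y. \<bar>\<delta>\<bar>)"
      unfolding w_def by (rule integral_add[OF integrable_add[OF i1] integrable_const_ivl])
    also have "\<dots> = integral {\<alpha>..\<beta>} (\<lambda>y. w0 (c * v y)) + integral {\<alpha>..\<beta>} (\<lambda>y. w0 (c0 * v y)) + L * \<bar>\<delta>\<bar>"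
      unfolding integral_add[OF i1] using le by (simp add: L_def)
    also have "L * \<bar>\<delta>\<bar> = \<epsilon> / 4" using L eps by (simp add: \<delta>_def)
    also have "integral {\<alpha>..\<beta>} (\<lambda>y. w0 (c * v y)) + integral {\<alpha>..\<beta>} (\<lambda>y. w0 (c0 * v y)) + \<epsilon> / 4
        \<le> integral {a..b} w0 / m + integral {a..b} w0 / m + \<epsilon> / 4"
      by (intro add_mono comp(2)[OF c] comp(2)[OF c00] order_refl)
    also have "\<dots> < \<eta> / m + \<eta> / m + \<epsilon> / 4"
    proof -
      have "integral {a..b} w0 / m < \<eta> / m"
        using small m unfolding w0_def by (intro divide_strict_right_mono)
      then show ?thesis by (intro add_strict_right_mono add_strict_mono)
    qed
    also have "\<dots> \<le> \<epsilon>" using m eps by (simp add: \<eta>_def field_simps)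
    finally have wi: "integral {\<alpha>..\<beta>} w < \<epsilon>" .
    have "min 1 \<bar>g (c * v y) - g (c0 * v y)\<bar> \<le> w y" if y: "y \<in> {\<alpha>..\<beta>}" for y
    proof -
      have s: "c * v y \<in> {a..b}" "c0 * v y \<in> {a..b}"
        using rng[OF c(2,3) y] rng[OF c00(2,3) y] by auto
      have "dist (c * v y) (c0 * v y) = \<bar>c - c0\<bar> * \<bar>v y\<bar>"
        unfolding dist_real_def abs_mult[symmetric] by (simp add: left_diff_distrib)
      also have "\<dots> \<le> \<bar>c - c0\<bar> * B" using B(2)[OF y] by (intro mult_left_mono) auto
      also have "\<dots> < \<rho>" using elim by simp
      finally have "\<bar>k (c * v y) - k (c0 * v y)\<bar> < \<delta>" using rho(2)[OF s] by (simp add: dist_real_def)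
      then show ?thesis unfolding w_def w0_def by (intro min1_triangle) linarith
    qed
    with iw wi show ?case by blast
  qed
qed

section \<open>The nine terms\<close>

text \<open>
  Here \<open>\<omega> = v / v'\<close>. Integrating by parts in the variable \<open>ln v\<close> differentiates \<open>\<omega>\<close> once; two such steps, ending
  with a continuous integrand, use two continuous derivatives of \<open>\<omega>\<close>.
\<close>
definition scale_factor :: "(real \<Rightarrow> real) \<Rightarrow> bool" where
  "scale_factor v \<longleftrightarrow> (\<exists>\<omega> \<omega>1 \<omega>2. continuous_on {0<..<1} \<omega>2 \<and>
     (\<forall>y\<in>{0<..<1}. 0 < v y \<and> \<omega> y \<noteq> 0 \<and> (v has_real_derivative v y / \<omega> y) (at y) \<and>
        (\<omega> has_real_derivative \<omega>1 y) (at y) \<and> (\<omega>1 has_real_derivative \<omega>2 y) (at y)))"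

lemma scale_factor_intro:
  assumes "\<And>y. 0 < y \<Longrightarrow> y < 1 \<Longrightarrow> 0 < v y" "\<And>y. 0 < y \<Longrightarrow> y < 1 \<Longrightarrow> \<omega> y \<noteq> 0"
    and "\<And>y. 0 < y \<Longrightarrow> y < 1 \<Longrightarrow> (v has_real_derivative v y / \<omega> y) (at y)"
    and "\<And>y. 0 < y \<Longrightarrow> y < 1 \<Longrightarrow> (\<omega> has_real_derivative \<omega>1 y) (at y)"
    and "\<And>y. 0 < y \<Longrightarrow> y < 1 \<Longrightarrow> (\<omega>1 has_real_derivative \<omega>2 y) (at y)"
    and "continuous_on {0<..<1} \<omega>2"
  shows "scale_factor v"
  unfolding scale_factor_def by (intro exI[of _ \<omega>] exI[of _ \<omega>1] exI[of _ \<omega>2]) (use assms in auto)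

lemma scale_factor_inverse: "scale_factor (\<lambda>y. 1 / y)"
  by (rule scale_factor_intro[of _ "\<lambda>y. - y" "\<lambda>y. - 1" "\<lambda>y. 0"])
    (auto intro!: derivative_eq_intros simp: power2_eq_square field_simps)

lemma scale_factor_complement: "scale_factor (\<lambda>y. 1 - y)"
  by (rule scale_factor_intro[of _ "\<lambda>y. - (1 - y)" "\<lambda>y. 1" "\<lambda>y. 0"])
    (auto intro!: derivative_eq_intros simp: power2_eq_square divide_simps)

lemma scale_factor_ident: "scale_factor (\<lambda>y. y)"
  by (rule scale_factor_intro[of _ "\<lambda>y. y" "\<lambda>y. 1" "\<lambda>y. 0"])
    (auto intro!: derivative_eq_intros)

lemma scale_factor_odds: "scale_factor (\<lambda>y. (1 - y) / y)"
  by (rule scale_factor_intro[of _ "\<lambda>y. - (y * (1 - y))" "\<lambda>y. 2 * y - 1" "\<lambda>y. 2"])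
    (auto intro!: derivative_eq_intros simp: power2_eq_square divide_simps algebra_simps)

text \<open>
  For \<open>v y = (1 - y)^2 / y\<close> one has \<open>\<omega> y = - y (1 - y) / (1 + y)\<close>; its partial fraction form is easier to
  differentiate.
\<close>
lemma scale_factor_odds_square: "scale_factor (\<lambda>y. (1 - y)\<^sup>2 / y)"
proof (rule scale_factor_intro[of _ "\<lambda>y. y - 2 + 2 / (1 + y)" "\<lambda>y. 1 - 2 / (1 + y)\<^sup>2" "\<lambda>y. 4 / (1 + y) ^ 3"])
  fix y :: real assume y: "0 < y" "y < 1"
  have w: "y - 2 + 2 / (1 + y) = - (y * (1 - y) / (1 + y))" using y by (simp add: field_simps)
  show "y - 2 + 2 / (1 + y) \<noteq> 0" unfolding w using y by simp
  have "(1 - y)\<^sup>2 / y / (y - 2 + 2 / (1 + y)) = - ((1 - y) * (1 + y) / y\<^sup>2)"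
    unfolding w using y by (simp add: divide_simps power2_eq_square)
  moreover have "((\<lambda>y. (1 - y)\<^sup>2 / y) has_real_derivative - ((1 - y) * (1 + y) / y\<^sup>2)) (at y)"
    using y by (auto intro!: derivative_eq_intros simp: power2_eq_square divide_simps algebra_simps)
  ultimately show "((\<lambda>y. (1 - y)\<^sup>2 / y) has_real_derivative (1 - y)\<^sup>2 / y / (y - 2 + 2 / (1 + y))) (at y)"
    by simp
  show "((\<lambda>y. y - 2 + 2 / (1 + y)) has_real_derivative 1 - 2 / (1 + y)\<^sup>2) (at y)"
    by (rule derivative_eq_intros refl | use y in \<open>simp; fail\<close>)+ (use y in \<open>simp add: power2_eq_square divide_simps\<close>)
  show "((\<lambda>y. 1 - 2 / (1 + y)\<^sup>2) has_real_derivative 4 / (1 + y) ^ 3) (at y)"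
    by (rule derivative_eq_intros refl | use y in \<open>simp; fail\<close>)+ (use y in \<open>simp add: power2_eq_square power3_eq_cube divide_simps\<close>)
qed (auto intro!: continuous_intros)

text \<open>
  The arguments other than \<open>x\<close> and \<open>y\<close>, with variables separated as \<open>c x * v y\<close>. The number \<open>k\<close> is the coefficient
  of the term once \<open>2 * g x\<close> has been isolated (\<open>kummer_sum_terms\<close>).
\<close>
definition kummer_terms :: "(real \<times> (real \<Rightarrow> real) \<times> (real \<Rightarrow> real)) list" where
  "kummer_terms =
     [(1, \<lambda>x. x, \<lambda>y. 1 / y), (-2, \<lambda>x. 1 / (1 - x), \<lambda>y. 1 - y),
      (-2, \<lambda>x. x / (1 - x), \<lambda>y. (1 - y) / y), (1, \<lambda>x. x, \<lambda>y. y),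
      (-2, \<lambda>x. - x / (1 - x), \<lambda>y. 1 - y), (-2, \<lambda>x. - 1 / (1 - x), \<lambda>y. (1 - y) / y),
      (1, \<lambda>x. x / (1 - x)\<^sup>2, \<lambda>y. (1 - y)\<^sup>2 / y)]"

definition kummer_sum :: "(real \<Rightarrow> real) \<Rightarrow> real \<Rightarrow> real \<Rightarrow> real" where
  "kummer_sum g x y =
     2 * g x + 2 * g y - g (x / y) + 2 * g ((1 - y) / (1 - x))
     + 2 * g (x * (1 - y) / (y * (1 - x))) - g (x * y)
     + 2 * g (x * (1 - y) / (x - 1)) + 2 * g ((1 - y) / (y * (x - 1)))
     - g (x * (1 - y)\<^sup>2 / (y * (1 - x)\<^sup>2))"

lemma minus_divide_flip: "(a::real) / (x - 1) = - (a / (1 - x))"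
  by (metis minus_diff_eq minus_divide_right)

lemma kummer_sum_terms:
  "kummer_sum g x y = 2 * g x + 2 * g y - (\<Sum>(k, c, v)\<leftarrow>kummer_terms. k * g (c x * v y))"
proof -
  have "(1 - y) / (y * (x - 1)) = - ((1 - y) / (y * (1 - x)))"
    using minus_divide_flip[of "(1-y)/y" x] by (simp add: mult.commute)
  then show ?thesis
    unfolding kummer_sum_def kummer_terms_def by (simp add: minus_divide_flip mult.commute mult.left_commute algebra_simps)
qed

lemma kummer_terms_cases:
  assumes "(k, c, v) \<in> set kummer_terms"
    and "P 1 (\<lambda>x. x) (\<lambda>y. 1 / y)" "P (-2) (\<lambda>x. 1 / (1 - x)) (\<lambda>y. 1 - y)"
     "P (-2) (\<lambda>x. x / (1 - x)) (\<lambda>y. (1 - y) / y)" "P 1 (\<lambda>x. x) (\<lambda>y. y)"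
     "P (-2) (\<lambda>x. - x / (1 - x)) (\<lambda>y. 1 - y)" "P (-2) (\<lambda>x. - 1 / (1 - x)) (\<lambda>y. (1 - y) / y)"
     "P 1 (\<lambda>x. x / (1 - x)\<^sup>2) (\<lambda>y. (1 - y)\<^sup>2 / y)"
  shows "P k c v"
  using assms unfolding kummer_terms_def by auto

lemma kummer_terms_scale_factor: "(k, c, v) \<in> set kummer_terms \<Longrightarrow> scale_factor v"
  by (erule kummer_terms_cases) (rule scale_factor_inverse scale_factor_complement scale_factor_ident
    scale_factor_odds scale_factor_odds_square)+

lemma kummer_terms_coeff: "(k, c, v) \<in> set kummer_terms \<Longrightarrow> \<bar>k\<bar> \<le> 2 \<and> 1 \<le> \<bar>k\<bar>"
  by (erule kummer_terms_cases) auto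

lemma kummer_terms_nonzero: "(k, c, v) \<in> set kummer_terms \<Longrightarrow> 0 < x \<Longrightarrow> x < 1 \<Longrightarrow> c x \<noteq> 0"
  by (erule kummer_terms_cases) auto

lemma kummer_terms_isCont: "(k, c, v) \<in> set kummer_terms \<Longrightarrow> x < 1 \<Longrightarrow> isCont c x"
  by (erule kummer_terms_cases) (auto intro!: continuous_intros)

text \<open>
  The ninth argument is below 1 because \<open>y (1 - x)^2 - x (1 - y)^2 = (y - x) (1 - x y)\<close>.
\<close>
lemma odds_square_less:
  fixes x y :: real assumes "0 < x" "x < y" "y < 1"
  shows "x * (1 - y)\<^sup>2 < y * (1 - x)\<^sup>2"
proof -
  have "y * (1 - x)\<^sup>2 - x * (1 - y)\<^sup>2 = (y - x) * (1 - x * y)" by (simp add: power2_eq_square algebra_simps)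
  moreover have "x * y < 1" using assms mult_strict_mono[of x 1 y 1] by simp
  ultimately show ?thesis using assms by (smt (verit) mult_pos_pos)
qed

lemma kummer_terms_less_1:
  assumes t: "(k, c, v) \<in> set kummer_terms" and x: "0 < x" "x < y" "y < 1"
  shows "c x * v y < 1"
proof -
  have xy: "x * y < 1" using x mult_strict_mono[of x 1 y 1] by simp
  have 9: "x / (1 - x)\<^sup>2 * ((1 - y)\<^sup>2 / y) < 1"
  proof -
    have "0 < y * (1 - x)\<^sup>2" using x by simp
    then have "x * (1 - y)\<^sup>2 / (y * (1 - x)\<^sup>2) < 1" using odds_square_less[OF x] by simp
    then show ?thesis by (simp add: mult.commute)
  qed
  have 5: "x / (1 - x) * ((1 - y) / y) < 1"
  proof -
    have "x * (1 - y) < y * (1 - x)" "0 < y * (1 - x)" using x by (simp_all add: algebra_simps)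
    then have "x * (1 - y) / (y * (1 - x)) < 1" by simp
    then show ?thesis by (simp add: mult.commute)
  qed
  have 7: "- x / (1 - x) * (1 - y) < 1" 
  proof -
    have "0 < x / (1 - x) * (1 - y)" using x by simp
    then show ?thesis by simp
  qed
  have 8: "- 1 / (1 - x) * ((1 - y) / y) < 1"
  proof -
    have "0 < 1 / (1 - x) * ((1 - y) / y)" using x by simp
    then show ?thesis by simp
  qed
  have 3: "x * (1 / y) < 1" "1 / (1 - x) * (1 - y) < 1" using x by (simp_all add: divide_simps)
  show ?thesis using t
    by (rule kummer_terms_cases[where P = "\<lambda>k c v. c x * v y < 1"]) (use 3 5 7 8 9 xy in auto)
qed

text \<open>
  A scale factor is injective, since its derivative \<open>v / \<omega>\<close> has no zero.
\<close>
lemma scale_factor_dilation: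
  fixes g v :: "real \<Rightarrow> real"
  assumes v: "scale_factor v" and g: "g \<in> borel_measurable (lebesgue_on {..<1})" and eps: "\<epsilon> > 0"
    and ab: "0 < \<alpha>" "\<alpha> < \<beta>" "\<beta> < 1"
    and c0: "c0 \<noteq> 0" "\<And>y. y \<in> {\<alpha>..\<beta>} \<Longrightarrow> c0 * v y < 1"
  shows "\<forall>\<^sub>F c in nhds c0. \<exists>w. w integrable_on {\<alpha>..\<beta>} \<and> integral {\<alpha>..\<beta>} w < \<epsilon> \<and>
           (\<forall>y\<in>{\<alpha>..\<beta>}. min 1 \<bar>g (c * v y) - g (c0 * v y)\<bar> \<le> w y)"
proof -
  obtain \<omega> \<omega>1 \<omega>2 where w: "\<And>y. y \<in> {0<..<1} \<Longrightarrow> 0 < v y \<and> \<omega> y \<noteq> 0 \<and> (v has_real_derivative v y / \<omega> y) (at y) \<and>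
        (\<omega> has_real_derivative \<omega>1 y) (at y) \<and> (\<omega>1 has_real_derivative \<omega>2 y) (at y)"
    using v unfolding scale_factor_def by blast
  have sub: "{\<alpha>..\<beta>} \<subseteq> {0<..<1}" using ab by auto
  have der: "(v has_real_derivative v y / \<omega> y) (at y)" if "y \<in> {\<alpha>..\<beta>}" for y using w sub that by blast
  have nz: "v y / \<omega> y \<noteq> 0" if "y \<in> {\<alpha>..\<beta>}" for y using w[of y] sub that by auto
  have cv: "continuous_on {\<alpha>..\<beta>} v"
    by (rule DERIV_continuous_on[where D = "\<lambda>y. v y / \<omega> y"]) (use der has_field_derivative_at_within in blast)
  have cw: "continuous_on {\<alpha>..\<beta>} \<omega>"
    by (rule DERIV_continuous_on[where D = \<omega>1]) (use w sub has_field_derivative_at_within in blast)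
  have cont: "continuous_on {\<alpha>..\<beta>} (\<lambda>y. v y / \<omega> y)"
    by (intro continuous_intros cv cw) (use w sub in blast)
  have inj: "inj_on v {\<alpha>..\<beta>}"
  proof (rule linorder_inj_onI')
    fix a b assume a: "a \<in> {\<alpha>..\<beta>}" "b \<in> {\<alpha>..\<beta>}" "a < b"
    show "v a \<noteq> v b"
    proof
      assume eq: "v a = v b"
      have "\<exists>z. a < z \<and> z < b \<and> v b - v a = (b - a) * (v z / \<omega> z)"
        by (rule MVT2[OF a(3)]) (use der a in auto)
      then obtain z where z: "a < z" "z < b" "v b - v a = (b - a) * (v z / \<omega> z)" by blast
      have zz: "z \<in> {\<alpha>..\<beta>}" using z a by auto
      show False using z(3) eq nz[OF zz] a(3) by simp
    qed
  qed
  have "\<forall>\<^sub>F c in at c0. \<exists>w. w integrable_on {\<alpha>..\<beta>} \<and> integral {\<alpha>..\<beta>} w < \<epsilon> \<and>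
           (\<forall>y\<in>{\<alpha>..\<beta>}. min 1 \<bar>g (c * v y) - g (c0 * v y)\<bar> \<le> w y)"
    by (rule dilation_continuous_in_measure[where v' = "\<lambda>y. v y / \<omega> y"])
      (use g eps der cont inj nz c0 ab(2) in auto)
  moreover have "\<exists>w. w integrable_on {\<alpha>..\<beta>} \<and> integral {\<alpha>..\<beta>} w < \<epsilon> \<and>
           (\<forall>y\<in>{\<alpha>..\<beta>}. min 1 \<bar>g (c0 * v y) - g (c0 * v y)\<bar> \<le> w y)"
    by (rule exI[of _ "\<lambda>_. 0"]) (use eps in auto)
  ultimately show ?thesis by (simp add: eventually_nhds_conv_at)
qed

lemma min1_linear:
  fixes k a b :: real assumes "1 \<le> \<bar>k\<bar>"
  shows "min 1 \<bar>k * a + b\<bar> \<le> \<bar>k\<bar> * min 1 \<bar>a\<bar> + min 1 \<bar>b\<bar>"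
proof -
  have t: "\<bar>k * a + b\<bar> \<le> \<bar>k\<bar> * \<bar>a\<bar> + \<bar>b\<bar>" by (metis abs_mult abs_triangle_ineq)
  show ?thesis
  proof (cases "\<bar>a\<bar> < 1 \<and> \<bar>b\<bar> < 1")
    case True
    then show ?thesis using t by (simp add: min_def)
  next
    case False
    have "0 \<le> \<bar>k\<bar> * min 1 \<bar>a\<bar>" by simp
    moreover have "\<bar>a\<bar> \<ge> 1 \<Longrightarrow> \<bar>k\<bar> * min 1 \<bar>a\<bar> \<ge> 1" using assms by simp
    moreover have "0 \<le> min 1 \<bar>b\<bar>" by simp
    moreover have "\<bar>b\<bar> \<ge> 1 \<Longrightarrow> min 1 \<bar>b\<bar> \<ge> 1" by simp
    moreover have "min 1 \<bar>k * a + b\<bar> \<le> 1" by simp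
    ultimately show ?thesis using False by linarith
  qed
qed

lemma dilated_sum_continuous_in_measure:
  fixes g :: "real \<Rightarrow> real" and ts :: "(real \<times> (real \<Rightarrow> real) \<times> (real \<Rightarrow> real)) list"
  assumes g: "g \<in> borel_measurable (lebesgue_on {..<1})"
    and ab: "0 < \<alpha>" "\<alpha> < \<beta>" "\<beta> < 1"
    and ts: "\<And>k c v. (k, c, v) \<in> set ts \<Longrightarrow> scale_factor v \<and> 1 \<le> \<bar>k\<bar> \<and> isCont c x0 \<and> c x0 \<noteq> 0 \<and>
                (\<forall>y\<in>{\<alpha>..\<beta>}. c x0 * v y < 1)"
    and eps: "\<epsilon> > 0"
  shows "\<forall>\<^sub>F x in nhds x0. \<exists>w. w integrable_on {\<alpha>..\<beta>} \<and> integral {\<alpha>..\<beta>} w < \<epsilon> \<and>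
           (\<forall>y\<in>{\<alpha>..\<beta>}. min 1 \<bar>\<Sum>(k, c, v)\<leftarrow>ts. k * (g (c x * v y) - g (c x0 * v y))\<bar> \<le> w y)"
  using ts eps
proof (induction ts arbitrary: \<epsilon>)
  case Nil
  show ?case
    by (rule always_eventually, intro allI exI[of _ "\<lambda>_. 0"]) (use Nil in auto)
next
  case (Cons t ts)
  obtain k c v where t: "t = (k, c, v)" by (cases t)
  have kcv: "scale_factor v" "1 \<le> \<bar>k\<bar>" "isCont c x0" "c x0 \<noteq> 0" "\<And>y. y \<in> {\<alpha>..\<beta>} \<Longrightarrow> c x0 * v y < 1"
    using Cons.prems(1)[of k c v] t by auto
  have e: "\<epsilon> / 2 > 0" "\<epsilon> / (2 * \<bar>k\<bar>) > 0" using Cons.prems(2) kcv(2) by auto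
  have "\<forall>\<^sub>F x in nhds x0. \<exists>w. w integrable_on {\<alpha>..\<beta>} \<and> integral {\<alpha>..\<beta>} w < \<epsilon> / 2 \<and>
           (\<forall>y\<in>{\<alpha>..\<beta>}. min 1 \<bar>\<Sum>(k, c, v)\<leftarrow>ts. k * (g (c x * v y) - g (c x0 * v y))\<bar> \<le> w y)"
    by (rule Cons.IH[OF _ e(1)]) (use Cons.prems(1) in auto)
  moreover have "\<forall>\<^sub>F x in nhds x0. \<exists>w. w integrable_on {\<alpha>..\<beta>} \<and> integral {\<alpha>..\<beta>} w < \<epsilon> / (2 * \<bar>k\<bar>) \<and>
           (\<forall>y\<in>{\<alpha>..\<beta>}. min 1 \<bar>g (c x * v y) - g (c x0 * v y)\<bar> \<le> w y)"
  proof -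
    have "filterlim c (nhds (c x0)) (nhds x0)" using kcv(3) by (simp add: isCont_def tendsto_at_iff_tendsto_nhds)
    with scale_factor_dilation[OF kcv(1) g e(2) ab kcv(4,5)] show ?thesis
      by (rule eventually_compose_filterlim)
  qed
  ultimately show ?case
  proof eventually_elim
    case (elim x)
    then obtain w1 w2 where w1: "w1 integrable_on {\<alpha>..\<beta>}" "integral {\<alpha>..\<beta>} w1 < \<epsilon> / 2"
        "\<And>y. y \<in> {\<alpha>..\<beta>} \<Longrightarrow> min 1 \<bar>\<Sum>(k, c, v)\<leftarrow>ts. k * (g (c x * v y) - g (c x0 * v y))\<bar> \<le> w1 y"
      and w2: "w2 integrable_on {\<alpha>..\<beta>}" "integral {\<alpha>..\<beta>} w2 < \<epsilon> / (2 * \<bar>k\<bar>)"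
        "\<And>y. y \<in> {\<alpha>..\<beta>} \<Longrightarrow> min 1 \<bar>g (c x * v y) - g (c x0 * v y)\<bar> \<le> w2 y"
      by blast
    define w where "w y = \<bar>k\<bar> * w2 y + w1 y" for y
    have i2: "(\<lambda>y. \<bar>k\<bar> * w2 y) integrable_on {\<alpha>..\<beta>}" using integrable_on_cmult_left[OF w2(1), of "\<bar>k\<bar>"] by simp
    have iw: "w integrable_on {\<alpha>..\<beta>}" unfolding w_def by (rule integrable_add[OF i2 w1(1)])
    have "integral {\<alpha>..\<beta>} w = \<bar>k\<bar> * integral {\<alpha>..\<beta>} w2 + integral {\<alpha>..\<beta>} w1"
      unfolding w_def integral_add[OF i2 w1(1)] by simp
    moreover have "\<bar>k\<bar> * integral {\<alpha>..\<beta>} w2 < \<bar>k\<bar> * (\<epsilon> / (2 * \<bar>k\<bar>))"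
      using w2(2) kcv(2) by (intro mult_strict_left_mono) auto
    moreover have "\<bar>k\<bar> * (\<epsilon> / (2 * \<bar>k\<bar>)) = \<epsilon> / 2" using kcv(2) by auto
    ultimately have wi: "integral {\<alpha>..\<beta>} w < \<epsilon>" using w1(2) by linarith
    have "min 1 \<bar>\<Sum>(k, c, v)\<leftarrow>t # ts. k * (g (c x * v y) - g (c x0 * v y))\<bar> \<le> w y" if y: "y \<in> {\<alpha>..\<beta>}" for y
    proof -
      have "min 1 \<bar>\<Sum>(k, c, v)\<leftarrow>t # ts. k * (g (c x * v y) - g (c x0 * v y))\<bar>
          \<le> \<bar>k\<bar> * min 1 \<bar>g (c x * v y) - g (c x0 * v y)\<bar>
            + min 1 \<bar>\<Sum>(k, c, v)\<leftarrow>ts. k * (g (c x * v y) - g (c x0 * v y))\<bar>"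
        unfolding t by simp (rule min1_linear[OF kcv(2)])
      also have "\<dots> \<le> \<bar>k\<bar> * w2 y + w1 y"
        by (intro add_mono mult_left_mono w1(3)[OF y] w2(3)[OF y]) simp
      finally show ?thesis by (simp add: w_def)
    qed
    with iw wi show ?case by blast
  qed
qed

text \<open>
  The homogeneous problem satisfied by the difference of two solutions.
\<close>
locale kummer_solution =
  fixes g :: "real \<Rightarrow> real" and e0 :: real
  assumes e0_gt: "(sqrt 5 - 1) / 2 < e0" and e0_less: "e0 < 1"
    and meas: "g \<in> borel_measurable (lebesgue_on {..<1})"
    and cont0: "isCont g 0"
    and equation: "\<And>x y. 0 < x \<Longrightarrow> x < y \<Longrightarrow> y < e0 \<Longrightarrow> kummer_sum g x y = 0"
begin

text \<open>
  The golden ratio is the positive root of \<open>1 - t = t^2\<close>, whence \<open>1 - e0 < e0^2\<close>. In this form the lower bound on \<open>e0\<close>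
  says that \<open>1 / (1 + t) \<ge> e0\<close> forces \<open>t < e0\<close>.
\<close>
lemma e0_bounds: "3/5 < e0" "0 < e0" "1 - e0 < e0\<^sup>2" "(sqrt 5 - 1)/2 > (3/5::real)"
proof -
  have s: "sqrt 5 > (11/5::real)" by (rule real_less_rsqrt) (simp add: power2_eq_square)
  then show "(sqrt 5 - 1)/2 > (3/5::real)" by simp
  then show e: "3/5 < e0" "0 < e0" using e0_gt by auto
  have "((sqrt 5 - 1)/2)\<^sup>2 = 1 - (sqrt 5 - 1)/2" by (simp add: power2_eq_square field_simps)
  moreover have "((sqrt 5 - 1)/2)\<^sup>2 < e0\<^sup>2" using e0_gt s by (intro power_strict_mono) auto
  ultimately show "1 - e0 < e0\<^sup>2" using e0_gt by linarith
qed

lemma separated: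
  assumes "0 < x" "x < y" "y < e0"
  shows "2 * g x = (\<Sum>(k, c, v)\<leftarrow>kummer_terms. k * g (c x * v y)) - 2 * g y"
  using equation[OF assms] unfolding kummer_sum_terms by linarith

text \<open>
  Integrate \<open>separated\<close> over an interval of values of \<open>y\<close> beyond \<open>x0\<close>. The left-hand side does not depend on \<open>y\<close>, and
  the right-hand side depends continuously on \<open>x\<close> in measure.
\<close>
lemma isCont_left:
  assumes x0: "0 < x0" "x0 < e0"
  shows "isCont g x0"
proof -
  define \<alpha> where "\<alpha> = (2 * x0 + e0) / 3"
  define \<beta> where "\<beta> = (x0 + 2 * e0) / 3"
  have ab: "0 < \<alpha>" "\<alpha> < \<beta>" "\<beta> < 1" "x0 < \<alpha>" "\<beta> < e0" using x0 e0_less by (auto simp: \<alpha>_def \<beta>_def)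
  have ts: "scale_factor v \<and> 1 \<le> \<bar>k\<bar> \<and> isCont c x0 \<and> c x0 \<noteq> 0 \<and> (\<forall>y\<in>{\<alpha>..\<beta>}. c x0 * v y < 1)"
    if "(k, c, v) \<in> set kummer_terms" for k c v
    using kummer_terms_scale_factor[OF that] kummer_terms_coeff[OF that] kummer_terms_isCont[OF that, of x0]
      kummer_terms_nonzero[OF that, of x0] kummer_terms_less_1[OF that, of x0] x0 ab e0_less by auto
  have near: "\<forall>\<^sub>F x in nhds x0. x \<in> {0<..<\<alpha>}"
    using x0 ab by (intro eventually_nhds_in_open) auto
  have "(g \<longlongrightarrow> g x0) (nhds x0)"
  proof (rule tendstoI)
    fix \<epsilon> :: real assume eps: "\<epsilon> > 0"
    define \<delta> where "\<delta> = min 1 (2 * \<epsilon>) * (\<beta> - \<alpha>)"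
    have del: "\<delta> > 0" using eps ab by (simp add: \<delta>_def)
    have "\<forall>\<^sub>F x in nhds x0. \<exists>w. w integrable_on {\<alpha>..\<beta>} \<and> integral {\<alpha>..\<beta>} w < \<delta> \<and>
        (\<forall>y\<in>{\<alpha>..\<beta>}. min 1 \<bar>\<Sum>(k, c, v)\<leftarrow>kummer_terms. k * (g (c x * v y) - g (c x0 * v y))\<bar> \<le> w y)"
      by (rule dilated_sum_continuous_in_measure[OF meas ab(1-3) _ del]) (rule ts)
    from this near
    show "\<forall>\<^sub>F x in nhds x0. dist (g x) (g x0) < \<epsilon>"
    proof eventually_elim
      case (elim x)
      then obtain w where w: "w integrable_on {\<alpha>..\<beta>}" "integral {\<alpha>..\<beta>} w < \<delta>"
        "\<And>y. y \<in> {\<alpha>..\<beta>} \<Longrightarrow> min 1 \<bar>\<Sum>(k, c, v)\<leftarrow>kummer_terms. k * (g (c x * v y) - g (c x0 * v y))\<bar> \<le> w y"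
        by blast
      define D where "D = min 1 \<bar>2 * g x - 2 * g x0\<bar>"
      have le: "D \<le> w y" if y: "y \<in> {\<alpha>..\<beta>}" for y
      proof -
        have "(\<Sum>(k, c, v)\<leftarrow>kummer_terms. k * (g (c x * v y) - g (c x0 * v y)))
           = (\<Sum>(k, c, v)\<leftarrow>kummer_terms. k * g (c x * v y)) - (\<Sum>(k, c, v)\<leftarrow>kummer_terms. k * g (c x0 * v y))"
          by (simp add: kummer_terms_def right_diff_distrib)
        also have "\<dots> = 2 * g x - 2 * g x0"
          using separated[of x y] separated[of x0 y] elim y ab x0 by auto
        finally show ?thesis using w(3)[OF y] by (simp add: D_def)
      qed
      have "integral {\<alpha>..\<beta>} (\<lambda>y. D) \<le> integral {\<alpha>..\<beta>} w"
        by (rule integral_le) (use w le in auto)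
      then have "D * (\<beta> - \<alpha>) \<le> integral {\<alpha>..\<beta>} w" using ab by (simp add: mult.commute)
      also have "\<dots> < min 1 (2 * \<epsilon>) * (\<beta> - \<alpha>)" using w(2) by (simp only: \<delta>_def)
      finally have "D < min 1 (2 * \<epsilon>)"
        by (rule mult_right_less_imp_less) (use ab in simp)
      then have "min 1 \<bar>2 * g x - 2 * g x0\<bar> < min 1 (2 * \<epsilon>)" by (simp only: D_def)
      then show ?case by (auto simp: dist_real_def min_def split: if_splits)
    qed
  qed
  then show ?thesis by (simp add: isCont_def tendsto_at_iff_tendsto_nhds)
qed

end

section \<open>Spreading local regularity along curves\<close>

text \<open>
  In terms of \<open>r = (1 - y) / (1 - x)\<close> all arguments become monomials in \<open>x\<close>, \<open>y\<close> and \<open>r\<close> up to sign.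
\<close>
lemma kummer_sum_ratio:
  assumes "0 < x" "x < 1" "0 < y" "y < 1" and r: "r = (1 - y) / (1 - x)"
  shows "kummer_sum g x y = 2 * g x + 2 * g y - g (x / y) + 2 * g r + 2 * g (x * r / y) - g (x * y)
      + 2 * g (- (x * r)) + 2 * g (- (r / y)) - g (x * r\<^sup>2 / y)"
proof -
  have "x * (1 - y) / (y * (1 - x)) = x * r / y" unfolding r by (simp add: mult.commute)
  moreover have "x * (1 - y) / (x - 1) = - (x * r)" unfolding r minus_divide_flip by simp
  moreover have "(1 - y) / (y * (x - 1)) = - (r / y)"
    unfolding r using minus_divide_flip[of "(1-y)/y" x] by (simp add: mult.commute)
  moreover have "x * (1 - y)\<^sup>2 / (y * (1 - x)\<^sup>2) = x * r\<^sup>2 / y"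
    unfolding r by (simp add: power_divide mult.commute)
  ultimately show ?thesis unfolding kummer_sum_def r[symmetric] by simp
qed

lemma eventually_between:
  assumes "isCont f t" "a < f t" "f t < b"
  shows "\<forall>\<^sub>F s in nhds t. a < (f s :: real) \<and> f s < b"
proof -
  have "(f \<longlongrightarrow> f t) (nhds t)" using assms(1) by (simp add: isCont_def tendsto_at_iff_tendsto_nhds)
  then show ?thesis using assms(2,3) by (intro eventually_conj) (auto dest: order_tendstoD)
qed

lemma eventually_between_ident:
  fixes t :: real
  assumes "a < t" "t < b"
  shows "\<forall>\<^sub>F s in nhds t. a < s \<and> s < b"
  using eventually_nhds_in_open[of "{a<..<b}" t] assms by simp

lemma eventually_less_cont:
  assumes "isCont f t" "isCont h t" "f t < h t"
  shows "\<forall>\<^sub>F s in nhds t. (f s :: real) < h s"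
proof -
  have "isCont (\<lambda>s. h s - f s) t" using assms by (intro continuous_intros)
  from eventually_between[OF this, of 0 "h t - f t + 1"] assms(3) show ?thesis
    by (auto elim: eventually_mono)
qed

lemma DERIV_imp_differentiable: "(f has_real_derivative d) (at t) \<Longrightarrow> f differentiable (at t)"
  unfolding real_differentiable_def by blast

text \<open>
  What continuity and differentiability at a point have in common: closure under the operations that allow the
  equation, restricted to a curve, to be solved for one of its terms.
\<close>
locale local_regularity =
  fixes P :: "(real \<Rightarrow> real) \<Rightarrow> real \<Rightarrow> bool"
  assumes lin: "\<And>a f h t. P f t \<Longrightarrow> P h t \<Longrightarrow> P (\<lambda>s. a * f s + h s) t"
    and const: "\<And>c t. P (\<lambda>_. c) t"
    and comp: "\<And>f \<phi> t. P f (\<phi> t) \<Longrightarrow> \<phi> differentiable (at t) \<Longrightarrow> P (\<lambda>s. f (\<phi> s)) t"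
    and cong: "\<And>f h t. P f t \<Longrightarrow> \<forall>\<^sub>F s in nhds t. h s = f s \<Longrightarrow> P h t"
begin

lemma comp_derivative: "P f (\<phi> t) \<Longrightarrow> (\<phi> has_real_derivative d) (at t) \<Longrightarrow> P (\<lambda>s. f (\<phi> s)) t"
  by (rule comp) (auto intro: DERIV_imp_differentiable)

text \<open>
  The nesting and the final 0 are the shape that repeated use of \<open>lin\<close> produces.
\<close>
lemma eight_terms:
  assumes "P f1 t" "P f2 t" "P f3 t" "P f4 t" "P f5 t" "P f6 t" "P f7 t" "P f8 t"
  shows "P (\<lambda>s. a1 * f1 s + (a2 * f2 s + (a3 * f3 s + (a4 * f4 s + (a5 * f5 s + (a6 * f6 s + (a7 * f7 s + (a8 * f8 s + 0)))))))) t"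
  by (intro lin const assms)

end

lemma local_regularity_isCont: "local_regularity (\<lambda>f t. isCont f t)"
proof
  fix f \<phi> :: "real \<Rightarrow> real" and t assume "isCont f (\<phi> t)" "\<phi> differentiable (at t)"
  then show "isCont (\<lambda>s. f (\<phi> s)) t"
    by (intro isCont_o2[of t \<phi> f]) (auto simp: differentiable_imp_continuous_within)
next
  fix f h :: "real \<Rightarrow> real" and t assume "isCont f t" "\<forall>\<^sub>F s in nhds t. h s = f s"
  then show "isCont h t" using isCont_cong by blast
qed (auto intro!: continuous_intros)

lemma local_regularity_differentiable: "local_regularity (\<lambda>f t. f differentiable (at t))"
proof
  fix f \<phi> :: "real \<Rightarrow> real" and t assume "f differentiable (at (\<phi> t))" "\<phi> differentiable (at t)"
  then show "(\<lambda>s. f (\<phi> s)) differentiable (at t)"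
    using differentiable_chain_at[of \<phi> t f] by (simp add: o_def)
next
  fix f h :: "real \<Rightarrow> real" and t assume "f differentiable (at t)" and ev: "\<forall>\<^sub>F s in nhds t. h s = f s"
  then obtain d where "(f has_real_derivative d) (at t)" by (auto simp: real_differentiable_def)
  then have "(h has_real_derivative d) (at t)" using DERIV_cong_ev[OF refl ev refl] by simp
  then show "h differentiable (at t)" by (rule DERIV_imp_differentiable)
qed auto

context kummer_solution
begin

lemma equation_ratio:
  assumes "0 < x" "x < y" "y < e0" and r: "r = (1 - y) / (1 - x)"
  shows "2 * g x + 2 * g y - g (x / y) + 2 * g r + 2 * g (x * r / y) - g (x * y)
      + 2 * g (- (x * r)) + 2 * g (- (r / y)) - g (x * r\<^sup>2 / y) = 0"
proof -
  have "0 < x" "x < 1" "0 < y" "y < 1" using assms e0_less by auto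
  from kummer_sum_ratio[OF this r, of g] equation[OF assms(1-3)] show ?thesis by simp
qed

text \<open>
  On the curve \<open>x = 2 t / (1 + t)\<close>, \<open>y = (1 + t) / 2\<close> one has \<open>r = y\<close>. The eighth argument is then the constant -1,
  several others coincide, and \<open>- t\<close> is the only one that moves outside \<open>(0, 1)\<close>.
\<close>
lemma equation_curve:
  assumes t: "0 < t" "t \<le> 1/5"
  shows "4 * g (2 * t / (1 + t)) + 4 * g ((1 + t) / 2) - g (4 * t / (1 + t)\<^sup>2) - 2 * g t + 2 * g (- t) + 2 * g (- 1) = 0"
proof -
  define x where "x = 2 * t / (1 + t)"
  define y where "y = (1 + t) / 2"
  have y: "y < e0" "y \<noteq> 0" using t e0_bounds by (auto simp: y_def)
  have xy: "0 < x" "x < y"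
  proof -
    show "0 < x" using t by (simp add: x_def)
    have "(1 + t)\<^sup>2 - 4 * t = (1 - t)\<^sup>2" by (simp add: power2_eq_square algebra_simps)
    moreover have "(1 - t)\<^sup>2 > 0" using t by simp
    ultimately have "4 * t < (1 + t)\<^sup>2" by linarith
    then show "x < y" using t by (simp add: x_def y_def divide_simps power2_eq_square)
  qed
  have r: "y = (1 - y) / (1 - x)" using t by (simp add: x_def y_def divide_simps)
  have e: "x / y = 4 * t / (1 + t)\<^sup>2" "x * y = t" "x * y / y = x" "x * y\<^sup>2 / y = t" "y / y = 1"
    using t y by (simp_all add: x_def y_def power2_eq_square divide_simps)
  from equation_ratio[OF xy y(1) r]
  have "2 * g x + 2 * g y - g (4 * t / (1 + t)\<^sup>2) + 2 * g y + 2 * g x - g (x * y)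
      + 2 * g (- (x * y)) + 2 * g (- 1) - g t = 0"
    by (simp only: e(1,3,4,5))
  then have "4 * g x + 4 * g y - g (4 * t / (1 + t)\<^sup>2) - 2 * g t + 2 * g (- t) + 2 * g (- 1) = 0"
    unfolding e(2) by linarith
  then show ?thesis unfolding x_def y_def .
qed

end

locale regular_kummer_solution = kummer_solution + local_regularity P for P +
  assumes base: "\<And>t. 0 < t \<Longrightarrow> t < e0 \<Longrightarrow> P g t"
begin

lemma deriv_base: "P (\<lambda>s. g (\<phi> s)) t"
  if "0 < \<phi> t" "\<phi> t < e0" "\<exists>d. (\<phi> has_real_derivative d) (at t)"
    using that base[of "\<phi> t"] comp_derivative[of g \<phi> t] by blast

text \<open>
  Solve \<open>equation_curve\<close> for \<open>g (- t)\<close>.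
\<close>
lemma small_neg: "P g (- t)" if t: "0 < t" "t < 1/5"
  proof -
    have "P (\<lambda>s. -2 * g (2 * (- s) / (1 + - s)) + (-2 * g ((1 + - s) / 2) + (1/2 * g (4 * (- s) / (1 + - s)\<^sup>2) +
            (1 * g (- s) + (-1 * g (- 1) + (0 * g (- 1) + (0 * g (- 1) + (0 * g (- 1) + 0)))))))) (- t)"
    proof (rule eight_terms)
      have "2 * t / (1 + t) \<le> 2 * t / 1" using t by (intro divide_left_mono) auto
      then have "0 < 2 * t / (1 + t)" "2 * t / (1 + t) < e0" using t e0_bounds by auto
      then show "P (\<lambda>s. g (2 * (- s) / (1 + - s))) (- t)"
        by - (rule deriv_base, use t in \<open>auto intro!: exI derivative_eq_intros\<close>)
      show "P (\<lambda>s. g ((1 + - s) / 2)) (- t)"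
        by (rule deriv_base) (use t e0_bounds in \<open>auto intro!: exI derivative_eq_intros\<close>)
      have "4 * t / (1 + t)\<^sup>2 < e0"
      proof -
        have "(1 + t)\<^sup>2 > 1 + 2 * t" using t by (simp add: power2_eq_square algebra_simps)
        then have "4 * t / (1 + t)\<^sup>2 \<le> 4 * t / (1 + 2 * t)" using t by (intro divide_left_mono) auto
        also have "\<dots> < 3/5" using t by (simp add: divide_simps)
        finally show ?thesis using e0_bounds by simp
      qed
      then show "P (\<lambda>s. g (4 * (- s) / (1 + - s)\<^sup>2)) (- t)"
        by - (rule deriv_base, use t in \<open>auto intro!: exI derivative_eq_intros\<close>)
      show "P (\<lambda>s. g (- s)) (- t)"
        by (rule deriv_base) (use t e0_bounds in \<open>auto intro!: exI derivative_eq_intros\<close>)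
    qed (rule const)+
    then show ?thesis
    proof (rule cong)
      have "\<forall>\<^sub>F s in nhds (- t). - (1/5) < s \<and> s < 0"
        using t by (intro eventually_between_ident) auto
      then show "\<forall>\<^sub>F s in nhds (- t). g s = -2 * g (2 * (- s) / (1 + - s)) + (-2 * g ((1 + - s) / 2) + (1/2 * g (4 * (- s) / (1 + - s)\<^sup>2) +
            (1 * g (- s) + (-1 * g (- 1) + (0 * g (- 1) + (0 * g (- 1) + (0 * g (- 1) + 0)))))))"
      proof eventually_elim
        case (elim s)
        then show ?case using equation_curve[of "- s"] by simp
      qed
    qed
  qed

text \<open>
  Near a point \<open>r0\<close> of \<open>[e0, 1)\<close>, move along the curve \<open>r / y = k\<close>. There the eighth argument is constant, and the
  equation can be solved for the fourth one.
\<close>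
lemma regular_pos: "P g r0" if r0: "0 < r0" "r0 < 1"
  proof (cases "r0 < e0")
    case True
    then show ?thesis using base r0 by blast
  next
    case False
    \<comment> \<open>\<open>x\<close> so small that \<open>x / y < 1/5\<close>: the arguments other than \<open>r0\<close> and \<open>- k\<close> then lie in \<open>(- 1/5, e0)\<close>\<close>
    define x0 where "x0 = (1 - r0) / 5"
    define y0 where "y0 = 1 - r0 * (1 - x0)"
    have x0: "0 < x0" "x0 < 2/25" using r0 False e0_bounds by (auto simp: x0_def)
    have y0eq: "y0 = 1 - r0 + r0 * x0" by (simp add: y0_def algebra_simps)
    have "r0 * x0 < x0" "0 < r0 * x0" using x0 r0 by auto
    moreover have "5 * x0 = 1 - r0" by (simp add: x0_def)
    ultimately have y0: "y0 > 5 * x0" "y0 < 1/2" "y0 > 0" using y0eq r0 x0 False e0_bounds(1) by linarith+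
    define k where "k = r0 / y0"
    have k: "k > 0" "r0 / k = y0" using r0 y0 by (auto simp: k_def)
    define x where "x s = 1 + 1 / k - 1 / s" for s
    define y where "y s = s / k" for s
    have xr0: "x r0 = x0"
    proof -
      have "1 / k = y0 / r0" by (simp add: k_def)
      also have "\<dots> = 1 / r0 - (1 - x0)" using r0 by (simp add: y0_def diff_divide_distrib)
      finally show ?thesis by (simp add: x_def)
    qed
    have yr0: "y r0 = y0" using k by (simp add: y_def)
    have dx: "(x has_real_derivative 1 / r0\<^sup>2) (at r0)"
      unfolding x_def[abs_def] using r0 by (auto intro!: derivative_eq_intros simp: power2_eq_square)
    have dy: "(y has_real_derivative 1 / k) (at r0)"
      unfolding y_def[abs_def] using k by (auto intro!: derivative_eq_intros)
    have did: "((\<lambda>s. s) has_real_derivative 1) (at r0)" by simp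
    have e35: "3/5 < e0" using e0_bounds by simp
    have xy5: "x0 / y0 < 1/5" "0 < x0 / y0" using x0 y0 by (simp_all add: divide_simps)
    have xye: "x0 / y0 < e0" using xy5 e35 by linarith
    have "P (\<lambda>s. -1 * g (x s) + (-1 * g (y s) + (1/2 * g (x s / y s) + (-1 * g (x s * s / y s) +
            (1/2 * g (x s * y s) + (-1 * g (- (x s * s)) + (-1 * g (- k) + (1/2 * g (x s * s\<^sup>2 / y s) + 0)))))))) r0"
    proof (rule eight_terms)
      show "P (\<lambda>s. g (x s)) r0" by (rule comp_derivative[OF _ dx]) (use xr0 x0 e35 in \<open>auto intro!: base\<close>)
      show "P (\<lambda>s. g (y s)) r0" by (rule comp_derivative[OF _ dy]) (use yr0 y0 e35 in \<open>auto intro!: base\<close>)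
      show "P (\<lambda>s. g (x s / y s)) r0"
        by (rule comp_derivative[OF _ DERIV_divide[OF dx dy]]) (use xr0 yr0 xye x0 y0 in \<open>auto intro!: base\<close>)
      have "x0 * r0 / y0 = (x0 / y0) * r0" by simp
      also have "\<dots> < 1/5 * 1" using xy5 r0 by (intro mult_strict_mono) auto
      finally have 5: "x0 * r0 / y0 < 1/5" by simp
      have 5: "x0 * r0 / y0 < 1/5" "x0 * r0 / y0 < e0" using 5 e35 by linarith+
      show "P (\<lambda>s. g (x s * s / y s)) r0"
        by (rule comp_derivative[OF _ DERIV_divide[OF DERIV_mult[OF dx did] dy]])
          (use xr0 yr0 5(2) x0 y0 r0 in \<open>auto intro!: base\<close>)
      have "x0 * y0 < x0" using x0 y0 by simp
      then have "x0 * y0 < e0" using x0 e35 by linarith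
      then show "P (\<lambda>s. g (x s * y s)) r0"
        by (intro comp_derivative[OF _ DERIV_mult[OF dx dy]]) (use xr0 yr0 x0 y0 in \<open>auto intro!: base\<close>)
      have "x0 * r0 < x0" using x0 r0 by simp
      then have "x0 * r0 < 1/5" using x0 by linarith
      then show "P (\<lambda>s. g (- (x s * s))) r0"
        by (intro comp_derivative[OF _ DERIV_minus[OF DERIV_mult[OF dx did]]]) (use xr0 x0 r0 in \<open>auto intro!: small_neg\<close>)
      have "x0 * r0\<^sup>2 / y0 = (x0 * r0 / y0) * r0" by (simp add: power2_eq_square)
      also have "\<dots> < 1/5 * 1" using 5(1) r0 x0 y0 by (intro mult_strict_mono) auto
      finally have 9: "x0 * r0\<^sup>2 / y0 < e0" using e35 by linarith
      have d2: "((\<lambda>s. s\<^sup>2) has_real_derivative 2 * r0) (at r0)" by (auto intro!: derivative_eq_intros)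
      show "P (\<lambda>s. g (x s * s\<^sup>2 / y s)) r0"
        by (rule comp_derivative[OF _ DERIV_divide[OF DERIV_mult[OF dx d2] dy]])
          (use xr0 yr0 9 x0 y0 r0 in \<open>auto intro!: base\<close>)
    qed (rule const)
    then show ?thesis
    proof (rule cong)
      have cx: "isCont x r0" "isCont y r0" using dx dy by (auto intro: DERIV_isCont)
      have "\<forall>\<^sub>F s in nhds r0. 0 < s \<and> s < 1" using r0 by (intro eventually_between_ident) auto
      moreover have "\<forall>\<^sub>F s in nhds r0. 0 < x s \<and> x s < 1" using cx xr0 x0 by (intro eventually_between) auto
      moreover have "\<forall>\<^sub>F s in nhds r0. 0 < y s \<and> y s < e0" using cx yr0 y0 e35 by (intro eventually_between) auto
      moreover have "\<forall>\<^sub>F s in nhds r0. x s < y s" using cx xr0 yr0 x0 y0 by (intro eventually_less_cont) auto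
      ultimately show "\<forall>\<^sub>F s in nhds r0. g s = -1 * g (x s) + (-1 * g (y s) + (1/2 * g (x s / y s) + (-1 * g (x s * s / y s) +
            (1/2 * g (x s * y s) + (-1 * g (- (x s * s)) + (-1 * g (- k) + (1/2 * g (x s * s\<^sup>2 / y s) + 0)))))))"
      proof eventually_elim
        case (elim s)
        have "s / k < 1" using elim e0_less by (simp add: y_def)
        then have sk: "s < k" using k by (simp add: divide_less_eq)
        have "s = (1 - y s) / (1 - x s)"
        proof -
          have "1 - x s = (k - s) / (k * s)" using elim k by (simp add: x_def field_simps)
          moreover have "1 - y s = (k - s) / k" using k by (simp add: y_def field_simps)
          ultimately show ?thesis using sk k elim by simp
        qed
        from equation_ratio[OF _ _ _ this] elim have "2 * g (x s) + 2 * g (y s) - g (x s / y s) + 2 * g s + 2 * g (x s * s / y s) - g (x s * y s)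
            + 2 * g (- (x s * s)) + 2 * g (- (s / y s)) - g (x s * s\<^sup>2 / y s) = 0" by blast
        moreover have "s / y s = k" using elim k by (simp add: y_def)
        ultimately show ?case by simp
      qed
    qed
  qed

text \<open>
  Fix a small \<open>x\<close> and solve for the eighth argument \<open>- r / y\<close>, which takes every value \<open>- k\<close> with
  \<open>k \<ge> e0\<close> at some \<open>y < e0\<close>.
\<close>
lemma large_neg: "P g (- k)" if k: "k \<ge> e0"
  proof -
    \<comment> \<open>positive because \<open>1 - e0 < e0^2\<close>; \<open>x0 < h\<close> makes \<open>y0 < e0\<close>\<close>
    define h where "h = 1 - (1 - e0) / e0\<^sup>2"
    have h: "h > 0" "h \<le> 1" using e0_bounds e0_less by (auto simp: h_def divide_simps)
    have k0: "k > 0" using k e0_bounds by simp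
    define x0 where "x0 = min (h / 2) (min (1 / (2 * (1 + k))) (1/10))"
    have x0: "0 < x0" "x0 < h" "x0 \<le> 1 / (2 * (1 + k))" "x0 \<le> 1/10" using h k0 by (auto simp: x0_def)
    have x1: "1 - x0 > (1 - e0) / e0\<^sup>2" using x0 by (simp add: h_def)
    define y where "y s = 1 / (1 - s * (1 - x0))" for s
    define y0 where "y0 = 1 / (1 + k * (1 - x0))"
    define r where "r s = (1 - y s) / (1 - x0)" for s
    have kx: "k * (1 - x0) > (1 - e0) / e0"
    proof -
      have "(1 - e0) / e0 = e0 * ((1 - e0) / e0\<^sup>2)" using e0_bounds by (simp add: power2_eq_square)
      also have "\<dots> < e0 * (1 - x0)" using x1 e0_bounds by (intro mult_strict_left_mono) auto
      also have "\<dots> \<le> k * (1 - x0)" using k x0 by (intro mult_right_mono) auto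
      finally show ?thesis .
    qed
    have pos1: "1 + k * (1 - x0) > 0" using k0 x0 by (simp add: add_pos_pos)
    have ye: "y0 < e0"
    proof -
      have "1 / e0 = 1 + (1 - e0) / e0" using e0_bounds by (simp add: diff_divide_distrib)
      then have "1 + k * (1 - x0) > 1 / e0" using kx by linarith
      then show ?thesis using pos1 e0_bounds by (simp add: y0_def divide_simps mult.commute)
    qed
    have yx: "x0 < y0"
    proof -
      have "x0 \<le> 1 / (2 * (1 + k))" using x0 by simp
      also have "\<dots> < 1 / (1 + k)" using k0 by (simp add: divide_simps)
      also have "\<dots> \<le> y0" unfolding y0_def using k0 x0 pos1 by (intro divide_left_mono) auto
      finally show ?thesis .
    qed
    have yk: "y (- k) = y0" by (simp add: y_def y0_def)
    define r0 where "r0 = (1 - y0) / (1 - x0)"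
    have rk: "r (- k) = r0" by (simp add: r_def yk r0_def)
    have y01: "0 < y0" "y0 < 1" using yx x0 ye e0_less by auto
    have r01: "0 < r0" "r0 < 1" using y01 yx x0 by (auto simp: r0_def divide_simps)
    have "\<exists>d. (y has_real_derivative d) (at (- k))"
      unfolding y_def[abs_def] using pos1 by (intro exI) (auto intro!: derivative_eq_intros)
    then obtain d where dy: "(y has_real_derivative d) (at (- k))" by blast
    have dr: "(r has_real_derivative (0 - d) / (1 - x0)) (at (- k))"
      unfolding r_def[abs_def] by (intro DERIV_cdivide DERIV_diff dy) auto
    have dc: "((\<lambda>s. x0) has_real_derivative 0) (at (- k))" by simp
    have dr2: "((\<lambda>s. (r s)\<^sup>2) has_real_derivative 2 * (r (- k) * ((0 - d) / (1 - x0)))) (at (- k))"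
      using DERIV_power[OF dr, of 2] by (simp add: mult.commute mult.left_commute)
    have xy1: "x0 / y0 < 1" "0 < x0 / y0" using yx x0 y01 by auto
    have "P (\<lambda>s. -1 * g x0 + (-1 * g (y s) + (1/2 * g (x0 / y s) + (-1 * g (r s) + (-1 * g (x0 * r s / y s) +
            (1/2 * g (x0 * y s) + (-1 * g (- (x0 * r s)) + (1/2 * g (x0 * (r s)\<^sup>2 / y s) + 0)))))))) (- k)"
    proof (rule eight_terms)
      show "P (\<lambda>s. g x0) (- k)" by (rule const)
      show "P (\<lambda>s. g (y s)) (- k)" by (rule comp_derivative[OF _ dy]) (use yk y01 in \<open>auto intro!: regular_pos\<close>)
      show "P (\<lambda>s. g (x0 / y s)) (- k)"
        by (rule comp_derivative[OF _ DERIV_divide[OF dc dy]]) (use yk y01 xy1 in \<open>auto intro!: regular_pos\<close>)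
      show "P (\<lambda>s. g (r s)) (- k)" by (rule comp_derivative[OF _ dr]) (use rk r01 in \<open>auto intro!: regular_pos\<close>)
      have "x0 * r0 / y0 = (x0 / y0) * r0" by simp
      also have "\<dots> < 1 * 1" using xy1 r01 by (intro mult_strict_mono) auto
      finally have 5: "x0 * r0 / y0 < 1" by simp
      show "P (\<lambda>s. g (x0 * r s / y s)) (- k)"
        by (rule comp_derivative[OF _ DERIV_divide[OF DERIV_mult[OF dc dr] dy]])
          (use yk rk 5 x0 y01 r01 in \<open>auto intro!: regular_pos\<close>)
      have "x0 * y0 < x0" using x0 y01 by simp
      then have "x0 * y0 < 1" using x0 by linarith
      then show "P (\<lambda>s. g (x0 * y s)) (- k)"
        by (intro comp_derivative[OF _ DERIV_mult[OF dc dy]]) (use yk x0 y01 in \<open>auto intro!: regular_pos\<close>)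
      have "x0 * r0 < x0" using x0 r01 by simp
      then have "x0 * r0 < 1/5" using x0 by linarith
      then show "P (\<lambda>s. g (- (x0 * r s))) (- k)"
        by (intro comp_derivative[OF _ DERIV_minus[OF DERIV_mult[OF dc dr]]]) (use rk x0 r01 in \<open>auto intro!: small_neg\<close>)
      have "x0 * r0\<^sup>2 / y0 = (x0 * r0 / y0) * r0" by (simp add: power2_eq_square)
      also have "\<dots> < 1 * 1" using 5 r01 x0 y01 by (intro mult_strict_mono) auto
      finally have 9: "x0 * r0\<^sup>2 / y0 < 1" by simp
      show "P (\<lambda>s. g (x0 * (r s)\<^sup>2 / y s)) (- k)"
        by (rule comp_derivative[OF _ DERIV_divide[OF DERIV_mult[OF dc dr2] dy]])
          (use rk yk 9 x0 y01 r01 in \<open>auto intro!: regular_pos\<close>)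
    qed
    then show ?thesis
    proof (rule cong)
      have cy: "isCont y (- k)" using dy by (rule DERIV_isCont)
      have "\<forall>\<^sub>F s in nhds (- k). x0 < y s \<and> y s < e0" using cy yk ye yx by (intro eventually_between) auto
      then show "\<forall>\<^sub>F s in nhds (- k). g s = -1 * g x0 + (-1 * g (y s) + (1/2 * g (x0 / y s) + (-1 * g (r s) + (-1 * g (x0 * r s / y s) +
            (1/2 * g (x0 * y s) + (-1 * g (- (x0 * r s)) + (1/2 * g (x0 * (r s)\<^sup>2 / y s) + 0)))))))"
      proof eventually_elim
        case (elim s)
        have "2 * g x0 + 2 * g (y s) - g (x0 / y s) + 2 * g (r s) + 2 * g (x0 * r s / y s) - g (x0 * y s)
            + 2 * g (- (x0 * r s)) + 2 * g (- (r s / y s)) - g (x0 * (r s)\<^sup>2 / y s) = 0"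
          by (rule equation_ratio) (use elim x0 in \<open>auto simp: r_def\<close>)
        moreover have "- (r s / y s) = s"
        proof -
          have y: "y s > 0" using elim x0 by simp
          then have nz: "1 - s * (1 - x0) \<noteq> 0" by (auto simp: y_def)
          have "(1 - y s) / y s = - (s * (1 - x0))" unfolding y_def using nz by (simp add: divide_simps)
          moreover have "r s / y s = (1 - y s) / y s / (1 - x0)" by (simp add: r_def mult.commute)
          ultimately have "r s / y s = - (s * (1 - x0)) / (1 - x0)" by simp
          then show ?thesis using x0 by simp
        qed
        ultimately show ?case by simp
      qed
    qed
  qed

text \<open>
  Fix \<open>y\<close> between \<open>t\<close> and \<open>e0\<close> and solve for the seventh argument \<open>- x r\<close>; the eighth one is then covered by
  \<open>large_neg\<close>.
\<close>
lemma mid_neg: "P g (- t)" if t: "0 < t" "t < e0"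
  proof -
    define y0 where "y0 = (t + e0) / 2"
    have y0: "t < y0" "y0 < e0" "0 < y0" "y0 < 1" using t e0_less by (auto simp: y0_def)
    define r where "r s = 1 - y0 - s" for s
    define x where "x s = - s / (1 - y0 - s)" for s
    define x0 where "x0 = t / (1 - y0 + t)"
    define r0 where "r0 = 1 - y0 + t"
    have rt: "r (- t) = r0" by (simp add: r_def r0_def)
    have xt: "x (- t) = x0" by (simp add: x_def x0_def)
    have r0: "0 < r0" "r0 < 1" using y0 t by (auto simp: r0_def)
    have x0: "0 < x0" "x0 < y0"
    proof -
      show "0 < x0" using t y0 by (simp add: x0_def)
      have "t * (1 - y0) < y0 * (1 - y0)" using y0 by (intro mult_strict_right_mono) auto
      then have "t < y0 * (1 - y0 + t)" by (simp add: algebra_simps)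
      then show "x0 < y0" using y0 t by (simp add: x0_def divide_simps)
    qed
    have xr: "x0 * r0 = t" using r0 by (simp add: x0_def r0_def)
    have x01: "x0 < 1" using x0 y0 by simp
    have dr: "(r has_real_derivative (- 1)) (at (- t))" unfolding r_def[abs_def] by (auto intro!: derivative_eq_intros)
    have "\<exists>d. (x has_real_derivative d) (at (- t))"
      unfolding x_def[abs_def] using y0 t by (intro exI) (auto intro!: derivative_eq_intros)
    then obtain d where dx: "(x has_real_derivative d) (at (- t))" by blast
    have dc: "((\<lambda>s. y0) has_real_derivative 0) (at (- t))" by simp
    have dr2: "((\<lambda>s. (r s)\<^sup>2) has_real_derivative 2 * (r (- t) * (- 1))) (at (- t))"
      using DERIV_power[OF dr, of 2] by (simp add: mult.commute mult.left_commute)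
    have xy1: "x0 / y0 < 1" "0 < x0 / y0" using x0 y0 by auto
    have "P (\<lambda>s. -1 * g (x s) + (-1 * g y0 + (1/2 * g (x s / y0) + (-1 * g (r s) + (-1 * g (x s * r s / y0) +
            (1/2 * g (x s * y0) + (-1 * g (- (r s / y0)) + (1/2 * g (x s * (r s)\<^sup>2 / y0) + 0)))))))) (- t)"
    proof (rule eight_terms)
      show "P (\<lambda>s. g (x s)) (- t)" by (rule comp_derivative[OF _ dx]) (use xt x0 x01 in \<open>auto intro!: regular_pos\<close>)
      show "P (\<lambda>s. g y0) (- t)" by (rule const)
      show "P (\<lambda>s. g (x s / y0)) (- t)"
        by (rule comp_derivative[OF _ DERIV_divide[OF dx dc]]) (use xt y0 xy1 in \<open>auto intro!: regular_pos\<close>)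
      show "P (\<lambda>s. g (r s)) (- t)" by (rule comp_derivative[OF _ dr]) (use rt r0 in \<open>auto intro!: regular_pos\<close>)
      show "P (\<lambda>s. g (x s * r s / y0)) (- t)"
        by (rule comp_derivative[OF _ DERIV_divide[OF DERIV_mult[OF dx dr] dc]])
          (use xt rt xr t y0 in \<open>auto intro!: regular_pos\<close>)
      have "x0 * y0 < 1 * 1" using x0 x01 y0 by (intro mult_strict_mono) auto
      then show "P (\<lambda>s. g (x s * y0)) (- t)"
        by (intro comp_derivative[OF _ DERIV_mult[OF dx dc]]) (use xt x0 y0 in \<open>auto intro!: regular_pos\<close>)
      have "e0 * y0 \<le> r0"
      proof -
        have "e0 * (t + e0) \<le> 1 * t + e0\<^sup>2" using t e0_less by (simp add: algebra_simps power2_eq_square)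
        moreover have "e0 * e0 < 1 * 1" using e0_bounds e0_less by (intro mult_strict_mono) auto
        ultimately show ?thesis using e0_less by (simp add: y0_def r0_def field_simps power2_eq_square)
      qed
      then have "e0 \<le> r0 / y0" using y0 by (simp add: divide_simps)
      then show "P (\<lambda>s. g (- (r s / y0))) (- t)"
        by (intro comp_derivative[OF _ DERIV_minus[OF DERIV_divide[OF dr dc]]]) (use rt y0 in \<open>auto intro!: large_neg\<close>)
      have "x0 * r0\<^sup>2 / y0 = (t / y0) * r0" using xr by (simp add: power2_eq_square)
      also have "\<dots> < 1 * 1" using r0 t y0 by (intro mult_strict_mono) auto
      finally have 9: "x0 * r0\<^sup>2 / y0 < 1" by simp
      show "P (\<lambda>s. g (x s * (r s)\<^sup>2 / y0)) (- t)"
        by (rule comp_derivative[OF _ DERIV_divide[OF DERIV_mult[OF dx dr2] dc]])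
          (use rt xt 9 x0 y0 r0 in \<open>auto intro!: regular_pos\<close>)
    qed
    then show ?thesis
    proof (rule cong)
      have cx: "isCont x (- t)" using dx by (rule DERIV_isCont)
      have "\<forall>\<^sub>F s in nhds (- t). 0 < x s \<and> x s < y0" using cx xt x0 by (intro eventually_between) auto
      moreover have "\<forall>\<^sub>F s in nhds (- t). - 1 < s \<and> s < 0" using t e0_less by (intro eventually_between_ident) auto
      ultimately show "\<forall>\<^sub>F s in nhds (- t). g s = -1 * g (x s) + (-1 * g y0 + (1/2 * g (x s / y0) + (-1 * g (r s) + (-1 * g (x s * r s / y0) +
            (1/2 * g (x s * y0) + (-1 * g (- (r s / y0)) + (1/2 * g (x s * (r s)\<^sup>2 / y0) + 0)))))))"
      proof eventually_elim
        case (elim s)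
        have nz: "1 - y0 - s > 0" using elim y0 by simp
        have "r s = (1 - y0) / (1 - x s)"
        proof -
          have "1 - x s = (1 - y0) / (1 - y0 - s)" using nz by (simp add: x_def field_simps)
          then show ?thesis using y0 nz by (simp add: r_def)
        qed
        from equation_ratio[OF _ _ _ this] elim y0
        have "2 * g (x s) + 2 * g y0 - g (x s / y0) + 2 * g (r s) + 2 * g (x s * r s / y0) - g (x s * y0)
            + 2 * g (- (x s * r s)) + 2 * g (- (r s / y0)) - g (x s * (r s)\<^sup>2 / y0) = 0" by blast
        moreover have "- (x s * r s) = s" using nz by (simp add: x_def r_def)
        ultimately show ?case by simp
      qed
    qed
  qed

lemma regular: "t < 1 \<Longrightarrow> t \<noteq> 0 \<Longrightarrow> P g t"
  using regular_pos[of t] mid_neg[of "- t"] large_neg[of "- t"] by (cases "t > 0"; cases "- t < e0") auto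

end

context kummer_solution
begin

lemma regular_everywhere:
  assumes "local_regularity P" and "\<And>t. 0 < t \<Longrightarrow> t < e0 \<Longrightarrow> P g t"
    and "t < 1" "t \<noteq> 0"
  shows "P g t"
proof -
  interpret local_regularity P by fact
  interpret regular_kummer_solution g e0 P by unfold_locales (use assms in blast)
  show ?thesis using regular assms by blast
qed

lemma isCont_g: "t < 1 \<Longrightarrow> isCont g t"
  using regular_everywhere[OF local_regularity_isCont isCont_left] cont0 by (cases "t = 0") auto

end

section \<open>Smoothness by averaging over dilations\<close>

text \<open>
  An average of dilates of a continuous \<open>g\<close> is differentiable in the dilation parameter. With a primitive \<open>Q\<close> of
  \<open>g t / t\<close>, integration by parts replaces \<open>g (c v)\<close> by \<open>Q (c v)\<close>, which may be differentiated in \<open>c\<close> under the integral;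
  the result is an average of the same kind, with weight \<open>- (\<omega> \<psi>)'\<close>.
\<close>
lemma log_average_deriv:
  fixes g v \<omega> \<omega>1 \<psi> \<psi>1 :: "real \<Rightarrow> real"
  assumes W: "open W" "is_interval W" "0 \<notin> W" and g: "continuous_on W g" and ab: "\<alpha> < \<beta>"
    and range: "\<And>y. y \<in> {\<alpha>..\<beta>} \<Longrightarrow> c0 * v y \<in> W"
    and v: "\<And>y. y \<in> {\<alpha>..\<beta>} \<Longrightarrow> (v has_real_derivative v y / \<omega> y) (at y)"
    and \<omega>0: "\<And>y. y \<in> {\<alpha>..\<beta>} \<Longrightarrow> \<omega> y \<noteq> 0"
    and \<omega>: "\<And>y. y \<in> {\<alpha>..\<beta>} \<Longrightarrow> (\<omega> has_real_derivative \<omega>1 y) (at y)" "continuous_on {\<alpha>..\<beta>} \<omega>1"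
    and \<psi>: "\<And>y. y \<in> {\<alpha>..\<beta>} \<Longrightarrow> (\<psi> has_real_derivative \<psi>1 y) (at y)" "continuous_on {\<alpha>..\<beta>} \<psi>1"
    and ends: "\<psi> \<alpha> = 0" "\<psi> \<beta> = 0"
  shows "((\<lambda>c. integral {\<alpha>..\<beta>} (\<lambda>y. g (c * v y) * \<psi> y)) has_real_derivative
      integral {\<alpha>..\<beta>} (\<lambda>y. g (c0 * v y) * - (\<omega>1 y * \<psi> y + \<omega> y * \<psi>1 y)) / c0) (at c0)"
proof -
  have ne: "{\<alpha>..\<beta>} \<noteq> {}" using ab by simp
  have cv: "continuous_on {\<alpha>..\<beta>} v"
    by (rule DERIV_continuous_on) (use v has_field_derivative_at_within in blast)
  have c\<omega>: "continuous_on {\<alpha>..\<beta>} \<omega>"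
    by (rule DERIV_continuous_on) (use \<omega> has_field_derivative_at_within in blast)
  have c\<psi>: "continuous_on {\<alpha>..\<beta>} \<psi>"
    by (rule DERIV_continuous_on) (use \<psi> has_field_derivative_at_within in blast)
  have ccv: "continuous_on {\<alpha>..\<beta>} (\<lambda>y. c0 * v y)" using cv by (intro continuous_intros)
  obtain ym where ym: "ym \<in> {\<alpha>..\<beta>}" "\<And>y. y \<in> {\<alpha>..\<beta>} \<Longrightarrow> c0 * v ym \<le> c0 * v y"
    using continuous_attains_inf[OF compact_Icc ne ccv] by blast
  obtain yM where yM: "yM \<in> {\<alpha>..\<beta>}" "\<And>y. y \<in> {\<alpha>..\<beta>} \<Longrightarrow> c0 * v y \<le> c0 * v yM"
    using continuous_attains_sup[OF compact_Icc ne ccv] by blast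
  obtain d1 where d1: "d1 > 0" "cball (c0 * v ym) d1 \<subseteq> W" using W(1) range[OF ym(1)] open_contains_cball by blast
  obtain d2 where d2: "d2 > 0" "cball (c0 * v yM) d2 \<subseteq> W" using W(1) range[OF yM(1)] open_contains_cball by blast
  define a where "a = c0 * v ym - d1"
  define b where "b = c0 * v yM + d2"
  have aW: "a \<in> W" "b \<in> W" using d1 d2 by (auto simp: a_def b_def subset_iff dist_real_def)
  have abW: "{a..b} \<subseteq> W" using mem_is_interval_1_I[OF W(2) aW] by (simp add: subset_iff)
  obtain B where B: "B > 0" "\<And>y. y \<in> {\<alpha>..\<beta>} \<Longrightarrow> \<bar>v y\<bar> \<le> B"
  proof -
    have "bounded (v ` {\<alpha>..\<beta>})" using cv by (intro compact_imp_bounded compact_continuous_image) auto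
    then show thesis using that unfolding bounded_pos by auto
  qed
  define \<delta> where "\<delta> = min d1 d2 / B"
  have del: "\<delta> > 0" using d1 d2 B by (simp add: \<delta>_def)
  define U where "U = {c0 - \<delta><..<c0 + \<delta>}"
  have U: "open U" "convex U" "c0 \<in> U" using del by (auto simp: U_def)
  have inab: "a < c * v y \<and> c * v y < b" if "c \<in> U" "y \<in> {\<alpha>..\<beta>}" for c y
  proof -
    have "\<bar>c - c0\<bar> < \<delta>" using that by (auto simp: U_def)
    then have "\<bar>c - c0\<bar> * B < min d1 d2" using B del by (simp add: \<delta>_def pos_less_divide_eq)
    moreover have "\<bar>(c - c0) * v y\<bar> \<le> \<bar>c - c0\<bar> * B" unfolding abs_mult using B(2)[OF that(2)] by (rule mult_left_mono) simp
    moreover have "c * v y = c0 * v y + (c - c0) * v y" by (simp add: algebra_simps)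
    ultimately show ?thesis using ym(2)[OF that(2)] yM(2)[OF that(2)] unfolding a_def b_def by linarith
  qed
  have nz: "c * v y \<noteq> 0" if "c \<in> U" "y \<in> {\<alpha>..\<beta>}" for c y
    using inab[OF that] abW W(3) by (metis atLeastAtMost_iff less_eq_real_def subsetD)
  have "continuous_on {a..b} (\<lambda>t. g t / t)"
    using abW W(3) by (intro continuous_intros continuous_on_subset[OF g]) auto
  then obtain Q where Q: "\<And>t. t \<in> {a..b} \<Longrightarrow> (Q has_vector_derivative g t / t) (at t within {a..b})"
    using antiderivative_continuous by blast
  have Q': "(Q has_real_derivative g t / t) (at t)" if "a < t" "t < b" for t
  proof -
    have "(Q has_real_derivative g t / t) (at t within {a..b})"
      using Q[of t] that by (simp add: has_real_derivative_iff_has_vector_derivative)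
    then show ?thesis using that by (simp add: at_within_Icc_at)
  qed
  define D where "D y = - (\<omega>1 y * \<psi> y + \<omega> y * \<psi>1 y)" for y
  have cD: "continuous_on {\<alpha>..\<beta>} D" unfolding D_def by (intro continuous_intros c\<omega> c\<psi> \<omega>(2) \<psi>(2))
  have cQ: "continuous_on {a<..<b} Q"
    by (rule DERIV_continuous_on[where D = "\<lambda>t. g t / t"]) (use Q' in \<open>auto intro: has_field_derivative_at_within\<close>)
  have contgc: "continuous_on {\<alpha>..\<beta>} (\<lambda>y. g (c * v y))" if "c \<in> U" for c
    by (rule continuous_on_compose2[OF g]) (use inab[OF that] abW in \<open>auto intro!: continuous_intros cv\<close>,
      meson atLeastAtMost_iff less_eq_real_def subsetD)
  have contQc: "continuous_on {\<alpha>..\<beta>} (\<lambda>y. Q (c * v y))" if "c \<in> U" for c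
    by (rule continuous_on_compose2[OF cQ]) (use inab[OF that] in \<open>auto intro!: continuous_intros cv\<close>)
  have parts: "integral {\<alpha>..\<beta>} (\<lambda>y. g (c * v y) * \<psi> y) = integral {\<alpha>..\<beta>} (\<lambda>y. Q (c * v y) * D y)" if c: "c \<in> U" for c
  proof -
    have "((\<lambda>y. g (c * v y) * \<psi> y - Q (c * v y) * D y) has_integral
        (Q (c * v \<beta>) * (\<omega> \<beta> * \<psi> \<beta>) - Q (c * v \<alpha>) * (\<omega> \<alpha> * \<psi> \<alpha>))) {\<alpha>..\<beta>}"
    proof (rule fundamental_theorem_of_calculus)
      fix y assume y: "y \<in> {\<alpha>..\<beta>}"
      have 1: "((\<lambda>y. Q (c * v y)) has_real_derivative g (c * v y) / (c * v y) * (c * (v y / \<omega> y))) (at y)"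
        by (rule DERIV_chain2[where f = Q]) (use inab[OF c y] Q' DERIV_cmult[OF v[OF y], of c] in auto)
      have 2: "((\<lambda>y. \<omega> y * \<psi> y) has_real_derivative \<omega>1 y * \<psi> y + \<psi>1 y * \<omega> y) (at y)"
        by (rule DERIV_mult) (use \<omega>(1)[OF y] \<psi>(1)[OF y] in auto)
      have "((\<lambda>y. Q (c * v y) * (\<omega> y * \<psi> y)) has_real_derivative g (c * v y) * \<psi> y - Q (c * v y) * D y) (at y)"
        by (rule DERIV_cong[OF DERIV_mult[OF 1 2]]) (use nz[OF c y] \<omega>0[OF y] in \<open>simp add: D_def field_simps\<close>)
      then show "((\<lambda>y. Q (c * v y) * (\<omega> y * \<psi> y)) has_vector_derivative g (c * v y) * \<psi> y - Q (c * v y) * D y)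
          (at y within {\<alpha>..\<beta>})"
        using has_field_derivative_at_within has_real_derivative_iff_has_vector_derivative by blast
    qed (use ab in simp)
    then have "integral {\<alpha>..\<beta>} (\<lambda>y. g (c * v y) * \<psi> y - Q (c * v y) * D y) = 0"
      using ends by (simp add: integral_unique)
    moreover have "integral {\<alpha>..\<beta>} (\<lambda>y. g (c * v y) * \<psi> y - Q (c * v y) * D y)
       = integral {\<alpha>..\<beta>} (\<lambda>y. g (c * v y) * \<psi> y) - integral {\<alpha>..\<beta>} (\<lambda>y. Q (c * v y) * D y)"
      by (rule integral_diff; intro integrable_continuous_real continuous_intros contgc contQc c c\<psi> cD)
    ultimately show ?thesis by simp
  qed
  have "((\<lambda>c. integral (cbox \<alpha> \<beta>) (\<lambda>y. Q (c * v y) * D y)) has_real_derivative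
      integral (cbox \<alpha> \<beta>) (\<lambda>y. g (c0 * v y) / c0 * D y)) (at c0 within U)"
  proof (rule leibniz_rule_field_derivative)
    fix c y assume c: "c \<in> U" and "y \<in> cbox \<alpha> \<beta>"
    then have y: "y \<in> {\<alpha>..\<beta>}" by simp
    have "((\<lambda>c. Q (c * v y)) has_real_derivative g (c * v y) / (c * v y) * v y) (at c)"
      by (rule DERIV_chain2[where f = Q]) (use inab[OF c y] Q' in \<open>auto intro!: derivative_eq_intros\<close>)
    then have "((\<lambda>c. Q (c * v y) * D y) has_real_derivative g (c * v y) / c * D y) (at c)"
      by (rule DERIV_cong[OF DERIV_cmult_right]) (use nz[OF c y] in simp)
    then show "((\<lambda>c. Q (c * v y) * D y) has_real_derivative g (c * v y) / c * D y) (at c within U)"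
      by (rule has_field_derivative_at_within)
  next
    fix c assume "c \<in> U"
    then show "(\<lambda>y. Q (c * v y) * D y) integrable_on cbox \<alpha> \<beta>"
      unfolding interval_cbox[symmetric] by (intro integrable_continuous_real continuous_intros contQc cD)
  next
    have vs: "continuous_on (U \<times> cbox \<alpha> \<beta>) (\<lambda>p. v (snd p))"
      by (rule continuous_on_compose2[OF cv]) (auto intro!: continuous_intros)
    have Ds: "continuous_on (U \<times> cbox \<alpha> \<beta>) (\<lambda>p. D (snd p))"
      by (rule continuous_on_compose2[OF cD]) (auto intro!: continuous_intros)
    have gs: "continuous_on (U \<times> cbox \<alpha> \<beta>) (\<lambda>p. g (fst p * v (snd p)))"
    proof (rule continuous_on_compose2[OF g])
      show "continuous_on (U \<times> cbox \<alpha> \<beta>) (\<lambda>p. fst p * v (snd p))" by (intro continuous_intros vs)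
      show "(\<lambda>p. fst p * v (snd p)) ` (U \<times> cbox \<alpha> \<beta>) \<subseteq> W"
      proof clarsimp
        fix c y assume "c \<in> U" "\<alpha> \<le> y" "y \<le> \<beta>"
        then show "c * v y \<in> W" using inab[of c y] abW by (auto simp: subset_iff)
      qed
    qed
    have c0: "fst p \<noteq> 0" if "p \<in> U \<times> cbox \<alpha> \<beta>" for p using nz[of "fst p" "snd p"] that by auto
    show "continuous_on (U \<times> cbox \<alpha> \<beta>) (\<lambda>(c, y). g (c * v y) / c * D y)"
      unfolding split_beta by (intro continuous_intros gs Ds) (use c0 in auto)
  qed (use U in auto)
  then have "((\<lambda>c. integral {\<alpha>..\<beta>} (\<lambda>y. Q (c * v y) * D y)) has_real_derivative
      integral {\<alpha>..\<beta>} (\<lambda>y. g (c0 * v y) / c0 * D y)) (at c0)"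
    by (simp only: at_within_open[OF U(3) U(1)] cbox_interval)
  moreover have "integral {\<alpha>..\<beta>} (\<lambda>y. g (c0 * v y) / c0 * D y) = integral {\<alpha>..\<beta>} (\<lambda>y. g (c0 * v y) * D y) / c0"
    using integral_mult_right[of "{\<alpha>..\<beta>}" "1 / c0" "\<lambda>y. g (c0 * v y) * D y"] by simp
  ultimately have "((\<lambda>c. integral {\<alpha>..\<beta>} (\<lambda>y. Q (c * v y) * D y)) has_real_derivative
      integral {\<alpha>..\<beta>} (\<lambda>y. g (c0 * v y) * D y) / c0) (at c0)" by simp
  then have "((\<lambda>c. integral {\<alpha>..\<beta>} (\<lambda>y. g (c * v y) * \<psi> y)) has_real_derivative
      integral {\<alpha>..\<beta>} (\<lambda>y. g (c0 * v y) * D y) / c0) (at c0)"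
    by (rule has_field_derivative_transform_within_open[OF _ U(1) U(3)]) (use parts in simp)
  then show ?thesis by (simp add: D_def)
qed

lemma eventually_at_right_0: "a > 0 \<Longrightarrow> \<forall>\<^sub>F x in at_right 0. x \<in> {0<..<(a::real)}"
  unfolding eventually_at_right_field by auto

text \<open>
  \<open>A\<close> and \<open>B\<close> are the first and second iterates of the Euler operator \<open>x d/dx\<close> on \<open>J\<close>.
\<close>
definition tame :: "real \<Rightarrow> (real \<Rightarrow> real) \<Rightarrow> bool" where
  "tame a J \<longleftrightarrow> (\<exists>A B. (\<forall>x\<in>{0<..<a}. (J has_real_derivative A x / x) (at x) \<and>
       (A has_real_derivative B x / x) (at x)) \<and> (A \<longlongrightarrow> 0) (at_right 0) \<and> (B \<longlongrightarrow> 0) (at_right 0))"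

lemma tame_const: "tame a (\<lambda>_. c)"
  unfolding tame_def by (intro exI[of _ "\<lambda>_. 0"]) auto

lemma tame_lin:
  assumes "tame a J" "tame a K"
  shows "tame a (\<lambda>x. k * J x + K x)"
proof -
  obtain A B where J: "\<And>x. x \<in> {0<..<a} \<Longrightarrow> (J has_real_derivative A x / x) (at x)"
      "\<And>x. x \<in> {0<..<a} \<Longrightarrow> (A has_real_derivative B x / x) (at x)"
      "(A \<longlongrightarrow> 0) (at_right 0)" "(B \<longlongrightarrow> 0) (at_right 0)"
    using assms(1) unfolding tame_def by blast
  obtain C D where K: "\<And>x. x \<in> {0<..<a} \<Longrightarrow> (K has_real_derivative C x / x) (at x)"
      "\<And>x. x \<in> {0<..<a} \<Longrightarrow> (C has_real_derivative D x / x) (at x)"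
      "(C \<longlongrightarrow> 0) (at_right 0)" "(D \<longlongrightarrow> 0) (at_right 0)"
    using assms(2) unfolding tame_def by blast
  show ?thesis unfolding tame_def
  proof (rule exI[of _ "\<lambda>x. k * A x + C x"], rule exI[of _ "\<lambda>x. k * B x + D x"], intro conjI ballI)
    fix x assume x: "x \<in> {0<..<a}"
    show "((\<lambda>x. k * J x + K x) has_real_derivative (k * A x + C x) / x) (at x)"
      by (rule DERIV_cong[OF DERIV_add[OF DERIV_cmult[OF J(1)[OF x]] K(1)[OF x]]]) (simp add: add_divide_distrib)
    show "((\<lambda>x. k * A x + C x) has_real_derivative (k * B x + D x) / x) (at x)"
      by (rule DERIV_cong[OF DERIV_add[OF DERIV_cmult[OF J(2)[OF x]] K(2)[OF x]]]) (simp add: add_divide_distrib)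
  next
    show "((\<lambda>x. k * A x + C x) \<longlongrightarrow> 0) (at_right 0)" using tendsto_add[OF tendsto_mult_left[OF J(3), of k] K(3)] by simp
    show "((\<lambda>x. k * B x + D x) \<longlongrightarrow> 0) (at_right 0)" using tendsto_add[OF tendsto_mult_left[OF J(4), of k] K(4)] by simp
  qed
qed

lemma tame_cong:
  assumes "tame a J" and "\<And>x. 0 < x \<Longrightarrow> x < a \<Longrightarrow> K x = J x"
  shows "tame a K"
proof -
  have "(K has_real_derivative d) (at x)" if "(J has_real_derivative d) (at x)" "x \<in> {0<..<a}" for x d
    by (rule has_field_derivative_transform_within_open[OF that(1), of "{0<..<a}"]) (use that assms(2) in auto)
  then show ?thesis using assms(1) unfolding tame_def by blast
qed

text \<open>
  \<open>l\<close> is the Euler derivative \<open>x d/dx\<close> of \<open>ln \<bar>c\<bar>\<close>, and \<open>l1\<close> that of \<open>l\<close>.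
\<close>
definition dilation_parameter :: "(real \<Rightarrow> real) \<Rightarrow> (real \<Rightarrow> real) \<Rightarrow> (real \<Rightarrow> real) \<Rightarrow> bool" where
  "dilation_parameter c l l1 \<longleftrightarrow> (\<forall>x\<in>{0<..<1}. (c has_real_derivative c x * l x / x) (at x) \<and>
     (l has_real_derivative l1 x / x) (at x))"

lemma dilation_parameters:
  "dilation_parameter (\<lambda>x. x) (\<lambda>x. 1) (\<lambda>x. 0)"
  "dilation_parameter (\<lambda>x. x / (1 - x)) (\<lambda>x. 1 / (1 - x)) (\<lambda>x. x / (1 - x)\<^sup>2)"
  "dilation_parameter (\<lambda>x. - x / (1 - x)) (\<lambda>x. 1 / (1 - x)) (\<lambda>x. x / (1 - x)\<^sup>2)"
  "dilation_parameter (\<lambda>x. x / (1 - x)\<^sup>2) (\<lambda>x. (1 + x) / (1 - x)) (\<lambda>x. 2 * x / (1 - x)\<^sup>2)"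
  "dilation_parameter (\<lambda>x. 1 / (1 - x)) (\<lambda>x. x / (1 - x)) (\<lambda>x. x / (1 - x)\<^sup>2)"
  "dilation_parameter (\<lambda>x. - 1 / (1 - x)) (\<lambda>x. x / (1 - x)) (\<lambda>x. x / (1 - x)\<^sup>2)"
  unfolding dilation_parameter_def
  by (auto intro!: derivative_eq_intros simp: power2_eq_square power4_eq_xxxx divide_simps) (auto simp: algebra_simps)

context kummer_solution
begin

lemma continuous_on_g: "S \<subseteq> {..<1} \<Longrightarrow> continuous_on S g"
  by (rule continuous_at_imp_continuous_on) (use isCont_g in auto)

text \<open>
  Apply \<open>log_average_deriv\<close> twice; \<open>\<phi>\<close> and its derivative vanish at the end points. The weights produced are
  derivatives of functions that vanish at the end points, so their integrals are 0. Hence the Euler derivatives tend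
  to 0 as \<open>x \<rightarrow> 0\<close>: if \<open>c \<rightarrow> 0\<close>, because \<open>g (c x * v y)\<close> tends to the constant \<open>g 0\<close>; in the other two terms, because the
  arguments stay in a compact set while the factors \<open>l\<close> and \<open>l1\<close> tend to 0.
\<close>
lemma tame_average:
  assumes t: "(k, c, v) \<in> set kummer_terms" and ab: "0 < \<alpha>" "\<alpha> < \<beta>" "\<beta> < 1"
    and \<phi>: "\<And>y. (\<phi> has_real_derivative \<phi>1 y) (at y)" "\<And>y. (\<phi>1 has_real_derivative \<phi>2 y) (at y)"
      "continuous_on UNIV \<phi>2" "\<phi> \<alpha> = 0" "\<phi> \<beta> = 0" "\<phi>1 \<alpha> = 0" "\<phi>1 \<beta> = 0"
  shows "tame \<alpha> (\<lambda>x. integral {\<alpha>..\<beta>} (\<lambda>y. g (c x * v y) * \<phi> y))"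
proof -
  obtain \<omega> \<omega>1 \<omega>2 where w2: "continuous_on {0<..<1} \<omega>2"
    and w: "\<And>y. y \<in> {0<..<1} \<Longrightarrow> 0 < v y \<and> \<omega> y \<noteq> 0 \<and> (v has_real_derivative v y / \<omega> y) (at y) \<and>
        (\<omega> has_real_derivative \<omega>1 y) (at y) \<and> (\<omega>1 has_real_derivative \<omega>2 y) (at y)"
    using kummer_terms_scale_factor[OF t] unfolding scale_factor_def by blast
  have sub: "{\<alpha>..\<beta>} \<subseteq> {0<..<1}" using ab by auto
  have D\<omega>: "(\<omega> has_real_derivative \<omega>1 y) (at y)" "(\<omega>1 has_real_derivative \<omega>2 y) (at y)"
    "(v has_real_derivative v y / \<omega> y) (at y)" "\<omega> y \<noteq> 0" "v y > 0" if "y \<in> {\<alpha>..\<beta>}" for y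
    using w[of y] sub that by blast+
  have c\<omega>: "continuous_on {\<alpha>..\<beta>} \<omega>" by (rule DERIV_continuous_on) (use D\<omega>(1) has_field_derivative_at_within in blast)
  have c\<omega>1: "continuous_on {\<alpha>..\<beta>} \<omega>1" by (rule DERIV_continuous_on) (use D\<omega>(2) has_field_derivative_at_within in blast)
  have c\<omega>2: "continuous_on {\<alpha>..\<beta>} \<omega>2" using w2 sub by (rule continuous_on_subset)
  have cv: "continuous_on {\<alpha>..\<beta>} v" by (rule DERIV_continuous_on) (use D\<omega>(3) has_field_derivative_at_within in blast)
  have c\<phi>: "continuous_on {\<alpha>..\<beta>} \<phi>" by (rule DERIV_continuous_on) (use \<phi>(1) has_field_derivative_at_within in blast)
  have c\<phi>1: "continuous_on {\<alpha>..\<beta>} \<phi>1" by (rule DERIV_continuous_on) (use \<phi>(2) has_field_derivative_at_within in blast)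
  have c\<phi>2: "continuous_on {\<alpha>..\<beta>} \<phi>2" using \<phi>(3) by (rule continuous_on_subset) simp
  define \<psi> where "\<psi> y = - (\<omega>1 y * \<phi> y + \<omega> y * \<phi>1 y)" for y
  define \<psi>1 where "\<psi>1 y = - (\<omega>2 y * \<phi> y + \<omega>1 y * \<phi>1 y + (\<omega>1 y * \<phi>1 y + \<omega> y * \<phi>2 y))" for y
  define \<zeta> where "\<zeta> y = - (\<omega>1 y * \<psi> y + \<omega> y * \<psi>1 y)" for y
  have D\<psi>: "(\<psi> has_real_derivative \<psi>1 y) (at y)" if y: "y \<in> {\<alpha>..\<beta>}" for y
  proof -
    have "((\<lambda>y. - (\<omega>1 y * \<phi> y + \<omega> y * \<phi>1 y)) has_real_derivative
       - (\<omega>2 y * \<phi> y + \<phi>1 y * \<omega>1 y + (\<omega>1 y * \<phi>1 y + \<phi>2 y * \<omega> y))) (at y)"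
      by (intro DERIV_minus DERIV_add DERIV_mult D\<omega>[OF y] \<phi>)
    then show ?thesis unfolding \<psi>_def[abs_def] \<psi>1_def by (simp add: mult.commute)
  qed
  have c\<psi>: "continuous_on {\<alpha>..\<beta>} \<psi>" unfolding \<psi>_def by (intro continuous_intros c\<omega> c\<omega>1 c\<phi> c\<phi>1)
  have c\<psi>1: "continuous_on {\<alpha>..\<beta>} \<psi>1" unfolding \<psi>1_def by (intro continuous_intros c\<omega> c\<omega>1 c\<omega>2 c\<phi> c\<phi>1 c\<phi>2)
  have c\<zeta>: "continuous_on {\<alpha>..\<beta>} \<zeta>" unfolding \<zeta>_def by (intro continuous_intros c\<omega> c\<omega>1 c\<psi> c\<psi>1)
  have ends: "\<psi> \<alpha> = 0" "\<psi> \<beta> = 0" using \<phi> by (auto simp: \<psi>_def)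
  have int0: "integral {\<alpha>..\<beta>} (\<lambda>y. - (\<omega>1 y * \<xi> y + \<omega> y * \<xi>1 y)) = 0"
    if "\<And>y. y \<in> {\<alpha>..\<beta>} \<Longrightarrow> (\<xi> has_real_derivative \<xi>1 y) (at y)" "\<xi> \<alpha> = 0" "\<xi> \<beta> = 0" for \<xi> \<xi>1
  proof -
    have "((\<lambda>y. - (\<omega>1 y * \<xi> y + \<omega> y * \<xi>1 y)) has_integral (- (\<omega> \<beta> * \<xi> \<beta>) - - (\<omega> \<alpha> * \<xi> \<alpha>))) {\<alpha>..\<beta>}"
    proof (rule fundamental_theorem_of_calculus)
      fix y assume y: "y \<in> {\<alpha>..\<beta>}"
      have "((\<lambda>y. - (\<omega> y * \<xi> y)) has_real_derivative - (\<omega>1 y * \<xi> y + \<xi>1 y * \<omega> y)) (at y)"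
        by (intro DERIV_minus DERIV_mult D\<omega>[OF y] that(1) y)
      then show "((\<lambda>y. - (\<omega> y * \<xi> y)) has_vector_derivative - (\<omega>1 y * \<xi> y + \<omega> y * \<xi>1 y)) (at y within {\<alpha>..\<beta>})"
        unfolding has_real_derivative_iff_has_vector_derivative[symmetric]
        by (simp add: mult.commute has_field_derivative_at_within)
    qed (use ab in simp)
    then show ?thesis using that by (simp add: integral_unique)
  qed
  have int\<psi>: "integral {\<alpha>..\<beta>} \<psi> = 0" unfolding \<psi>_def[abs_def] by (rule int0) (use \<phi> in auto)
  have int\<zeta>: "integral {\<alpha>..\<beta>} \<zeta> = 0" unfolding \<zeta>_def[abs_def] by (rule int0) (use D\<psi> ends in auto)
  define I where "I \<xi> x = integral {\<alpha>..\<beta>} (\<lambda>y. g (c x * v y) * \<xi> y)" for \<xi> x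
  have dI: "((\<lambda>c. integral {\<alpha>..\<beta>} (\<lambda>y. g (c * v y) * \<xi> y)) has_real_derivative
      integral {\<alpha>..\<beta>} (\<lambda>y. g (c x * v y) * - (\<omega>1 y * \<xi> y + \<omega> y * \<xi>1 y)) / c x) (at (c x))"
    if x: "x \<in> {0<..<\<alpha>}" and \<xi>: "\<And>y. y \<in> {\<alpha>..\<beta>} \<Longrightarrow> (\<xi> has_real_derivative \<xi>1 y) (at y)"
      "continuous_on {\<alpha>..\<beta>} \<xi>1" "\<xi> \<alpha> = 0" "\<xi> \<beta> = 0" for x \<xi> \<xi>1
  proof (rule log_average_deriv)
    define W where "W = (if c x > 0 then {0<..<1} else {..<0::real})"
    show "open W" "is_interval W" "0 \<notin> W" by (auto simp: W_def is_interval_1)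
    show "continuous_on W g" by (rule continuous_on_g) (auto simp: W_def)
    fix y assume y: "y \<in> {\<alpha>..\<beta>}"
    have "c x * v y < 1" using kummer_terms_less_1[OF t, of x y] x y ab by auto
    moreover have "c x \<noteq> 0" using kummer_terms_nonzero[OF t, of x] x ab by auto
    ultimately show "c x * v y \<in> W" using D\<omega>(5)[OF y] by (auto simp: W_def mult_neg_pos)
  qed (use ab D\<omega> \<xi> c\<omega>1 in auto)
  obtain l l1 where l: "dilation_parameter c l l1"
    and lim: "((c \<longlongrightarrow> 0) (at_right 0) \<and> (\<exists>L. (l \<longlongrightarrow> L) (at_right 0)) \<and> (\<exists>L. (l1 \<longlongrightarrow> L) (at_right 0))) \<or>
       ((l \<longlongrightarrow> 0) (at_right 0) \<and> (l1 \<longlongrightarrow> 0) (at_right 0) \<and>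
         (\<exists>K. compact K \<and> K \<subseteq> {..<1} \<and> (\<forall>x\<in>{0<..<\<alpha> / 2}. \<forall>y\<in>{\<alpha>..\<beta>}. c x * v y \<in> K)))"
  proof -
    have T: "((\<lambda>x. x / (1 - x)) \<longlongrightarrow> 0) (at_right (0::real))" "((\<lambda>x. 1 / (1 - x)) \<longlongrightarrow> 1) (at_right (0::real))"
      "((\<lambda>x. x / (1 - x)\<^sup>2) \<longlongrightarrow> 0) (at_right (0::real))" "((\<lambda>x. (1 + x) / (1 - x)) \<longlongrightarrow> 1) (at_right (0::real))"
      "((\<lambda>x. 2 * x / (1 - x)\<^sup>2) \<longlongrightarrow> 0) (at_right (0::real))" "((\<lambda>x. - x / (1 - x)) \<longlongrightarrow> 0) (at_right (0::real))"
      "((\<lambda>x. x) \<longlongrightarrow> 0) (at_right (0::real))"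
      by (auto intro!: tendsto_eq_intros)
    have K4: "\<exists>K. compact K \<and> K \<subseteq> {..<1} \<and> (\<forall>x\<in>{0<..<\<alpha> / 2}. \<forall>y\<in>{\<alpha>..\<beta>}. 1 / (1 - x) * (1 - y) \<in> K)"
    proof (intro exI[of _ "{0..(1 - \<alpha>) / (1 - \<alpha> / 2)}"] conjI ballI)
      have "(1 - \<alpha>) / (1 - \<alpha> / 2) < 1" using ab by simp
      then show "{0..(1 - \<alpha>) / (1 - \<alpha> / 2)} \<subseteq> {..<1}" by auto
      fix x y assume "x \<in> {0<..<\<alpha> / 2}" "y \<in> {\<alpha>..\<beta>}"
      then have "(1 - y) / (1 - x) \<le> (1 - \<alpha>) / (1 - \<alpha> / 2)" "0 \<le> (1 - y) / (1 - x)"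
        using ab by (auto intro!: frac_le)
      then show "1 / (1 - x) * (1 - y) \<in> {0..(1 - \<alpha>) / (1 - \<alpha> / 2)}" by simp
    qed simp
    have K8: "\<exists>K. compact K \<and> K \<subseteq> {..<1} \<and> (\<forall>x\<in>{0<..<\<alpha> / 2}. \<forall>y\<in>{\<alpha>..\<beta>}. - 1 / (1 - x) * ((1 - y) / y) \<in> K)"
    proof (intro exI[of _ "{- (1 / ((1 - \<alpha> / 2) * \<alpha>))..0}"] conjI ballI)
      fix x y assume xy: "x \<in> {0<..<\<alpha> / 2}" "y \<in> {\<alpha>..\<beta>}"
      have "(1 - y) / ((1 - x) * y) \<le> 1 / ((1 - \<alpha> / 2) * \<alpha>)"
        using ab xy by (intro frac_le mult_mono) auto
      moreover have "0 \<le> (1 - y) / ((1 - x) * y)" using ab xy by simp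
      ultimately show "- 1 / (1 - x) * ((1 - y) / y) \<in> {- (1 / ((1 - \<alpha> / 2) * \<alpha>))..0}" by simp
    qed auto
    \<comment> \<open>the goal as a predicate of the term, to be checked for the seven terms in turn\<close>
    define X where "X k c v \<longleftrightarrow> (\<exists>l l1. dilation_parameter c l l1 \<and> (((c \<longlongrightarrow> 0) (at_right 0) \<and> (\<exists>L. (l \<longlongrightarrow> L) (at_right 0)) \<and> (\<exists>L. (l1 \<longlongrightarrow> L) (at_right 0))) \<or>
       ((l \<longlongrightarrow> 0) (at_right 0) \<and> (l1 \<longlongrightarrow> 0) (at_right 0) \<and>
         (\<exists>K. compact K \<and> K \<subseteq> {..<1} \<and> (\<forall>x\<in>{0<..<\<alpha> / 2}. \<forall>y\<in>{\<alpha>..\<beta>}. c x * v y \<in> K)))))" for k :: real and c v :: "real \<Rightarrow> real"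
    have X1: "X k c v" if "dilation_parameter c l l1" "(c \<longlongrightarrow> 0) (at_right 0)" "(l \<longlongrightarrow> L) (at_right 0)" "(l1 \<longlongrightarrow> L1) (at_right 0)" for k c v l l1 L L1
      using that unfolding X_def by blast
    have X2: "X k c v" if "dilation_parameter c l l1" "(l \<longlongrightarrow> 0) (at_right 0)" "(l1 \<longlongrightarrow> 0) (at_right 0)"
      "\<exists>K. compact K \<and> K \<subseteq> {..<1} \<and> (\<forall>x\<in>{0<..<\<alpha> / 2}. \<forall>y\<in>{\<alpha>..\<beta>}. c x * v y \<in> K)" for k c v l l1
      using that unfolding X_def by blast
    note near0 = X1[OF dilation_parameters(1) T(7) tendsto_const tendsto_const]
      X1[OF dilation_parameters(2) T(1,2,3)] X1[OF dilation_parameters(3) T(6,2,3)] X1[OF dilation_parameters(4) T(3,4,5)]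
      X2[OF dilation_parameters(5) T(1,3) K4] X2[OF dilation_parameters(6) T(1,3) K8]
    have "X k c v" using t by (rule kummer_terms_cases[where P = X]) (rule near0)+
    then have "\<exists>l l1. dilation_parameter c l l1 \<and> (((c \<longlongrightarrow> 0) (at_right 0) \<and> (\<exists>L. (l \<longlongrightarrow> L) (at_right 0)) \<and> (\<exists>L. (l1 \<longlongrightarrow> L) (at_right 0))) \<or>
       ((l \<longlongrightarrow> 0) (at_right 0) \<and> (l1 \<longlongrightarrow> 0) (at_right 0) \<and>
         (\<exists>K. compact K \<and> K \<subseteq> {..<1} \<and> (\<forall>x\<in>{0<..<\<alpha> / 2}. \<forall>y\<in>{\<alpha>..\<beta>}. c x * v y \<in> K))))" unfolding X_def .
    then show thesis using that by blast
  qed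
  have dc: "(c has_real_derivative c x * l x / x) (at x)" "(l has_real_derivative l1 x / x) (at x)" if "x \<in> {0<..<\<alpha>}" for x
    using l that ab unfolding dilation_parameter_def by auto
  have cnz: "c x \<noteq> 0" if "x \<in> {0<..<\<alpha>}" for x using kummer_terms_nonzero[OF t, of x] that ab by auto
  have dI0: "(I \<phi> has_real_derivative l x * I \<psi> x / x) (at x)" if x: "x \<in> {0<..<\<alpha>}" for x
    using DERIV_chain2[OF dI[OF x, of \<phi> \<phi>1] dc(1)[OF x]] \<phi> c\<phi>1 cnz[OF x]
    unfolding I_def[abs_def] \<psi>_def by (simp add: mult.commute)
  have dI1: "(I \<psi> has_real_derivative l x * I \<zeta> x / x) (at x)" if x: "x \<in> {0<..<\<alpha>}" for x
    using DERIV_chain2[OF dI[OF x, of \<psi> \<psi>1] dc(1)[OF x]] D\<psi> c\<psi>1 ends cnz[OF x]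
    unfolding I_def[abs_def] \<zeta>_def by (simp add: mult.commute)
  have contgc: "continuous_on {\<alpha>..\<beta>} (\<lambda>y. g (c x * v y))" if x: "x \<in> {0<..<\<alpha>}" for x
  proof (rule continuous_on_compose2[OF continuous_on_g[OF order_refl]])
    show "(\<lambda>y. c x * v y) ` {\<alpha>..\<beta>} \<subseteq> {..<1}"
      using kummer_terms_less_1[OF t, of x] x ab by auto
  qed (intro continuous_intros cv)
  have lim0: "((\<lambda>x. l x * I \<xi> x) \<longlongrightarrow> 0) (at_right 0) \<and> ((\<lambda>x. l1 x * I \<xi> x) \<longlongrightarrow> 0) (at_right 0)"
    if \<xi>: "continuous_on {\<alpha>..\<beta>} \<xi>" and i0: "integral {\<alpha>..\<beta>} \<xi> = 0" for \<xi>
  proof -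
    obtain M where M: "M > 0" "\<And>y. y \<in> {\<alpha>..\<beta>} \<Longrightarrow> \<bar>\<xi> y\<bar> \<le> M"
    proof -
      have "bounded (\<xi> ` {\<alpha>..\<beta>})" using \<xi> by (intro compact_imp_bounded compact_continuous_image) auto
      then show thesis using that unfolding bounded_pos by auto
    qed
    have nearx: "\<forall>\<^sub>F x in at_right 0. x \<in> {0<..<\<alpha> / 2}"
      using ab by (intro eventually_at_right_0) auto
    from lim show ?thesis
    proof
      assume L: "(c \<longlongrightarrow> 0) (at_right 0) \<and> (\<exists>L. (l \<longlongrightarrow> L) (at_right 0)) \<and> (\<exists>L. (l1 \<longlongrightarrow> L) (at_right 0))"
      obtain B where B: "B > 0" "\<And>y. y \<in> {\<alpha>..\<beta>} \<Longrightarrow> \<bar>v y\<bar> \<le> B"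
      proof -
        have "bounded (v ` {\<alpha>..\<beta>})" using cv by (intro compact_imp_bounded compact_continuous_image) auto
        then show thesis using that unfolding bounded_pos by auto
      qed
      have "(I \<xi> \<longlongrightarrow> 0) (at_right 0)"
      proof (rule tendstoI)
        fix \<epsilon> :: real assume eps: "\<epsilon> > 0"
        define \<eta> where "\<eta> = \<epsilon> / (2 * M * (\<beta> - \<alpha>))"
        have eta: "\<eta> > 0" using eps M ab by (simp add: \<eta>_def)
        obtain d where d: "d > 0" "\<And>t. \<bar>t\<bar> < d \<Longrightarrow> \<bar>g t - g 0\<bar> < \<eta>"
          using cont0 eta unfolding continuous_at_eps_delta dist_real_def by (metis diff_zero)
        have "\<forall>\<^sub>F x in at_right 0. dist (c x) 0 < d / B" using L d B by (intro tendstoD) auto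
        with nearx show "\<forall>\<^sub>F x in at_right 0. dist (I \<xi> x) 0 < \<epsilon>"
        proof eventually_elim
          case (elim x)
          have x: "x \<in> {0<..<\<alpha>}" using elim by auto
          have small: "\<bar>g (c x * v y) - g 0\<bar> \<le> \<eta>" if y: "y \<in> {\<alpha>..\<beta>}" for y
          proof -
            have "\<bar>c x * v y\<bar> \<le> \<bar>c x\<bar> * B" unfolding abs_mult using B(2)[OF y] by (rule mult_left_mono) simp
            also have "\<dots> < d" using elim B by (simp add: dist_real_def pos_less_divide_eq)
            finally show ?thesis using d(2) by (simp add: less_imp_le)
          qed
          have "I \<xi> x = integral {\<alpha>..\<beta>} (\<lambda>y. (g (c x * v y) - g 0) * \<xi> y) + integral {\<alpha>..\<beta>} (\<lambda>y. g 0 * \<xi> y)"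
            unfolding I_def
            by (subst integral_add[symmetric]) (auto intro!: integrable_continuous_real continuous_intros contgc x \<xi> simp: algebra_simps)
          then have "I \<xi> x = integral {\<alpha>..\<beta>} (\<lambda>y. (g (c x * v y) - g 0) * \<xi> y)" using i0 by simp
          moreover have "norm (integral {\<alpha>..\<beta>} (\<lambda>y. (g (c x * v y) - g 0) * \<xi> y)) \<le> \<eta> * M * (\<beta> - \<alpha>)"
          proof (rule integral_bound)
            show "continuous_on {\<alpha>..\<beta>} (\<lambda>y. (g (c x * v y) - g 0) * \<xi> y)" by (intro continuous_intros contgc x \<xi>)
            fix y assume y: "y \<in> {\<alpha>..\<beta>}"
            show "norm ((g (c x * v y) - g 0) * \<xi> y) \<le> \<eta> * M"
              unfolding real_norm_def abs_mult using small[OF y] M(2)[OF y] eta by (intro mult_mono) auto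
          qed (use ab in simp)
          moreover have "\<eta> * M * (\<beta> - \<alpha>) = \<epsilon> / 2"
          proof -
            have nz: "2 * M * (\<beta> - \<alpha>) \<noteq> 0" using M ab by auto
            have "\<eta> * (2 * M * (\<beta> - \<alpha>)) = \<epsilon>"
              by (simp only: \<eta>_def times_divide_eq_left nonzero_mult_div_cancel_right[OF nz])
            moreover have "\<eta> * (2 * M * (\<beta> - \<alpha>)) = 2 * (\<eta> * M * (\<beta> - \<alpha>))" by algebra
            ultimately show ?thesis by linarith
          qed
          ultimately show ?case using eps by (simp add: dist_real_def)
        qed
      qed
      then show ?thesis using L by (metis mult_zero_right tendsto_mult)
    next
      assume L: "(l \<longlongrightarrow> 0) (at_right 0) \<and> (l1 \<longlongrightarrow> 0) (at_right 0) \<and>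
         (\<exists>K. compact K \<and> K \<subseteq> {..<1} \<and> (\<forall>x\<in>{0<..<\<alpha> / 2}. \<forall>y\<in>{\<alpha>..\<beta>}. c x * v y \<in> K))"
      then obtain K where K: "compact K" "K \<subseteq> {..<1}" "\<And>x y. x \<in> {0<..<\<alpha> / 2} \<Longrightarrow> y \<in> {\<alpha>..\<beta>} \<Longrightarrow> c x * v y \<in> K"
        by blast
      have "bounded (g ` K)" by (intro compact_imp_bounded compact_continuous_image continuous_on_g K)
      then obtain G where G: "G > 0" "\<And>t. t \<in> K \<Longrightarrow> \<bar>g t\<bar> \<le> G" unfolding bounded_pos by auto
      have bd: "\<forall>\<^sub>F x in at_right 0. norm (I \<xi> x) \<le> G * M * (\<beta> - \<alpha>)"
        using nearx
      proof eventually_elim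
        case (elim x)
        have x: "x \<in> {0<..<\<alpha>}" using elim by auto
        show ?case unfolding I_def
        proof (rule integral_bound)
          show "continuous_on {\<alpha>..\<beta>} (\<lambda>y. g (c x * v y) * \<xi> y)" by (intro continuous_intros contgc x \<xi>)
          fix y assume y: "y \<in> {\<alpha>..\<beta>}"
          show "norm (g (c x * v y) * \<xi> y) \<le> G * M"
            unfolding real_norm_def abs_mult using G(2)[OF K(3)[OF elim y]] M(2)[OF y] G(1) by (intro mult_mono) auto
        qed (use ab in simp)
      qed
      have "((\<lambda>x. m x * I \<xi> x) \<longlongrightarrow> 0) (at_right 0)" if m: "(m \<longlongrightarrow> 0) (at_right 0)" for m
      proof (rule Lim_null_comparison)
        show "\<forall>\<^sub>F x in at_right 0. norm (m x * I \<xi> x) \<le> \<bar>m x\<bar> * (G * M * (\<beta> - \<alpha>))"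
          using bd by eventually_elim (simp add: abs_mult mult_left_mono)
        show "((\<lambda>x. \<bar>m x\<bar> * (G * M * (\<beta> - \<alpha>))) \<longlongrightarrow> 0) (at_right 0)"
          using tendsto_mult_left_zero[OF tendsto_rabs_zero[OF m]] .
      qed
      then show ?thesis using L by blast
    qed
  qed
  have llim: "\<exists>L. (l \<longlongrightarrow> L) (at_right 0)" using lim by blast
  have "tame \<alpha> (I \<phi>)" unfolding tame_def
  proof (rule exI[of _ "\<lambda>x. l x * I \<psi> x"], rule exI[of _ "\<lambda>x. l1 x * I \<psi> x + l x * (l x * I \<zeta> x)"], intro conjI ballI)
    fix x assume x: "x \<in> {0<..<\<alpha>}"
    show "(I \<phi> has_real_derivative l x * I \<psi> x / x) (at x)" by (rule dI0[OF x])
    show "((\<lambda>x. l x * I \<psi> x) has_real_derivative (l1 x * I \<psi> x + l x * (l x * I \<zeta> x)) / x) (at x)"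
      by (rule DERIV_cong[OF DERIV_mult[OF dc(2)[OF x] dI1[OF x]]]) (simp add: add_divide_distrib)
  next
    show "((\<lambda>x. l x * I \<psi> x) \<longlongrightarrow> 0) (at_right 0)" using lim0[OF c\<psi> int\<psi>] by blast
    obtain L where "(l \<longlongrightarrow> L) (at_right 0)" using llim by blast
    then show "((\<lambda>x. l1 x * I \<psi> x + l x * (l x * I \<zeta> x)) \<longlongrightarrow> 0) (at_right 0)"
      using tendsto_add[OF conjunct2[OF lim0[OF c\<psi> int\<psi>]] tendsto_mult[OF _ conjunct1[OF lim0[OF c\<zeta> int\<zeta>]]]] by force
  qed
  then show ?thesis by (simp add: I_def[abs_def])
qed

lemma tame_average_sum:
  assumes ab: "0 < \<alpha>" "\<alpha> < \<beta>" "\<beta> < 1"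
    and \<phi>: "\<And>y. (\<phi> has_real_derivative \<phi>1 y) (at y)" "\<And>y. (\<phi>1 has_real_derivative \<phi>2 y) (at y)"
      "continuous_on UNIV \<phi>2" "\<phi> \<alpha> = 0" "\<phi> \<beta> = 0" "\<phi>1 \<alpha> = 0" "\<phi>1 \<beta> = 0"
    and ts: "set ts \<subseteq> set kummer_terms"
  shows "tame \<alpha> (\<lambda>x. integral {\<alpha>..\<beta>} (\<lambda>y. (\<Sum>(k, c, v)\<leftarrow>ts. k * g (c x * v y)) * \<phi> y))
     \<and> (\<forall>x\<in>{0<..<\<alpha>}. continuous_on {\<alpha>..\<beta>} (\<lambda>y. (\<Sum>(k, c, v)\<leftarrow>ts. k * g (c x * v y))))"
  using ts
proof (induction ts)
  case Nil
  then show ?case using tame_const[of \<alpha> 0] by simp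
next
  case (Cons t ts)
  obtain k c v where t: "t = (k, c, v)" by (cases t)
  have kt: "(k, c, v) \<in> set kummer_terms" using Cons.prems t by simp
  have IH: "tame \<alpha> (\<lambda>x. integral {\<alpha>..\<beta>} (\<lambda>y. (\<Sum>(k, c, v)\<leftarrow>ts. k * g (c x * v y)) * \<phi> y))"
     "\<And>x. x\<in>{0<..<\<alpha>} \<Longrightarrow> continuous_on {\<alpha>..\<beta>} (\<lambda>y. (\<Sum>(k, c, v)\<leftarrow>ts. k * g (c x * v y)))"
    using Cons by auto
  have cv: "continuous_on {\<alpha>..\<beta>} v"
  proof -
    have "\<exists>d. (v has_real_derivative d) (at y)" if "y \<in> {\<alpha>..\<beta>}" for y
      using kummer_terms_scale_factor[OF kt] that ab unfolding scale_factor_def by fastforce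
    then show ?thesis by (meson DERIV_isCont continuous_at_imp_continuous_on)
  qed
  have contgc: "continuous_on {\<alpha>..\<beta>} (\<lambda>y. g (c x * v y))" if x: "x \<in> {0<..<\<alpha>}" for x
  proof (rule continuous_on_compose2[OF continuous_on_g[OF order_refl]])
    show "(\<lambda>y. c x * v y) ` {\<alpha>..\<beta>} \<subseteq> {..<1}"
      using kummer_terms_less_1[OF kt, of x] x ab by auto
  qed (intro continuous_intros cv)
  have c\<phi>: "continuous_on {\<alpha>..\<beta>} \<phi>" by (rule DERIV_continuous_on) (use \<phi>(1) has_field_derivative_at_within in blast)
  have "tame \<alpha> (\<lambda>x. integral {\<alpha>..\<beta>} (\<lambda>y. (\<Sum>(k, c, v)\<leftarrow>t # ts. k * g (c x * v y)) * \<phi> y))"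
  proof (rule tame_cong[OF tame_lin[OF tame_average[OF kt ab \<phi>] IH(1), of k]])
    fix x assume x: "0 < x" "x < \<alpha>"
    have i1: "(\<lambda>y. k * (g (c x * v y) * \<phi> y)) integrable_on {\<alpha>..\<beta>}"
      using x by (intro integrable_continuous_real continuous_intros contgc c\<phi>) auto
    have i2: "(\<lambda>y. (\<Sum>(k, c, v)\<leftarrow>ts. k * g (c x * v y)) * \<phi> y) integrable_on {\<alpha>..\<beta>}"
      by (intro integrable_continuous_real continuous_on_mult IH(2) c\<phi>) (use x in auto)
    have "integral {\<alpha>..\<beta>} (\<lambda>y. (\<Sum>(k, c, v)\<leftarrow>t # ts. k * g (c x * v y)) * \<phi> y)
        = integral {\<alpha>..\<beta>} (\<lambda>y. k * (g (c x * v y) * \<phi> y) + (\<Sum>(k, c, v)\<leftarrow>ts. k * g (c x * v y)) * \<phi> y)"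
      unfolding t by (simp add: distrib_right mult.assoc)
    also have "\<dots> = integral {\<alpha>..\<beta>} (\<lambda>y. k * (g (c x * v y) * \<phi> y)) + integral {\<alpha>..\<beta>} (\<lambda>y. (\<Sum>(k, c, v)\<leftarrow>ts. k * g (c x * v y)) * \<phi> y)"
      by (rule integral_add[OF i1 i2])
    also have "integral {\<alpha>..\<beta>} (\<lambda>y. k * (g (c x * v y) * \<phi> y)) = k * integral {\<alpha>..\<beta>} (\<lambda>y. g (c x * v y) * \<phi> y)"
      by (rule integral_mult_right)
    finally show "integral {\<alpha>..\<beta>} (\<lambda>y. (\<Sum>(k, c, v)\<leftarrow>t # ts. k * g (c x * v y)) * \<phi> y) =
       k * integral {\<alpha>..\<beta>} (\<lambda>y. g (c x * v y) * \<phi> y) + integral {\<alpha>..\<beta>} (\<lambda>y. (\<Sum>(k, c, v)\<leftarrow>ts. k * g (c x * v y)) * \<phi> y)" .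
  qed
  moreover have "continuous_on {\<alpha>..\<beta>} (\<lambda>y. (\<Sum>(k, c, v)\<leftarrow>t # ts. k * g (c x * v y)))" if "x\<in>{0<..<\<alpha>}" for x
    unfolding t using IH(2)[OF that] contgc[OF that] by (auto intro!: continuous_intros)
  ultimately show ?case by blast
qed

text \<open>
  Integrate \<open>separated\<close> against a bump function; the left-hand side becomes a positive multiple of \<open>g x\<close>.
\<close>
lemma tame_g:
  assumes "0 < \<alpha>" "\<alpha> < e0"
  shows "tame \<alpha> g"
proof -
  define \<beta> where "\<beta> = (\<alpha> + e0) / 2"
  have ab: "0 < \<alpha>" "\<alpha> < \<beta>" "\<beta> < 1" "\<beta> < e0" using assms e0_less by (auto simp: \<beta>_def)
  \<comment> \<open>the cube makes the first derivative vanish at the end points, too\<close>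
  define \<phi> where "\<phi> y = ((y - \<alpha>) * (\<beta> - y)) ^ 3" for y
  define \<phi>1 where "\<phi>1 y = 3 * ((y - \<alpha>) * (\<beta> - y))\<^sup>2 * (\<alpha> + \<beta> - 2 * y)" for y
  define \<phi>2 where "\<phi>2 y = 6 * ((y - \<alpha>) * (\<beta> - y)) * (\<alpha> + \<beta> - 2 * y)\<^sup>2 - 6 * ((y - \<alpha>) * (\<beta> - y))\<^sup>2" for y
  have d1: "(\<phi> has_real_derivative \<phi>1 y) (at y)" for y
    unfolding \<phi>_def[abs_def] \<phi>1_def by (rule derivative_eq_intros refl)+ (simp add: algebra_simps power2_eq_square)
  have d2: "(\<phi>1 has_real_derivative \<phi>2 y) (at y)" for y
    unfolding \<phi>1_def[abs_def] \<phi>2_def by (rule derivative_eq_intros refl)+ (simp add: algebra_simps power2_eq_square)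
  have c2: "continuous_on UNIV \<phi>2" unfolding \<phi>2_def by (intro continuous_intros)
  have z: "\<phi> \<alpha> = 0" "\<phi> \<beta> = 0" "\<phi>1 \<alpha> = 0" "\<phi>1 \<beta> = 0" by (auto simp: \<phi>_def \<phi>1_def)
  have c\<phi>: "continuous_on {\<alpha>..\<beta>} \<phi>" unfolding \<phi>_def by (intro continuous_intros)
  define m where "m = integral {\<alpha>..\<beta>} \<phi>"
  have m: "m > 0"
  proof -
    have "\<phi> y \<ge> 0" if "y \<in> {\<alpha>..\<beta>}" for y using that by (simp add: \<phi>_def)
    then have "m \<ge> 0" unfolding m_def by (rule integral_nonneg[OF integrable_continuous_real[OF c\<phi>]])
    moreover have "m \<noteq> 0"
    proof
      assume "m = 0"
      then have "\<phi> ((\<alpha> + \<beta>) / 2) = 0"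
        using integral_eq_0_iff[OF c\<phi> ab(2)] \<open>\<And>y. y \<in> {\<alpha>..\<beta>} \<Longrightarrow> \<phi> y \<ge> 0\<close> ab unfolding m_def by auto
      then show False using ab by (auto simp: \<phi>_def)
    qed
    ultimately show ?thesis by simp
  qed
  have S: "tame \<alpha> (\<lambda>x. integral {\<alpha>..\<beta>} (\<lambda>y. (\<Sum>(k, c, v)\<leftarrow>kummer_terms. k * g (c x * v y)) * \<phi> y))"
    "\<And>x. x\<in>{0<..<\<alpha>} \<Longrightarrow> continuous_on {\<alpha>..\<beta>} (\<lambda>y. (\<Sum>(k, c, v)\<leftarrow>kummer_terms. k * g (c x * v y)))"
    using tame_average_sum[OF ab(1-3) d1 d2 c2 z order_refl] by auto
  define C where "C = integral {\<alpha>..\<beta>} (\<lambda>y. 2 * g y * \<phi> y)"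
  have cg: "continuous_on {\<alpha>..\<beta>} g" by (rule continuous_on_g) (use ab in auto)
  show ?thesis
  proof (rule tame_cong[OF tame_lin[OF S(1) tame_const[of \<alpha> "- C / (2 * m)"], of "1 / (2 * m)"]])
    fix x assume x: "0 < x" "x < \<alpha>"
    have "2 * g x * m = integral {\<alpha>..\<beta>} (\<lambda>y. 2 * g x * \<phi> y)" by (simp add: m_def)
    also have "\<dots> = integral {\<alpha>..\<beta>} (\<lambda>y. (\<Sum>(k, c, v)\<leftarrow>kummer_terms. k * g (c x * v y)) * \<phi> y - 2 * g y * \<phi> y)"
    proof (rule integral_cong)
      fix y assume "y \<in> {\<alpha>..\<beta>}"
      then have "2 * g x = (\<Sum>(k, c, v)\<leftarrow>kummer_terms. k * g (c x * v y)) - 2 * g y"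
        using x ab by (intro separated) auto
      then show "2 * g x * \<phi> y = (\<Sum>(k, c, v)\<leftarrow>kummer_terms. k * g (c x * v y)) * \<phi> y - 2 * g y * \<phi> y"
        by (simp only: left_diff_distrib)
    qed
    also have "\<dots> = integral {\<alpha>..\<beta>} (\<lambda>y. (\<Sum>(k, c, v)\<leftarrow>kummer_terms. k * g (c x * v y)) * \<phi> y) - C"
      unfolding C_def using x
      by (intro integral_diff integrable_continuous_real continuous_on_mult S(2) c\<phi> cg continuous_on_const) auto
    finally show "g x = 1 / (2 * m) * integral {\<alpha>..\<beta>} (\<lambda>y. (\<Sum>(k, c, v)\<leftarrow>kummer_terms. k * g (c x * v y)) * \<phi> y) + - C / (2 * m)"
      using m by (simp add: field_simps)
  qed
qed

text \<open>
  The Euler derivative of \<open>g\<close>. Differentiating an identity between values of \<open>g\<close> at monomials gives one between values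
  of \<open>f\<close> at the same arguments.
\<close>
definition f :: "real \<Rightarrow> real" where "f t = t * deriv g t"

lemma tame_imp_f:
  assumes "0 < \<alpha>" "\<alpha> < e0"
  obtains B where "\<And>x. x \<in> {0<..<\<alpha>} \<Longrightarrow> (g has_real_derivative f x / x) (at x)"
    "\<And>x. x \<in> {0<..<\<alpha>} \<Longrightarrow> (f has_real_derivative B x / x) (at x)"
    "(f \<longlongrightarrow> 0) (at_right 0)" "(B \<longlongrightarrow> 0) (at_right 0)"
proof -
  obtain A B where A: "\<And>x. x \<in> {0<..<\<alpha>} \<Longrightarrow> (g has_real_derivative A x / x) (at x)"
      "\<And>x. x \<in> {0<..<\<alpha>} \<Longrightarrow> (A has_real_derivative B x / x) (at x)"
      "(A \<longlongrightarrow> 0) (at_right 0)" "(B \<longlongrightarrow> 0) (at_right 0)"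
    using tame_g[OF assms] unfolding tame_def by blast
  have fA: "f x = A x" if "x \<in> {0<..<\<alpha>}" for x
    using DERIV_imp_deriv[OF A(1)[OF that]] that by (simp add: f_def)
  have "(f has_real_derivative B x / x) (at x)" if x: "x \<in> {0<..<\<alpha>}" for x
    by (rule has_field_derivative_transform_within_open[OF A(2)[OF x], of "{0<..<\<alpha>}"]) (use x fA in auto)
  moreover have "(f \<longlongrightarrow> 0) (at_right 0)"
  proof (rule Lim_transform_eventually[OF A(3)])
    have "\<forall>\<^sub>F x in at_right 0. x \<in> {0<..<\<alpha>}"
      using assms by (intro eventually_at_right_0) auto
    then show "\<forall>\<^sub>F x in at_right 0. A x = f x" by eventually_elim (use fA in auto)
  qed
  ultimately show ?thesis using that[of B] A fA by auto
qed

lemma g_DERIV: 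
  assumes "t < 1" "t \<noteq> 0"
  shows "(g has_real_derivative f t / t) (at t)"
proof -
  have "g differentiable (at t)"
  proof (rule regular_everywhere[OF local_regularity_differentiable _ assms])
    fix t assume t: "0 < t" "t < e0"
    have "\<And>x. x \<in> {0<..<(t + e0) / 2} \<Longrightarrow> (g has_real_derivative f x / x) (at x)"
      by (rule tame_imp_f[of "(t + e0) / 2"]) (use t in auto)
    then have "(g has_real_derivative f t / t) (at t)" using t by auto
    then show "g differentiable (at t)" by (rule DERIV_imp_differentiable)
  qed
  then have "(g has_real_derivative deriv g t) (at t)"
    using DERIV_deriv_iff_real_differentiable by blast
  then show ?thesis using assms by (simp add: f_def)
qed

lemma f_DERIV: "0 < t \<Longrightarrow> t < e0 \<Longrightarrow> (f has_real_derivative deriv f t) (at t)"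
proof -
  assume t: "0 < t" "t < e0"
  obtain B where "\<And>x. x \<in> {0<..<(t + e0) / 2} \<Longrightarrow> (f has_real_derivative B x / x) (at x)"
    by (rule tame_imp_f[of "(t + e0) / 2"]) (use t in auto)
  then have "(f has_real_derivative B t / t) (at t)" using t by auto
  then show ?thesis using DERIV_deriv_iff_real_differentiable DERIV_imp_differentiable by blast
qed

lemma f_tendsto_0: "(f \<longlongrightarrow> 0) (at_right 0)" and theta_f_tendsto_0: "((\<lambda>t. t * deriv f t) \<longlongrightarrow> 0) (at_right 0)"
proof -
  have e: "0 < e0 / 2" "e0 / 2 < e0" using e0_bounds by auto
  obtain B where "\<And>x. x \<in> {0<..<e0 / 2} \<Longrightarrow> (g has_real_derivative f x / x) (at x)"
    and B: "\<And>x. x \<in> {0<..<e0 / 2} \<Longrightarrow> (f has_real_derivative B x / x) (at x)"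
    "(f \<longlongrightarrow> 0) (at_right 0)" "(B \<longlongrightarrow> 0) (at_right 0)"
    by (rule tame_imp_f[OF e], rule that)
  show "(f \<longlongrightarrow> 0) (at_right 0)" by fact
  show "((\<lambda>t. t * deriv f t) \<longlongrightarrow> 0) (at_right 0)"
  proof (rule Lim_transform_eventually[OF B(3)])
    have "\<forall>\<^sub>F x in at_right 0. x \<in> {0<..<e0 / 2}"
      using e by (intro eventually_at_right_0) auto
    then show "\<forall>\<^sub>F x in at_right 0. B x = x * deriv f x"
    proof eventually_elim
      case (elim x)
      then show ?case using DERIV_imp_deriv[OF B(1)[OF elim]] by simp
    qed
  qed
qed

end

section \<open>Slow variation, entropy averages and the golden ratio\<close>

text \<open>
  Slow variation at \<open>0+\<close>: in the variable \<open>ln t\<close>, the Lipschitz constant of \<open>k\<close> near \<open>t = 0\<close> is arbitrarily small.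
\<close>
definition log_slow :: "(real \<Rightarrow> real) \<Rightarrow> bool" where
  "log_slow k \<longleftrightarrow> (\<forall>\<epsilon>>0. \<exists>\<delta>>0. \<forall>s t. 0 < s \<longrightarrow> s < \<delta> \<longrightarrow> 0 < t \<longrightarrow> t < \<delta> \<longrightarrow> \<bar>k s - k t\<bar> \<le> \<epsilon> * \<bar>ln s - ln t\<bar>)"

text \<open>
  The Euler derivative is the derivative with respect to \<open>ln t\<close>; if it tends to 0, the mean value theorem applies.
\<close>
lemma log_slowI:
  assumes a: "a > 0" and der: "\<And>t. 0 < t \<Longrightarrow> t < a \<Longrightarrow> (k has_real_derivative d t / t) (at t)"
    and d: "(d \<longlongrightarrow> 0) (at_right 0)"
  shows "log_slow k"
  unfolding log_slow_def
proof (intro allI impI)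
  fix \<epsilon> :: real assume eps: "\<epsilon> > 0"
  have "\<forall>\<^sub>F t in at_right 0. dist (d t) 0 < \<epsilon>" using d eps by (rule tendstoD)
  then obtain b where b: "b > 0" "\<And>t. 0 < t \<Longrightarrow> t < b \<Longrightarrow> \<bar>d t\<bar> < \<epsilon>"
    by (auto simp: eventually_at_right_field)
  have main: "\<bar>k t - k s\<bar> \<le> \<epsilon> * (ln t - ln s)" if st: "0 < s" "s < t" "t < min a b" for s t
  proof -
    have "\<exists>z. ln s < z \<and> z < ln t \<and> k (exp (ln t)) - k (exp (ln s)) = (ln t - ln s) * d (exp z)"
    proof (rule MVT2)
      show "ln s < ln t" using st by simp
      fix u assume u: "ln s \<le> u" "u \<le> ln t"
      have "exp u \<le> t" using u st by (metis exp_le_cancel_iff exp_ln less_trans)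
      then have "(k has_real_derivative d (exp u) / exp u) (at (exp u))" using st by (intro der) auto
      then have "((\<lambda>u. k (exp u)) has_real_derivative d (exp u) / exp u * exp u) (at u)"
        by (rule DERIV_chain2) (rule DERIV_exp)
      then show "((\<lambda>u. k (exp u)) has_real_derivative d (exp u)) (at u)" by simp
    qed
    then obtain z where z: "ln s < z" "z < ln t" "k t - k s = (ln t - ln s) * d (exp z)" using st by auto
    have "exp z < t" using z st by (metis exp_less_cancel_iff exp_ln less_trans)
    then have "\<bar>d (exp z)\<bar> \<le> \<epsilon>" using b(2)[of "exp z"] st by auto
    then have "(ln t - ln s) * \<bar>d (exp z)\<bar> \<le> (ln t - ln s) * \<epsilon>" using st by (intro mult_left_mono) auto
    then show ?thesis using z st by (simp add: abs_mult mult.commute)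
  qed
  show "\<exists>\<delta>>0. \<forall>s t. 0 < s \<longrightarrow> s < \<delta> \<longrightarrow> 0 < t \<longrightarrow> t < \<delta> \<longrightarrow> \<bar>k s - k t\<bar> \<le> \<epsilon> * \<bar>ln s - ln t\<bar>"
  proof (intro exI[of _ "min a b"] conjI allI impI)
    fix s t assume st: "0 < s" "s < min a b" "0 < t" "t < min a b"
    show "\<bar>k s - k t\<bar> \<le> \<epsilon> * \<bar>ln s - ln t\<bar>"
    proof (cases s t rule: linorder_cases)
      case less then show ?thesis using main[of s t] st by (simp add: abs_minus_commute)
    next
      case greater then show ?thesis using main[of t s] st by simp
    qed simp
  qed (use a b in simp)
qed

text \<open>
  In an expansion to order \<open>\<tau>\<close>, an argument may be replaced by another one at logarithmic distance \<open>O(\<tau>)\<close>.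
\<close>
lemma log_slow_diff:
  fixes k :: "real \<Rightarrow> real"
  assumes k: "log_slow k" and a: "(a \<longlongrightarrow> 0) F" "\<forall>\<^sub>F t in F. 0 < a t" and b: "(b \<longlongrightarrow> 0) F" "\<forall>\<^sub>F t in F. 0 < b t"
    and r: "\<forall>\<^sub>F t in F. \<bar>ln (a t) - ln (b t)\<bar> \<le> C * \<tau> t" and \<tau>: "\<forall>\<^sub>F t in F. 0 < \<tau> t"
  shows "((\<lambda>t. (k (a t) - k (b t)) / \<tau> t) \<longlongrightarrow> 0) F"
proof (rule tendstoI)
  fix \<epsilon> :: real assume eps: "\<epsilon> > 0"
  define \<eta> where "\<eta> = \<epsilon> / (2 * (\<bar>C\<bar> + 1))"
  have eta: "\<eta> > 0" using eps by (simp add: \<eta>_def add_nonneg_pos)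
  obtain \<delta> where d: "\<delta> > 0" "\<And>s t. 0 < s \<Longrightarrow> s < \<delta> \<Longrightarrow> 0 < t \<Longrightarrow> t < \<delta> \<Longrightarrow> \<bar>k s - k t\<bar> \<le> \<eta> * \<bar>ln s - ln t\<bar>"
    using k eta unfolding log_slow_def by meson
  from order_tendstoD(2)[OF a(1) d(1)] order_tendstoD(2)[OF b(1) d(1)] a(2) b(2) r \<tau>
  show "\<forall>\<^sub>F t in F. dist ((k (a t) - k (b t)) / \<tau> t) 0 < \<epsilon>"
  proof eventually_elim
    case (elim t)
    have "\<bar>k (a t) - k (b t)\<bar> \<le> \<eta> * \<bar>ln (a t) - ln (b t)\<bar>" using d(2) elim by blast
    also have "\<dots> \<le> \<eta> * (C * \<tau> t)" using elim eta by (intro mult_left_mono) auto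
    also have "\<dots> \<le> \<eta> * ((\<bar>C\<bar> + 1) * \<tau> t)" using elim eta by (intro mult_left_mono mult_right_mono) auto
    also have "\<dots> = \<epsilon> / 2 * \<tau> t" by (simp add: \<eta>_def add_nonneg_pos field_simps) 
    finally have "\<bar>k (a t) - k (b t)\<bar> / \<tau> t \<le> \<epsilon> / 2" using elim by (simp add: divide_simps)
    then have "\<bar>k (a t) - k (b t)\<bar> / \<tau> t < \<epsilon>" using eps by linarith
    then show ?case using elim by (simp add: dist_real_def)
  qed
qed

text \<open>
  If \<open>q s = p (exp s) / exp s\<close>, then \<open>mix y q s = (p (y * exp s) + p ((1 - y) * exp s)) / exp s\<close>: the point \<open>exp s\<close> is split in the
  proportion \<open>y : 1 - y\<close>.
\<close>
definition mix :: "real \<Rightarrow> (real \<Rightarrow> real) \<Rightarrow> real \<Rightarrow> real" where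
  "mix y q s = y * q (s + ln y) + (1 - y) * q (s + ln (1 - y))"

lemma mix_diff: "mix y (\<lambda>s. f s - h s) = (\<lambda>s. mix y f s - mix y h s)"
  by (auto simp: mix_def algebra_simps)

lemma mix_add: "mix y (\<lambda>s. f s + h s) = (\<lambda>s. mix y f s + mix y h s)"
  by (auto simp: mix_def algebra_simps)

lemma mix_pow_diff: "(mix y ^^ n) (\<lambda>s. f s - h s) = (\<lambda>s. (mix y ^^ n) f s - (mix y ^^ n) h s)"
  by (induction n) (auto simp: mix_diff)

lemma mix_pow_add: "(mix y ^^ n) (\<lambda>s. f s + h s) = (\<lambda>s. (mix y ^^ n) f s + (mix y ^^ n) h s)"
  by (induction n) (auto simp: mix_add)

lemma mix_near_const:
  assumes "0 < y" "y < 1" and "\<And>t. t \<le> s \<Longrightarrow> \<bar>f t - \<kappa>\<bar> \<le> \<epsilon>"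
  shows "\<bar>mix y f s - \<kappa>\<bar> \<le> \<epsilon>"
proof -
  have l: "ln y < 0" "ln (1 - y) < 0" using assms by auto
  have "mix y f s - \<kappa> = y * (f (s + ln y) - \<kappa>) + (1 - y) * (f (s + ln (1 - y)) - \<kappa>)" by (simp add: mix_def algebra_simps)
  also have "\<bar>\<dots>\<bar> \<le> y * \<bar>f (s + ln y) - \<kappa>\<bar> + (1 - y) * \<bar>f (s + ln (1 - y)) - \<kappa>\<bar>"
    using assms(1,2) by (intro order_trans[OF abs_triangle_ineq]) (simp add: abs_mult)
  also have "\<dots> \<le> y * \<epsilon> + (1 - y) * \<epsilon>"
    using assms l by (intro add_mono mult_left_mono assms(3)) auto
  finally show ?thesis by (simp add: algebra_simps)
qed

text \<open>
  Each application moves the argument to the left by at most \<open>c\<close>.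
\<close>
lemma mix_pow_bound:
  assumes y: "0 < y" "y < 1" and c: "- ln y \<le> c" "- ln (1 - y) \<le> c"
    and h: "\<And>t u. t \<le> u \<Longrightarrow> u \<le> s1 \<Longrightarrow> h u \<le> h t" and f: "\<And>t. t \<le> s1 \<Longrightarrow> \<bar>f t\<bar> \<le> h t" and t: "t \<le> s1"
  shows "\<bar>(mix y ^^ n) f t\<bar> \<le> h (t - of_nat n * c)"
  using t
proof (induction n arbitrary: t)
  case 0
  then show ?case using f by simp
next
  case (Suc n)
  have l: "ln y < 0" "ln (1 - y) < 0" using y by auto
  have c0: "c \<ge> 0" using c l by linarith
  have "\<bar>(mix y ^^ Suc n) f t\<bar> = \<bar>y * (mix y ^^ n) f (t + ln y) + (1 - y) * (mix y ^^ n) f (t + ln (1 - y))\<bar>"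
    by (simp add: mix_def)
  also have "\<dots> \<le> y * \<bar>(mix y ^^ n) f (t + ln y)\<bar> + (1 - y) * \<bar>(mix y ^^ n) f (t + ln (1 - y))\<bar>"
    using y by (intro order_trans[OF abs_triangle_ineq]) (simp add: abs_mult)
  also have "\<dots> \<le> y * h (t - of_nat (Suc n) * c) + (1 - y) * h (t - of_nat (Suc n) * c)"
  proof (intro add_mono mult_left_mono)
    have nc: "0 \<le> of_nat n * c" using c0 by simp
    have S: "of_nat (Suc n) * c = of_nat n * c + c" by (simp add: algebra_simps)
    have "h (t + ln y - of_nat n * c) \<le> h (t - of_nat (Suc n) * c)"
      by (rule h) (use S Suc.prems l c nc in linarith)+
    then show "\<bar>(mix y ^^ n) f (t + ln y)\<bar> \<le> h (t - of_nat (Suc n) * c)"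
      using Suc.IH[of "t + ln y"] Suc.prems l by linarith
    have "h (t + ln (1 - y) - of_nat n * c) \<le> h (t - of_nat (Suc n) * c)"
      by (rule h) (use S Suc.prems l c nc in linarith)+
    then show "\<bar>(mix y ^^ n) f (t + ln (1 - y))\<bar> \<le> h (t - of_nat (Suc n) * c)"
      using Suc.IH[of "t + ln (1 - y)"] Suc.prems l by linarith
  qed (use y in auto)
  finally show ?case by (simp add: algebra_simps)
qed

text \<open>
  Write \<open>1 - T^n\<close> as \<open>(1 - T) + T (1 - T^(n-1))\<close> for \<open>T = mix y\<close>; averaging preserves the distance to a constant.
\<close>
lemma mix_pow_first_difference:
  assumes y: "0 < y" "y < 1" and f: "\<And>t. t \<le> s1 \<Longrightarrow> \<bar>f t - mix y f t - \<kappa>\<bar> \<le> \<epsilon>" and t: "t \<le> s1"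
  shows "\<bar>f t - (mix y ^^ n) f t - of_nat n * \<kappa>\<bar> \<le> of_nat n * \<epsilon>"
  using t
proof (induction n arbitrary: t)
  case (Suc n)
  have "\<bar>mix y (\<lambda>t. f t - (mix y ^^ n) f t) t - of_nat n * \<kappa>\<bar> \<le> of_nat n * \<epsilon>"
    by (rule mix_near_const[OF y]) (use Suc in auto)
  then show ?case using f[OF Suc.prems] by (simp add: mix_diff algebra_simps)
qed simp

text \<open>
  For \<open>T = mix y\<close>, the \<open>n\<close>-step difference of \<open>(1 - T) f\<close> is close to \<open>n \<kappa>\<close> by \<open>mix_pow_first_difference\<close>. As powers of \<open>T\<close>
  commute, the same telescoping over \<open>m\<close> further steps treats the \<open>n\<close>-step difference of \<open>(1 - T^m) f\<close>; finally \<open>m = n\<close>.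
\<close>
lemma mix_pow_second_difference:
  assumes y: "0 < y" "y < 1"
    and f: "\<And>t. t \<le> s1 \<Longrightarrow> \<bar>f t - 2 * mix y f t + mix y (mix y f) t - \<kappa>\<bar> \<le> \<epsilon>" and t: "t \<le> s1"
  shows "\<bar>f t - 2 * (mix y ^^ n) f t + (mix y ^^ (n + n)) f t - (of_nat n)\<^sup>2 * \<kappa>\<bar> \<le> (of_nat n)\<^sup>2 * \<epsilon>"
proof -
  define E where "E t = f t - mix y f t" for t
  have E: "\<bar>E t - (mix y ^^ n) E t - of_nat n * \<kappa>\<bar> \<le> of_nat n * \<epsilon>" if "t \<le> s1" for t
  proof (rule mix_pow_first_difference[OF y _ that])
    fix t assume "t \<le> s1"
    from f[OF this] show "\<bar>E t - mix y E t - \<kappa>\<bar> \<le> \<epsilon>"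
      unfolding E_def mix_diff by (simp add: algebra_simps)
  qed
  define Z where "Z m t = f t - (mix y ^^ m) f t" for m t
  have Z: "\<bar>Z m t - (mix y ^^ n) (Z m) t - of_nat m * (of_nat n * \<kappa>)\<bar> \<le> of_nat m * (of_nat n * \<epsilon>)" if "t \<le> s1" for m t
    using that
  proof (induction m arbitrary: t)
    case 0
    have "(mix y ^^ n) (\<lambda>_. 0) = (\<lambda>_. 0)" by (induction n) (auto simp: mix_def)
    then show ?case by (simp add: Z_def[abs_def])
  next
    case (Suc m)
    have ZS: "Z (Suc m) = (\<lambda>t. E t + mix y (Z m) t)"
      by (auto simp: Z_def[abs_def] E_def[abs_def] mix_diff)
    have comm: "(mix y ^^ n) (mix y (Z m)) = mix y ((mix y ^^ n) (Z m))"
      by (metis comp_apply funpow_Suc_right funpow.simps(2))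
    have "\<bar>mix y (\<lambda>t. Z m t - (mix y ^^ n) (Z m) t) t - of_nat m * (of_nat n * \<kappa>)\<bar> \<le> of_nat m * (of_nat n * \<epsilon>)"
      by (rule mix_near_const[OF y]) (use Suc in auto)
    then have 1: "\<bar>mix y (Z m) t - mix y ((mix y ^^ n) (Z m)) t - of_nat m * (of_nat n * \<kappa>)\<bar> \<le> of_nat m * (of_nat n * \<epsilon>)"
      unfolding mix_diff .
    have 2: "Z (Suc m) t - (mix y ^^ n) (Z (Suc m)) t = (E t - (mix y ^^ n) E t) + (mix y (Z m) t - mix y ((mix y ^^ n) (Z m)) t)"
      unfolding ZS mix_pow_add comm by simp
    show ?case unfolding 2 using 1 E[OF Suc.prems] by (simp add: algebra_simps)
  qed
  have "(mix y ^^ n) (Z n) t = (mix y ^^ n) f t - (mix y ^^ (n + n)) f t"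
    unfolding Z_def[abs_def] mix_pow_diff by (simp add: funpow_add)
  then show ?thesis using Z[OF t, of n] by (simp add: Z_def power2_eq_square algebra_simps)
qed

text \<open>
  The drift of the averaging operator: \<open>mix y\<close> maps the identity to \<open>\<lambda>s. s - entropy y\<close>.
\<close>
definition entropy :: "real \<Rightarrow> real" where
  "entropy y = - (y * ln y) - (1 - y) * ln (1 - y)"

lemma entropy_pos: "0 < y \<Longrightarrow> y < 1 \<Longrightarrow> entropy y > 0"
proof -
  assume y: "0 < y" "y < 1"
  then have "y * ln y < 0" "(1 - y) * ln (1 - y) < 0" by (auto simp: mult_pos_neg)
  then show ?thesis by (simp add: entropy_def)
qed

lemma entropy_commute: "entropy (1 - y) = entropy y"
  by (simp add: entropy_def)

lemma zero_if_small: "(\<And>\<epsilon>. \<epsilon> > 0 \<Longrightarrow> \<bar>x\<bar> \<le> C * \<epsilon>) \<Longrightarrow> x = (0::real)"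
proof (rule ccontr)
  assume h: "\<And>\<epsilon>. \<epsilon> > 0 \<Longrightarrow> \<bar>x\<bar> \<le> C * \<epsilon>" and x: "x \<noteq> 0"
  define \<epsilon> where "\<epsilon> = \<bar>x\<bar> / (2 * (\<bar>C\<bar> + 1))"
  have "\<epsilon> > 0" using x by (simp add: \<epsilon>_def add_nonneg_pos)
  have "C * \<epsilon> \<le> (\<bar>C\<bar> + 1) * \<epsilon>" using \<open>\<epsilon> > 0\<close> by (intro mult_right_mono) auto
  also have "\<dots> = \<bar>x\<bar> / 2" by (simp add: \<epsilon>_def field_simps add_nonneg_pos)
  finally show False using h[OF \<open>\<epsilon> > 0\<close>] x by simp
qed

lemma eventually_at_bot_le: "(\<forall>\<^sub>F s in at_bot. P (s::real)) \<Longrightarrow> \<exists>s1. s1 < 0 \<and> (\<forall>s\<le>s1. P s)"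
proof -
  assume "\<forall>\<^sub>F s in at_bot. P s"
  then obtain N where N: "\<And>s. s \<le> N \<Longrightarrow> P s" unfolding eventually_at_bot_linorder by blast
  show ?thesis by (rule exI[of _ "min N (-1)"]) (use N in auto)
qed

text \<open>
  On \<open>q s = a * s\<close> the difference \<open>q - mix y q\<close> is \<open>a * entropy y\<close>. The remainder \<open>R\<close> is \<open>o(s)\<close> and satisfies the hypothesis with
  the limit \<open>\<kappa>'\<close>. The sum of \<open>n\<close> such differences is \<open>n \<kappa>'\<close> up to \<open>n \<epsilon>\<close>; it is also a difference of two averages of \<open>R\<close>,
  which is \<open>O(\<epsilon> n)\<close>. Division by \<open>n\<close> shows \<open>\<kappa>' = 0\<close>.
\<close>
lemma mix_first_order_limit:
  assumes y: "0 < y" "y < 1" and q: "((\<lambda>s. q s / s) \<longlongrightarrow> a) at_bot"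
    and lim: "((\<lambda>s. q s - mix y q s) \<longlongrightarrow> \<kappa>) at_bot"
  shows "\<kappa> = a * entropy y"
proof -
  define c where "c = - ln y - ln (1 - y)"
  have l: "ln y < 0" "ln (1 - y) < 0" using y by auto
  have c: "- ln y \<le> c" "- ln (1 - y) \<le> c" "c > 0" using l by (auto simp: c_def)
  define R where "R s = q s - a * s" for s
  define \<kappa>' where "\<kappa>' = \<kappa> - a * entropy y"
  have Rm: "R s - mix y R s - \<kappa>' = q s - mix y q s - \<kappa>" for s
    by (simp add: R_def mix_def \<kappa>'_def entropy_def algebra_simps)
  have "\<bar>\<kappa>'\<bar> \<le> (1 + c) * \<epsilon>" if eps: "\<epsilon> > 0" for \<epsilon>
  proof -
    have "\<forall>\<^sub>F s in at_bot. dist (q s / s) a < \<epsilon> \<and> dist (q s - mix y q s) \<kappa> < \<epsilon>"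
      using tendstoD[OF q eps] tendstoD[OF lim eps] by eventually_elim simp
    from eventually_at_bot_le[OF this] obtain s1 where s1: "s1 < 0"
      "\<And>s. s \<le> s1 \<Longrightarrow> dist (q s / s) a < \<epsilon>" "\<And>s. s \<le> s1 \<Longrightarrow> dist (q s - mix y q s) \<kappa> < \<epsilon>" by blast
    have R1: "\<bar>R t\<bar> \<le> \<epsilon> * - t" if "t \<le> s1" for t
    proof -
      have t: "t < 0" using that s1 by simp
      have "R t = (q t / t - a) * t" using t by (simp add: R_def left_diff_distrib)
      then have "\<bar>R t\<bar> = \<bar>q t / t - a\<bar> * - t" using t by (simp add: abs_mult)
      also have "\<dots> \<le> \<epsilon> * - t" using s1(2)[OF that] t by (intro mult_right_mono) (auto simp: dist_real_def)
      finally show ?thesis .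
    qed
    have R2: "\<bar>R t - mix y R t - \<kappa>'\<bar> \<le> \<epsilon>" if "t \<le> s1" for t
      using s1(3)[OF that] unfolding Rm by (simp add: dist_real_def)
    have "of_nat n * \<bar>\<kappa>'\<bar> \<le> of_nat n * \<epsilon> + 2 * (\<epsilon> * - s1) + \<epsilon> * of_nat n * c" for n :: nat
    proof -
      have "\<bar>R s1 - (mix y ^^ n) R s1 - of_nat n * \<kappa>'\<bar> \<le> of_nat n * \<epsilon>"
        by (rule mix_pow_first_difference[OF y R2]) auto
      moreover have "\<bar>(mix y ^^ n) R s1\<bar> \<le> \<epsilon> * - (s1 - of_nat n * c)"
        by (rule mix_pow_bound[OF y c(1,2), where h = "\<lambda>t. \<epsilon> * - t" and ?s1.0 = s1]) (use R1 eps in auto)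
      moreover have "\<bar>R s1\<bar> \<le> \<epsilon> * - s1" by (rule R1) simp
      moreover have "of_nat n * \<bar>\<kappa>'\<bar> = \<bar>of_nat n * \<kappa>'\<bar>" by (simp add: abs_mult)
      ultimately show ?thesis by (simp add: algebra_simps)
    qed
    then have ev: "\<bar>\<kappa>'\<bar> \<le> \<epsilon> + 2 * (\<epsilon> * - s1) / of_nat n + \<epsilon> * c" if "n > 0" for n :: nat
      using that by (simp add: field_simps)
    have "(\<lambda>n. \<epsilon> + 2 * (\<epsilon> * - s1) / of_nat n + \<epsilon> * c) \<longlonglongrightarrow> \<epsilon> + 0 + \<epsilon> * c"
      by (intro tendsto_add tendsto_const lim_const_over_n)
    then have "\<bar>\<kappa>'\<bar> \<le> \<epsilon> + 0 + \<epsilon> * c"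
      by (rule tendsto_lowerbound) (use ev in \<open>auto intro!: eventually_mono[OF eventually_gt_at_top[of "0::nat"]]\<close>)
    then show ?thesis by (simp add: algebra_simps)
  qed
  then have "\<kappa>' = 0" by (rule zero_if_small)
  then show ?thesis by (simp add: \<kappa>'_def)
qed

text \<open>
  As for the first order: the second difference of \<open>a * s^2\<close> is \<open>2 * a * (entropy y)^2\<close>, and \<open>n^2\<close> second differences of the
  remainder add up to at most \<open>O(\<epsilon> n^2)\<close>.
\<close>
lemma mix_second_order_limit:
  assumes y: "0 < y" "y < 1" and q: "((\<lambda>s. q s / s\<^sup>2) \<longlongrightarrow> a) at_bot"
    and lim: "((\<lambda>s. q s - 2 * mix y q s + mix y (mix y q) s) \<longlongrightarrow> \<kappa>) at_bot"
  shows "\<kappa> = 2 * a * (entropy y)\<^sup>2"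
proof -
  define c where "c = - ln y - ln (1 - y)"
  have l: "ln y < 0" "ln (1 - y) < 0" using y by auto
  have c: "- ln y \<le> c" "- ln (1 - y) \<le> c" "c > 0" using l by (auto simp: c_def)
  define R where "R s = q s - a * s\<^sup>2" for s
  define \<kappa>' where "\<kappa>' = \<kappa> - 2 * a * (entropy y)\<^sup>2"
  have Rm: "R s - 2 * mix y R s + mix y (mix y R) s - \<kappa>' = q s - 2 * mix y q s + mix y (mix y q) s - \<kappa>" for s
    by (simp add: R_def mix_def \<kappa>'_def entropy_def algebra_simps power2_eq_square)
  have "\<bar>\<kappa>'\<bar> \<le> (1 + 16 * c\<^sup>2) * \<epsilon>" if eps: "\<epsilon> > 0" for \<epsilon>
  proof -
    have "\<forall>\<^sub>F s in at_bot. dist (q s / s\<^sup>2) a < \<epsilon> \<and> dist (q s - 2 * mix y q s + mix y (mix y q) s) \<kappa> < \<epsilon>"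
      using tendstoD[OF q eps] tendstoD[OF lim eps] by eventually_elim simp
    from eventually_at_bot_le[OF this] obtain s1 where s1: "s1 < 0"
      "\<And>s. s \<le> s1 \<Longrightarrow> dist (q s / s\<^sup>2) a < \<epsilon>"
      "\<And>s. s \<le> s1 \<Longrightarrow> dist (q s - 2 * mix y q s + mix y (mix y q) s) \<kappa> < \<epsilon>" by blast
    have R1: "\<bar>R t\<bar> \<le> \<epsilon> * t\<^sup>2" if "t \<le> s1" for t
    proof -
      have t: "t < 0" using that s1 by simp
      have "R t = (q t / t\<^sup>2 - a) * t\<^sup>2" using t by (simp add: R_def left_diff_distrib)
      then have "\<bar>R t\<bar> = \<bar>q t / t\<^sup>2 - a\<bar> * t\<^sup>2" using t by (simp add: abs_mult)
      also have "\<dots> \<le> \<epsilon> * t\<^sup>2" using s1(2)[OF that] t by (intro mult_right_mono) (auto simp: dist_real_def)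
      finally show ?thesis .
    qed
    have R2: "\<bar>R t - 2 * mix y R t + mix y (mix y R) t - \<kappa>'\<bar> \<le> \<epsilon>" if "t \<le> s1" for t
      using s1(3)[OF that] unfolding Rm by (simp add: dist_real_def)
    have sq: "u\<^sup>2 \<le> t\<^sup>2" if "t \<le> u" "u \<le> s1" for t u :: real
      using that s1(1) by (metis abs_le_square_iff abs_of_neg le_less_trans neg_le_iff_le)
    have bound: "\<bar>(mix y ^^ n) R s1\<bar> \<le> \<epsilon> * (s1 - of_nat n * c)\<^sup>2" for n
      by (rule mix_pow_bound[OF y c(1,2), where h = "\<lambda>t. \<epsilon> * t\<^sup>2" and ?s1.0 = s1]) (use R1 eps sq in auto)
    have "(of_nat n)\<^sup>2 * \<bar>\<kappa>'\<bar> \<le> (of_nat n)\<^sup>2 * \<epsilon> + 4 * (\<epsilon> * (s1 - of_nat (n + n) * c)\<^sup>2)" for n :: nat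
    proof -
      have "\<bar>R s1 - 2 * (mix y ^^ n) R s1 + (mix y ^^ (n + n)) R s1 - (of_nat n)\<^sup>2 * \<kappa>'\<bar> \<le> (of_nat n)\<^sup>2 * \<epsilon>"
        by (rule mix_pow_second_difference[OF y R2]) auto
      moreover have "\<epsilon> * (s1 - of_nat n * c)\<^sup>2 \<le> \<epsilon> * (s1 - of_nat (n + n) * c)\<^sup>2"
        using eps c by (intro mult_left_mono sq) (auto simp: algebra_simps)
      moreover have "\<epsilon> * s1\<^sup>2 \<le> \<epsilon> * (s1 - of_nat (n + n) * c)\<^sup>2"
        using eps c by (intro mult_left_mono sq) (auto simp: algebra_simps)
      moreover have "\<bar>R s1\<bar> \<le> \<epsilon> * s1\<^sup>2" by (rule R1) simp
      moreover have "(of_nat n)\<^sup>2 * \<bar>\<kappa>'\<bar> = \<bar>(of_nat n)\<^sup>2 * \<kappa>'\<bar>" by (simp add: abs_mult)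
      ultimately show ?thesis using bound[of n] bound[of "n + n"] by linarith
    qed
    then have ev: "\<bar>\<kappa>'\<bar> \<le> \<epsilon> + 4 * (\<epsilon> * (s1 / of_nat n - 2 * c)\<^sup>2)" if n: "n > 0" for n :: nat
    proof -
      have "(of_nat n)\<^sup>2 * \<bar>\<kappa>'\<bar> \<le> (of_nat n)\<^sup>2 * (\<epsilon> + 4 * (\<epsilon> * (s1 / of_nat n - 2 * c)\<^sup>2))"
      proof -
        have "(of_nat n)\<^sup>2 * (s1 / of_nat n - 2 * c)\<^sup>2 = (s1 - of_nat (n + n) * c)\<^sup>2"
          unfolding power_mult_distrib[symmetric] using n by (simp add: algebra_simps)
        then have "(of_nat n)\<^sup>2 * (\<epsilon> + 4 * (\<epsilon> * (s1 / of_nat n - 2 * c)\<^sup>2))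
           = (of_nat n)\<^sup>2 * \<epsilon> + 4 * (\<epsilon> * (s1 - of_nat (n + n) * c)\<^sup>2)" by (simp add: algebra_simps)
        then show ?thesis using \<open>\<And>n. (of_nat n)\<^sup>2 * \<bar>\<kappa>'\<bar> \<le> (of_nat n)\<^sup>2 * \<epsilon> + 4 * (\<epsilon> * (s1 - of_nat (n + n) * c)\<^sup>2)\<close> by metis
      qed
      then show ?thesis by (rule mult_left_le_imp_le) (use n in simp)
    qed
    have "(\<lambda>n. \<epsilon> + 4 * (\<epsilon> * (s1 / of_nat n - 2 * c)\<^sup>2)) \<longlonglongrightarrow> \<epsilon> + 4 * (\<epsilon> * (0 - 2 * c)\<^sup>2)"
      by (intro tendsto_intros lim_const_over_n)
    then have "\<bar>\<kappa>'\<bar> \<le> \<epsilon> + 4 * (\<epsilon> * (0 - 2 * c)\<^sup>2)"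
      by (rule tendsto_lowerbound) (use ev in \<open>auto intro!: eventually_mono[OF eventually_gt_at_top[of "0::nat"]]\<close>)
    then show ?thesis by (simp add: algebra_simps power2_eq_square)
  qed
  then have "\<kappa>' = 0" by (rule zero_if_small)
  then show ?thesis by (simp add: \<kappa>'_def)
qed

text \<open>
  Add the increments along \<open>s, s + L, s + 2 L, ...\<close> until the interval \<open>[s1 - L, s1]\<close> is reached.
\<close>
lemma lattice_growth:
  fixes R m :: "real \<Rightarrow> real"
  assumes L: "L > 0" and d: "\<And>s. s \<le> s1 \<Longrightarrow> \<bar>R s - R (s - L)\<bar> \<le> m s"
    and m: "\<And>s t. s \<le> t \<Longrightarrow> t \<le> s1 \<Longrightarrow> 0 \<le> m t \<and> m t \<le> m s"
    and B: "\<And>s. s1 - L \<le> s \<Longrightarrow> s \<le> s1 \<Longrightarrow> \<bar>R s\<bar> \<le> B" and s: "s \<le> s1"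
  shows "\<bar>R s\<bar> \<le> B + (s1 - s) / L * m s"
proof -
  have main: "\<forall>s. s1 - of_nat (Suc n) * L \<le> s \<longrightarrow> s \<le> s1 \<longrightarrow> \<bar>R s\<bar> \<le> B + (s1 - s) / L * m s" for n
  proof (induction n)
    case 0
    show ?case
    proof (intro allI impI)
      fix s assume "s1 - of_nat (Suc 0) * L \<le> s" "s \<le> s1"
      then have "\<bar>R s\<bar> \<le> B" "0 \<le> (s1 - s) / L * m s" using B[of s] m[of s s] L by auto
      then show "\<bar>R s\<bar> \<le> B + (s1 - s) / L * m s" by linarith
    qed
  next
    case (Suc n)
    show ?case
    proof (intro allI impI)
      fix s assume s: "s1 - of_nat (Suc (Suc n)) * L \<le> s" "s \<le> s1"
      show "\<bar>R s\<bar> \<le> B + (s1 - s) / L * m s"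
      proof (cases "s1 - L \<le> s")
        case True
        then have "\<bar>R s\<bar> \<le> B" "0 \<le> (s1 - s) / L * m s" using B[of s] m[of s s] L s by auto
        then show ?thesis by linarith
      next
        case False
        have sl: "s1 - of_nat (Suc n) * L \<le> s + L" "s + L \<le> s1" using s False by (auto simp: algebra_simps)
        have "\<bar>R (s + L)\<bar> \<le> B + (s1 - (s + L)) / L * m (s + L)" using Suc.IH sl by blast
        moreover have "\<bar>R (s + L) - R s\<bar> \<le> m (s + L)" using d[OF sl(2)] by simp
        moreover have "(s1 - (s + L)) / L * m (s + L) + m (s + L) = (s1 - s) / L * m (s + L)"
          using L by (simp add: field_simps)
        moreover have "(s1 - s) / L * m (s + L) \<le> (s1 - s) / L * m s"
          using m[of s "s + L"] sl L s by (intro mult_left_mono) auto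
        ultimately show ?thesis by linarith
      qed
    qed
  qed
  obtain n :: nat where n: "(s1 - s) / L \<le> of_nat n" using real_arch_simple by blast
  then have "s1 - of_nat (Suc n) * L \<le> s" using L by (simp add: field_simps)
  then show ?thesis using main[of n] s by blast
qed

lemma first_difference_growth:
  fixes q :: "real \<Rightarrow> real"
  assumes L: "L > 0" and cont: "continuous_on {..s0} q" and lim: "((\<lambda>s. q s - q (s - L)) \<longlongrightarrow> \<kappa>) at_bot"
  shows "((\<lambda>s. q s / s) \<longlongrightarrow> \<kappa> / L) at_bot"
proof (rule tendstoI)
  fix \<epsilon> :: real assume eps: "\<epsilon> > 0"
  define R where "R s = q s - \<kappa> / L * s" for s
  define \<eta> where "\<eta> = \<epsilon> * L / 4"
  have eta: "\<eta> > 0" using eps L by (simp add: \<eta>_def)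
  have "\<forall>\<^sub>F s in at_bot. s \<le> s0 \<and> dist (q s - q (s - L)) \<kappa> < \<eta>"
    using tendstoD[OF lim eta] eventually_le_at_bot[of s0] by eventually_elim simp
  from eventually_at_bot_le[OF this] obtain s1 where s1: "s1 < 0"
    "\<And>s. s \<le> s1 \<Longrightarrow> s \<le> s0" "\<And>s. s \<le> s1 \<Longrightarrow> dist (q s - q (s - L)) \<kappa> < \<eta>" by blast
  have dR: "\<bar>R s - R (s - L)\<bar> \<le> \<eta>" if "s \<le> s1" for s
  proof -
    have "R s - R (s - L) = q s - q (s - L) - \<kappa>" using L by (simp add: R_def field_simps)
    then show ?thesis using s1(3)[OF that] by (simp add: dist_real_def)
  qed
  have "continuous_on {s1 - L..s1} R" unfolding R_def
    by (intro continuous_intros continuous_on_subset[OF cont]) (use s1(2) in auto)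
  then have "bounded (R ` {s1 - L..s1})" by (intro compact_imp_bounded compact_continuous_image) auto
  then obtain B where B: "B > 0" "\<And>s. s1 - L \<le> s \<Longrightarrow> s \<le> s1 \<Longrightarrow> \<bar>R s\<bar> \<le> B" unfolding bounded_pos by auto
  have bd: "\<bar>R s\<bar> \<le> B + (s1 - s) / L * \<eta>" if "s \<le> s1" for s
    by (rule lattice_growth[where R = R and m = "\<lambda>_. \<eta>" and ?s1.0 = s1]) (use L dR B(2) that eta in auto)
  have "((\<lambda>s. B / \<bar>s\<bar>) \<longlongrightarrow> 0) at_bot"
    by real_asymp
  then have "\<forall>\<^sub>F s in at_bot. B / \<bar>s\<bar> < \<epsilon> / 2" by (rule order_tendstoD(2)) (use eps in simp)
  with eventually_le_at_bot[of s1] show "\<forall>\<^sub>F s in at_bot. dist (q s / s) (\<kappa> / L) < \<epsilon>"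
  proof eventually_elim
    case (elim s)
    have s: "s < 0" using elim s1 by simp
    have "(s1 - s) / L * \<eta> = (s1 - s) * (\<epsilon> / 4)" using L by (simp add: \<eta>_def)
    also have "\<dots> \<le> \<bar>s\<bar> * (\<epsilon> / 4)" using s s1(1) eps by (intro mult_right_mono) auto
    finally have "\<bar>R s\<bar> \<le> B + \<bar>s\<bar> * (\<epsilon> / 4)" using bd[OF elim(1)] by linarith
    then have "\<bar>R s\<bar> / \<bar>s\<bar> \<le> B / \<bar>s\<bar> + \<epsilon> / 4" using s by (simp add: field_simps)
    moreover have "q s / s - \<kappa> / L = R s / s" using s by (simp add: R_def field_simps)
    ultimately show ?case using elim(2) eps by (simp add: dist_real_def)
  qed
qed

text \<open>
  \<open>lattice_growth\<close> is used twice, for the first difference of \<open>q - a * s^2\<close> and then for this function itself.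
\<close>
lemma second_difference_growth:
  fixes q :: "real \<Rightarrow> real"
  assumes L: "L > 0" and cont: "continuous_on {..s0} q"
    and lim: "((\<lambda>s. q s - 2 * q (s - L) + q (s - 2 * L)) \<longlongrightarrow> \<kappa>) at_bot"
  shows "((\<lambda>s. q s / s\<^sup>2) \<longlongrightarrow> \<kappa> / (2 * L\<^sup>2)) at_bot"
proof (rule tendstoI)
  fix \<epsilon> :: real assume eps: "\<epsilon> > 0"
  define a where "a = \<kappa> / (2 * L\<^sup>2)"
  have aL: "2 * a * L\<^sup>2 = \<kappa>" using L by (simp add: a_def)
  define R where "R s = q s - a * s\<^sup>2" for s
  define d where "d s = R s - R (s - L)" for s
  define \<eta> where "\<eta> = \<epsilon> * L\<^sup>2 / 4"
  have eta: "\<eta> > 0" using eps L by (simp add: \<eta>_def)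
  have "\<forall>\<^sub>F s in at_bot. s \<le> s0 \<and> dist (q s - 2 * q (s - L) + q (s - 2 * L)) \<kappa> < \<eta>"
    using tendstoD[OF lim eta] eventually_le_at_bot[of s0] by eventually_elim simp
  from eventually_at_bot_le[OF this] obtain s1 where s1: "s1 < 0"
    "\<And>s. s \<le> s1 \<Longrightarrow> s \<le> s0" "\<And>s. s \<le> s1 \<Longrightarrow> dist (q s - 2 * q (s - L) + q (s - 2 * L)) \<kappa> < \<eta>" by blast
  have dd: "\<bar>d s - d (s - L)\<bar> \<le> \<eta>" if "s \<le> s1" for s
  proof -
    have "a * s\<^sup>2 - 2 * (a * (s - L)\<^sup>2) + a * (s - 2 * L)\<^sup>2 = 2 * a * L\<^sup>2" by (simp add: power2_eq_square algebra_simps)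
    moreover have "s - L - L = s - 2 * L" by simp
    ultimately have "d s - d (s - L) = q s - 2 * q (s - L) + q (s - 2 * L) - \<kappa>" unfolding d_def R_def aL by simp
    then show ?thesis using s1(3)[OF that] by (simp add: dist_real_def)
  qed
  have cR: "continuous_on {..s1} R" unfolding R_def
    by (intro continuous_intros continuous_on_subset[OF cont]) (use s1(2) in auto)
  have "bounded (R ` {s1 - L..s1})"
    by (intro compact_imp_bounded compact_continuous_image continuous_on_subset[OF cR]) auto
  then obtain B where B: "B > 0" "\<And>s. s1 - L \<le> s \<Longrightarrow> s \<le> s1 \<Longrightarrow> \<bar>R s\<bar> \<le> B" unfolding bounded_pos by auto
  have "continuous_on {s1 - L..s1} (\<lambda>s. R (s - L))"
    by (rule continuous_on_compose2[OF cR]) (use L in \<open>auto intro!: continuous_intros\<close>)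
  then have "continuous_on {s1 - L..s1} d" unfolding d_def
    by (intro continuous_intros continuous_on_subset[OF cR]) auto
  then have "bounded (d ` {s1 - L..s1})" by (intro compact_imp_bounded compact_continuous_image) auto
  then obtain B1 where B1: "B1 > 0" "\<And>s. s1 - L \<le> s \<Longrightarrow> s \<le> s1 \<Longrightarrow> \<bar>d s\<bar> \<le> B1" unfolding bounded_pos by auto
  have bd: "\<bar>d s\<bar> \<le> B1 + (s1 - s) / L * \<eta>" if "s \<le> s1" for s
    by (rule lattice_growth[where R = d and m = "\<lambda>_. \<eta>" and ?s1.0 = s1]) (use L dd B1(2) that eta in auto)
  have bR: "\<bar>R s\<bar> \<le> B + (s1 - s) / L * (B1 + (s1 - s) / L * \<eta>)" if "s \<le> s1" for s
  proof (rule lattice_growth[where R = R and m = "\<lambda>s. B1 + (s1 - s) / L * \<eta>" and ?s1.0 = s1, OF L _ _ _ that])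
    show "\<bar>R s\<bar> \<le> B" if "s1 - L \<le> s" "s \<le> s1" for s using B(2) that .
  next
    fix s assume "s \<le> s1" then show "\<bar>R s - R (s - L)\<bar> \<le> B1 + (s1 - s) / L * \<eta>" using bd unfolding d_def by blast
  next
    fix s t assume st: "s \<le> t" "t \<le> s1"
    have "(s1 - t) / L * \<eta> \<le> (s1 - s) / L * \<eta>" using st eta L by (intro mult_right_mono divide_right_mono) auto
    moreover have "0 \<le> (s1 - t) / L * \<eta>" using st eta L by simp
    ultimately show "0 \<le> B1 + (s1 - t) / L * \<eta> \<and> B1 + (s1 - t) / L * \<eta> \<le> B1 + (s1 - s) / L * \<eta>" using B1 by linarith
  qed
  have top: "filterlim (\<lambda>s::real. \<bar>s\<bar>) at_top at_bot" by real_asymp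
  have 1: "((\<lambda>s. B / \<bar>s\<bar> * (1 / \<bar>s\<bar>) + B1 / L / \<bar>s\<bar>) \<longlongrightarrow> 0 * 0 + 0) at_bot"
    by (intro tendsto_add tendsto_mult real_tendsto_divide_at_top[OF tendsto_const] top)
  then have "\<forall>\<^sub>F s in at_bot. B / \<bar>s\<bar> * (1 / \<bar>s\<bar>) + B1 / L / \<bar>s\<bar> < \<epsilon> / 2" by (rule order_tendstoD(2)) (use eps in simp)
  with eventually_le_at_bot[of s1] show "\<forall>\<^sub>F s in at_bot. dist (q s / s\<^sup>2) (\<kappa> / (2 * L\<^sup>2)) < \<epsilon>"
  proof eventually_elim
    case (elim s)
    have s: "s < 0" using elim s1 by simp
    define z where "z = \<bar>s\<bar>"
    have z: "z > 0" using s by (simp add: z_def)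
    have 2: "(s1 - s) / L \<le> z / L" "0 \<le> (s1 - s) / L" using s s1(1) L elim by (auto simp: z_def divide_simps)
    define w v where "w = (s1 - s) / L" and "v = z / L"
    have wv: "0 \<le> w" "w \<le> v" using 2 by (auto simp: w_def v_def)
    have "w * (B1 + w * \<eta>) \<le> v * (B1 + v * \<eta>)"
      using wv eta B1(1) by (intro mult_mono add_mono order_refl) auto
    then have "(s1 - s) / L * (B1 + (s1 - s) / L * \<eta>) \<le> z / L * (B1 + z / L * \<eta>)"
      by (simp only: w_def v_def)
    then have "\<bar>R s\<bar> \<le> B + z / L * (B1 + z / L * \<eta>)" using bR[OF elim(1)] by linarith
    then have "\<bar>R s\<bar> / z\<^sup>2 \<le> (B + z / L * (B1 + z / L * \<eta>)) / z\<^sup>2" using z by (intro divide_right_mono) auto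
    also have "\<dots> = B / z * (1 / z) + B1 / L / z + \<epsilon> / 4"
      using z L by (simp add: \<eta>_def field_simps power2_eq_square)
    finally have "\<bar>R s\<bar> / s\<^sup>2 \<le> B / \<bar>s\<bar> * (1 / \<bar>s\<bar>) + B1 / L / \<bar>s\<bar> + \<epsilon> / 4" by (simp add: z_def)
    moreover have "q s / s\<^sup>2 - \<kappa> / (2 * L\<^sup>2) = R s / s\<^sup>2" using s by (simp add: R_def a_def diff_divide_distrib)
    ultimately show ?case using elim(2) eps by (simp add: dist_real_def)
  qed
qed

lemma golden_ratio:
  fixes \<phi> :: real defines "\<phi> \<equiv> (sqrt 5 - 1) / 2"
  shows "\<phi>\<^sup>2 = 1 - \<phi>" "3/5 < \<phi>" "\<phi> < 31/50" "sqrt \<phi> < 79/100"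
proof -
  show "\<phi>\<^sup>2 = 1 - \<phi>" by (simp add: \<phi>_def power2_eq_square field_simps)
  have s: "sqrt 5 > (11/5::real)" "sqrt 5 < (56/25::real)"
    by (rule real_less_rsqrt, simp add: power2_eq_square) (rule real_less_lsqrt, auto simp: power2_eq_square)
  then show "3/5 < \<phi>" and l: "\<phi> < 31/50" by (auto simp: \<phi>_def)
  show "sqrt \<phi> < 79/100" using l by (intro real_less_lsqrt) (auto simp: power2_eq_square)
qed

text \<open>
  The first difference \<open>d u = p u - p (\<phi> u)\<close> satisfies \<open>d u = d (\<phi> u) + d (\<phi>^2 u)\<close> up to \<open>o(sqrt u)\<close>. The modes of this recursion,
  \<open>d (\<phi>^n u)\<close> proportional to \<open>\<lambda>^n\<close>, have \<open>\<lambda> = \<phi>\<close> or \<open>\<lambda> = - 1 / \<phi>\<close>. The second grows and is excluded as \<open>p\<close> is bounded; the first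
  is of size \<open>u\<close>, which is negligible against \<open>sqrt u\<close>. What remains is the error itself.
\<close>
lemma golden_decay:
  fixes p :: "real \<Rightarrow> real" and \<phi> :: real
  defines "\<phi> \<equiv> (sqrt 5 - 1) / 2"
  assumes p0: "(p \<longlongrightarrow> 0) (at_right 0)"
    and lim: "((\<lambda>w. (p (\<phi> * w) - 2 * p (\<phi>\<^sup>2 * w) + p (\<phi> ^ 4 * w)) / sqrt w) \<longlongrightarrow> 0) (at_right 0)"
  shows "((\<lambda>w. p w / sqrt w) \<longlongrightarrow> 0) (at_right 0)"
proof (rule tendstoI)
  fix \<epsilon> :: real assume eps: "\<epsilon> > 0"
  note g = golden_ratio[folded \<phi>_def]
  have ph: "0 < \<phi>" "\<phi> < 1" using g by auto
  define \<eta> where "\<eta> = \<epsilon> / 200"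
  have eta: "\<eta> > 0" using eps by (simp add: \<eta>_def)
  have "\<forall>\<^sub>F w in at_right 0. dist (p w) 0 < 1 \<and> dist ((p (\<phi> * w) - 2 * p (\<phi>\<^sup>2 * w) + p (\<phi> ^ 4 * w)) / sqrt w) 0 < \<eta>"
    using tendstoD[OF p0 zero_less_one] tendstoD[OF lim eta] by eventually_elim simp
  then obtain b where b: "b > 0" "\<And>w. 0 < w \<Longrightarrow> w < b \<Longrightarrow> \<bar>p w\<bar> < 1"
    "\<And>w. 0 < w \<Longrightarrow> w < b \<Longrightarrow> \<bar>(p (\<phi> * w) - 2 * p (\<phi>\<^sup>2 * w) + p (\<phi> ^ 4 * w)) / sqrt w\<bar> < \<eta>"
    unfolding eventually_at_right_field by auto
  define u1 where "u1 = \<phi> * b / 2"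
  have u1: "0 < u1" "u1 < \<phi> * b" "u1 < b"
  proof -
    show "0 < u1" "u1 < \<phi> * b" using b ph by (auto simp: u1_def)
    moreover have "\<phi> * b < b" using b ph by simp
    ultimately show "u1 < b" by simp
  qed
  define d where "d u = p u - p (\<phi> * u)" for u
  \<comment> \<open>this combination annihilates the mode \<open>\<lambda> = \<phi>\<close> and satisfies \<open>t u = - \<phi> * t (\<phi> u)\<close> up to the error\<close>
  define t where "t u = d u - d (\<phi> * u) / \<phi>" for u
  define e where "e = \<eta> * (5/3)"
  have shrink: "0 < \<phi> * u" "\<phi> * u \<le> u1" if "0 < u" "u \<le> u1" for u
    using that ph by (auto intro: order_trans[OF mult_left_le_one_le])
  have sq: "sqrt (\<phi> * u) = sqrt \<phi> * sqrt u" for u by (rule real_sqrt_mult)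
  have rec: "\<bar>d u - d (\<phi> * u) - d (\<phi>\<^sup>2 * u)\<bar> \<le> e * sqrt u" if u: "0 < u" "u \<le> u1" for u
  proof -
    define w where "w = u / \<phi>"
    have w: "0 < w" "w < b" "u = \<phi> * w" using u u1 ph by (auto simp: w_def divide_simps mult.commute)
    have "\<bar>p (\<phi> * w) - 2 * p (\<phi>\<^sup>2 * w) + p (\<phi> ^ 4 * w)\<bar> \<le> \<eta> * sqrt w"
      using b(3)[OF w(1,2)] w(1) by (simp add: divide_simps)
    also have "\<dots> \<le> \<eta> * (5/3 * sqrt u)"
    proof (intro mult_left_mono)
      have "sqrt u = sqrt \<phi> * sqrt w" unfolding w(3) by (rule sq)
      moreover have "3/5 \<le> sqrt \<phi>" using g by (intro real_le_rsqrt) (auto simp: power2_eq_square)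
      ultimately have "3/5 * sqrt w \<le> sqrt u" using w(1) by (simp add: mult_right_mono)
      then show "sqrt w \<le> 5/3 * sqrt u" by simp
    qed (use eta in simp)
    finally have "\<bar>p (\<phi> * w) - 2 * p (\<phi>\<^sup>2 * w) + p (\<phi> ^ 4 * w)\<bar> \<le> e * sqrt u" by (simp add: e_def)
    moreover have "d u - d (\<phi> * u) - d (\<phi>\<^sup>2 * u) = p (\<phi> * w) - 2 * p (\<phi>\<^sup>2 * w) + p (\<phi> ^ 4 * w)"
      unfolding d_def w(3) by (simp add: power2_eq_square power4_eq_xxxx mult.assoc)
    ultimately show ?thesis by simp
  qed
  have trec: "\<bar>t u\<bar> \<le> e * sqrt u + \<phi> * \<bar>t (\<phi> * u)\<bar>" if u: "0 < u" "u \<le> u1" for u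
  proof -
    have "1 / \<phi> - \<phi> = 1" using g(1) ph by (simp add: field_simps power2_eq_square)
    then have i: "1 / \<phi> = 1 + \<phi>" by simp
    have "t u + \<phi> * t (\<phi> * u) = d u - d (\<phi> * u) * (1 / \<phi>) + \<phi> * d (\<phi> * u) - d (\<phi> * (\<phi> * u))"
      using ph by (simp add: t_def algebra_simps)
    also have "\<dots> = d u - d (\<phi> * u) - d (\<phi>\<^sup>2 * u)" unfolding i by (simp add: algebra_simps power2_eq_square)
    finally have "\<bar>t u + \<phi> * t (\<phi> * u)\<bar> \<le> e * sqrt u" using rec[OF u] by simp
    moreover have "\<bar>t u\<bar> \<le> \<bar>t u + \<phi> * t (\<phi> * u)\<bar> + \<bar>\<phi> * t (\<phi> * u)\<bar>" by simp
    ultimately show ?thesis using ph by (simp add: abs_mult)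
  qed
  have dbound: "\<bar>d u\<bar> \<le> 2" if "0 < u" "u \<le> u1" for u
    using b(2)[of u] b(2)[of "\<phi> * u"] shrink[OF that] that u1 unfolding d_def by linarith
  have tbound: "\<bar>t u\<bar> \<le> 6" if u: "0 < u" "u \<le> u1" for u
  proof -
    have "\<bar>d (\<phi> * u) / \<phi>\<bar> \<le> 2 / (3/5)"
      unfolding abs_divide using dbound[OF shrink[OF u]] g by (intro frac_le) auto
    then have 4: "\<bar>d (\<phi> * u) / \<phi>\<bar> \<le> 4" by (rule order_trans) simp
    have "\<bar>t u\<bar> \<le> \<bar>d u\<bar> + \<bar>d (\<phi> * u) / \<phi>\<bar>" unfolding t_def by (rule abs_triangle_ineq4)
    also have "\<dots> \<le> 2 + 4" by (intro add_mono dbound u 4)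
    finally show ?thesis by simp
  qed
  have tn: "\<bar>t u\<bar> \<le> 2 * (e * sqrt u) + \<phi> ^ n * 6" if u: "0 < u" "u \<le> u1" for u n
    using u
  proof (induction n arbitrary: u)
    case 0
    have "0 \<le> e * sqrt u" using eta 0 by (simp add: e_def)
    then show ?case using tbound[OF 0] by simp
  next
    case (Suc n)
    have "\<bar>t u\<bar> \<le> e * sqrt u + \<phi> * (2 * (e * sqrt (\<phi> * u)) + \<phi> ^ n * 6)"
      using trec[OF Suc.prems] Suc.IH[OF shrink[OF Suc.prems]] ph by (smt (verit) mult_left_mono)
    also have "\<dots> = (1 + 2 * (\<phi> * sqrt \<phi>)) * (e * sqrt u) + \<phi> ^ Suc n * 6" by (simp add: sq algebra_simps)
    also have "\<dots> \<le> 2 * (e * sqrt u) + \<phi> ^ Suc n * 6"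
    proof -
      have "\<phi> * sqrt \<phi> \<le> 31/50 * (79/100)" using g ph by (intro mult_mono) auto
      then show ?thesis using eta Suc.prems by (intro add_right_mono mult_right_mono) (auto simp: e_def)
    qed
    finally show ?case .
  qed
  have t2: "\<bar>t u\<bar> \<le> 2 * (e * sqrt u)" if u: "0 < u" "u \<le> u1" for u
  proof -
    have "(\<lambda>n. 2 * (e * sqrt u) + \<phi> ^ n * 6) \<longlonglongrightarrow> 2 * (e * sqrt u) + 0 * 6"
      using ph by (intro tendsto_intros LIMSEQ_power_zero) auto
    then have "\<bar>t u\<bar> \<le> 2 * (e * sqrt u) + 0 * 6"
      by (rule tendsto_lowerbound) (use tn[OF u] in auto)
    then show ?thesis by simp
  qed
  \<comment> \<open>chosen such that \<open>K * x\<close> dominates the bound 2 for \<open>d\<close> on \<open>(\<phi> u1, u1]\<close>\<close>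
  define K where "K = 2 / (\<phi> * u1)"
  have K: "K > 0" using ph u1 by (simp add: K_def)
  have dn: "\<forall>x. \<phi> ^ Suc n * u1 < x \<longrightarrow> x \<le> u1 \<longrightarrow> \<bar>d x\<bar> \<le> K * x + 8 * (e * sqrt x)" for n
  proof (induction n)
    case 0
    show ?case
    proof (intro allI impI)
      fix x assume x: "\<phi> ^ Suc 0 * u1 < x" "x \<le> u1"
      have x0: "0 < x" using x ph u1 by (auto intro: less_trans[of 0 "\<phi> * u1"])
      have "2 \<le> K * x" using x ph u1 by (simp add: K_def divide_simps)
      moreover have "0 \<le> 8 * (e * sqrt x)" using eta x0 by (simp add: e_def)
      ultimately show "\<bar>d x\<bar> \<le> K * x + 8 * (e * sqrt x)" using dbound[OF x0 x(2)] by linarith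
    qed
  next
    case (Suc n)
    show ?case
    proof (intro allI impI)
      fix x assume x: "\<phi> ^ Suc (Suc n) * u1 < x" "x \<le> u1"
      have x0: "0 < x" using x ph u1 by (auto intro: less_trans[of 0 "\<phi> ^ Suc (Suc n) * u1"])
      show "\<bar>d x\<bar> \<le> K * x + 8 * (e * sqrt x)"
      proof (cases "\<phi> * u1 < x")
        case True
        have "2 \<le> K * x" using True ph u1 by (simp add: K_def divide_simps)
        moreover have "0 \<le> 8 * (e * sqrt x)" using eta x0 by (simp add: e_def)
        ultimately show ?thesis using dbound[OF x0 x(2)] by linarith
      next
        case False
        define u where "u = x / \<phi>"
        have u: "x = \<phi> * u" "0 < u" "u \<le> u1" "\<phi> ^ Suc n * u1 < u"
          using False x x0 ph by (auto simp: u_def divide_simps mult_ac)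
        have "\<bar>d u\<bar> \<le> K * u + 8 * (e * sqrt u)" using Suc.IH u by blast
        have "d x = \<phi> * (d u - t u)" using ph by (simp add: t_def u(1))
        have "\<bar>d x\<bar> \<le> \<phi> * (K * u + 8 * (e * sqrt u) + 2 * (e * sqrt u))"
        proof -
          have "\<bar>d u - t u\<bar> \<le> K * u + 8 * (e * sqrt u) + 2 * (e * sqrt u)"
            using \<open>\<bar>d u\<bar> \<le> K * u + 8 * (e * sqrt u)\<close> t2[OF u(2,3)] abs_triangle_ineq4[of "d u" "t u"] by linarith
          then have "\<phi> * \<bar>d u - t u\<bar> \<le> \<phi> * (K * u + 8 * (e * sqrt u) + 2 * (e * sqrt u))"
            using ph by (intro mult_left_mono) auto
          then show ?thesis unfolding \<open>d x = \<phi> * (d u - t u)\<close> abs_mult using ph by simp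
        qed
        also have "\<dots> = K * x + 10 * sqrt \<phi> * (e * sqrt x)"
        proof -
          have "\<phi> * sqrt u = sqrt \<phi> * sqrt x" unfolding u(1) sq using ph by simp
          then have "\<phi> * (e * sqrt u) = sqrt \<phi> * (e * sqrt x)" by (simp add: mult.left_commute)
          then show ?thesis by (simp add: u(1) algebra_simps)
        qed
        also have "\<dots> \<le> K * x + 8 * (e * sqrt x)"
          using g eta x0 by (intro add_left_mono mult_right_mono) (auto simp: e_def)
        finally show ?thesis .
      qed
    qed
  qed
  have dx: "\<bar>d x\<bar> \<le> K * x + 8 * (e * sqrt x)" if x: "0 < x" "x \<le> u1" for x
  proof -
    obtain n where "\<phi> ^ n < x / u1" using real_arch_pow_inv[of "x / u1" \<phi>] x u1 ph by auto
    then have "\<phi> ^ n * u1 < x" using u1 by (simp add: divide_simps)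
    moreover have "\<phi> ^ Suc n * u1 \<le> \<phi> ^ n * u1" using ph u1 by simp
    ultimately show ?thesis using dn[of n] x by force
  qed
  have pn: "\<bar>p x\<bar> \<le> 3 * (K * x) + 40 * (e * sqrt x) + \<bar>p (\<phi> ^ n * x)\<bar>" if x: "0 < x" "x \<le> u1" for x n
    using x
  proof (induction n arbitrary: x)
    case 0
    then show ?case using K eta by (simp add: e_def)
  next
    case (Suc n)
    have "\<bar>p x\<bar> \<le> \<bar>d x\<bar> + \<bar>p (\<phi> * x)\<bar>" unfolding d_def by simp
    also have "\<dots> \<le> K * x + 8 * (e * sqrt x) + (3 * (K * (\<phi> * x)) + 40 * (e * sqrt (\<phi> * x)) + \<bar>p (\<phi> ^ n * (\<phi> * x))\<bar>)"
      by (intro add_mono dx Suc.prems Suc.IH shrink)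
    also have "\<dots> = (1 + 3 * \<phi>) * (K * x) + (8 + 40 * sqrt \<phi>) * (e * sqrt x) + \<bar>p (\<phi> ^ Suc n * x)\<bar>"
      by (simp add: sq algebra_simps)
    also have "\<dots> \<le> 3 * (K * x) + 40 * (e * sqrt x) + \<bar>p (\<phi> ^ Suc n * x)\<bar>"
      using g K Suc.prems eta by (intro add_mono mult_right_mono order_refl) (auto simp: e_def)
    finally show ?case .
  qed
  have pf: "\<bar>p x\<bar> \<le> 3 * (K * x) + 40 * (e * sqrt x)" if x: "0 < x" "x \<le> u1" for x
  proof -
    have "(\<lambda>n. \<phi> ^ n * x) \<longlonglongrightarrow> 0 * x" using ph by (intro tendsto_intros LIMSEQ_power_zero) auto
    then have "filterlim (\<lambda>n. \<phi> ^ n * x) (at_right 0) sequentially"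
      using ph x by (intro filterlim_at_withinI) (auto simp: eventually_sequentially)
    then have "(\<lambda>n. p (\<phi> ^ n * x)) \<longlonglongrightarrow> 0" using p0 by (rule filterlim_compose[rotated])
    then have "(\<lambda>n. 3 * (K * x) + 40 * (e * sqrt x) + \<bar>p (\<phi> ^ n * x)\<bar>) \<longlonglongrightarrow> 3 * (K * x) + 40 * (e * sqrt x) + \<bar>0\<bar>"
      by (intro tendsto_intros)
    then have "\<bar>p x\<bar> \<le> 3 * (K * x) + 40 * (e * sqrt x) + \<bar>0\<bar>"
      by (rule tendsto_lowerbound) (use pn[OF x] in auto)
    then show ?thesis by simp
  qed
  have "((\<lambda>x. 3 * K * sqrt x) \<longlongrightarrow> 3 * K * sqrt 0) (at_right 0)" by (intro tendsto_intros)
  then have "\<forall>\<^sub>F x in at_right 0. 3 * K * sqrt x < \<epsilon> / 2" by (rule order_tendstoD(2)) (use eps in simp)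
  moreover have "\<forall>\<^sub>F x in at_right 0. 0 < x \<and> x < u1" using u1 unfolding eventually_at_right_field by blast
  ultimately show "\<forall>\<^sub>F x in at_right 0. dist (p x / sqrt x) 0 < \<epsilon>"
  proof eventually_elim
    case (elim x)
    have "\<bar>p x\<bar> / sqrt x \<le> (3 * (K * x) + 40 * (e * sqrt x)) / sqrt x"
      using pf[of x] elim by (intro divide_right_mono) auto
    also have "\<dots> = 3 * K * sqrt x + 40 * e"
      using elim real_sqrt_mult_self[of x] by (simp add: divide_simps) (simp add: algebra_simps)
    also have "\<dots> < \<epsilon>" using elim eps by (simp add: e_def \<eta>_def)
    finally show ?case using elim by (simp add: dist_real_def)
  qed
qed

section \<open>The equation and its derivatives near the origin\<close>

lemma at_right_eventually: "a > 0 \<Longrightarrow> \<forall>\<^sub>F x in at_right (0::real). 0 < x \<and> x < a"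
  unfolding eventually_at_right_field by blast

lemma abs_ln_one_minus: "0 \<le> t \<Longrightarrow> t \<le> 1/2 \<Longrightarrow> \<bar>ln (1 - t)\<bar> \<le> 2 * (t::real)"
proof -
  assume t: "0 \<le> t" "t \<le> 1/2"
  have "- t - 2 * t\<^sup>2 \<le> ln (1 - t)" using ln_one_minus_pos_lower_bound[of t] t by simp
  moreover have "2 * t\<^sup>2 \<le> t" using t mult_right_mono[of "2 * t" 1 t] by (simp add: power2_eq_square)
  moreover have "ln (1 - t) \<le> 0" using t by simp
  ultimately show ?thesis by linarith
qed

lemma log_slow_comparable:
  fixes k :: "real \<Rightarrow> real"
  assumes k: "log_slow k" and b: "(b \<longlongrightarrow> 0) F" "\<forall>\<^sub>F t in F. 0 < b t"
    and r: "((\<lambda>t. a t / b t) \<longlongrightarrow> c) F" "c > 0"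
  shows "((\<lambda>t. k (a t) - k (b t)) \<longlongrightarrow> 0) F"
proof -
  have pos: "\<forall>\<^sub>F t in F. 0 < a t / b t" using r by (rule order_tendstoD(1))
  have apos: "\<forall>\<^sub>F t in F. 0 < a t" using pos b(2) by eventually_elim (simp add: zero_less_divide_iff)
  have "((\<lambda>t. a t / b t * b t) \<longlongrightarrow> c * 0) F" by (intro tendsto_mult r b)
  moreover have "\<forall>\<^sub>F t in F. a t / b t * b t = a t" using b(2) by eventually_elim simp
  ultimately have a: "(a \<longlongrightarrow> 0) F" using Lim_transform_eventually by force
  have "((\<lambda>t. ln (a t / b t)) \<longlongrightarrow> ln c) F" using r by (intro tendsto_ln) auto
  then have "((\<lambda>t. \<bar>ln (a t / b t)\<bar>) \<longlongrightarrow> \<bar>ln c\<bar>) F" by (rule tendsto_rabs)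
  then have "\<forall>\<^sub>F t in F. \<bar>ln (a t / b t)\<bar> < \<bar>ln c\<bar> + 1" by (rule order_tendstoD(2)) simp
  with apos b(2) have "\<forall>\<^sub>F t in F. \<bar>ln (a t) - ln (b t)\<bar> \<le> (\<bar>ln c\<bar> + 1) * 1"
    by eventually_elim (simp add: ln_div)
  from log_slow_diff[OF k a apos b this] show ?thesis by simp
qed

lemma theta_chain:
  fixes g f \<phi> :: "real \<Rightarrow> real"
  assumes "(g has_real_derivative f (\<phi> t) / \<phi> t) (at (\<phi> t))" "(\<phi> has_real_derivative \<phi> t * d) (at t)" "\<phi> t \<noteq> 0"
  shows "((\<lambda>s. g (\<phi> s)) has_real_derivative f (\<phi> t) * d) (at t)"
  by (rule DERIV_cong[OF DERIV_chain2[OF assms(1,2)]]) (use assms in simp)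

lemma ratio_bounds:
  fixes x y r :: real
  assumes "0 < x" "x < y" "y < 1" and r: "r = (1 - y) / (1 - x)"
  shows "0 < r" "r < 1" "0 < x / y" "x / y < 1" "0 < x * y" "x * y < 1" "0 < x * r" "0 < r / y"
    "0 < x * r / y" "x * r / y < 1" "0 < x * r\<^sup>2 / y" "x * r\<^sup>2 / y < 1"
proof -
  have y0: "0 < y" using assms by simp
  show r0: "0 < r" "r < 1" using assms by (auto simp: r)
  show "0 < x / y" "x / y < 1" "0 < x * y" "0 < x * r" "0 < r / y" "0 < x * r / y" "0 < x * r\<^sup>2 / y"
    using assms r0 y0 by auto
  show "x * y < 1" using mult_strict_mono[of x 1 y 1] assms by simp
  have "x * r < y * 1" using r0 assms(1,2) y0 by (intro mult_strict_mono) auto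
  then show l5: "x * r / y < 1" using y0 by simp
  then have "x * r / y * r < 1 * 1" using r0 assms(1) y0 by (intro mult_strict_mono) auto
  then show "x * r\<^sup>2 / y < 1" by (simp add: power2_eq_square mult.assoc)
qed

text \<open>
  The coefficients are arbitrary because the same computation serves the equation and the two sums, \<open>A\<close> and \<open>S\<close> below, in
  which its derivative is organised.
\<close>
lemma combination_DERIV:
  fixes g f R :: "real \<Rightarrow> real"
  assumes g: "\<And>t. t < 1 \<Longrightarrow> t \<noteq> 0 \<Longrightarrow> (g has_real_derivative f t / t) (at t)"
    and xy: "0 < x" "x < y" "y < 1" and R: "R = (\<lambda>x. (1 - y) / (1 - x))"
  shows "((\<lambda>x. c1 * g x + c2 * g y + c3 * g (x / y) + c4 * g (R x) + c5 * g (x * R x / y) + c6 * g (x * y)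
      + c7 * g (- (x * R x)) + c8 * g (- (R x / y)) + c9 * g (x * (R x)\<^sup>2 / y)) has_real_derivative
     (c1 * f x + c3 * f (x / y) + c5 * f (x * R x / y) + c6 * f (x * y) + c7 * f (- (x * R x)) + c9 * f (x * (R x)\<^sup>2 / y)) / x
     + (c4 * f (R x) + c5 * f (x * R x / y) + c7 * f (- (x * R x)) + c8 * f (- (R x / y)) + 2 * c9 * f (x * (R x)\<^sup>2 / y)) / (1 - x))
     (at x)"
proof -
  define r where "r = R x"
  have Rr: "R x = r" by (simp add: r_def)
  have x1: "x < 1" "y > 0" using xy by auto
  have rr: "r = (1 - y) / (1 - x)" by (simp add: r_def R)
  note l = ratio_bounds[OF xy rr]
  have dR: "(R has_real_derivative r / (1 - x)) (at x)"
    unfolding R rr using x1 by (auto intro!: derivative_eq_intros simp: divide_simps)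
  have dx: "((\<lambda>x. x) has_real_derivative 1) (at x)" by auto
  have "((\<lambda>x. c1 * g x + c2 * g y + c3 * g (x / y) + c4 * g (R x) + c5 * g (x * R x / y) + c6 * g (x * y)
      + c7 * g (- (x * R x)) + c8 * g (- (R x / y)) + c9 * g (x * (R x)\<^sup>2 / y)) has_real_derivative
      c1 * (f x * (1 / x)) + 0 + c3 * (f (x / y) * (1 / x)) + c4 * (f (R x) * (1 / (1 - x)))
      + c5 * (f (x * R x / y) * (1 / x + 1 / (1 - x))) + c6 * (f (x * y) * (1 / x))
      + c7 * (f (- (x * R x)) * (1 / x + 1 / (1 - x))) + c8 * (f (- (R x / y)) * (1 / (1 - x)))
      + c9 * (f (x * (R x)\<^sup>2 / y) * (1 / x + 2 / (1 - x)))) (at x)"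
  proof (intro DERIV_add DERIV_cmult theta_chain[where g = g and f = f] DERIV_const g)
    show "((\<lambda>x. x) has_real_derivative x * (1 / x)) (at x)" using xy by simp
    show "((\<lambda>x. x / y) has_real_derivative x / y * (1 / x)) (at x)" using xy by (auto intro!: derivative_eq_intros)
    show "(R has_real_derivative R x * (1 / (1 - x))) (at x)" using dR by (simp add: Rr)
    have 1: "((\<lambda>x. x * R x) has_real_derivative x * r * (1 / x + 1 / (1 - x))) (at x)"
      by (rule DERIV_cong[OF DERIV_mult[OF dx dR]]) (use xy x1 in \<open>simp add: Rr algebra_simps\<close>)
    show "((\<lambda>x. x * R x / y) has_real_derivative x * R x / y * (1 / x + 1 / (1 - x))) (at x)"
      by (rule DERIV_cong[OF DERIV_cdivide[OF 1]]) (simp add: Rr)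
    show "((\<lambda>x. x * y) has_real_derivative x * y * (1 / x)) (at x)" using xy by (auto intro!: derivative_eq_intros)
    show "((\<lambda>x. - (x * R x)) has_real_derivative - (x * R x) * (1 / x + 1 / (1 - x))) (at x)"
      by (rule DERIV_cong[OF DERIV_minus[OF 1]]) (simp add: Rr)
    show "((\<lambda>x. - (R x / y)) has_real_derivative - (R x / y) * (1 / (1 - x))) (at x)"
      by (rule DERIV_cong[OF DERIV_minus[OF DERIV_cdivide[OF dR]]]) (simp add: Rr)
    have 2: "((\<lambda>x. (R x)\<^sup>2) has_real_derivative 2 * r\<^sup>2 / (1 - x)) (at x)"
      by (rule DERIV_cong[OF DERIV_power[OF dR, of 2]]) (simp add: Rr power2_eq_square)
    show "((\<lambda>x. x * (R x)\<^sup>2 / y) has_real_derivative x * (R x)\<^sup>2 / y * (1 / x + 2 / (1 - x))) (at x)"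
      by (rule DERIV_cong[OF DERIV_cdivide[OF DERIV_mult[OF dx 2]]]) (use xy x1 in \<open>simp add: Rr divide_simps, simp add: algebra_simps\<close>)
    show "- (x * R x) < 1" "- (R x / y) < 1" using l(7,8) unfolding Rr by linarith+
    show "x < 1" "x \<noteq> 0" "x / y < 1" "x / y \<noteq> 0" "R x < 1" "R x \<noteq> 0" "x * R x / y < 1" "x * R x / y \<noteq> 0"
      "x * y < 1" "x * y \<noteq> 0" "- (x * R x) \<noteq> 0" "- (R x / y) \<noteq> 0" "x * (R x)\<^sup>2 / y < 1" "x * (R x)\<^sup>2 / y \<noteq> 0"
      unfolding Rr using xy x1 l by (simp_all del: divide_less_eq_1_pos)
    then show "x \<noteq> 0" "x / y \<noteq> 0" "R x \<noteq> 0" "x * R x / y \<noteq> 0" "x * y \<noteq> 0" "- (x * R x) \<noteq> 0" "- (R x / y) \<noteq> 0"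
      "x * (R x)\<^sup>2 / y \<noteq> 0" by auto
  qed
  then show ?thesis
    by (rule DERIV_cong) (simp add: add_divide_distrib algebra_simps)
qed

lemma combination_tendsto:
  fixes g R :: "real \<Rightarrow> real"
  assumes g: "\<And>t. t < 1 \<Longrightarrow> isCont g t" and y: "0 < y" "y < 1" and R: "R = (\<lambda>x. (1 - y) / (1 - x))"
  shows "((\<lambda>x. c1 * g x + c2 * g y + c3 * g (x / y) + c4 * g (R x) + c5 * g (x * R x / y) + c6 * g (x * y)
      + c7 * g (- (x * R x)) + c8 * g (- (R x / y)) + c9 * g (x * (R x)\<^sup>2 / y)) \<longlongrightarrow>
     c1 * g 0 + c2 * g y + c3 * g 0 + c4 * g (1 - y) + c5 * g 0 + c6 * g 0 + c7 * g 0 + c8 * g (- ((1 - y) / y)) + c9 * g 0)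
     (at_right 0)"
proof -
  have r: "(R \<longlongrightarrow> 1 - y) (at_right 0)" unfolding R by (auto intro!: tendsto_eq_intros)
  have x: "((\<lambda>x. x) \<longlongrightarrow> 0) (at_right (0::real))" by (rule tendsto_ident_at)
  have U: "((\<lambda>x. x / y) \<longlongrightarrow> 0) (at_right 0)" "((\<lambda>x. x * y) \<longlongrightarrow> 0) (at_right 0)"
    "((\<lambda>x. x * R x / y) \<longlongrightarrow> 0) (at_right 0)" "((\<lambda>x. - (x * R x)) \<longlongrightarrow> 0) (at_right 0)"
    "((\<lambda>x. x * (R x)\<^sup>2 / y) \<longlongrightarrow> 0) (at_right 0)" "((\<lambda>x. - (R x / y)) \<longlongrightarrow> - ((1 - y) / y)) (at_right 0)"
    using y by (auto intro!: tendsto_eq_intros r)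
  have "0 < (1 - y) / y" using y by simp
  then have neg: "- ((1 - y) / y) < 1" by linarith
  show ?thesis
    by (intro tendsto_intros isCont_tendsto_compose[OF g] x U r neg) (use y in auto)
qed

context kummer_solution
begin

lemma g_tendsto: "(a \<longlongrightarrow> l) F \<Longrightarrow> l < 1 \<Longrightarrow> ((\<lambda>x. g (a x)) \<longlongrightarrow> g l) F"
  by (rule isCont_tendsto_compose[OF isCont_g])

lemma f_tendsto: "(a \<longlongrightarrow> l) F \<Longrightarrow> 0 < l \<Longrightarrow> l < e0 \<Longrightarrow> ((\<lambda>x. f (a x)) \<longlongrightarrow> f l) F"
  by (rule isCont_tendsto_compose[OF DERIV_isCont[OF f_DERIV]])

text \<open>
  The limit \<open>x \<rightarrow> 0\<close> of the equation.
\<close>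
lemma reflection:
  assumes y: "0 < y" "y < e0"
  shows "2 * g y + 2 * g (1 - y) + 2 * g (- ((1 - y) / y)) + 3 * g 0 = 0"
proof -
  define R where "R = (\<lambda>x. (1 - y) / (1 - x))"
  have y1: "y < 1" using y e0_less by simp
  note lim = combination_tendsto[OF isCont_g y(1) y1 R_def, of 2 2 "-1" 2 2 "-1" 2 2 "-1"]
  moreover have "\<forall>\<^sub>F x in at_right 0. 2 * g x + 2 * g y + (- 1) * g (x / y) + 2 * g (R x) + 2 * g (x * R x / y) + (- 1) * g (x * y)
      + 2 * g (- (x * R x)) + 2 * g (- (R x / y)) + (- 1) * g (x * (R x)\<^sup>2 / y) = 0"
    using at_right_eventually[OF y(1)]
  proof eventually_elim
    case (elim x)
    then show ?case using equation_ratio[of x y "R x"] y by (simp add: R_def)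
  qed
  ultimately have "((\<lambda>x. 0) \<longlongrightarrow> 2 * g 0 + 2 * g y + (- 1) * g 0 + 2 * g (1 - y) + 2 * g 0 + (- 1) * g 0 + 2 * g 0
      + 2 * g (- ((1 - y) / y)) + (- 1) * g 0) (at_right (0::real))"
    by (rule Lim_transform_eventually)
  then show ?thesis by (auto simp: tendsto_const_iff)
qed

lemma g_chain:
  assumes "(\<phi> has_real_derivative \<phi> t * d) (at t)" "\<phi> t < 1" "\<phi> t \<noteq> 0"
  shows "((\<lambda>s. g (\<phi> s)) has_real_derivative f (\<phi> t) * d) (at t)"
  by (rule DERIV_cong[OF DERIV_chain2[OF g_DERIV[OF assms(2,3)] assms(1)]]) (use assms in simp)

lemma reflection_deriv:
  assumes y: "0 < y" "y < e0"
  shows "(1 - y) * f y - y * f (1 - y) - f (- ((1 - y) / y)) = 0"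
proof -
  have y1: "y < 1" using y e0_less by simp
  have d1: "((\<lambda>y. y) has_real_derivative y * (1 / y)) (at y)" using y by simp
  have d2: "((\<lambda>y. 1 - y) has_real_derivative (1 - y) * (- 1 / (1 - y))) (at y)"
    using y1 by (auto intro!: derivative_eq_intros)
  have d3: "((\<lambda>y. - ((1 - y) / y)) has_real_derivative - ((1 - y) / y) * (- 1 / (y * (1 - y)))) (at y)"
    using y y1 by (auto intro!: derivative_eq_intros simp: divide_simps)
  have "(1 - y) / y > 0" using y y1 by simp
  then have neg: "(1 - y) / y > 0" "- 1 < (1 - y) / y" by linarith+
  have "((\<lambda>y. 2 * g y + 2 * g (1 - y) + 2 * g (- ((1 - y) / y)) + 3 * g 0) has_real_derivative
      2 * (f y * (1 / y)) + 2 * (f (1 - y) * (- 1 / (1 - y))) + 2 * (f (- ((1 - y) / y)) * (- 1 / (y * (1 - y)))) + 0) (at y)"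
    by (intro DERIV_add DERIV_cmult g_chain d1 d2 d3 DERIV_const) (use y y1 neg in auto)
  then have "((\<lambda>y. 0) has_real_derivative
      2 * (f y * (1 / y)) + 2 * (f (1 - y) * (- 1 / (1 - y))) + 2 * (f (- ((1 - y) / y)) * (- 1 / (y * (1 - y)))) + 0) (at y)"
    by (rule has_field_derivative_transform_within_open[of _ _ _ "{0<..<e0}"]) (use y reflection in auto)
  then have "2 * (f y * (1 / y)) + 2 * (f (1 - y) * (- 1 / (1 - y))) + 2 * (f (- ((1 - y) / y)) * (- 1 / (y * (1 - y)))) + 0 = 0"
    using DERIV_unique[OF _ DERIV_const] by blast
  then have "f y / y - f (1 - y) / (1 - y) - f (- ((1 - y) / y)) / (y * (1 - y)) = 0" by simp
  then have "y * (1 - y) * (f y / y - f (1 - y) / (1 - y) - f (- ((1 - y) / y)) / (y * (1 - y))) = 0" by simp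
  moreover have "y * (1 - y) * (f y / y - f (1 - y) / (1 - y) - f (- ((1 - y) / y)) / (y * (1 - y))) =
     (1 - y) * f y - y * f (1 - y) - f (- ((1 - y) / y))"
  proof -
    have "y * (1 - y) * (a / y) = (1 - y) * a" "y * (1 - y) * (a / (1 - y)) = y * a" "y * (1 - y) * (a / (y * (1 - y))) = a" for a
      using y y1 by simp_all
    then show ?thesis by (simp only: right_diff_distrib)
  qed
  ultimately show ?thesis by simp
qed

text \<open>
  The partial derivatives of the equation in \<open>x\<close> and in \<open>y\<close>. The coefficients in \<open>A\<close>, \<open>B\<close>, \<open>S\<close> are those of the equation times
  the exponent of \<open>x\<close>, of \<open>y\<close> and of \<open>r\<close> in the respective argument.
\<close>
lemma derivative_equations:
  assumes xy: "0 < x" "x < y" "y < e0" and r: "r = (1 - y) / (1 - x)"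
  defines "A \<equiv> 2 * f x - f (x / y) + 2 * f (x * r / y) - f (x * y) + 2 * f (- (x * r)) - f (x * r\<^sup>2 / y)"
    and "B \<equiv> 2 * f y + f (x / y) - 2 * f (x * r / y) - f (x * y) - 2 * f (- (r / y)) + f (x * r\<^sup>2 / y)"
    and "S \<equiv> 2 * (f r + f (x * r / y) + f (- (x * r)) + f (- (r / y)) - f (x * r\<^sup>2 / y))"
  shows "A / x + S / (1 - x) = 0" "B / y - S / (1 - y) = 0"
proof -
  have x1: "x < 1" "y < 1" "y > 0" using xy e0_less by auto
  note l = ratio_bounds[OF xy(1,2) x1(2) r]
  define R where "R x y = (1 - y) / (1 - x)" for x y :: real
  have Rr: "R x y = r" by (simp add: R_def r)
  have dRy: "(R x has_real_derivative - r / (1 - y)) (at y)"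
    unfolding R_def[abs_def] r using x1 by (auto intro!: derivative_eq_intros simp: divide_simps)
  have dy: "((\<lambda>y. y) has_real_derivative 1) (at y)" by auto
  have Rl: "(\<lambda>x. R x y) = (\<lambda>x. (1 - y) / (1 - x))" by (simp add: R_def)
  have "((\<lambda>x. 0) has_real_derivative
     (2 * f x + (- 1) * f (x / y) + 2 * f (x * R x y / y) + (- 1) * f (x * y) + 2 * f (- (x * R x y)) + (- 1) * f (x * (R x y)\<^sup>2 / y)) / x
     + (2 * f (R x y) + 2 * f (x * R x y / y) + 2 * f (- (x * R x y)) + 2 * f (- (R x y / y)) + 2 * (- 1) * f (x * (R x y)\<^sup>2 / y)) / (1 - x)) (at x)"
  proof (rule has_field_derivative_transform_within_open[OF combination_DERIV[OF g_DERIV xy(1,2) x1(2) Rl, of 2 2 "-1" 2 2 "-1" 2 2 "-1"], of "{0<..<y}"])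
    fix x' assume "x' \<in> {0<..<y}"
    then show "2 * g x' + 2 * g y + (- 1) * g (x' / y) + 2 * g (R x' y) + 2 * g (x' * R x' y / y) + (- 1) * g (x' * y)
      + 2 * g (- (x' * R x' y)) + 2 * g (- (R x' y / y)) + (- 1) * g (x' * (R x' y)\<^sup>2 / y) = 0"
      using equation_ratio[of x' y "R x' y"] xy by (simp add: R_def)
  qed (use xy in auto)
  from DERIV_unique[OF this DERIV_const] show "A / x + S / (1 - x) = 0"
    unfolding Rr A_def S_def by (simp add: algebra_simps)
  have "((\<lambda>y. 2 * g x + 2 * g y - g (x / y) + 2 * g (R x y) + 2 * g (x * R x y / y) - g (x * y)
      + 2 * g (- (x * R x y)) + 2 * g (- (R x y / y)) - g (x * (R x y)\<^sup>2 / y)) has_real_derivative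
      0 + 2 * (f y * (1 / y)) - f (x / y) * (- 1 / y) + 2 * (f (R x y) * (- 1 / (1 - y))) + 2 * (f (x * R x y / y) * (- 1 / (1 - y) - 1 / y))
      - f (x * y) * (1 / y) + 2 * (f (- (x * R x y)) * (- 1 / (1 - y))) + 2 * (f (- (R x y / y)) * (- 1 / (1 - y) - 1 / y))
      - f (x * (R x y)\<^sup>2 / y) * (- 2 / (1 - y) - 1 / y)) (at y)"
  proof (intro DERIV_add DERIV_diff DERIV_cmult g_chain DERIV_const)
    have y0: "y \<noteq> 0" "1 - y \<noteq> 0" using x1 by auto
    show "((\<lambda>y. y) has_real_derivative y * (1 / y)) (at y)" using y0 by simp
    show "((\<lambda>y. x / y) has_real_derivative x / y * (- 1 / y)) (at y)" using y0 by (auto intro!: derivative_eq_intros)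
    show "(R x has_real_derivative R x y * (- 1 / (1 - y))) (at y)" using dRy by (simp add: Rr)
    have 1: "((\<lambda>y. x * R x y) has_real_derivative x * r * (- 1 / (1 - y))) (at y)"
      by (rule DERIV_cong[OF DERIV_cmult[OF dRy]]) (simp add: Rr)
    show "((\<lambda>y. x * R x y / y) has_real_derivative x * R x y / y * (- 1 / (1 - y) - 1 / y)) (at y)"
      by (rule DERIV_cong[OF DERIV_divide[OF 1 dy y0(1)]]) (use y0 in \<open>simp add: Rr field_simps\<close>)
    show "((\<lambda>y. x * y) has_real_derivative x * y * (1 / y)) (at y)" using y0 by (auto intro!: derivative_eq_intros)
    show "((\<lambda>y. - (x * R x y)) has_real_derivative - (x * R x y) * (- 1 / (1 - y))) (at y)"
      by (rule DERIV_cong[OF DERIV_minus[OF 1]]) (simp add: Rr)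
    show "((\<lambda>y. - (R x y / y)) has_real_derivative - (R x y / y) * (- 1 / (1 - y) - 1 / y)) (at y)"
      by (rule DERIV_cong[OF DERIV_minus[OF DERIV_divide[OF dRy dy y0(1)]]]) (use y0 in \<open>simp add: Rr field_simps\<close>)
    have 2: "((\<lambda>y. (R x y)\<^sup>2) has_real_derivative r\<^sup>2 * (- 2 / (1 - y))) (at y)"
      by (rule DERIV_cong[OF DERIV_power[OF dRy, of 2]]) (simp add: Rr power2_eq_square)
    have 3: "((\<lambda>y. x * (R x y)\<^sup>2) has_real_derivative x * r\<^sup>2 * (- 2 / (1 - y))) (at y)"
      by (rule DERIV_cong[OF DERIV_cmult[OF 2]]) simp
    show "((\<lambda>y. x * (R x y)\<^sup>2 / y) has_real_derivative x * (R x y)\<^sup>2 / y * (- 2 / (1 - y) - 1 / y)) (at y)"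
      by (rule DERIV_cong[OF DERIV_divide[OF 3 dy y0(1)]]) (use y0 in \<open>simp add: Rr field_simps\<close>)
    show "- (x * R x y) < 1" "- (R x y / y) < 1" using l(7,8) unfolding Rr by linarith+
  qed (use xy x1 l Rr in auto)
  then have "((\<lambda>y. 0) has_real_derivative
      0 + 2 * (f y * (1 / y)) - f (x / y) * (- 1 / y) + 2 * (f (R x y) * (- 1 / (1 - y))) + 2 * (f (x * R x y / y) * (- 1 / (1 - y) - 1 / y))
      - f (x * y) * (1 / y) + 2 * (f (- (x * R x y)) * (- 1 / (1 - y))) + 2 * (f (- (R x y / y)) * (- 1 / (1 - y) - 1 / y))
      - f (x * (R x y)\<^sup>2 / y) * (- 2 / (1 - y) - 1 / y)) (at y)"
  proof (rule has_field_derivative_transform_within_open[of _ _ _ "{x<..<e0}"])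
    fix y' assume "y' \<in> {x<..<e0}"
    then show "2 * g x + 2 * g y' - g (x / y') + 2 * g (R x y') + 2 * g (x * R x y' / y') - g (x * y')
      + 2 * g (- (x * R x y')) + 2 * g (- (R x y' / y')) - g (x * (R x y')\<^sup>2 / y') = 0"
      using equation_ratio[of x y' "R x y'"] xy by (simp add: R_def)
  qed (use xy in auto)
  then have DY: "0 + 2 * (f y * (1 / y)) - f (x / y) * (- 1 / y) + 2 * (f (R x y) * (- 1 / (1 - y))) + 2 * (f (x * R x y / y) * (- 1 / (1 - y) - 1 / y))
      - f (x * y) * (1 / y) + 2 * (f (- (x * R x y)) * (- 1 / (1 - y))) + 2 * (f (- (R x y / y)) * (- 1 / (1 - y) - 1 / y))
      - f (x * (R x y)\<^sup>2 / y) * (- 2 / (1 - y) - 1 / y) = 0"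
    using DERIV_unique[OF _ DERIV_const] by blast
  show "B / y - S / (1 - y) = 0"
    using DY unfolding Rr B_def S_def by (simp add: add_divide_distrib diff_divide_distrib algebra_simps)
qed

lemma f_small: "(a \<longlongrightarrow> 0) F \<Longrightarrow> \<forall>\<^sub>F x in F. 0 < a x \<Longrightarrow> ((\<lambda>x. f (a x)) \<longlongrightarrow> 0) F"
  by (rule filterlim_compose[OF f_tendsto_0]) (auto intro!: filterlim_atI simp: filterlim_at elim: eventually_mono)

text \<open>
  Differentiate \<open>equation_curve\<close>; all other terms tend to 0 by \<open>f_tendsto_0\<close>.
\<close>
lemma f_neg_tendsto_0: "((\<lambda>t. f (- t)) \<longlongrightarrow> 0) (at_right 0)"
proof -
  have eq: "f (- t) = - (2 * f (2 * t / (1 + t)) * (1 / (1 + t))) - 2 * f ((1 + t) / 2) * (t / (1 + t))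
      + f (4 * t / (1 + t)\<^sup>2) * ((1 - t) / (1 + t)) / 2 + f t" if t: "0 < t" "t < 1/5" for t
  proof -
    have c9: "4 * t / (1 + t)\<^sup>2 < 1"
    proof -
      have "(1 + t)\<^sup>2 - 4 * t = (1 - t)\<^sup>2" by (simp add: power2_eq_square algebra_simps)
      moreover have "(1 - t)\<^sup>2 > 0" using t by simp
      ultimately have "4 * t < (1 + t)\<^sup>2" by linarith
      then show ?thesis using t by simp
    qed
    have "((\<lambda>t. 4 * g (2 * t / (1 + t)) + 4 * g ((1 + t) / 2) - g (4 * t / (1 + t)\<^sup>2) - 2 * g t + 2 * g (- t) + 2 * g (- 1))
       has_real_derivative 4 * (f (2 * t / (1 + t)) * (1 / (t * (1 + t)))) + 4 * (f ((1 + t) / 2) * (1 / (1 + t)))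
        - f (4 * t / (1 + t)\<^sup>2) * ((1 - t) / (t * (1 + t))) - 2 * (f t * (1 / t)) + 2 * (f (- t) * (1 / t)) + 0) (at t)"
    proof (intro DERIV_add DERIV_diff DERIV_cmult g_chain DERIV_const)
      show "((\<lambda>t. 2 * t / (1 + t)) has_real_derivative 2 * t / (1 + t) * (1 / (t * (1 + t)))) (at t)"
        using t by (auto intro!: derivative_eq_intros simp: divide_simps) 
      show "((\<lambda>t. (1 + t) / 2) has_real_derivative (1 + t) / 2 * (1 / (1 + t))) (at t)"
        using t by (auto intro!: derivative_eq_intros)
      have "((\<lambda>t. 4 * t / (1 + t)\<^sup>2) has_real_derivative (4 * (1 + t)\<^sup>2 - 4 * t * (2 * (1 + t))) / ((1 + t)\<^sup>2 * (1 + t)\<^sup>2)) (at t)"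
        using t by (auto intro!: derivative_eq_intros)
      moreover have "(4 * (1 + t)\<^sup>2 - 4 * t * (2 * (1 + t))) / ((1 + t)\<^sup>2 * (1 + t)\<^sup>2) = 4 * t / (1 + t)\<^sup>2 * ((1 - t) / (t * (1 + t)))"
      proof -
        have "4 * (1 + t)\<^sup>2 - 4 * t * (2 * (1 + t)) = (1 + t) * (4 * (1 - t))" by (simp add: power2_eq_square algebra_simps)
        then show ?thesis using t by (simp add: divide_simps power2_eq_square)
      qed
      ultimately show "((\<lambda>t. 4 * t / (1 + t)\<^sup>2) has_real_derivative 4 * t / (1 + t)\<^sup>2 * ((1 - t) / (t * (1 + t)))) (at t)" by simp
    qed (use t c9 in \<open>auto simp: divide_simps intro!: derivative_eq_intros\<close>)
    then have "((\<lambda>t. 0) has_real_derivative 4 * (f (2 * t / (1 + t)) * (1 / (t * (1 + t)))) + 4 * (f ((1 + t) / 2) * (1 / (1 + t)))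
        - f (4 * t / (1 + t)\<^sup>2) * ((1 - t) / (t * (1 + t))) - 2 * (f t * (1 / t)) + 2 * (f (- t) * (1 / t)) + 0) (at t)"
      by (rule has_field_derivative_transform_within_open[of _ _ _ "{0<..<1/5}"]) (use t equation_curve in auto)
    then have z: "4 * (f (2 * t / (1 + t)) * (1 / (t * (1 + t)))) + 4 * (f ((1 + t) / 2) * (1 / (1 + t)))
        - f (4 * t / (1 + t)\<^sup>2) * ((1 - t) / (t * (1 + t))) - 2 * (f t * (1 / t)) + 2 * (f (- t) * (1 / t)) + 0 = 0"
      using DERIV_unique[OF _ DERIV_const] by blast
    define a b c where "a = f (2 * t / (1 + t))" and "b = f ((1 + t) / 2)" and "c = f (4 * t / (1 + t)\<^sup>2)"
    have "t / 2 * (4 * (a * (1 / (t * (1 + t)))) + 4 * (b * (1 / (1 + t)))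
        - c * ((1 - t) / (t * (1 + t))) - 2 * (f t * (1 / t)) + 2 * (f (- t) * (1 / t)) + 0) = 0"
      unfolding a_def b_def c_def z by simp
    moreover have "t / 2 * (4 * (a * (1 / (t * (1 + t)))) + 4 * (b * (1 / (1 + t)))
        - c * ((1 - t) / (t * (1 + t))) - 2 * (f t * (1 / t)) + 2 * (f (- t) * (1 / t)) + 0)
       = 2 * a * (1 / (1 + t)) + 2 * b * (t / (1 + t)) - c * ((1 - t) / (1 + t)) / 2 - f t + f (- t)"
    proof -
      define i u w where "i = 1 / t" and "u = 1 / (1 + t)" and "w = (1 - t) / (1 + t)"
      have i: "t * i = 1" using t by (simp add: i_def)
      have e: "1 / (t * (1 + t)) = i * u" "(1 - t) / (t * (1 + t)) = i * w" "t / (1 + t) = t * u" by (simp_all add: i_def u_def w_def)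
      have "t / 2 * (4 * (a * (i * u)) + 4 * (b * u) - c * (i * w) - 2 * (f t * i) + 2 * (f (- t) * i) + 0)
          = (t * i) * (2 * a * u - c * w / 2 - f t + f (- t)) + 2 * b * (t * u)" by (simp add: algebra_simps)
      then show ?thesis unfolding e i unfolding i_def[symmetric] u_def[symmetric] w_def[symmetric] by simp
    qed
    ultimately show ?thesis unfolding a_def b_def c_def by linarith
  qed
  have ev: "\<forall>\<^sub>F t in at_right (0::real). 0 < t \<and> t < 1/5" by (rule at_right_eventually) simp
  have half: "(0::real) < 1/2" "1/2 < e0" using e0_bounds by auto
  have "((\<lambda>t. - (2 * f (2 * t / (1 + t)) * (1 / (1 + t))) - 2 * f ((1 + t) / 2) * (t / (1 + t))
      + f (4 * t / (1 + t)\<^sup>2) * ((1 - t) / (1 + t)) / 2 + f t) \<longlongrightarrow> - (2 * 0 * 1) - 2 * f (1/2) * 0 + 0 * 1 / 2 + 0) (at_right 0)"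
  proof (intro tendsto_intros)
    show "((\<lambda>t. f (2 * t / (1 + t))) \<longlongrightarrow> 0) (at_right 0)"
      by (rule f_small) (use ev in \<open>auto intro!: tendsto_eq_intros elim: eventually_mono\<close>)
    show "((\<lambda>t. f ((1 + t) / 2)) \<longlongrightarrow> f (1/2)) (at_right 0)"
      by (rule f_tendsto) (use half in \<open>auto intro!: tendsto_eq_intros\<close>)
    show "((\<lambda>t. f (4 * t / (1 + t)\<^sup>2)) \<longlongrightarrow> 0) (at_right 0)"
      by (rule f_small) (use ev in \<open>auto intro!: tendsto_eq_intros elim: eventually_mono\<close>)
    show "((\<lambda>t::real. 1 / (1 + t)) \<longlongrightarrow> 1) (at_right 0)" "((\<lambda>t::real. t / (1 + t)) \<longlongrightarrow> 0) (at_right 0)"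
      "((\<lambda>t::real. (1 - t) / (1 + t)) \<longlongrightarrow> 1) (at_right 0)" by (auto intro!: tendsto_eq_intros)
    show "(f \<longlongrightarrow> 0) (at_right 0)" by (rule f_tendsto_0)
  qed auto
  then have "((\<lambda>t. - (2 * f (2 * t / (1 + t)) * (1 / (1 + t))) - 2 * f ((1 + t) / 2) * (t / (1 + t))
      + f (4 * t / (1 + t)\<^sup>2) * ((1 - t) / (1 + t)) / 2 + f t) \<longlongrightarrow> 0) (at_right 0)" by simp
  then show ?thesis
    by (rule Lim_transform_eventually) (use ev in \<open>eventually_elim\<close>, use eq in auto)
qed

lemma f_small_neg: "(a \<longlongrightarrow> 0) F \<Longrightarrow> \<forall>\<^sub>F x in F. 0 < a x \<Longrightarrow> ((\<lambda>x. f (- a x)) \<longlongrightarrow> 0) F"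
  by (rule filterlim_compose[OF f_neg_tendsto_0]) (auto intro!: filterlim_atI simp: filterlim_at elim: eventually_mono)

text \<open>
  Choose \<open>x\<close> and \<open>y\<close> of order \<open>1 / k\<close> such that the eighth argument is exactly \<open>- k\<close>, and eliminate \<open>S\<close> between the two
  derivative equations. The other arguments tend to 0, or to 1/2, and the contributions of the latter cancel.
\<close>
lemma f_tendsto_0_at_infinity: "((\<lambda>k. f (- k)) \<longlongrightarrow> 0) at_top"
proof -
  define x where "x k = 1 / (2 * k)" for k :: real
  define y where "y k = 1 / (k + 1/2)" for k :: real
  define r where "r k = k / (k + 1/2)" for k :: real
  have ev: "\<forall>\<^sub>F k in at_top. k > (2::real)" by (rule eventually_gt_at_top)
  have eq: "f (- k) = (2 * f (y k) + f (x k / y k) - 2 * f (x k * r k / y k) - f (x k * y k) + f (x k * (r k)\<^sup>2 / y k)) / 2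
      + (2 * f (x k) - f (x k / y k) + 2 * f (x k * r k / y k) - f (x k * y k) + 2 * f (- (x k * r k)) - f (x k * (r k)\<^sup>2 / y k))"
    if k: "k > 2" for k
  proof -
    have xy: "0 < x k" "x k < y k" "y k < e0"
    proof -
      show "0 < x k" "x k < y k" using k by (auto simp: x_def y_def divide_simps)
      have "y k < 2/5" using k by (simp add: y_def divide_simps)
      then show "y k < e0" using e0_bounds by simp
    qed
    have r: "r k = (1 - y k) / (1 - x k)" using k by (simp add: r_def y_def x_def divide_simps)
    have ry: "r k / y k = k" using k by (simp add: r_def y_def)
    define A B S where "A = 2 * f (x k) - f (x k / y k) + 2 * f (x k * r k / y k) - f (x k * y k) + 2 * f (- (x k * r k)) - f (x k * (r k)\<^sup>2 / y k)"
      and "B = 2 * f (y k) + f (x k / y k) - 2 * f (x k * r k / y k) - f (x k * y k) - 2 * f (- (r k / y k)) + f (x k * (r k)\<^sup>2 / y k)"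
      and "S = 2 * (f (r k) + f (x k * r k / y k) + f (- (x k * r k)) + f (- (r k / y k)) - f (x k * (r k)\<^sup>2 / y k))"
    have D: "A / x k + S / (1 - x k) = 0" "B / y k - S / (1 - y k) = 0"
      using derivative_equations[OF xy r] unfolding A_def B_def S_def by auto
    have nz: "1 - x k > 0" "1 - y k > 0" "y k > 0" using xy e0_less by auto
    have "S = - (A * (1 - x k) / x k)" using D(1) nz xy by (simp add: field_simps)
    moreover have "S = B * (1 - y k) / y k" using D(2) nz xy by (simp add: field_simps)
    moreover have "(1 - x k) / x k = 2 * k - 1" "(1 - y k) / y k = k - 1/2" using k by (simp_all add: x_def y_def field_simps)
    ultimately have "B * (k - 1/2) = - (A * (2 * k - 1))" by (metis times_divide_eq_right)
    then have "(k - 1/2) * (B + 2 * A) = 0" by (simp add: algebra_simps)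
    then have "B + 2 * A = 0" using k by simp
    moreover have "fk = (2 * fy + f3 - 2 * f5 - f6 + f9) / 2 + a" if "(2 * fy + f3 - 2 * f5 - f6 - 2 * fk + f9) + 2 * a = 0"
      for fk fy f3 f5 f6 f9 a :: real using that by (simp add: field_simps)
    ultimately show ?thesis unfolding A_def B_def ry by blast
  qed
  have T: "(x \<longlongrightarrow> 0) at_top" "(y \<longlongrightarrow> 0) at_top" "(r \<longlongrightarrow> 1) at_top" "((\<lambda>k. x k / y k) \<longlongrightarrow> 1/2) at_top"
    unfolding x_def[abs_def] y_def[abs_def] r_def[abs_def] by real_asymp+
  have pos: "\<forall>\<^sub>F k in at_top. 0 < x k" "\<forall>\<^sub>F k in at_top. 0 < y k" "\<forall>\<^sub>F k in at_top. 0 < x k * y k" "\<forall>\<^sub>F k in at_top. 0 < x k * r k"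
  proof -
    have "0 < x k" "0 < y k" "0 < r k" if "k > 2" for k using that by (auto simp: x_def y_def r_def)
    then show "\<forall>\<^sub>F k in at_top. 0 < x k" "\<forall>\<^sub>F k in at_top. 0 < y k" "\<forall>\<^sub>F k in at_top. 0 < x k * y k" "\<forall>\<^sub>F k in at_top. 0 < x k * r k"
      by (auto intro!: eventually_mono[OF ev] mult_pos_pos)
  qed
  have half: "(0::real) < 1/2" "1/2 < e0" using e0_bounds by auto
  have "((\<lambda>k. x k * y k) \<longlongrightarrow> 0) at_top" using tendsto_mult[OF T(1,2)] by simp
  moreover have "((\<lambda>k. x k * r k) \<longlongrightarrow> 0) at_top" using tendsto_mult[OF T(1,3)] by simp
  ultimately have small: "((\<lambda>k. f (x k)) \<longlongrightarrow> 0) at_top" "((\<lambda>k. f (y k)) \<longlongrightarrow> 0) at_top"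
    "((\<lambda>k. f (x k * y k)) \<longlongrightarrow> 0) at_top" "((\<lambda>k. f (- (x k * r k))) \<longlongrightarrow> 0) at_top"
    using f_small[OF T(1) pos(1)] f_small[OF T(2) pos(2)] f_small[OF _ pos(3)] f_small_neg[OF _ pos(4)] by auto
  have T2: "((\<lambda>k. x k * r k / y k) \<longlongrightarrow> 1/2) at_top" using tendsto_mult[OF T(4) T(3)] by (simp add: mult.commute mult.left_commute)
  have T3: "((\<lambda>k. x k * (r k)\<^sup>2 / y k) \<longlongrightarrow> 1/2) at_top"
    using tendsto_mult[OF T2 T(3)] by (simp add: power2_eq_square mult.commute mult.left_commute)
  have "((\<lambda>k. (2 * f (y k) + f (x k / y k) - 2 * f (x k * r k / y k) - f (x k * y k) + f (x k * (r k)\<^sup>2 / y k)) / 2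
      + (2 * f (x k) - f (x k / y k) + 2 * f (x k * r k / y k) - f (x k * y k) + 2 * f (- (x k * r k)) - f (x k * (r k)\<^sup>2 / y k)))
     \<longlongrightarrow> (2 * 0 + f (1/2) - 2 * f (1/2) - 0 + f (1/2)) / 2 + (2 * 0 - f (1/2) + 2 * f (1/2) - 0 + 2 * 0 - f (1/2))) at_top"
    by (intro tendsto_intros f_tendsto[OF T(4) half] f_tendsto[OF T2 half] f_tendsto[OF T3 half] small) auto
  then have "((\<lambda>k. (2 * f (y k) + f (x k / y k) - 2 * f (x k * r k / y k) - f (x k * y k) + f (x k * (r k)\<^sup>2 / y k)) / 2
      + (2 * f (x k) - f (x k / y k) + 2 * f (x k * r k / y k) - f (x k * y k) + 2 * f (- (x k * r k)) - f (x k * (r k)\<^sup>2 / y k)))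
     \<longlongrightarrow> 0) at_top" by simp
  then show ?thesis
    by (rule Lim_transform_eventually) (use ev in \<open>eventually_elim\<close>, use eq in auto)
qed

lemma f_near_1: "((\<lambda>y. y * f (1 - y)) \<longlongrightarrow> 0) (at_right 0)"
proof -
  have ev: "\<forall>\<^sub>F t in at_right (0::real). 0 < t \<and> t < e0" by (rule at_right_eventually) (use e0_bounds in simp)
  have "filterlim (\<lambda>y::real. (1 - y) / y) at_top (at_right 0)" by real_asymp
  then have "((\<lambda>y. f (- ((1 - y) / y))) \<longlongrightarrow> 0) (at_right 0)" by (rule filterlim_compose[OF f_tendsto_0_at_infinity])
  then have "((\<lambda>y. (1 - y) * f y - f (- ((1 - y) / y))) \<longlongrightarrow> (1 - 0) * 0 - 0) (at_right 0)"
    by (intro tendsto_intros f_tendsto_0)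
  then have "((\<lambda>y. (1 - y) * f y - f (- ((1 - y) / y))) \<longlongrightarrow> 0) (at_right 0)" by simp
  then show ?thesis
  proof (rule Lim_transform_eventually)
    show "\<forall>\<^sub>F y in at_right 0. (1 - y) * f y - f (- ((1 - y) / y)) = y * f (1 - y)"
      using ev by eventually_elim (use reflection_deriv in force)
  qed
qed

text \<open>
  Slow variation in the four regimes: at \<open>0+\<close>, at \<open>0-\<close>, at \<open>1-\<close> and at minus infinity.
\<close>
lemma log_slow_g: "log_slow g"
  by (rule log_slowI[of 1 _ f]) (auto intro!: g_DERIV f_tendsto_0)

lemma log_slow_neg: "log_slow (\<lambda>t. g (- t))"
proof (rule log_slowI[of 1 _ "\<lambda>t. f (- t)"])
  fix t :: real assume t: "0 < t" "t < 1"
  have "((\<lambda>t. g (- t)) has_real_derivative f (- t) * (1 / t)) (at t)"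
    by (rule g_chain) (use t in \<open>auto intro!: derivative_eq_intros\<close>)
  then show "((\<lambda>t. g (- t)) has_real_derivative f (- t) / t) (at t)" by simp
qed (auto intro: f_neg_tendsto_0)

lemma log_slow_1: "log_slow (\<lambda>t. g (1 - t))"
proof (rule log_slowI[of 1 _ "\<lambda>t. - (t * f (1 - t)) / (1 - t)"])
  fix t :: real assume t: "0 < t" "t < 1"
  have "((\<lambda>t. g (1 - t)) has_real_derivative f (1 - t) * (- 1 / (1 - t))) (at t)"
    by (rule g_chain) (use t in \<open>auto intro!: derivative_eq_intros\<close>)
  then show "((\<lambda>t. g (1 - t)) has_real_derivative - (t * f (1 - t)) / (1 - t) / t) (at t)" using t by simp
next
  show "((\<lambda>t. - (t * f (1 - t)) / (1 - t)) \<longlongrightarrow> 0) (at_right 0)"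
    by (rule tendsto_eq_intros f_near_1 tendsto_ident_at refl | simp)+
qed simp

lemma log_slow_infinity: "log_slow (\<lambda>t. g (- (1 / t)))"
proof (rule log_slowI[of 1 _ "\<lambda>t. - f (- (1 / t))"])
  fix t :: real assume t: "0 < t" "t < 1"
  have "((\<lambda>t. g (- (1 / t))) has_real_derivative f (- (1 / t)) * (- 1 / t)) (at t)"
    by (rule g_chain) (use t in \<open>auto intro!: derivative_eq_intros\<close>, smt (verit) divide_pos_pos)
  then show "((\<lambda>t. g (- (1 / t))) has_real_derivative - f (- (1 / t)) / t) (at t)" by simp
next
  have "filterlim (\<lambda>y::real. 1 / y) at_top (at_right 0)" by real_asymp
  then have "((\<lambda>y. f (- (1 / y))) \<longlongrightarrow> 0) (at_right 0)" by (rule filterlim_compose[OF f_tendsto_0_at_infinity])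
  then show "((\<lambda>t. - f (- (1 / t))) \<longlongrightarrow> 0) (at_right 0)" using tendsto_minus by fastforce
qed simp

end

section \<open>The diagonal, and the behaviour at 1\<close>

lemma DERIV_quotient_at_right:
  assumes "(h has_real_derivative D) (at 0)"
  shows "((\<lambda>t. (h t - h 0) / t) \<longlongrightarrow> D) (at_right (0::real))"
  using has_field_derivative_at_within[OF assms, of "{0<..}"] unfolding has_field_derivative_iff by simp

context kummer_solution
begin

text \<open>
  With \<open>x = y - \<delta>\<close>, the terms whose arguments stay below 1 as \<open>\<delta> \<rightarrow> 0\<close>, and those whose arguments tend to 1.
\<close>
definition regular_part :: "real \<Rightarrow> real \<Rightarrow> real" where
  "regular_part y \<delta> = 2 * g (y - \<delta>) + 2 * g y - g ((y - \<delta>) * y)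
     + 2 * g (- ((y - \<delta>) * ((1 - y) / (1 - y + \<delta>)))) + 2 * g (- ((1 - y) / (1 - y + \<delta>) / y))"

definition singular_part :: "real \<Rightarrow> real \<Rightarrow> real" where
  "singular_part y \<delta> = - g (1 - \<delta> / y) + 2 * g (1 - \<delta> / (1 - y + \<delta>)) + 2 * g (1 - \<delta> / (y * (1 - y + \<delta>)))
     - g (1 - \<delta> * (1 - (y - \<delta>) * y) / (y * (1 - y + \<delta>)\<^sup>2))"

lemma diagonal_equation:
  assumes d: "0 < \<delta>" "\<delta> < y" and y: "y < e0"
  shows "regular_part y \<delta> + singular_part y \<delta> = 0"
proof -
  define x where "x = y - \<delta>"
  define r where "r = (1 - y) / (1 - x)"
  have x: "0 < x" "x < y" "x < 1" "y < 1" "y \<noteq> 0" using d y e0_less by (auto simp: x_def)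
  have x1: "1 - x \<noteq> 0" using x by simp
  have dx: "1 - y + \<delta> = 1 - x" "\<delta> = y - x" by (auto simp: x_def)
  have 1: "x / y = 1 - \<delta> / y" using x unfolding dx(2) by (simp add: diff_divide_distrib)
  have 2: "r = 1 - \<delta> / (1 - x)" unfolding r_def dx(2) using x1 by (simp add: field_simps)
  have 3: "x * r / y = 1 - \<delta> / (y * (1 - x))" unfolding r_def dx(2) using x1 x by (simp add: field_simps)
  have 4: "x * r\<^sup>2 / y = 1 - \<delta> * (1 - x * y) / (y * (1 - x)\<^sup>2)"
    unfolding r_def dx(2) power_divide using x1 x by (simp add: divide_simps) (simp add: algebra_simps power2_eq_square)
  from equation_ratio[OF x(1,2) y r_def]
  have "2 * g x + 2 * g y - g (x / y) + 2 * g r + 2 * g (x * r / y) - g (x * y)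
      + 2 * g (- (x * r)) + 2 * g (- (r / y)) - g (x * r\<^sup>2 / y) = 0" .
  then have "2 * g x + 2 * g y - g (1 - \<delta> / y) + 2 * g (1 - \<delta> / (1 - x)) + 2 * g (1 - \<delta> / (y * (1 - x))) - g (x * y)
      + 2 * g (- (x * r)) + 2 * g (- (r / y)) - g (1 - \<delta> * (1 - x * y) / (y * (1 - x)\<^sup>2)) = 0"
    by (simp only: 1 3 4 2[symmetric])
  then show ?thesis unfolding regular_part_def singular_part_def x_def[symmetric] dx(1) r_def[symmetric] by simp
qed

definition duplication_defect :: "real \<Rightarrow> real" where
  "duplication_defect y = 4 * g y - g (y\<^sup>2) + 2 * g (- y) + 2 * g (- (1 / y))"

definition g1 :: real where "g1 = - duplication_defect (1/2) / 2"

text \<open>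
  By slow variation at 1 the singular part is \<open>2 * g (1 - \<delta>)\<close> up to \<open>o(1)\<close>: its four arguments are at distances comparable to \<open>\<delta>\<close>
  from 1, and the coefficients add up to 2.
\<close>
lemma limit_at_1_aux:
  assumes y: "0 < y" "y < e0"
  shows "((\<lambda>\<delta>. g (1 - \<delta>)) \<longlongrightarrow> - duplication_defect y / 2) (at_right 0)"
proof -
  have y1: "y < 1" "1 - y > 0" using y e0_less by auto
  have id: "((\<lambda>\<delta>. \<delta>) \<longlongrightarrow> 0) (at_right (0::real))" by (rule tendsto_ident_at)
  have pos: "\<forall>\<^sub>F \<delta> in at_right (0::real). 0 < \<delta>" using at_right_eventually[of 1] by (auto elim: eventually_mono)
  have "(regular_part y \<longlongrightarrow> 2 * g y + 2 * g y - g (y * y) + 2 * g (- y) + 2 * g (- (1 / y))) (at_right 0)"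
    unfolding regular_part_def[abs_def]
  proof (intro tendsto_add tendsto_diff tendsto_mult[OF tendsto_const] tendsto_const g_tendsto)
    show "((\<lambda>\<delta>. y - \<delta>) \<longlongrightarrow> y) (at_right 0)" by (auto intro!: tendsto_eq_intros)
    show "((\<lambda>\<delta>. (y - \<delta>) * y) \<longlongrightarrow> y * y) (at_right 0)" by (auto intro!: tendsto_eq_intros)
    show "((\<lambda>\<delta>. - ((y - \<delta>) * ((1 - y) / (1 - y + \<delta>)))) \<longlongrightarrow> - y) (at_right 0)" using y1 by (auto intro!: tendsto_eq_intros)
    show "((\<lambda>\<delta>. - ((1 - y) / (1 - y + \<delta>) / y)) \<longlongrightarrow> - (1 / y)) (at_right 0)" using y1 y by (auto intro!: tendsto_eq_intros)
    show "y * y < 1" using y y1 mult_strict_mono[of y 1 y 1] by simp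
    have "1 / y > 0" using y by simp
    then show "- (1 / y) < 1" by linarith
  qed (use y y1 in auto)
  then have R: "(regular_part y \<longlongrightarrow> duplication_defect y) (at_right 0)"
    by (simp add: duplication_defect_def power2_eq_square)
  have K: "((\<lambda>\<delta>. g (1 - a \<delta>) - g (1 - \<delta>)) \<longlongrightarrow> 0) (at_right 0)" if "((\<lambda>\<delta>. a \<delta> / \<delta>) \<longlongrightarrow> c) (at_right 0)" "c > 0" for a c
    using log_slow_comparable[OF log_slow_1 id pos that] .
  have a1: "((\<lambda>\<delta>. \<delta> / y / \<delta>) \<longlongrightarrow> 1 / y) (at_right 0)"
    by (rule Lim_transform_eventually[OF tendsto_const]) (use pos in eventually_elim, simp)
  have a2: "((\<lambda>\<delta>. \<delta> / (1 - y + \<delta>) / \<delta>) \<longlongrightarrow> 1 / (1 - y)) (at_right 0)"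
    by (rule Lim_transform_eventually[where f = "\<lambda>\<delta>. 1 / (1 - y + \<delta>)"])
      ((use y1 y in \<open>auto intro!: tendsto_eq_intros\<close>)[1], use pos in eventually_elim, simp)
  have a3: "((\<lambda>\<delta>. \<delta> / (y * (1 - y + \<delta>)) / \<delta>) \<longlongrightarrow> 1 / (y * (1 - y))) (at_right 0)"
    by (rule Lim_transform_eventually[where f = "\<lambda>\<delta>. 1 / (y * (1 - y + \<delta>))"])
      ((use y1 y in \<open>auto intro!: tendsto_eq_intros\<close>)[1], use pos in eventually_elim, simp)
  have a4: "((\<lambda>\<delta>. \<delta> * (1 - (y - \<delta>) * y) / (y * (1 - y + \<delta>)\<^sup>2) / \<delta>) \<longlongrightarrow> (1 - y * y) / (y * (1 - y)\<^sup>2)) (at_right 0)"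
    by (rule Lim_transform_eventually[where f = "\<lambda>\<delta>. (1 - (y - \<delta>) * y) / (y * (1 - y + \<delta>)\<^sup>2)"])
      ((use y1 y in \<open>auto intro!: tendsto_eq_intros\<close>)[1], use pos in eventually_elim, simp)
  have yy: "y * y < 1" using y y1 mult_strict_mono[of y 1 y 1] by simp
  have "((\<lambda>\<delta>. - (g (1 - \<delta> / y) - g (1 - \<delta>)) + 2 * (g (1 - \<delta> / (1 - y + \<delta>)) - g (1 - \<delta>))
      + 2 * (g (1 - \<delta> / (y * (1 - y + \<delta>))) - g (1 - \<delta>))
      - (g (1 - \<delta> * (1 - (y - \<delta>) * y) / (y * (1 - y + \<delta>)\<^sup>2)) - g (1 - \<delta>)) ) \<longlongrightarrow> - 0 + 2 * 0 + 2 * 0 - 0) (at_right 0)"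
    by (intro tendsto_intros K[OF a1] K[OF a2] K[OF a3] K[OF a4]) (use y y1 yy in auto)
  then have S: "((\<lambda>\<delta>. singular_part y \<delta> - 2 * g (1 - \<delta>)) \<longlongrightarrow> 0) (at_right 0)"
    by (simp add: singular_part_def algebra_simps)
  have "((\<lambda>\<delta>. - (regular_part y \<delta> + (singular_part y \<delta> - 2 * g (1 - \<delta>))) / 2) \<longlongrightarrow> - (duplication_defect y + 0) / 2) (at_right 0)"
    by (intro tendsto_intros R S) auto
  then have "((\<lambda>\<delta>. - (regular_part y \<delta> + (singular_part y \<delta> - 2 * g (1 - \<delta>))) / 2) \<longlongrightarrow> - duplication_defect y / 2) (at_right 0)" by simp
  then show ?thesis
  proof (rule Lim_transform_eventually)
    show "\<forall>\<^sub>F \<delta> in at_right 0. - (regular_part y \<delta> + (singular_part y \<delta> - 2 * g (1 - \<delta>))) / 2 = g (1 - \<delta>)"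
      using at_right_eventually[OF y(1)] by eventually_elim (use diagonal_equation y in force)
  qed
qed

lemma limit_at_1: "((\<lambda>\<delta>. g (1 - \<delta>)) \<longlongrightarrow> g1) (at_right 0)"
  unfolding g1_def by (rule limit_at_1_aux) (use e0_bounds in auto)

text \<open>
  The limit at 1 is the same for every \<open>y\<close>.
\<close>
lemma duplication:
  assumes "0 < y" "y < e0"
  shows "4 * g y - g (y\<^sup>2) + 2 * g (- y) + 2 * g (- (1 / y)) = - 2 * g1"
  using tendsto_unique[OF trivial_limit_at_right_real limit_at_1_aux[OF assms] limit_at_1]
  by (simp add: duplication_defect_def)

lemma duplication_deriv:
  assumes y: "0 < y" "y < e0"
  shows "2 * f y - f (y\<^sup>2) + f (- y) - f (- (1 / y)) = 0"
proof -
  have y1: "y < 1" "y \<noteq> 0" using y e0_less by auto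
  have yy: "y\<^sup>2 < 1" using y y1 mult_strict_mono[of y 1 y 1] by (simp add: power2_eq_square)
  have "1 / y > 0" using y by simp
  then have neg: "1 / y > 0" "- 1 < 1 / y" by linarith+
  have "((\<lambda>y. 4 * g y - g (y\<^sup>2) + 2 * g (- y) + 2 * g (- (1 / y))) has_real_derivative
     4 * (f y * (1 / y)) - f (y\<^sup>2) * (2 / y) + 2 * (f (- y) * (1 / y)) + 2 * (f (- (1 / y)) * (- 1 / y))) (at y)"
  proof (intro DERIV_add DERIV_diff DERIV_cmult g_chain)
    show "((\<lambda>y. y) has_real_derivative y * (1 / y)) (at y)" using y1 by simp
    show "((\<lambda>y. y\<^sup>2) has_real_derivative y\<^sup>2 * (2 / y)) (at y)" using y1 by (auto intro!: derivative_eq_intros simp: power2_eq_square)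
    show "((\<lambda>y. - y) has_real_derivative - y * (1 / y)) (at y)" using y1 by (auto intro!: derivative_eq_intros)
    show "((\<lambda>y. - (1 / y)) has_real_derivative - (1 / y) * (- 1 / y)) (at y)" using y1 by (auto intro!: derivative_eq_intros)
  qed (use y y1 yy neg in auto)
  then have "((\<lambda>y. - 2 * g1) has_real_derivative
     4 * (f y * (1 / y)) - f (y\<^sup>2) * (2 / y) + 2 * (f (- y) * (1 / y)) + 2 * (f (- (1 / y)) * (- 1 / y))) (at y)"
    by (rule has_field_derivative_transform_within_open[of _ _ _ "{0<..<e0}"]) (use y duplication in auto)
  then have "4 * (f y * (1 / y)) - f (y\<^sup>2) * (2 / y) + 2 * (f (- y) * (1 / y)) + 2 * (f (- (1 / y)) * (- 1 / y)) = 0"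
    using DERIV_unique[OF _ DERIV_const] by blast
  then have "2 * (2 * f y - f (y\<^sup>2) + f (- y) - f (- (1 / y))) / y = 0"
    by (simp add: add_divide_distrib diff_divide_distrib algebra_simps)
  then show ?thesis using y1 by simp
qed

text \<open>
  The eighth argument is \<open>- (1 - y') / y'\<close> for \<open>y' = y (1 - x) / (1 - x y)\<close>, so \<open>reflection\<close> trades it for values at \<open>y'\<close> and \<open>1 - y'\<close>.
  \<open>reflection\<close> and \<open>duplication\<close> at \<open>x\<close> bring in \<open>1 - x\<close>. For \<open>x = s y\<close> and \<open>y \<rightarrow> 0\<close> the arguments \<open>1 - x\<close>, \<open>r\<close> and \<open>1 - y'\<close> are
  at distances about \<open>s y\<close>, \<open>(1 - s) y\<close> and \<open>y\<close> from 1, and each bracket after the two quadratic terms is \<open>o(y)\<close>.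
\<close>
lemma additive_identity:
  assumes x: "0 < x" "x < y" "y < e0" and r: "r = (1 - y) / (1 - x)"
  shows "2 * (g (1 - x) + g (1 - (y - x) / (1 - x)) - g (1 - y * (1 - x) / (1 - x * y)) - g1) + g (x\<^sup>2) - g (x * y)
     - 2 * (g (- (1 / x)) - g (- (1 / (x / (1 - x))))) + 2 * (g (- (x * r)) - g (- x))
     + 2 * (g y - g (y * (1 - x) / (1 - x * y))) - (g (x / y) - 2 * g (x / y * r) + g (x / y * r\<^sup>2)) = 0"
proof -
  define y' where "y' = y * (1 - x) / (1 - x * y)"
  have x1: "x < 1" "y < 1" "y > 0" using x e0_less by auto
  have xy: "x * y < 1" using x x1 mult_strict_mono[of x 1 y 1] by simp
  have y': "0 < y'" "y' < y"
  proof -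
    show "0 < y'" using x1 x xy by (simp add: y'_def)
    have "x * y < x * 1" using x x1 by (intro mult_strict_left_mono) auto
    then have "(1 - x) / (1 - x * y) < 1" using xy by simp
    then have "y * ((1 - x) / (1 - x * y)) < y * 1" using x1 by (intro mult_strict_left_mono) auto
    then show "y' < y" by (simp add: y'_def)
  qed
  have 1: "1 - r = (y - x) / (1 - x)" using x1 unfolding r by (simp add: field_simps)
  have "1 - y' = (1 - y) / (1 - x * y)" using xy by (simp add: y'_def field_simps)
  then have "(1 - y') / y' = (1 - y) / (1 - x * y) / (y * (1 - x) / (1 - x * y))" by (simp only: y'_def)
  also have "\<dots> = (1 - y) / (y * (1 - x))"
  proof -
    have "a / q / (b / q) = a / b" if "q \<noteq> 0" for a b q :: real using that by simp
    then show ?thesis using xy by simp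
  qed
  also have "\<dots> = r / y" unfolding r by (simp add: mult.commute)
  finally have 2: "(1 - y') / y' = r / y" .
  have 3: "1 / (x / (1 - x)) = (1 - x) / x" by simp
  have r1: "g (1 - (y - x) / (1 - x)) = g r" using 1 by (metis add_diff_cancel_left' diff_add_cancel)
  have E: "2 * g x + 2 * g y - g (x / y) + 2 * g r + 2 * g (x * r / y) - g (x * y)
      + 2 * g (- (x * r)) + 2 * g (- (r / y)) - g (x * r\<^sup>2 / y) = 0" by (rule equation_ratio[OF x r])
  have A1: "2 * g y' + 2 * g (1 - y') + 2 * g (- (r / y)) + 3 * g 0 = 0"
    using reflection[of y'] y' x unfolding 2 by simp
  have A2: "2 * g x + 2 * g (1 - x) + 2 * g (- ((1 - x) / x)) + 3 * g 0 = 0" using reflection[of x] x by simp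
  have D: "4 * g x - g (x\<^sup>2) + 2 * g (- x) + 2 * g (- (1 / x)) = - 2 * g1" using duplication[of x] x by simp
  have "x * r / y = x / y * r" "x * r\<^sup>2 / y = x / y * r\<^sup>2" by auto
  with E A1 A2 D show ?thesis unfolding y'_def[symmetric] 3 r1 by (simp only: distrib_left right_diff_distrib)
qed

text \<open>
  A second difference with both steps of order \<open>y\<close>, so its derivative at \<open>y = 0\<close> vanishes.
\<close>
lemma second_difference_small:
  assumes s: "0 < s" "s < 1"
  shows "((\<lambda>y. (g s - 2 * g (s * ((1 - y) / (1 - s * y))) + g (s * ((1 - y) / (1 - s * y))\<^sup>2)) / y) \<longlongrightarrow> 0) (at_right 0)"
proof -
  define r where "r y = (1 - y) / (1 - s * y)" for y
  define h where "h y = g s - 2 * g (s * r y) + g (s * (r y)\<^sup>2)" for y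
  have r0: "r 0 = 1" by (simp add: r_def)
  have dr: "(r has_real_derivative (s - 1)) (at 0)" unfolding r_def[abs_def] by (auto intro!: derivative_eq_intros)
  have d1: "((\<lambda>y. s * r y) has_real_derivative s * r 0 * (s - 1)) (at 0)" using DERIV_cmult[OF dr, of s] by (simp add: r0)
  have d2: "((\<lambda>y. s * (r y)\<^sup>2) has_real_derivative s * (r 0)\<^sup>2 * (2 * (s - 1))) (at 0)"
    using DERIV_cmult[OF DERIV_power[OF dr, of 2], of s] by (simp add: r0)
  have "(h has_real_derivative 0 - 2 * (f (s * r 0) * (s - 1)) + f (s * (r 0)\<^sup>2) * (2 * (s - 1))) (at 0)"
    unfolding h_def[abs_def]
    by (intro DERIV_add DERIV_diff DERIV_cmult DERIV_const g_chain d1 d2) (use s r0 in auto)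
  then have "(h has_real_derivative 0) (at 0)" by (simp add: r0 algebra_simps)
  from DERIV_quotient_at_right[OF this] show ?thesis by (simp add: h_def r_def)
qed

lemma near_additive_with_square:
  assumes s: "0 < s" "s < 1"
  shows "((\<lambda>y. (g (1 - s * y) + g (1 - (1 - s) * y) - g (1 - y) - g1 + g ((s * y)\<^sup>2) / 2 - g (s * y * y) / 2) / y) \<longlongrightarrow> 0) (at_right 0)"
proof -
  have ev: "\<forall>\<^sub>F y in at_right 0. 0 < y \<and> y < (1/2::real)" by (rule at_right_eventually) simp
  have pos: "\<forall>\<^sub>F y in at_right (0::real). 0 < y" using ev by (auto elim: eventually_mono)
  have sy: "0 < s * y" "s * y < y" "s * y \<le> 1/2" "s * y * y < 1/2" "0 < s * y * y" "s * y * y \<le> y" if "0 < y" "y < 1/2" for y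
  proof -
    show 1: "0 < s * y" "s * y < y" using s that by auto
    then show "s * y \<le> 1/2" using that by linarith
    have "s * y < 1/2" using 1 that by linarith
    then have "s * y * y < 1/2 * 1" using 1 that by (intro mult_strict_mono) linarith+
    then show "s * y * y < 1/2" by simp
    show "0 < s * y * y" using 1 that by simp
    have "s * y * y \<le> y * 1" using 1 that by (intro mult_mono) auto
    then show "s * y * y \<le> y" by simp
  qed
  have l: "\<bar>ln (1 - s * y)\<bar> \<le> 2 * y" "\<bar>ln (1 - y)\<bar> \<le> 2 * y" "\<bar>ln (1 - s * y * y)\<bar> \<le> 2 * y" if "0 < y" "y < 1/2" for y
    using abs_ln_one_minus[of "s * y"] abs_ln_one_minus[of y] abs_ln_one_minus[of "s * y * y"] sy[OF that] that by linarith+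
  have T: "((\<lambda>y. s * y) \<longlongrightarrow> 0) (at_right 0)" "((\<lambda>y. (1 - s) * y) \<longlongrightarrow> 0) (at_right 0)" "((\<lambda>y. y) \<longlongrightarrow> 0) (at_right (0::real))"
    "((\<lambda>y. (y - s * y) / (1 - s * y)) \<longlongrightarrow> 0) (at_right 0)" "((\<lambda>y. y * (1 - s * y) / (1 - s * y * y)) \<longlongrightarrow> 0) (at_right 0)"
    "((\<lambda>y. s * y / (1 - s * y)) \<longlongrightarrow> 0) (at_right 0)" "((\<lambda>y. s * y * ((1 - y) / (1 - s * y))) \<longlongrightarrow> 0) (at_right 0)"
    by (auto intro!: tendsto_eq_intros)
  have P: "\<forall>\<^sub>F y in at_right 0. 0 < s * y" "\<forall>\<^sub>F y in at_right 0. 0 < (1 - s) * y"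
    "\<forall>\<^sub>F y in at_right 0. 0 < (y - s * y) / (1 - s * y)" "\<forall>\<^sub>F y in at_right 0. 0 < y * (1 - s * y) / (1 - s * y * y)"
    "\<forall>\<^sub>F y in at_right 0. 0 < s * y / (1 - s * y)" "\<forall>\<^sub>F y in at_right 0. 0 < s * y * ((1 - y) / (1 - s * y))"
    using ev by (eventually_elim, use sy s in \<open>force intro!: mult_pos_pos divide_pos_pos\<close>)+
  have lna: "ln ((y - s * y) / (1 - s * y)) - ln ((1 - s) * y) = - ln (1 - s * y)"
     "ln (y * (1 - s * y) / (1 - s * y * y)) - ln y = ln (1 - s * y) - ln (1 - s * y * y)"
     "ln (s * y) - ln (s * y / (1 - s * y)) = ln (1 - s * y)"
     "ln (s * y * ((1 - y) / (1 - s * y))) - ln (s * y) = ln (1 - y) - ln (1 - s * y)" if y: "0 < y" "y < 1/2" for y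
  proof -
    have "0 < (1 - s) * y" using y s by simp
    with sy[OF y] y have p: "0 < s * y" "0 < 1 - s * y" "0 < 1 - s * y * y" "0 < y" "0 < 1 - y" "0 < (1 - s) * y" by linarith+
    have e: "y - s * y = (1 - s) * y" by (simp add: algebra_simps)
    show "ln ((y - s * y) / (1 - s * y)) - ln ((1 - s) * y) = - ln (1 - s * y)" unfolding e using p s by (simp add: ln_div)
    show "ln (y * (1 - s * y) / (1 - s * y * y)) - ln y = ln (1 - s * y) - ln (1 - s * y * y)"
      using p s ln_mult[of y "1 - s * y"] ln_div[of "y * (1 - s * y)" "1 - s * y * y"] by simp
    show "ln (s * y) - ln (s * y / (1 - s * y)) = ln (1 - s * y)" using p s ln_div[of "s * y" "1 - s * y"] by simp
    show "ln (s * y * ((1 - y) / (1 - s * y))) - ln (s * y) = ln (1 - y) - ln (1 - s * y)"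
      using p s ln_mult[of "s * y" "(1 - y) / (1 - s * y)"] ln_div[of "1 - y" "1 - s * y"] by simp
  qed
  have a: "((\<lambda>y. (g (1 - (y - s * y) / (1 - s * y)) - g (1 - (1 - s) * y)) / y) \<longlongrightarrow> 0) (at_right 0)"
    by (rule log_slow_diff[OF log_slow_1 T(4) P(3) T(2) P(2) _ pos, of 4])
      (use ev in eventually_elim, use l lna in force)
  have b: "((\<lambda>y. (g (1 - y * (1 - s * y) / (1 - s * y * y)) - g (1 - y)) / y) \<longlongrightarrow> 0) (at_right 0)"
    by (rule log_slow_diff[OF log_slow_1 T(5) P(4) T(3) pos _ pos, of 4])
      (use ev in eventually_elim, use l lna in smt)
  have c: "((\<lambda>y. (g (- (1 / (s * y))) - g (- (1 / (s * y / (1 - s * y))))) / y) \<longlongrightarrow> 0) (at_right 0)"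
    by (rule log_slow_diff[OF log_slow_infinity T(1) P(1) T(6) P(5) _ pos, of 4])
      (use ev in eventually_elim, use l lna in force)
  have d: "((\<lambda>y. (g (- (s * y * ((1 - y) / (1 - s * y)))) - g (- (s * y))) / y) \<longlongrightarrow> 0) (at_right 0)"
    by (rule log_slow_diff[OF log_slow_neg T(7) P(6) T(1) P(1) _ pos, of 4])
      (use ev in eventually_elim, use l lna in smt)
  have e: "((\<lambda>y. (g (y * (1 - s * y) / (1 - s * y * y)) - g y) / y) \<longlongrightarrow> 0) (at_right 0)"
    by (rule log_slow_diff[OF log_slow_g T(5) P(4) T(3) pos _ pos, of 4])
      (use ev in eventually_elim, use l lna in smt)
  have sd: "((\<lambda>y. (g s - 2 * g (s * ((1 - y) / (1 - s * y))) + g (s * ((1 - y) / (1 - s * y))\<^sup>2)) / y) \<longlongrightarrow> 0) (at_right 0)"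
    by (rule second_difference_small[OF s])
  have "((\<lambda>y. - ((g (1 - (y - s * y) / (1 - s * y)) - g (1 - (1 - s) * y)) / y) + (g (1 - y * (1 - s * y) / (1 - s * y * y)) - g (1 - y)) / y
      + (g (- (1 / (s * y))) - g (- (1 / (s * y / (1 - s * y))))) / y - (g (- (s * y * ((1 - y) / (1 - s * y)))) - g (- (s * y))) / y
      + (g (y * (1 - s * y) / (1 - s * y * y)) - g y) / y
      + (g s - 2 * g (s * ((1 - y) / (1 - s * y))) + g (s * ((1 - y) / (1 - s * y))\<^sup>2)) / y / 2) \<longlongrightarrow> - 0 + 0 + 0 - 0 + 0 + 0 / 2) (at_right 0)"
    by (intro tendsto_intros a b c d e sd) auto
  then have lim: "((\<lambda>y. - ((g (1 - (y - s * y) / (1 - s * y)) - g (1 - (1 - s) * y)) / y) + (g (1 - y * (1 - s * y) / (1 - s * y * y)) - g (1 - y)) / y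
      + (g (- (1 / (s * y))) - g (- (1 / (s * y / (1 - s * y))))) / y - (g (- (s * y * ((1 - y) / (1 - s * y)))) - g (- (s * y))) / y
      + (g (y * (1 - s * y) / (1 - s * y * y)) - g y) / y
      + (g s - 2 * g (s * ((1 - y) / (1 - s * y))) + g (s * ((1 - y) / (1 - s * y))\<^sup>2)) / y / 2) \<longlongrightarrow> 0) (at_right 0)" by simp
  show ?thesis
  proof (rule Lim_transform_eventually[OF lim])
    show "\<forall>\<^sub>F y in at_right 0. - ((g (1 - (y - s * y) / (1 - s * y)) - g (1 - (1 - s) * y)) / y) + (g (1 - y * (1 - s * y) / (1 - s * y * y)) - g (1 - y)) / y
      + (g (- (1 / (s * y))) - g (- (1 / (s * y / (1 - s * y))))) / y - (g (- (s * y * ((1 - y) / (1 - s * y)))) - g (- (s * y))) / y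
      + (g (y * (1 - s * y) / (1 - s * y * y)) - g y) / y
      + (g s - 2 * g (s * ((1 - y) / (1 - s * y))) + g (s * ((1 - y) / (1 - s * y))\<^sup>2)) / y / 2
      = (g (1 - s * y) + g (1 - (1 - s) * y) - g (1 - y) - g1 + g ((s * y)\<^sup>2) / 2 - g (s * y * y) / 2) / y"
      using ev
    proof eventually_elim
      case (elim y)
      have e12: "y < e0" using elim e0_bounds by simp
      have sdy: "s * y / y = s" using elim by simp
      have "2 * (g (1 - s * y) + g (1 - (y - s * y) / (1 - s * y)) - g (1 - y * (1 - s * y) / (1 - s * y * y)) - g1) + g ((s * y)\<^sup>2) - g (s * y * y)
     - 2 * (g (- (1 / (s * y))) - g (- (1 / (s * y / (1 - s * y))))) + 2 * (g (- (s * y * ((1 - y) / (1 - s * y)))) - g (- (s * y)))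
     + 2 * (g y - g (y * (1 - s * y) / (1 - s * y * y))) - (g s - 2 * g (s * ((1 - y) / (1 - s * y))) + g (s * ((1 - y) / (1 - s * y))\<^sup>2)) = 0"
        using additive_identity[OF sy(1,2) e12 refl, OF conjunct1[OF elim] conjunct2[OF elim] conjunct1[OF elim] conjunct2[OF elim]] unfolding sdy .
      moreover have "- (Ga - Gc) + (Gb - Gd) + (J1 - J2) - (D1 - D2) + (E1 - E2) + S / 2 = G1 + Gc - Gd - c + q1 / 2 - q2 / 2"
        if "2 * (G1 + Ga - Gb - c) + q1 - q2 - 2 * (J1 - J2) + 2 * (D1 - D2) + 2 * (E2 - E1) - S = 0"
        for Ga Gb Gc Gd G1 J1 J2 D1 D2 E1 E2 S c q1 q2 :: real
        using that by (simp add: field_simps)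
      ultimately have "- (g (1 - (y - s * y) / (1 - s * y)) - g (1 - (1 - s) * y)) + (g (1 - y * (1 - s * y) / (1 - s * y * y)) - g (1 - y))
      + (g (- (1 / (s * y))) - g (- (1 / (s * y / (1 - s * y))))) - (g (- (s * y * ((1 - y) / (1 - s * y)))) - g (- (s * y)))
      + (g (y * (1 - s * y) / (1 - s * y * y)) - g y)
      + (g s - 2 * g (s * ((1 - y) / (1 - s * y))) + g (s * ((1 - y) / (1 - s * y))\<^sup>2)) / 2
      = g (1 - s * y) + g (1 - (1 - s) * y) - g (1 - y) - g1 + g ((s * y)\<^sup>2) / 2 - g (s * y * y) / 2" by blast
      moreover have "- (a / y) + b / y + c / y - d / y + e / y + k / y / 2 = (- a + b + c - d + e + k / 2) / y" for a b c d e k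
        by (simp add: add_divide_distrib diff_divide_distrib mult.commute)
      ultimately show ?case by (simp only:)
    qed
  qed
qed

text \<open>
  The proportions \<open>\<phi>\<close> and \<open>\<phi>^2 = 1 - \<phi>\<close> split 1 in either order, so the terms near 1 in \<open>near_additive_with_square\<close> are the same
  for \<open>s = \<phi>\<close> and \<open>s = \<phi>^2\<close>. Subtraction leaves the three-term relation of \<open>golden_decay\<close>.
\<close>
lemma sqrt_decay: "((\<lambda>w. (g w - g 0) / sqrt w) \<longlongrightarrow> 0) (at_right 0)"
proof -
  define \<phi> :: real where "\<phi> = (sqrt 5 - 1) / 2"
  note gr = golden_ratio[folded \<phi>_def]
  have s1: "0 < \<phi>" "\<phi> < 1" using gr by auto
  have s2: "0 < \<phi>\<^sup>2" "\<phi>\<^sup>2 < 1" using gr by auto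
  have c: "1 - \<phi> = \<phi>\<^sup>2" "1 - \<phi>\<^sup>2 = \<phi>" using gr(1) by auto
  have lim1: "((\<lambda>y. (g (1 - \<phi> * y) + g (1 - \<phi>\<^sup>2 * y) - g (1 - y) - g1 + g ((\<phi> * y)\<^sup>2) / 2 - g (\<phi> * y * y) / 2) / y) \<longlongrightarrow> 0) (at_right 0)"
    using near_additive_with_square[OF s1] unfolding c(1) .
  have lim2: "((\<lambda>y. (g (1 - \<phi>\<^sup>2 * y) + g (1 - \<phi> * y) - g (1 - y) - g1 + g ((\<phi>\<^sup>2 * y)\<^sup>2) / 2 - g (\<phi>\<^sup>2 * y * y) / 2) / y) \<longlongrightarrow> 0) (at_right 0)"
    using near_additive_with_square[OF s2] unfolding c(2) .
  have "((\<lambda>y. 2 * ((g (1 - \<phi>\<^sup>2 * y) + g (1 - \<phi> * y) - g (1 - y) - g1 + g ((\<phi>\<^sup>2 * y)\<^sup>2) / 2 - g (\<phi>\<^sup>2 * y * y) / 2) / y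
     - (g (1 - \<phi> * y) + g (1 - \<phi>\<^sup>2 * y) - g (1 - y) - g1 + g ((\<phi> * y)\<^sup>2) / 2 - g (\<phi> * y * y) / 2) / y)) \<longlongrightarrow> 2 * (0 - 0)) (at_right 0)"
    by (intro tendsto_intros lim1 lim2)
  moreover have "2 * ((g (1 - \<phi>\<^sup>2 * y) + g (1 - \<phi> * y) - g (1 - y) - g1 + g ((\<phi>\<^sup>2 * y)\<^sup>2) / 2 - g (\<phi>\<^sup>2 * y * y) / 2) / y
     - (g (1 - \<phi> * y) + g (1 - \<phi>\<^sup>2 * y) - g (1 - y) - g1 + g ((\<phi> * y)\<^sup>2) / 2 - g (\<phi> * y * y) / 2) / y)
     = (g (\<phi> * y\<^sup>2) - 2 * g (\<phi>\<^sup>2 * y\<^sup>2) + g (\<phi> ^ 4 * y\<^sup>2)) / y" for y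
  proof -
    have e: "(\<phi>\<^sup>2 * y)\<^sup>2 = \<phi> ^ 4 * y\<^sup>2" "(\<phi> * y)\<^sup>2 = \<phi>\<^sup>2 * y\<^sup>2" "\<phi>\<^sup>2 * y * y = \<phi>\<^sup>2 * y\<^sup>2" "\<phi> * y * y = \<phi> * y\<^sup>2"
      by (simp_all add: power2_eq_square power4_eq_xxxx)
    have "2 * ((a + b - c - d + A / 2 - B / 2) / y - (b + a - c - d + B / 2 - C / 2) / y) = (C - 2 * B + A) / y" for a b c d A B C
      by (simp add: add_divide_distrib diff_divide_distrib)
    then show ?thesis unfolding e .
  qed
  ultimately have L: "((\<lambda>y. (g (\<phi> * y\<^sup>2) - 2 * g (\<phi>\<^sup>2 * y\<^sup>2) + g (\<phi> ^ 4 * y\<^sup>2)) / y) \<longlongrightarrow> 0) (at_right 0)" by simp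
  have "filterlim sqrt (at_right 0) (at_right (0::real))" by real_asymp
  from filterlim_compose[OF L this]
  have "((\<lambda>w. (g (\<phi> * (sqrt w)\<^sup>2) - 2 * g (\<phi>\<^sup>2 * (sqrt w)\<^sup>2) + g (\<phi> ^ 4 * (sqrt w)\<^sup>2)) / sqrt w) \<longlongrightarrow> 0) (at_right 0)" .
  then have L2: "((\<lambda>w. ((g (\<phi> * w) - g 0) - 2 * (g (\<phi>\<^sup>2 * w) - g 0) + (g (\<phi> ^ 4 * w) - g 0)) / sqrt w) \<longlongrightarrow> 0) (at_right 0)"
  proof (rule Lim_transform_eventually)
    show "\<forall>\<^sub>F w in at_right 0. (g (\<phi> * (sqrt w)\<^sup>2) - 2 * g (\<phi>\<^sup>2 * (sqrt w)\<^sup>2) + g (\<phi> ^ 4 * (sqrt w)\<^sup>2)) / sqrt w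
       = ((g (\<phi> * w) - g 0) - 2 * (g (\<phi>\<^sup>2 * w) - g 0) + (g (\<phi> ^ 4 * w) - g 0)) / sqrt w"
      using at_right_eventually[of 1] by (auto elim!: eventually_mono simp: real_sqrt_pow2)
  qed
  have "((\<lambda>w. g w - g 0) \<longlongrightarrow> g 0 - g 0) (at_right 0)"
    by (intro tendsto_intros g_tendsto tendsto_ident_at) auto
  then have p0: "((\<lambda>w. g w - g 0) \<longlongrightarrow> 0) (at_right 0)" by simp
  show ?thesis using golden_decay[OF p0] L2 unfolding \<phi>_def by blast
qed

lemma square_decay:
  assumes c: "c > 0"
  shows "((\<lambda>y. (g (c * y\<^sup>2) - g 0) / y) \<longlongrightarrow> 0) (at_right 0)"
proof -
  have "filterlim (\<lambda>y. c * y\<^sup>2) (at_right 0) (at_right (0::real))" using c by real_asymp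
  from filterlim_compose[OF sqrt_decay this]
  have "((\<lambda>y. sqrt c * ((g (c * y\<^sup>2) - g 0) / sqrt (c * y\<^sup>2))) \<longlongrightarrow> sqrt c * 0) (at_right 0)" by (intro tendsto_intros)
  then have "((\<lambda>y. sqrt c * ((g (c * y\<^sup>2) - g 0) / sqrt (c * y\<^sup>2))) \<longlongrightarrow> 0) (at_right 0)" by simp
  then show ?thesis
  proof (rule Lim_transform_eventually)
    show "\<forall>\<^sub>F y in at_right 0. sqrt c * ((g (c * y\<^sup>2) - g 0) / sqrt (c * y\<^sup>2)) = (g (c * y\<^sup>2) - g 0) / y"
      using at_right_eventually[of 1] by (rule eventually_mono) (use c in \<open>auto simp: real_sqrt_mult\<close>)
  qed
qed

lemma near_additive:
  assumes s: "0 < s" "s < 1"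
  shows "((\<lambda>y. (g (1 - s * y) + g (1 - (1 - s) * y) - g (1 - y) - g1) / y) \<longlongrightarrow> 0) (at_right 0)"
proof -
  have "((\<lambda>y. (g (1 - s * y) + g (1 - (1 - s) * y) - g (1 - y) - g1 + g ((s * y)\<^sup>2) / 2 - g (s * y * y) / 2) / y
      - (g (s\<^sup>2 * y\<^sup>2) - g 0) / y / 2 + (g (s * y\<^sup>2) - g 0) / y / 2) \<longlongrightarrow> 0 - 0 / 2 + 0 / 2) (at_right 0)"
    by (intro tendsto_intros near_additive_with_square[OF s] square_decay) (use s in auto)
  moreover have "(g (1 - s * y) + g (1 - (1 - s) * y) - g (1 - y) - g1 + g ((s * y)\<^sup>2) / 2 - g (s * y * y) / 2) / y
      - (g (s\<^sup>2 * y\<^sup>2) - g 0) / y / 2 + (g (s * y\<^sup>2) - g 0) / y / 2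
      = (g (1 - s * y) + g (1 - (1 - s) * y) - g (1 - y) - g1) / y" for y
  proof -
    have e: "(s * y)\<^sup>2 = s\<^sup>2 * y\<^sup>2" "s * y * y = s * y\<^sup>2" by (simp_all add: power2_eq_square)
    have "(A + B / 2 - C / 2) / y - (B - c) / y / 2 + (C - c) / y / 2 = A / y" for A B C c
      by (simp add: add_divide_distrib diff_divide_distrib mult.commute)
    then show ?thesis unfolding e .
  qed
  ultimately show ?thesis by simp
qed

lemma regular_part_DERIV:
  assumes y: "0 < y" "y < e0"
  shows "(regular_part y has_real_derivative
     - 2 * f y / y + f (y\<^sup>2) / y - 2 * f (- y) / (y * (1 - y)) - 2 * f (- (1 / y)) / (1 - y)) (at 0)"
proof -
  have y1: "y < 1" "y \<noteq> 0" "1 - y \<noteq> 0" using y e0_less by auto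
  have yy: "y * y < 1" using y y1 mult_strict_mono[of y 1 y 1] by simp
  have "1 / y > 0" using y by simp
  then have neg: "1 / y > 0" "- 1 < 1 / y" by linarith+
  define r where "r \<delta> = (1 - y) / (1 - y + \<delta>)" for \<delta>
  have r0: "r 0 = 1" using y1 by (simp add: r_def)
  have dr: "(r has_real_derivative - 1 / (1 - y)) (at 0)"
    unfolding r_def[abs_def] using y1 by (auto intro!: derivative_eq_intros simp: divide_simps)
  have dx: "((\<lambda>\<delta>. y - \<delta>) has_real_derivative - 1) (at 0)" by (auto intro!: derivative_eq_intros)
  have "((\<lambda>\<delta>. 2 * g (y - \<delta>) + 2 * g y - g ((y - \<delta>) * y) + 2 * g (- ((y - \<delta>) * r \<delta>)) + 2 * g (- (r \<delta> / y))) has_real_derivative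
     2 * (f (y - 0) * (- 1 / y)) + 0 - f ((y - 0) * y) * (- 1 / y) + 2 * (f (- ((y - 0) * r 0)) * (- 1 / y - 1 / (1 - y)))
     + 2 * (f (- (r 0 / y)) * (- 1 / (1 - y)))) (at 0)"
  proof (intro DERIV_add DERIV_diff DERIV_cmult g_chain DERIV_const)
    show "((\<lambda>\<delta>. y - \<delta>) has_real_derivative (y - 0) * (- 1 / y)) (at 0)" using dx y1 by simp
    show "((\<lambda>\<delta>. (y - \<delta>) * y) has_real_derivative (y - 0) * y * (- 1 / y)) (at 0)"
      using DERIV_cmult_right[OF dx, of y] y1 by simp
    show "((\<lambda>\<delta>. - ((y - \<delta>) * r \<delta>)) has_real_derivative - ((y - 0) * r 0) * (- 1 / y - 1 / (1 - y))) (at 0)"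
      by (rule DERIV_cong[OF DERIV_minus[OF DERIV_mult[OF dx dr]]]) (use y1 r0 in \<open>simp add: field_simps\<close>)
    show "((\<lambda>\<delta>. - (r \<delta> / y)) has_real_derivative - (r 0 / y) * (- 1 / (1 - y))) (at 0)"
      by (rule DERIV_cong[OF DERIV_minus[OF DERIV_cdivide[OF dr]]]) (use y1 r0 in \<open>simp add: field_simps\<close>)
  qed (use y y1 yy neg r0 in auto)
  then have "(regular_part y has_real_derivative
     2 * (f y * (- 1 / y)) + 0 - f (y * y) * (- 1 / y) + 2 * (f (- y) * (- 1 / y - 1 / (1 - y)))
     + 2 * (f (- (1 / y)) * (- 1 / (1 - y)))) (at 0)"
    unfolding regular_part_def[abs_def] r_def[symmetric] r0 by simp
  moreover have "- 1 / y - 1 / (1 - y) = - (1 / (y * (1 - y)))" using y1 by (simp add: field_simps)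
  ultimately show ?thesis by (simp add: power2_eq_square)
qed

text \<open>
  The regular part is differentiable at \<open>\<delta> = 0\<close>, and the two parts add up to 0.
\<close>
lemma singular_part_quotient:
  assumes y: "0 < y" "y < e0"
  shows "((\<lambda>\<delta>. (singular_part y \<delta> - 2 * g1) / \<delta>) \<longlongrightarrow>
     2 * f y / y - f (y\<^sup>2) / y + 2 * f (- y) / (y * (1 - y)) + 2 * f (- (1 / y)) / (1 - y)) (at_right 0)"
proof -
  have y1: "1 - y \<noteq> 0" using y e0_less by auto
  have r0: "regular_part y 0 = - 2 * g1"
    using duplication[OF y] y1 by (simp add: regular_part_def power2_eq_square)
  have "((\<lambda>\<delta>. - ((regular_part y \<delta> - regular_part y 0) / \<delta>)) \<longlongrightarrow>
     - (- 2 * f y / y + f (y\<^sup>2) / y - 2 * f (- y) / (y * (1 - y)) - 2 * f (- (1 / y)) / (1 - y))) (at_right 0)"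
    by (rule tendsto_minus[OF DERIV_quotient_at_right[OF regular_part_DERIV[OF y]]])
  then have "((\<lambda>\<delta>. - ((regular_part y \<delta> - regular_part y 0) / \<delta>)) \<longlongrightarrow>
     2 * f y / y - f (y\<^sup>2) / y + 2 * f (- y) / (y * (1 - y)) + 2 * f (- (1 / y)) / (1 - y)) (at_right 0)" by (simp add: algebra_simps)
  then show ?thesis
  proof (rule Lim_transform_eventually)
    show "\<forall>\<^sub>F \<delta> in at_right 0. - ((regular_part y \<delta> - regular_part y 0) / \<delta>) = (singular_part y \<delta> - 2 * g1) / \<delta>"
      using at_right_eventually[OF y(1)]
    proof eventually_elim
      case (elim \<delta>)
      then have "regular_part y \<delta> = - singular_part y \<delta>" using diagonal_equation[of \<delta> y] y by simp
      then show ?case unfolding r0 by (simp add: diff_divide_distrib add_divide_distrib)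
    qed
  qed
qed

text \<open>
  At \<open>y = 1/2\<close> the singular part is, up to \<open>o(\<delta>)\<close>, equal to \<open>g (1 - 2 \<delta>) + 2 g (1 - 4 \<delta>) - g (1 - 6 \<delta>)\<close>. Since \<open>2 + 4 = 6\<close>,
  \<open>near_additive\<close> for \<open>s = 1/3\<close> leaves \<open>g (1 - 4 \<delta>)\<close> alone.
\<close>
lemma slope_at_1_exists: "\<exists>e. ((\<lambda>t. (g (1 - t) - g1) / t) \<longlongrightarrow> e) (at_right 0)"
proof -
  have half: "(0::real) < 1/2" "1/2 < e0" using e0_bounds by auto
  have ev: "\<forall>\<^sub>F \<delta> in at_right 0. 0 < \<delta> \<and> \<delta> < (1/8::real)" by (rule at_right_eventually) simp
  have pos: "\<forall>\<^sub>F y in at_right (0::real). 0 < y" using ev by (auto elim: eventually_mono)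
  obtain K where K: "((\<lambda>\<delta>. (singular_part (1/2) \<delta> - 2 * g1) / \<delta>) \<longlongrightarrow> K) (at_right 0)"
    using singular_part_quotient[OF half] by blast
  have l: "\<bar>ln (1 + c * \<delta>)\<bar> \<le> c * \<delta>" if "0 < \<delta>" "c > 0" for c \<delta> :: real
    using ln_add_one_self_le_self[of "c * \<delta>"] that by simp
  have T: "((\<lambda>\<delta>. \<delta> / (1/2 + \<delta>)) \<longlongrightarrow> 0) (at_right (0::real))" "((\<lambda>\<delta>. 2 * \<delta>) \<longlongrightarrow> 0) (at_right (0::real))"
    "((\<lambda>\<delta>. \<delta> / (1/2 * (1/2 + \<delta>))) \<longlongrightarrow> 0) (at_right (0::real))" "((\<lambda>\<delta>. 4 * \<delta>) \<longlongrightarrow> 0) (at_right (0::real))"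
    "((\<lambda>\<delta>. \<delta> * (1 - (1/2 - \<delta>) * (1/2)) / (1/2 * (1/2 + \<delta>)\<^sup>2)) \<longlongrightarrow> 0) (at_right (0::real))" "((\<lambda>\<delta>. 6 * \<delta>) \<longlongrightarrow> 0) (at_right (0::real))"
    by (auto intro!: tendsto_eq_intros)
  have id: "\<delta> / (1/2 + \<delta>) = 2 * \<delta> / (1 + 2 * \<delta>)" "\<delta> / (1/2 * (1/2 + \<delta>)) = 4 * \<delta> / (1 + 2 * \<delta>)"
    "\<delta> * (1 - (1/2 - \<delta>) * (1/2)) / (1/2 * (1/2 + \<delta>)\<^sup>2) = 6 * \<delta> * (1 + 2/3 * \<delta>) / (1 + 2 * \<delta>)\<^sup>2" if "0 < \<delta>" for \<delta> :: real
  proof -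
    have h: "1/2 + \<delta> = (1 + 2 * \<delta>) / 2" by simp
    have p: "1 + 2 * \<delta> \<noteq> 0" using that by simp
    show "\<delta> / (1/2 + \<delta>) = 2 * \<delta> / (1 + 2 * \<delta>)" unfolding h by simp
    show "\<delta> / (1/2 * (1/2 + \<delta>)) = 4 * \<delta> / (1 + 2 * \<delta>)" unfolding h by simp
    have e: "1 - (1/2 - \<delta>) * (1/2) = 3/4 * (1 + 2/3 * \<delta>)" by (simp add: field_simps)
    show "\<delta> * (1 - (1/2 - \<delta>) * (1/2)) / (1/2 * (1/2 + \<delta>)\<^sup>2) = 6 * \<delta> * (1 + 2/3 * \<delta>) / (1 + 2 * \<delta>)\<^sup>2"
      unfolding e h power_divide using p by simp
  qed
  have P: "\<forall>\<^sub>F \<delta> in at_right (0::real). 0 < \<delta> / (1/2 + \<delta>)" "\<forall>\<^sub>F \<delta> in at_right (0::real). 0 < 2 * \<delta>"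
    "\<forall>\<^sub>F \<delta> in at_right (0::real). 0 < \<delta> / (1/2 * (1/2 + \<delta>))" "\<forall>\<^sub>F \<delta> in at_right (0::real). 0 < 4 * \<delta>"
    "\<forall>\<^sub>F \<delta> in at_right (0::real). 0 < \<delta> * (1 - (1/2 - \<delta>) * (1/2)) / (1/2 * (1/2 + \<delta>)\<^sup>2)" "\<forall>\<^sub>F \<delta> in at_right (0::real). 0 < 6 * \<delta>"
    using ev by (eventually_elim, auto intro!: divide_pos_pos mult_pos_pos)+
  have a: "((\<lambda>\<delta>. (g (1 - \<delta> / (1/2 + \<delta>)) - g (1 - 2 * \<delta>)) / \<delta>) \<longlongrightarrow> 0) (at_right 0)"
  proof (rule log_slow_diff[OF log_slow_1 T(1) P(1) T(2) P(2) _ pos, of 2])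
    show "\<forall>\<^sub>F \<delta> in at_right (0::real). \<bar>ln (\<delta> / (1/2 + \<delta>)) - ln (2 * \<delta>)\<bar> \<le> 2 * \<delta>" using ev
    proof eventually_elim
      case (elim \<delta>)
      then show ?case using l[of \<delta> 2] ln_div[of "2 * \<delta>" "1 + 2 * \<delta>"] unfolding id(1)[OF conjunct1[OF elim]] by simp
    qed
  qed
  have b: "((\<lambda>\<delta>. (g (1 - \<delta> / (1/2 * (1/2 + \<delta>))) - g (1 - 4 * \<delta>)) / \<delta>) \<longlongrightarrow> 0) (at_right 0)"
  proof (rule log_slow_diff[OF log_slow_1 T(3) P(3) T(4) P(4) _ pos, of 2])
    show "\<forall>\<^sub>F \<delta> in at_right (0::real). \<bar>ln (\<delta> / (1/2 * (1/2 + \<delta>))) - ln (4 * \<delta>)\<bar> \<le> 2 * \<delta>" using ev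
    proof eventually_elim
      case (elim \<delta>)
      then show ?case using l[of \<delta> 2] ln_div[of "4 * \<delta>" "1 + 2 * \<delta>"] unfolding id(2)[OF conjunct1[OF elim]] by simp
    qed
  qed
  have c: "((\<lambda>\<delta>. (g (1 - \<delta> * (1 - (1/2 - \<delta>) * (1/2)) / (1/2 * (1/2 + \<delta>)\<^sup>2)) - g (1 - 6 * \<delta>)) / \<delta>) \<longlongrightarrow> 0) (at_right 0)"
  proof (rule log_slow_diff[OF log_slow_1 T(5) P(5) T(6) P(6) _ pos, of 5])
    show "\<forall>\<^sub>F \<delta> in at_right (0::real). \<bar>ln (\<delta> * (1 - (1/2 - \<delta>) * (1/2)) / (1/2 * (1/2 + \<delta>)\<^sup>2)) - ln (6 * \<delta>)\<bar> \<le> 5 * \<delta>" using ev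
    proof eventually_elim
      case (elim \<delta>)
      have p: "0 < 6 * \<delta>" "0 < 1 + 2/3 * \<delta>" "0 < 1 + 2 * \<delta>" using elim by auto
      have e: "ln (6 * \<delta> * (1 + 2/3 * \<delta>) / (1 + 2 * \<delta>)\<^sup>2) = ln (6 * \<delta>) + ln (1 + 2/3 * \<delta>) - 2 * ln (1 + 2 * \<delta>)"
        using p by (simp add: ln_div ln_mult_pos ln_realpow)
      have "0 \<le> ln (1 + 2 * \<delta>)" "0 \<le> ln (1 + 2/3 * \<delta>)" using elim by (auto intro!: ln_ge_zero)
      then show ?case using l[of \<delta> 2] l[of \<delta> "2/3"] elim unfolding id(3)[OF conjunct1[OF elim]] e by linarith
    qed
  qed
  have "filterlim (\<lambda>\<delta>. 6 * \<delta>) (at_right 0) (at_right (0::real))" by real_asymp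
  from filterlim_compose[OF near_additive[of "1/3"] this]
  have d: "((\<lambda>\<delta>. 6 * ((g (1 - 1/3 * (6 * \<delta>)) + g (1 - (1 - 1/3) * (6 * \<delta>)) - g (1 - 6 * \<delta>) - g1) / (6 * \<delta>))) \<longlongrightarrow> 6 * 0) (at_right 0)"
    by (intro tendsto_intros) auto
  have "((\<lambda>\<delta>. (singular_part (1/2) \<delta> - 2 * g1) / \<delta> - 2 * ((g (1 - \<delta> / (1/2 + \<delta>)) - g (1 - 2 * \<delta>)) / \<delta>)
     - 2 * ((g (1 - \<delta> / (1/2 * (1/2 + \<delta>))) - g (1 - 4 * \<delta>)) / \<delta>)
     + (g (1 - \<delta> * (1 - (1/2 - \<delta>) * (1/2)) / (1/2 * (1/2 + \<delta>)\<^sup>2)) - g (1 - 6 * \<delta>)) / \<delta>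
     - 6 * ((g (1 - 1/3 * (6 * \<delta>)) + g (1 - (1 - 1/3) * (6 * \<delta>)) - g (1 - 6 * \<delta>) - g1) / (6 * \<delta>)))
      \<longlongrightarrow> K - 2 * 0 - 2 * 0 + 0 - 6 * 0) (at_right 0)"
    by (intro tendsto_intros K a b c d)
  then have "((\<lambda>\<delta>. (singular_part (1/2) \<delta> - 2 * g1) / \<delta> - 2 * ((g (1 - \<delta> / (1/2 + \<delta>)) - g (1 - 2 * \<delta>)) / \<delta>)
     - 2 * ((g (1 - \<delta> / (1/2 * (1/2 + \<delta>))) - g (1 - 4 * \<delta>)) / \<delta>)
     + (g (1 - \<delta> * (1 - (1/2 - \<delta>) * (1/2)) / (1/2 * (1/2 + \<delta>)\<^sup>2)) - g (1 - 6 * \<delta>)) / \<delta>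
     - 6 * ((g (1 - 1/3 * (6 * \<delta>)) + g (1 - (1 - 1/3) * (6 * \<delta>)) - g (1 - 6 * \<delta>) - g1) / (6 * \<delta>))) \<longlongrightarrow> K) (at_right 0)" by simp
  moreover have "(singular_part (1/2) \<delta> - 2 * g1) / \<delta> - 2 * ((g (1 - \<delta> / (1/2 + \<delta>)) - g (1 - 2 * \<delta>)) / \<delta>)
     - 2 * ((g (1 - \<delta> / (1/2 * (1/2 + \<delta>))) - g (1 - 4 * \<delta>)) / \<delta>)
     + (g (1 - \<delta> * (1 - (1/2 - \<delta>) * (1/2)) / (1/2 * (1/2 + \<delta>)\<^sup>2)) - g (1 - 6 * \<delta>)) / \<delta>
     - 6 * ((g (1 - 1/3 * (6 * \<delta>)) + g (1 - (1 - 1/3) * (6 * \<delta>)) - g (1 - 6 * \<delta>) - g1) / (6 * \<delta>))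
     = (g (1 - 4 * \<delta>) - g1) / \<delta>" for \<delta>
  proof -
    have s: "singular_part (1/2) \<delta> = - g (1 - 2 * \<delta>) + 2 * g (1 - \<delta> / (1/2 + \<delta>)) + 2 * g (1 - \<delta> / (1/2 * (1/2 + \<delta>)))
       - g (1 - \<delta> * (1 - (1/2 - \<delta>) * (1/2)) / (1/2 * (1/2 + \<delta>)\<^sup>2))" by (simp add: singular_part_def mult.commute)
    have m: "1/3 * (6 * \<delta>) = 2 * \<delta>" "(1 - 1/3) * (6 * \<delta>) = 4 * \<delta>" by auto
    have q: "6 * (z / (6 * \<delta>)) = z / \<delta>" for z by simp
    show ?thesis unfolding s m q
      by (simp only: diff_divide_distrib[symmetric] add_divide_distrib[symmetric] times_divide_eq_right) (rule arg_cong[of _ _ "\<lambda>z. z / \<delta>"], simp)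
  qed
  ultimately have L: "((\<lambda>\<delta>. (g (1 - 4 * \<delta>) - g1) / \<delta>) \<longlongrightarrow> K) (at_right 0)" by simp
  have "filterlim (\<lambda>t. t / 4) (at_right 0) (at_right (0::real))" by real_asymp
  from filterlim_compose[OF L this] have "((\<lambda>t. (g (1 - 4 * (t / 4)) - g1) / (t / 4) / 4) \<longlongrightarrow> K / 4) (at_right 0)"
    by (intro tendsto_intros) auto
  moreover have "Z / (t / 4) / 4 = Z / t" "4 * (t / 4) = t" for Z t :: real by simp_all
  ultimately show ?thesis by (simp only:) blast
qed

text \<open>
  Both parts of the equation on the diagonal are expanded to first order in \<open>\<delta>\<close>, now with the slope \<open>e\<close> at 1.
\<close>
lemma slope_relation:
  assumes e: "((\<lambda>t. (g (1 - t) - g1) / t) \<longlongrightarrow> e) (at_right 0)" and y: "0 < y" "y < e0"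
  shows "2 * (1 - y) * f y - (1 - y) * f (y\<^sup>2) + 2 * f (- y) + 2 * y * f (- (1 / y)) = 2 * e * y"
proof -
  have y1: "y < 1" "1 - y > 0" "1 - y \<noteq> 0" "y \<noteq> 0" using y e0_less by auto
  have pos: "\<forall>\<^sub>F \<delta> in at_right (0::real). 0 < \<delta>" using at_right_eventually[of 1] by (auto elim: eventually_mono)
  have K: "((\<lambda>\<delta>. (g (1 - \<delta> * a \<delta>) - g1) / \<delta>) \<longlongrightarrow> e * c) (at_right 0)"
    if a: "(a \<longlongrightarrow> c) (at_right 0)" "c > 0" for a c
  proof -
    have apos: "\<forall>\<^sub>F \<delta> in at_right 0. 0 < a \<delta>" using a by (rule order_tendstoD(1))
    have "((\<lambda>\<delta>. \<delta> * a \<delta>) \<longlongrightarrow> 0 * c) (at_right 0)" by (intro tendsto_mult a tendsto_ident_at)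
    moreover have "\<forall>\<^sub>F \<delta> in at_right 0. 0 < \<delta> * a \<delta>" using pos apos by eventually_elim simp
    ultimately have "filterlim (\<lambda>\<delta>. \<delta> * a \<delta>) (at_right 0) (at_right 0)"
      unfolding filterlim_at by (auto elim: eventually_mono)
    from filterlim_compose[OF e this]
    have "((\<lambda>\<delta>. (g (1 - \<delta> * a \<delta>) - g1) / (\<delta> * a \<delta>) * a \<delta>) \<longlongrightarrow> e * c) (at_right 0)" by (intro tendsto_mult a)
    then show ?thesis
      by (rule Lim_transform_eventually) (use pos apos in \<open>eventually_elim\<close>, auto)
  qed
  have yy: "y * y < 1" using y y1 mult_strict_mono[of y 1 y 1] by simp
  have "((\<lambda>\<delta>. - ((g (1 - \<delta> * (1 / y)) - g1) / \<delta>) + 2 * ((g (1 - \<delta> * (1 / (1 - y + \<delta>))) - g1) / \<delta>)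
      + 2 * ((g (1 - \<delta> * (1 / (y * (1 - y + \<delta>)))) - g1) / \<delta>) - (g (1 - \<delta> * ((1 - (y - \<delta>) * y) / (y * (1 - y + \<delta>)\<^sup>2))) - g1) / \<delta>)
     \<longlongrightarrow> - (e * (1 / y)) + 2 * (e * (1 / (1 - y))) + 2 * (e * (1 / (y * (1 - y)))) - e * ((1 - y * y) / (y * (1 - y)\<^sup>2))) (at_right 0)"
    by (intro tendsto_intros K) (use y y1 yy in \<open>auto intro!: tendsto_eq_intros\<close>)
  moreover have "- ((g (1 - \<delta> * (1 / y)) - g1) / \<delta>) + 2 * ((g (1 - \<delta> * (1 / (1 - y + \<delta>))) - g1) / \<delta>)
      + 2 * ((g (1 - \<delta> * (1 / (y * (1 - y + \<delta>)))) - g1) / \<delta>) - (g (1 - \<delta> * ((1 - (y - \<delta>) * y) / (y * (1 - y + \<delta>)\<^sup>2))) - g1) / \<delta>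
      = (singular_part y \<delta> - 2 * g1) / \<delta>" for \<delta>
    unfolding singular_part_def
    by (simp only: diff_divide_distrib[symmetric] add_divide_distrib[symmetric] times_divide_eq_right minus_divide_left) (rule arg_cong[of _ _ "\<lambda>z. z / \<delta>"], simp)
  ultimately have "((\<lambda>\<delta>. (singular_part y \<delta> - 2 * g1) / \<delta>) \<longlongrightarrow>
     - (e * (1 / y)) + 2 * (e * (1 / (1 - y))) + 2 * (e * (1 / (y * (1 - y)))) - e * ((1 - y * y) / (y * (1 - y)\<^sup>2))) (at_right 0)" by simp
  from tendsto_unique[OF trivial_limit_at_right_real singular_part_quotient[OF y] this]
  have "2 * f y / y - f (y\<^sup>2) / y + 2 * f (- y) / (y * (1 - y)) + 2 * f (- (1 / y)) / (1 - y)
     = - (e * (1 / y)) + 2 * (e * (1 / (1 - y))) + 2 * (e * (1 / (y * (1 - y)))) - e * ((1 - y * y) / (y * (1 - y)\<^sup>2))" .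
  also have "\<dots> = 2 * e / (1 - y)"
  proof -
    have e1: "(1 - y * y) / (y * (1 - y)\<^sup>2) = (1 + y) / (y * (1 - y))"
    proof -
      have "1 - y * y = (1 + y) * (1 - y)" by (simp add: algebra_simps)
      then show ?thesis using y1 by (simp add: power2_eq_square)
    qed
    show ?thesis unfolding e1 using y1 by (simp add: divide_simps) (simp add: algebra_simps)
  qed
  finally have eq: "2 * f y / y - f (y\<^sup>2) / y + 2 * f (- y) / (y * (1 - y)) + 2 * f (- (1 / y)) / (1 - y) = 2 * e / (1 - y)" .
  have "y * (1 - y) * (2 * f y / y - f (y\<^sup>2) / y + 2 * f (- y) / (y * (1 - y)) + 2 * f (- (1 / y)) / (1 - y)) = y * (1 - y) * (2 * e / (1 - y))"
    unfolding eq ..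
  moreover have "y * (1 - y) * (2 * f y / y - f (y\<^sup>2) / y + 2 * f (- y) / (y * (1 - y)) + 2 * f (- (1 / y)) / (1 - y))
     = 2 * (1 - y) * f y - (1 - y) * f (y\<^sup>2) + 2 * f (- y) + 2 * y * f (- (1 / y))"
  proof -
    have "y * (1 - y) * (a / y) = (1 - y) * a" "y * (1 - y) * (a / (1 - y)) = y * a" "y * (1 - y) * (a / (y * (1 - y))) = a" for a
      using y1 by simp_all
    then show ?thesis by (simp only: distrib_left right_diff_distrib) simp
  qed
  moreover have "y * (1 - y) * (2 * e / (1 - y)) = 2 * e * y" using y1 by simp
  ultimately show ?thesis by simp
qed

lemma inversion_with_slope:
  assumes e: "((\<lambda>t. (g (1 - t) - g1) / t) \<longlongrightarrow> e) (at_right 0)" and y: "0 < y" "y < e0"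
  shows "(1 + y) * (f (- y) + f (- (1 / y))) = 2 * e * y"
proof -
  have "2 * f y - f (y\<^sup>2) = f (- (1 / y)) - f (- y)" using duplication_deriv[OF y] by simp
  then have "(1 - y) * (2 * f y - f (y\<^sup>2)) = (1 - y) * (f (- (1 / y)) - f (- y))" by simp
  then show ?thesis using slope_relation[OF e y] by (simp add: algebra_simps)
qed

text \<open>
  With \<open>(1 - z) / z = y\<close>, adding \<open>reflection_deriv\<close> at \<open>z\<close> and at \<open>1 - z\<close> gives \<open>f (- y) + f (- 1 / y) = 0\<close>, which contradicts
  \<open>inversion_with_slope\<close> unless \<open>e = 0\<close>. This uses \<open>y < e0\<close> and \<open>z = 1 / (1 + y) < e0\<close>, and such a \<open>y\<close> exists because
  \<open>e0\<close> exceeds the golden ratio.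
\<close>
lemma slope_at_1: "((\<lambda>t. (g (1 - t) - g1) / t) \<longlongrightarrow> 0) (at_right 0)"
proof -
  obtain e where e: "((\<lambda>t. (g (1 - t) - g1) / t) \<longlongrightarrow> e) (at_right 0)" using slope_at_1_exists by blast
  \<comment> \<open>any number between the golden ratio and \<open>e0\<close> would do\<close>
  define y where "y = ((sqrt 5 - 1) / 2 + e0) / 2"
  note gr = golden_ratio
  have y: "(sqrt 5 - 1) / 2 < y" "y < e0" "0 < y" 
  proof -
    have "a < (a + b) / 2" "(a + b) / 2 < b" if "a < b" for a b :: real using that by simp_all
    from this[OF e0_gt] show "(sqrt 5 - 1) / 2 < y" "y < e0" unfolding y_def .
    then show "0 < y" using gr(2) by linarith
  qed
  define z where "z = 1 / (1 + y)"
  have z0: "0 < z" using y by (simp add: z_def)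
  have z1: "1 - z = y / (1 + y)" using y by (simp add: z_def field_simps)
  have z2: "z < e0"
  proof -
    define \<phi> where "\<phi> = (sqrt 5 - 1) / (2::real)"
    have p: "\<phi>\<^sup>2 = 1 - \<phi>" "3/5 < \<phi>" using gr by (auto simp: \<phi>_def)
    have "\<phi> * (1 + \<phi>) = 1" using p(1) by (simp add: algebra_simps power2_eq_square)
    moreover have "\<phi> * (1 + \<phi>) < \<phi> * (1 + y)" using y p by (intro mult_strict_left_mono) (auto simp: \<phi>_def)
    ultimately have "1 < \<phi> * (1 + y)" by simp
    then have "z < \<phi>" using y by (simp add: z_def divide_less_eq)
    then show ?thesis using e0_gt by (simp add: \<phi>_def)
  qed
  have z3: "0 < 1 - z" "1 - z < e0"
  proof -
    show "0 < 1 - z" using z1 y by simp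
    have "y / (1 + y) \<le> 1/2" using y e0_less by (simp add: divide_simps)
    then show "1 - z < e0" using z1 e0_bounds by simp
  qed
  have q: "(1 - z) / z = y" "(1 - (1 - z)) / (1 - z) = 1 / y"
  proof -
    show "(1 - z) / z = y" unfolding z1 unfolding z_def using y by simp
    have "(1 - (1 - z)) / (1 - z) = z / (y / (1 + y))" using z1 by simp
    also have "\<dots> = 1 / y" using y by (simp add: z_def)
    finally show "(1 - (1 - z)) / (1 - z) = 1 / y" .
  qed
  have "(1 - z) * f z - z * f (1 - z) - f (- y) = 0" using reflection_deriv[OF z0 z2] unfolding q .
  moreover have "(1 - (1 - z)) * f (1 - z) - (1 - z) * f (1 - (1 - z)) - f (- (1 / y)) = 0"
    using reflection_deriv[OF z3] unfolding q .
  ultimately have "f (- y) + f (- (1 / y)) = 0" by simp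
  then have "e = 0" using inversion_with_slope[OF e y(3,2)] y by simp
  then show ?thesis using e by simp
qed

lemma inversion: "0 < y \<Longrightarrow> y < e0 \<Longrightarrow> f (- (1 / y)) = - f (- y)"
  using inversion_with_slope[OF slope_at_1, of y] by auto

text \<open>
  Eliminate \<open>g (- (1 - x) / x)\<close> and \<open>g (- 1 / x)\<close> from \<open>reflection\<close> and \<open>duplication\<close>: their difference is \<open>o(x)\<close> by slow
  variation, and the remaining terms are \<open>o(x)\<close> by \<open>slope_at_1\<close> and \<open>square_decay\<close>.
\<close>
lemma even_part_small: "((\<lambda>x. (g x + g (- x) - 2 * g 0) / x) \<longlongrightarrow> 0) (at_right 0)"
proof -
  have ev: "\<forall>\<^sub>F y in at_right 0. 0 < y \<and> y < (1/2::real)" by (rule at_right_eventually) simp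
  have pos: "\<forall>\<^sub>F y in at_right (0::real). 0 < y" using ev by (auto elim: eventually_mono)
  have T: "((\<lambda>x. x) \<longlongrightarrow> 0) (at_right (0::real))" "((\<lambda>x. x / (1 - x)) \<longlongrightarrow> 0) (at_right (0::real))" by (auto intro!: tendsto_eq_intros)
  have P: "\<forall>\<^sub>F x in at_right (0::real). 0 < x / (1 - x)" using ev by eventually_elim simp
  have J: "((\<lambda>x. (g (- (1 / x)) - g (- (1 / (x / (1 - x))))) / x) \<longlongrightarrow> 0) (at_right 0)"
  proof (rule log_slow_diff[OF log_slow_infinity T(1) pos T(2) P _ pos, of 2])
    show "\<forall>\<^sub>F x in at_right (0::real). \<bar>ln x - ln (x / (1 - x))\<bar> \<le> 2 * x" using ev
    proof eventually_elim
      case (elim x)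
      then show ?case using abs_ln_one_minus[of x] ln_div[of x "1 - x"] by simp
    qed
  qed
  have "((\<lambda>x. (g (1 * x\<^sup>2) - g 0) / x / 2 + (g (1 - x) - g1) / x - (g (- (1 / x)) - g (- (1 / (x / (1 - x))))) / x) \<longlongrightarrow> 0 / 2 + 0 - 0) (at_right 0)"
    by (intro tendsto_intros square_decay slope_at_1 J) auto
  then have "((\<lambda>x. (g (1 * x\<^sup>2) - g 0) / x / 2 + (g (1 - x) - g1) / x - (g (- (1 / x)) - g (- (1 / (x / (1 - x))))) / x) \<longlongrightarrow> 0) (at_right 0)" by simp
  then show ?thesis
  proof (rule Lim_transform_eventually)
    show "\<forall>\<^sub>F x in at_right 0. (g (1 * x\<^sup>2) - g 0) / x / 2 + (g (1 - x) - g1) / x - (g (- (1 / x)) - g (- (1 / (x / (1 - x))))) / x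
       = (g x + g (- x) - 2 * g 0) / x"
      using ev
    proof eventually_elim
      case (elim x)
      have x: "0 < x" "x < e0" using elim e0_bounds by auto
      have A: "2 * g x + 2 * g (1 - x) + 2 * g (- ((1 - x) / x)) + 3 * g 0 = 0" by (rule reflection[OF x])
      have D: "4 * g x - g (x\<^sup>2) + 2 * g (- x) + 2 * g (- (1 / x)) = - 2 * g1" by (rule duplication[OF x])
      have i: "1 / (x / (1 - x)) = (1 - x) / x" by simp
      have "(g (1 * x\<^sup>2) - g 0) / 2 + (g (1 - x) - g1) - (g (- (1 / x)) - g (- (1 / (x / (1 - x))))) = g x + g (- x) - 2 * g 0"
      proof -
        have "(c - z) / 2 + (d - e) - (h - k) = a + b - 2 * z"
          if "2 * a + 2 * d + 2 * k + 3 * z = 0" "4 * a - c + 2 * b + 2 * h = - 2 * e" for a b c d e h k z :: real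
          using that by (simp add: field_simps)
        from this[OF A D] show ?thesis unfolding i by simp
      qed
      from arg_cong[OF this, of "\<lambda>z. z / x"] show ?case
        by (simp only: add_divide_distrib diff_divide_distrib divide_divide_eq_left mult.commute[of x 2])
    qed
  qed
qed

end

section \<open>The second difference at the origin\<close>

context kummer_solution
begin

text \<open>
  The equation to first order in \<open>x\<close>. In the arguments that tend to 0, \<open>r\<close> may be replaced by its limit \<open>1 - y\<close> by slow
  variation, and \<open>g (- x r)\<close> by \<open>2 * g 0 - g (x r)\<close> by \<open>even_part_small\<close>. The fourth and eighth terms contribute
  \<open>f (1 - y)\<close> and \<open>f (- (1 - y) / y)\<close>, which \<open>reflection_deriv\<close> combines.
\<close>
lemma second_difference_at_0:
  assumes y: "0 < y" "y < e0"
  shows "((\<lambda>x. (g (x / y) - 2 * g x - 2 * g (x * (1 - y) / y) + g (x * y) + 2 * g (x * (1 - y)) + g (x * (1 - y)\<^sup>2 / y) - g 0) / x)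
     \<longlongrightarrow> 2 * (1 - y) * (f y + f (1 - y))) (at_right 0)"
proof -
  define r where "r x = (1 - y) / (1 - x)" for x
  have y1: "y < 1" "0 < 1 - y" using y e0_less by auto
  have r0: "r 0 = 1 - y" by (simp add: r_def)
  have ev: "\<forall>\<^sub>F x in at_right 0. 0 < x \<and> x < min y (1/2)" by (rule at_right_eventually) (use y in simp)
  have pos: "\<forall>\<^sub>F x in at_right (0::real). 0 < x" using ev by (auto elim: eventually_mono)
  have rpos: "0 < r x" if "0 < x \<and> x < min y (1/2)" for x using that y1 by (simp add: r_def)
  have lnr: "ln (r x) = ln (1 - y) - ln (1 - x)" if "0 < x \<and> x < min y (1/2)" for x
    using that y1 by (simp add: r_def ln_div)
  have l: "\<bar>ln (1 - x)\<bar> \<le> 2 * x" if "0 < x \<and> x < min y (1/2)" for x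
    using that by (intro abs_ln_one_minus) auto
  have rlim: "(r \<longlongrightarrow> 1 - y) (at_right 0)" unfolding r_def[abs_def] by (auto intro!: tendsto_eq_intros)
  have dr: "(r has_real_derivative (1 - y)) (at 0)"
    unfolding r_def[abs_def] using y1 by (auto intro!: derivative_eq_intros)
  have T: "((\<lambda>x. x * r x / y) \<longlongrightarrow> 0) (at_right 0)" "((\<lambda>x. x * (1 - y) / y) \<longlongrightarrow> 0) (at_right 0)"
    "((\<lambda>x. x * (r x)\<^sup>2 / y) \<longlongrightarrow> 0) (at_right 0)" "((\<lambda>x. x * (1 - y)\<^sup>2 / y) \<longlongrightarrow> 0) (at_right 0)"
    "((\<lambda>x. x * r x) \<longlongrightarrow> 0) (at_right 0)" "((\<lambda>x. x * (1 - y)) \<longlongrightarrow> 0) (at_right 0)"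
    using y by (auto intro!: tendsto_eq_intros rlim)
  have P: "\<forall>\<^sub>F x in at_right 0. 0 < x * r x / y" "\<forall>\<^sub>F x in at_right 0. 0 < x * (1 - y) / y"
    "\<forall>\<^sub>F x in at_right 0. 0 < x * (r x)\<^sup>2 / y" "\<forall>\<^sub>F x in at_right 0. 0 < x * (1 - y)\<^sup>2 / y"
    "\<forall>\<^sub>F x in at_right 0. 0 < x * r x" "\<forall>\<^sub>F x in at_right 0. 0 < x * (1 - y)"
    using y y1 by (auto intro!: eventually_mono[OF ev] divide_pos_pos mult_pos_pos rpos zero_less_power)
  have E1: "((\<lambda>x. (g (x * r x / y) - g (x * (1 - y) / y)) / x) \<longlongrightarrow> 0) (at_right 0)"
  proof (rule log_slow_diff[OF log_slow_g T(1) P(1) T(2) P(2) _ pos, of 2])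
    show "\<forall>\<^sub>F x in at_right 0. \<bar>ln (x * r x / y) - ln (x * (1 - y) / y)\<bar> \<le> 2 * x" using ev
    proof eventually_elim
      case (elim x)
      have "ln (x * r x / y) - ln (x * (1 - y) / y) = - ln (1 - x)"
        using elim rpos[OF elim] y y1 by (simp add: ln_div ln_mult lnr)
      then show ?case using l[OF elim] by linarith
    qed
  qed
  have E2: "((\<lambda>x. (g (x * (r x)\<^sup>2 / y) - g (x * (1 - y)\<^sup>2 / y)) / x) \<longlongrightarrow> 0) (at_right 0)"
  proof (rule log_slow_diff[OF log_slow_g T(3) P(3) T(4) P(4) _ pos, of 4])
    show "\<forall>\<^sub>F x in at_right 0. \<bar>ln (x * (r x)\<^sup>2 / y) - ln (x * (1 - y)\<^sup>2 / y)\<bar> \<le> 4 * x" using ev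
    proof eventually_elim
      case (elim x)
      have "ln (x * (r x)\<^sup>2 / y) - ln (x * (1 - y)\<^sup>2 / y) = - 2 * ln (1 - x)"
        using elim rpos[OF elim] y y1 by (simp add: ln_div ln_mult ln_realpow lnr)
      then show ?case using l[OF elim] by linarith
    qed
  qed
  have E4: "((\<lambda>x. (g (x * r x) - g (x * (1 - y))) / x) \<longlongrightarrow> 0) (at_right 0)"
  proof (rule log_slow_diff[OF log_slow_g T(5) P(5) T(6) P(6) _ pos, of 2])
    show "\<forall>\<^sub>F x in at_right 0. \<bar>ln (x * r x) - ln (x * (1 - y))\<bar> \<le> 2 * x" using ev
    proof eventually_elim
      case (elim x)
      have "ln (x * r x) - ln (x * (1 - y)) = - ln (1 - x)"
        using elim rpos[OF elim] y y1 by (simp add: ln_mult lnr)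
      then show ?case using l[OF elim] by linarith
    qed
  qed
  have "filterlim (\<lambda>x. x * r x) (at_right 0) (at_right 0)"
    unfolding filterlim_at using T(5) P(5) by (auto elim: eventually_mono)
  from filterlim_compose[OF even_part_small this]
  have E3: "((\<lambda>x. (g (x * r x) + g (- (x * r x)) - 2 * g 0) / (x * r x)) \<longlongrightarrow> 0) (at_right 0)" .
  have E5: "((\<lambda>x. (g (r x) - g (r 0)) / x) \<longlongrightarrow> f (1 - y)) (at_right 0)"
  proof -
    have "((\<lambda>x. g (r x)) has_real_derivative f (r 0) * 1) (at 0)"
      by (rule g_chain) (use dr r0 y y1 in auto)
    from DERIV_quotient_at_right[OF this] show ?thesis by (simp add: r0)
  qed
  have E6: "((\<lambda>x. (g (- (r x / y)) - g (- (r 0 / y))) / x) \<longlongrightarrow> f (- ((1 - y) / y))) (at_right 0)"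
  proof -
    have "0 < (1 - y) / y" using y y1 by simp
    then have neg: "- (r 0 / y) < 1" "- (r 0 / y) \<noteq> 0" unfolding r0 by linarith+
    have "((\<lambda>x. - (r x / y)) has_real_derivative - (r 0 / y) * 1) (at 0)"
      by (rule DERIV_cong[OF DERIV_minus[OF DERIV_cdivide[OF dr]]]) (simp add: r0)
    from g_chain[OF this neg] have "((\<lambda>x. g (- (r x / y))) has_real_derivative f (- (r 0 / y)) * 1) (at 0)" .
    from DERIV_quotient_at_right[OF this] show ?thesis by (simp add: r0)
  qed
  have "((\<lambda>x. 2 * ((g (x * r x / y) - g (x * (1 - y) / y)) / x) - (g (x * (r x)\<^sup>2 / y) - g (x * (1 - y)\<^sup>2 / y)) / x
      + 2 * ((g (x * r x) + g (- (x * r x)) - 2 * g 0) / (x * r x) * r x) - 2 * ((g (x * r x) - g (x * (1 - y))) / x)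
      + 2 * ((g (r x) - g (r 0)) / x) + 2 * ((g (- (r x / y)) - g (- (r 0 / y))) / x))
      \<longlongrightarrow> 2 * 0 - 0 + 2 * (0 * (1 - y)) - 2 * 0 + 2 * f (1 - y) + 2 * f (- ((1 - y) / y))) (at_right 0)"
    by (intro tendsto_add tendsto_diff tendsto_mult[OF tendsto_const] tendsto_mult[OF E3 rlim] E1 E2 E4 E5 E6)
  moreover have "2 * 0 - 0 + 2 * (0 * (1 - y)) - 2 * 0 + 2 * f (1 - y) + 2 * f (- ((1 - y) / y)) = 2 * (1 - y) * (f y + f (1 - y))"
    using reflection_deriv[OF y] by (simp add: algebra_simps)
  moreover have "\<forall>\<^sub>F x in at_right 0. 2 * ((g (x * r x / y) - g (x * (1 - y) / y)) / x) - (g (x * (r x)\<^sup>2 / y) - g (x * (1 - y)\<^sup>2 / y)) / x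
      + 2 * ((g (x * r x) + g (- (x * r x)) - 2 * g 0) / (x * r x) * r x) - 2 * ((g (x * r x) - g (x * (1 - y))) / x)
      + 2 * ((g (r x) - g (r 0)) / x) + 2 * ((g (- (r x / y)) - g (- (r 0 / y))) / x)
    = (g (x / y) - 2 * g x - 2 * g (x * (1 - y) / y) + g (x * y) + 2 * g (x * (1 - y)) + g (x * (1 - y)\<^sup>2 / y) - g 0) / x"
    using ev
  proof eventually_elim
    case (elim x)
    have c: "Z / (x * r x) * r x = Z / x" for Z using rpos[OF elim] by simp
    have d: "2 * (A / x) - B / x + 2 * (C / x) - 2 * (D / x) + 2 * (E / x) + 2 * (G / x) = (2 * A - B + 2 * C - 2 * D + 2 * E + 2 * G) / x"
      for A B C D E G by (simp add: add_divide_distrib diff_divide_distrib)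
    have eq: "2 * g x + 2 * g y - g (x / y) + 2 * g (r x) + 2 * g (x * r x / y) - g (x * y)
      + 2 * g (- (x * r x)) + 2 * g (- (r x / y)) - g (x * (r x)\<^sup>2 / y) = 0"
      by (rule equation_ratio) (use elim y in \<open>auto simp: r_def\<close>)
    have num: "2 * (u5 - v5) - (u9 - v9) + 2 * (m + u7 - 2 * z) - 2 * (m - v) + 2 * (u4 - v4) + 2 * (u8 - v8)
      = u3 - 2 * u1 - 2 * v5 + u6 + 2 * v + v9 - z"
      if "2 * u1 + 2 * u2 - u3 + 2 * u4 + 2 * u5 - u6 + 2 * u7 + 2 * u8 - u9 = 0" "2 * u2 + 2 * v4 + 2 * v8 + 3 * z = 0"
      for u1 u2 u3 u4 u5 u6 u7 u8 u9 v v4 v5 v8 v9 m z :: real using that by algebra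
    show ?case unfolding c d r0 by (rule arg_cong[where f = "\<lambda>z. z / x"]) (rule num[OF eq reflection[OF y]])
  qed
  ultimately show ?thesis using Lim_transform_eventually by force
qed

definition scaled :: "real \<Rightarrow> real" where
  "scaled s = (g (exp s) - g 0) / exp s"

lemma mix_scaled:
  assumes "0 < y" "y < 1"
  shows "mix y scaled s = (g (y * exp s) + g ((1 - y) * exp s) - 2 * g 0) / exp s"
  using assms by (simp add: mix_def scaled_def exp_add mult.commute add_divide_distrib[symmetric] diff_divide_distrib[symmetric])

lemma mix_mix_scaled:
  assumes "0 < y" "y < 1"
  shows "mix y (mix y scaled) s = (g (y * (y * exp s)) + 2 * g (y * ((1 - y) * exp s)) + g ((1 - y) * ((1 - y) * exp s)) - 4 * g 0) / exp s"
proof -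
  have e: "exp (s + ln y) = y * exp s" "exp (s + ln (1 - y)) = (1 - y) * exp s" using assms by (simp_all add: exp_add)
  have c: "y * (A / (y * E)) + (1 - y) * (B / ((1 - y) * E)) = (A + B) / E" for A B E
    using assms by (simp add: add_divide_distrib)
  have "mix y (mix y scaled) s = y * mix y scaled (s + ln y) + (1 - y) * mix y scaled (s + ln (1 - y))"
    by (simp add: mix_def)
  also have "\<dots> = ((g (y * (y * exp s)) + g ((1 - y) * (y * exp s)) - 2 * g 0) + (g (y * ((1 - y) * exp s)) + g ((1 - y) * ((1 - y) * exp s)) - 2 * g 0)) / exp s"
    unfolding mix_scaled[OF assms] e c ..
  also have "(1 - y) * (y * exp s) = y * ((1 - y) * exp s)" by simp
  finally show ?thesis by (simp add: algebra_simps)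
qed

lemma mix_second_difference:
  assumes y: "0 < y" "y < e0"
  shows "((\<lambda>s. scaled s - 2 * mix y scaled s + mix y (mix y scaled) s) \<longlongrightarrow> 2 * y * (1 - y) * (f y + f (1 - y))) at_bot"
proof -
  have y1: "0 < y" "y < 1" using y e0_less by auto
  have "filterlim (\<lambda>s. y * exp s) (at_right 0) at_bot" using y by real_asymp
  from tendsto_mult[OF tendsto_const[of y] filterlim_compose[OF second_difference_at_0[OF y] this]]
  have "((\<lambda>s. y * ((g (y * exp s / y) - 2 * g (y * exp s) - 2 * g (y * exp s * (1 - y) / y) + g (y * exp s * y)
     + 2 * g (y * exp s * (1 - y)) + g (y * exp s * (1 - y)\<^sup>2 / y) - g 0) / (y * exp s)))
     \<longlongrightarrow> y * (2 * (1 - y) * (f y + f (1 - y)))) at_bot" .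
  moreover have "y * ((g (y * exp s / y) - 2 * g (y * exp s) - 2 * g (y * exp s * (1 - y) / y) + g (y * exp s * y)
     + 2 * g (y * exp s * (1 - y)) + g (y * exp s * (1 - y)\<^sup>2 / y) - g 0) / (y * exp s))
     = scaled s - 2 * mix y scaled s + mix y (mix y scaled) s" for s
  proof -
    have a: "y * exp s / y = exp s" "y * exp s * (1 - y) / y = (1 - y) * exp s" "y * exp s * y = y * (y * exp s)"
      "y * exp s * (1 - y) = y * ((1 - y) * exp s)" "y * exp s * (1 - y)\<^sup>2 / y = (1 - y) * ((1 - y) * exp s)"
      using y1 by (simp_all add: power2_eq_square)
    have b: "y * (A / (y * E)) = A / E" for A E using y1 by simp
    have c: "A / E - 2 * (B / E) + C / E = (A - 2 * B + C) / E" for A B C E :: real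
      by (simp add: add_divide_distrib diff_divide_distrib)
    show ?thesis unfolding mix_scaled[OF y1] mix_mix_scaled[OF y1] unfolding scaled_def a b c
      by (rule arg_cong[where f = "\<lambda>z. z / exp s"]) (use y1 in simp)
  qed
  ultimately show ?thesis by (simp add: mult.assoc mult.left_commute)
qed

text \<open>
  For \<open>y = 1/2\<close> the operator \<open>mix y\<close> is a translation by \<open>ln 2\<close>, so \<open>second_difference_growth\<close> determines the quadratic growth of
  \<open>scaled\<close>; by \<open>mix_second_order_limit\<close> this growth determines the limit for every other \<open>y\<close>. Values \<open>y \<ge> e0\<close> are reached
  through \<open>1 - y\<close>.
\<close>
lemma reflection_defect:
  "\<exists>a. \<forall>y. 0 < y \<longrightarrow> y < 1 \<longrightarrow> y * (1 - y) * (f y + f (1 - y)) = a * (entropy y)\<^sup>2"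
proof -
  have half: "(0::real) < 1/2" "1/2 < e0" "1/2 < (1::real)" using e0_bounds by auto
  define L :: real where "L = ln 2"
  define \<kappa> where "\<kappa> = 2 * (1/2) * (1 - 1/2) * (f (1/2) + f (1 - 1/2))"
  have L: "L > 0" by (simp add: L_def)
  have cont: "continuous_on {..-1} scaled"
    unfolding scaled_def[abs_def]
  proof (intro continuous_on_divide continuous_on_diff continuous_on_const continuous_on_exp continuous_on_id)
    show "continuous_on {..-1} (\<lambda>s. g (exp s))"
    proof (rule continuous_at_imp_continuous_on, rule ballI)
      fix s :: real assume "s \<in> {..-1}"
      then have "exp s < exp 0" by (subst exp_less_cancel_iff) simp
      then have "isCont g (exp s)" by (intro isCont_g) simp
      then show "isCont (\<lambda>s. g (exp s)) s" by (rule isCont_o2[OF isCont_exp])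
    qed
  qed simp
  have m: "mix (1/2) h = (\<lambda>s. h (s - L))" for h :: "real \<Rightarrow> real"
    by (rule ext) (simp add: mix_def L_def ln_div)
  have "((\<lambda>s. scaled s - 2 * scaled (s - L) + scaled (s - 2 * L)) \<longlongrightarrow> \<kappa>) at_bot"
    using mix_second_difference[OF half(1,2)] unfolding m \<kappa>_def by (simp add: algebra_simps)
  from second_difference_growth[OF L cont this]
  have q: "((\<lambda>s. scaled s / s\<^sup>2) \<longlongrightarrow> \<kappa> / (2 * L\<^sup>2)) at_bot" .
  define a where "a = \<kappa> / (2 * L\<^sup>2)"
  have small: "y * (1 - y) * (f y + f (1 - y)) = a * (entropy y)\<^sup>2" if y: "0 < y" "y < e0" for y
    using mix_second_order_limit[OF y(1) _ q mix_second_difference[OF y]] y e0_less by (simp add: a_def mult.assoc)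
  have "y * (1 - y) * (f y + f (1 - y)) = a * (entropy y)\<^sup>2" if y: "0 < y" "y < 1" for y
  proof (cases "y < e0")
    case False
    then have "0 < 1 - y" "1 - y < e0" using y e0_bounds by auto
    from small[OF this] show ?thesis by (simp add: entropy_commute algebra_simps)
  qed (use small y in auto)
  then show ?thesis by blast
qed

end

section \<open>Polylogarithms on the real line\<close>

lemma real_in_slit_plane: "x < 1 \<Longrightarrow> of_real x \<in> slit_plane"
  unfolding slit_plane_def by (auto simp: image_iff)

text \<open>
  On the unit disc this is termwise differentiation; \<open>z * deriv (polylog (Suc n)) z\<close> then agrees with \<open>polylog n\<close> everywhere by
  uniqueness of the continuation.
\<close>
lemma polylog_DERIV:
  assumes z: "z \<in> slit_plane" "z \<noteq> 0"
  shows "(polylog (Suc n) has_field_derivative polylog n z / z) (at z)"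
proof -
  define D where "D = deriv (polylog (Suc n))"
  have D: "(polylog (Suc n) has_field_derivative D w) (at w)" if "w \<in> slit_plane" for w
    unfolding D_def by (rule holomorphic_derivI[OF holomorphic_polylog open_slit_plane that])
  have "w * D w = polylog n w" if "w \<in> slit_plane" for w
  proof (rule polylog_unique[OF _ _ that])
    show "(\<lambda>w. w * D w) holomorphic_on slit_plane"
      unfolding D_def by (intro holomorphic_intros holomorphic_deriv holomorphic_polylog open_slit_plane)
    fix w :: complex assume w: "norm w < 1"
    have "((\<lambda>z. \<Sum>k. polylog_coeff (Suc n) k * z ^ k) has_field_derivative (\<Sum>k. diffs (polylog_coeff (Suc n)) k * w ^ k)) (at w)"
      using w summable_polylog_coeff by (intro termdiffs_strong') auto
    then have "(polylog (Suc n) has_field_derivative (\<Sum>k. diffs (polylog_coeff (Suc n)) k * w ^ k)) (at w)"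
    proof (rule has_field_derivative_transform_within_open[of _ _ _ "ball 0 1"])
      fix v :: complex assume "v \<in> ball 0 1"
      then show "(\<Sum>k. polylog_coeff (Suc n) k * v ^ k) = polylog (Suc n) v"
        using polylog_eq_series[of v "Suc n"] polylog_series_coeff[of v "Suc n"] by simp
    qed (use w in auto)
    moreover have "w \<in> slit_plane" using w ball_subset_slit_plane by auto
    ultimately have "D w = (\<Sum>k. diffs (polylog_coeff (Suc n)) k * w ^ k)" using D DERIV_unique by blast
    then show "w * D w = polylog_series n w"
      using diffs_polylog_coeff[OF w, of n] polylog_series_coeff[OF w, of n] by simp
  qed
  from this[OF z(1)] have "D z = polylog n z / z" using z by (simp add: field_simps)
  with D[OF z(1)] show ?thesis by simp
qed

lemma Re_polylog_DERIV:
  assumes "(polylog n has_field_derivative D) (at (of_real x))" "x < 1"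
  shows "(Li n has_real_derivative Re D) (at x)"
proof -
  have "((\<lambda>x. polylog n (of_real x)) has_vector_derivative D) (at x)"
    by (rule has_vector_derivative_real_field[OF assms(1)])
  then have "((\<lambda>x. Re (polylog n (of_real x))) has_real_derivative Re D) (at x)"
    by (rule has_field_derivative_Re)
  then show ?thesis
    by (rule has_field_derivative_transform_within_open[of _ _ _ "{..<1}"]) (use assms in \<open>auto simp: Li_def\<close>)
qed

lemma Li_DERIV:
  assumes "x < 1" "x \<noteq> 0"
  shows "(Li (Suc n) has_real_derivative Li n x / x) (at x)"
proof -
  have "(Li (Suc n) has_real_derivative Re (polylog n (of_real x) / of_real x)) (at x)"
    by (intro Re_polylog_DERIV polylog_DERIV real_in_slit_plane) (use assms in auto)
  then show ?thesis using assms by (simp add: Li_def Re_divide_of_real)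
qed

lemma Li_differentiable:
  assumes "x < 1" shows "\<exists>D. (Li n has_real_derivative D) (at x)"
  using Re_polylog_DERIV[OF holomorphic_derivI[OF holomorphic_polylog open_slit_plane real_in_slit_plane[OF assms]] assms] by blast

lemma isCont_Li: "x < 1 \<Longrightarrow> isCont (Li n) x"
  using Li_differentiable DERIV_isCont by blast

lemma Li_0 [simp]: "Li n 0 = 0"
proof -
  have "polylog n 0 = 0" by (subst polylog_eq_series) (auto simp: polylog_series_def)
  then show ?thesis by (simp add: Li_def)
qed

lemma Li_1:
  assumes "x < 1" shows "Li 1 x = - ln (1 - x)"
proof -
  have "polylog 1 (of_real x) = - Ln (of_real (1 - x))"
    using polylog_1[OF real_in_slit_plane[OF assms]] by simp
  also have "\<dots> = of_real (- ln (1 - x))" using assms by (subst Ln_of_real) auto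
  finally show ?thesis using assms by (simp add: Li_def)
qed

lemma Li_summable:
  assumes "0 \<le> x" "x < 1"
  shows "summable (\<lambda>k. x ^ Suc k / real (Suc k) ^ n)"
proof (rule summable_comparison_test[OF _ summable_geometric])
  have "norm (x ^ Suc k / real (Suc k) ^ n) \<le> x ^ k" for k
  proof -
    have "x ^ Suc k / real (Suc k) ^ n \<le> x ^ Suc k / 1"
      by (intro divide_left_mono) (use assms in \<open>auto simp: one_le_power\<close>)
    also have "\<dots> \<le> x ^ k" using assms by (simp add: mult_left_le_one_le)
    finally show ?thesis using assms by simp
  qed
  then show "\<exists>N. \<forall>k\<ge>N. norm (x ^ Suc k / real (Suc k) ^ n) \<le> x ^ k" by blast
qed (use assms in auto)

lemma Li_series:
  assumes "0 \<le> x" "x < 1"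
  shows "Li n x = (\<Sum>k. x ^ Suc k / real (Suc k) ^ n)"
proof -
  have "polylog n (of_real x) = (\<Sum>k. of_real (x ^ Suc k / real (Suc k) ^ n))"
    using assms by (subst polylog_eq_series) (auto simp: polylog_series_def)
  also have "\<dots> = of_real (\<Sum>k. x ^ Suc k / real (Suc k) ^ n)"
    by (rule suminf_of_real[OF Li_summable[OF assms], symmetric])
  finally show ?thesis using assms by (simp add: Li_def)
qed

lemma Li_nonneg: "0 \<le> x \<Longrightarrow> x < 1 \<Longrightarrow> 0 \<le> Li n x"
  unfolding Li_series by (intro suminf_nonneg Li_summable) auto

text \<open>
  The series converges uniformly on \<open>[0, 1]\<close> for \<open>n \<ge> 2\<close>.
\<close>
lemma Li_tendsto_1:
  assumes "n \<ge> 2"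
  shows "(Li n \<longlongrightarrow> Li n 1) (at_left 1)"
proof -
  have M: "summable (\<lambda>k. 1 / real (Suc k) ^ n)"
    using inverse_power_summable[OF assms, where 'a = real] summable_Suc_iff[of "\<lambda>k. inverse (real k ^ n)"]
    by (simp add: inverse_eq_divide)
  have "uniform_limit {0..1} (\<lambda>N x. \<Sum>k<N. x ^ Suc k / real (Suc k) ^ n) (\<lambda>x. \<Sum>k. x ^ Suc k / real (Suc k) ^ n) sequentially"
  proof (rule Weierstrass_m_test[OF _ M])
    fix k and x :: real assume "x \<in> {0..1}"
    then have "x ^ Suc k \<le> 1" "0 \<le> x ^ Suc k" by (auto intro: power_le_one simp del: power_Suc)
    then show "norm (x ^ Suc k / real (Suc k) ^ n) \<le> 1 / real (Suc k) ^ n"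
      by (simp add: divide_right_mono del: power_Suc of_nat_Suc)
  qed
  then have "continuous_on {0..1} (\<lambda>x. \<Sum>k. x ^ Suc k / real (Suc k) ^ n)"
    by (rule uniform_limit_theorem[rotated]) (auto intro!: always_eventually continuous_intros)
  then have "continuous_on {0..1} (Li n)"
  proof (rule continuous_on_eq)
    fix x :: real assume "x \<in> {0..1}"
    then show "(\<Sum>k. x ^ Suc k / real (Suc k) ^ n) = Li n x"
      by (cases "x = 1") (auto simp: Li_series, simp add: Li_def)
  qed
  then have "(Li n \<longlongrightarrow> Li n 1) (at 1 within {0..1})" by (auto simp: continuous_on_def)
  then show ?thesis by (simp add: at_within_Icc_at_left)
qed

lemma Li_2_1: "Li 2 1 = pi\<^sup>2 / 6"
  using sums_unique[OF inverse_squares_sums] by (simp add: Li_def add.commute)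

lemma Li2_DERIV: "t < 1 \<Longrightarrow> t \<noteq> 0 \<Longrightarrow> (Li 2 has_real_derivative (- ln (1 - t)) / t) (at t)"
  using Li_DERIV[of t 1] Li_1[of t] by (simp add: numeral_2_eq_2)

lemma Li3_DERIV: "t < 1 \<Longrightarrow> t \<noteq> 0 \<Longrightarrow> (Li 3 has_real_derivative Li 2 t / t) (at t)"
  using Li_DERIV[of t 2] by (simp add: numeral_3_eq_3 numeral_2_eq_2)

lemma zero_derivative_imp_limit:
  fixes h :: "real \<Rightarrow> real"
  assumes d: "\<And>t. a < t \<Longrightarrow> t < b \<Longrightarrow> (h has_real_derivative 0) (at t)" and t: "a < t" "t < b"
    and lim: "(h \<longlongrightarrow> c) (at_right a) \<or> (h \<longlongrightarrow> c) (at_left b)"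
  shows "h t = c"
proof -
  have ab: "a < b" using t by simp
  have "\<exists>C. \<forall>x\<in>{a<..<b}. h x = C"
    by (rule has_field_derivative_zero_constant) (auto intro: d DERIV_subset)
  then obtain C where C: "\<And>x. x \<in> {a<..<b} \<Longrightarrow> h x = C" by blast
  have "\<forall>\<^sub>F x in at_right a. C = h x" using eventually_at_right_real[OF ab] by eventually_elim (simp add: C)
  moreover have "\<forall>\<^sub>F x in at_left b. C = h x" using eventually_at_left_real[OF ab] by eventually_elim (simp add: C)
  ultimately have "(h \<longlongrightarrow> C) (at_right a)" "(h \<longlongrightarrow> C) (at_left b)"
    using Lim_transform_eventually[OF tendsto_const] by blast+
  then have "C = c" using lim tendsto_unique[of "at_right a"] tendsto_unique[of "at_left b"] by auto
  then show ?thesis using C t by auto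
qed

lemma reflection_map_DERIVs:
  fixes t :: real
  assumes "0 < t" "t < 1"
  shows "((\<lambda>y. y) has_real_derivative t * (1 / t)) (at t)"
    "((\<lambda>y. 1 - y) has_real_derivative (1 - t) * (- 1 / (1 - t))) (at t)"
    "((\<lambda>y. - ((1 - y) / y)) has_real_derivative - ((1 - t) / t) * (- 1 / (t * (1 - t)))) (at t)"
    "1 - - ((1 - t) / t) = 1 / t" "- ((1 - t) / t) < 1" "- ((1 - t) / t) \<noteq> 0"
proof -
  have "(1 - t) / t > 0" using assms by simp
  then show "- ((1 - t) / t) < 1" by linarith
qed (use assms in \<open>auto intro!: derivative_eq_intros simp: divide_simps\<close>)

text \<open>
  The derivative vanishes, and the limit at 0 is \<open>Li 2 1\<close>.
\<close>
lemma Li2_reflection: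
  assumes "0 < y" "y < 1"
  shows "Li 2 y + Li 2 (1 - y) + ln y * ln (1 - y) = pi\<^sup>2 / 6"
proof (rule zero_derivative_imp_limit[OF _ assms])
  fix t :: real assume t: "0 < t" "t < 1"
  have "((\<lambda>y. Li 2 y + Li 2 (1 - y) + ln y * ln (1 - y)) has_real_derivative
     (- ln (1 - t)) * (1 / t) + (- ln (1 - (1 - t))) * (- 1 / (1 - t)) + (1 / t * ln (1 - t) + (- 1 / (1 - t)) * ln t)) (at t)"
    by (intro DERIV_add DERIV_mult theta_chain[where g = "Li 2" and f = "\<lambda>t. - ln (1 - t)"] Li2_DERIV reflection_map_DERIVs)
      (use t in \<open>auto intro!: derivative_eq_intros\<close>)
  then show "((\<lambda>y. Li 2 y + Li 2 (1 - y) + ln y * ln (1 - y)) has_real_derivative 0) (at t)"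
    by (rule DERIV_cong) (use t in \<open>simp add: field_simps\<close>)
next
  have "((\<lambda>y. Li 2 y + Li 2 (1 - y) + ln y * ln (1 - y)) \<longlongrightarrow> Li 2 0 + Li 2 1 + 0) (at_right 0)"
  proof (intro tendsto_add)
    show "(Li 2 \<longlongrightarrow> Li 2 0) (at_right 0)" using isCont_Li[of 0 2] by (auto simp: isCont_def intro: tendsto_within_subset)
    have "filterlim (\<lambda>y::real. 1 - y) (at_left 1) (at_right 0)" by real_asymp
    then show "((\<lambda>y. Li 2 (1 - y)) \<longlongrightarrow> Li 2 1) (at_right 0)" by (rule filterlim_compose[OF Li_tendsto_1[of 2], rotated]) simp
    show "((\<lambda>y::real. ln y * ln (1 - y)) \<longlongrightarrow> 0) (at_right 0)" by real_asymp
  qed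
  then show "((\<lambda>y. Li 2 y + Li 2 (1 - y) + ln y * ln (1 - y)) \<longlongrightarrow> pi\<^sup>2 / 6) (at_right 0) \<or>
     ((\<lambda>y. Li 2 y + Li 2 (1 - y) + ln y * ln (1 - y)) \<longlongrightarrow> pi\<^sup>2 / 6) (at_left 1)"
    by (simp add: Li_2_1)
qed

lemma Li_small_tendsto: "((\<lambda>y. Li n (1 - y)) \<longlongrightarrow> 0) (at_left 1)" "((\<lambda>y. Li n (- ((1 - y) / y))) \<longlongrightarrow> 0) (at_left 1)"
proof -
  have c: "isCont (Li n) 0" by (simp add: isCont_Li)
  have "((\<lambda>y::real. 1 - y) \<longlongrightarrow> 0) (at_left 1)" "((\<lambda>y::real. - ((1 - y) / y)) \<longlongrightarrow> 0) (at_left 1)"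
    by (auto intro!: tendsto_eq_intros)
  from this[THEN isCont_tendsto_compose[OF c]]
  show "((\<lambda>y. Li n (1 - y)) \<longlongrightarrow> 0) (at_left 1)" "((\<lambda>y. Li n (- ((1 - y) / y))) \<longlongrightarrow> 0) (at_left 1)" by simp_all
qed

text \<open>
  The derivative vanishes, and the limit at 1 is 0.
\<close>
lemma Li2_Landen:
  assumes "0 < y" "y < 1"
  shows "Li 2 (1 - y) + Li 2 (- ((1 - y) / y)) + (ln y)\<^sup>2 / 2 = 0"
proof (rule zero_derivative_imp_limit[OF _ assms])
  fix t :: real assume t: "0 < t" "t < 1"
  have "((\<lambda>y. Li 2 (1 - y) + Li 2 (- ((1 - y) / y)) + (ln y)\<^sup>2 / 2) has_real_derivative
     (- ln (1 - (1 - t))) * (- 1 / (1 - t)) + (- ln (1 - - ((1 - t) / t))) * (- 1 / (t * (1 - t))) + ln t / t) (at t)"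
    by (intro DERIV_add theta_chain[where g = "Li 2" and f = "\<lambda>t. - ln (1 - t)"] Li2_DERIV reflection_map_DERIVs)
      (use t reflection_map_DERIVs(5)[OF t] in \<open>auto intro!: derivative_eq_intros\<close>)
  then show "((\<lambda>y. Li 2 (1 - y) + Li 2 (- ((1 - y) / y)) + (ln y)\<^sup>2 / 2) has_real_derivative 0) (at t)"
  proof (rule DERIV_cong)
    have "(- ln (1 - (1 - t))) * (- 1 / (1 - t)) + (- ln (1 - - ((1 - t) / t))) * (- 1 / (t * (1 - t))) + ln t / t
      = ln t * (1 / (1 - t) - 1 / (t * (1 - t)) + 1 / t)"
      unfolding reflection_map_DERIVs(4)[OF t] using t by (simp add: ln_div algebra_simps)
    also have "1 / (1 - t) - 1 / (t * (1 - t)) + 1 / t = 0" using t by (simp add: divide_simps)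
    finally show "(- ln (1 - (1 - t))) * (- 1 / (1 - t)) + (- ln (1 - - ((1 - t) / t))) * (- 1 / (t * (1 - t))) + ln t / t = 0" by simp
  qed
next
  have "((\<lambda>y. Li 2 (1 - y) + Li 2 (- ((1 - y) / y)) + (ln y)\<^sup>2 / 2) \<longlongrightarrow> 0 + 0 + (ln 1)\<^sup>2 / 2) (at_left (1::real))"
    by (intro tendsto_intros Li_small_tendsto) auto
  then show "((\<lambda>y. Li 2 (1 - y) + Li 2 (- ((1 - y) / y)) + (ln y)\<^sup>2 / 2) \<longlongrightarrow> 0) (at_right 0) \<or>
     ((\<lambda>y. Li 2 (1 - y) + Li 2 (- ((1 - y) / y)) + (ln y)\<^sup>2 / 2) \<longlongrightarrow> 0) (at_left 1)" by simp
qed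

text \<open>
  By \<open>Li2_reflection\<close> and \<open>Li2_Landen\<close> the derivative vanishes; the limit at 1 is \<open>Li 3 1\<close>.
\<close>
lemma Li3_Landen:
  assumes "0 < y" "y < 1"
  shows "Li 3 y + Li 3 (1 - y) + Li 3 (- ((1 - y) / y)) - (ln y) ^ 3 / 6 - pi\<^sup>2 / 6 * ln y + (ln y)\<^sup>2 * ln (1 - y) / 2 = Li 3 1"
proof (rule zero_derivative_imp_limit[OF _ assms])
  fix t :: real assume t: "0 < t" "t < 1"
  have "((\<lambda>y. Li 3 y + Li 3 (1 - y) + Li 3 (- ((1 - y) / y)) - (ln y) ^ 3 / 6 - pi\<^sup>2 / 6 * ln y + (ln y)\<^sup>2 * ln (1 - y) / 2) has_real_derivative
     Li 2 t * (1 / t) + Li 2 (1 - t) * (- 1 / (1 - t)) + Li 2 (- ((1 - t) / t)) * (- 1 / (t * (1 - t)))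
      - (ln t)\<^sup>2 / (2 * t) - pi\<^sup>2 / 6 * (1 / t) + (2 * ln t / t * ln (1 - t) + (- 1 / (1 - t)) * (ln t)\<^sup>2) / 2) (at t)"
    by (intro DERIV_add DERIV_diff DERIV_cmult DERIV_cdivide DERIV_mult theta_chain[where g = "Li 3" and f = "Li 2"] Li3_DERIV reflection_map_DERIVs)
      (use t reflection_map_DERIVs(5)[OF t] in \<open>auto intro!: derivative_eq_intros simp: power2_eq_square divide_simps\<close>)
  then show "((\<lambda>y. Li 3 y + Li 3 (1 - y) + Li 3 (- ((1 - y) / y)) - (ln y) ^ 3 / 6 - pi\<^sup>2 / 6 * ln y + (ln y)\<^sup>2 * ln (1 - y) / 2) has_real_derivative 0) (at t)"
  proof (rule DERIV_cong)
    define u v p where "u = ln t" and "v = ln (1 - t)" and "p = Li 2 (1 - t)"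
    have 1: "Li 2 t = pi\<^sup>2 / 6 - u * v - p" using Li2_reflection[OF t] by (simp add: u_def v_def p_def)
    have 2: "Li 2 (- ((1 - t) / t)) = - u\<^sup>2 / 2 - p" using Li2_Landen[OF t] by (simp add: u_def p_def)
    show "Li 2 t * (1 / t) + Li 2 (1 - t) * (- 1 / (1 - t)) + Li 2 (- ((1 - t) / t)) * (- 1 / (t * (1 - t)))
      - (ln t)\<^sup>2 / (2 * t) - pi\<^sup>2 / 6 * (1 / t) + (2 * ln t / t * ln (1 - t) + (- 1 / (1 - t)) * (ln t)\<^sup>2) / 2 = 0"
      unfolding 1 2 u_def[symmetric] v_def[symmetric] p_def[symmetric]
      using t by (simp add: divide_simps) (simp add: algebra_simps power2_eq_square)
  qed
next
  have "((\<lambda>y. Li 3 y + Li 3 (1 - y) + Li 3 (- ((1 - y) / y)) - (ln y) ^ 3 / 6 - pi\<^sup>2 / 6 * ln y + (ln y)\<^sup>2 * ln (1 - y) / 2)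
      \<longlongrightarrow> Li 3 1 + 0 + 0 - (ln 1) ^ 3 / 6 - pi\<^sup>2 / 6 * ln 1 + 0 / 2) (at_left (1::real))"
  proof (intro tendsto_intros Li_small_tendsto Li_tendsto_1)
    show "((\<lambda>y::real. (ln y)\<^sup>2 * ln (1 - y)) \<longlongrightarrow> 0) (at_left 1)" by real_asymp
  qed auto
  then show "((\<lambda>y. Li 3 y + Li 3 (1 - y) + Li 3 (- ((1 - y) / y)) - (ln y) ^ 3 / 6 - pi\<^sup>2 / 6 * ln y + (ln y)\<^sup>2 * ln (1 - y) / 2) \<longlongrightarrow> Li 3 1) (at_right 0) \<or>
     ((\<lambda>y. Li 3 y + Li 3 (1 - y) + Li 3 (- ((1 - y) / y)) - (ln y) ^ 3 / 6 - pi\<^sup>2 / 6 * ln y + (ln y)\<^sup>2 * ln (1 - y) / 2) \<longlongrightarrow> Li 3 1) (at_left 1)"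
    by simp
qed

text \<open>
  If the \<open>x\<close>-derivative of a combination of the nine terms is known, the combination follows from its limit at \<open>x = 0\<close>.
\<close>
lemma combination_value:
  fixes g f h D R :: "real \<Rightarrow> real"
  assumes g: "\<And>t. t < 1 \<Longrightarrow> t \<noteq> 0 \<Longrightarrow> (g has_real_derivative f t / t) (at t)" and g0: "isCont g 0" "g 0 = 0"
    and xy: "0 < x" "x < y" "y < 1" and R: "R = (\<lambda>x. (1 - y) / (1 - x))"
    and h: "\<And>x. 0 < x \<Longrightarrow> x < y \<Longrightarrow> (h has_real_derivative D x) (at x)" "(h \<longlongrightarrow> 0) (at_right 0)"
    and D: "\<And>x. 0 < x \<Longrightarrow> x < y \<Longrightarrow>
      (c1 * f x + c3 * f (x / y) + c5 * f (x * R x / y) + c6 * f (x * y) + c7 * f (- (x * R x)) + c9 * f (x * (R x)\<^sup>2 / y)) / x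
     + (c4 * f (R x) + c5 * f (x * R x / y) + c7 * f (- (x * R x)) + c8 * f (- (R x / y)) + 2 * c9 * f (x * (R x)\<^sup>2 / y)) / (1 - x) = D x"
  shows "c1 * g x + c2 * g y + c3 * g (x / y) + c4 * g (R x) + c5 * g (x * R x / y) + c6 * g (x * y)
      + c7 * g (- (x * R x)) + c8 * g (- (R x / y)) + c9 * g (x * (R x)\<^sup>2 / y)
     = c2 * g y + c4 * g (1 - y) + c8 * g (- ((1 - y) / y)) + h x"
proof -
  have c: "isCont g t" if "t < 1" for t using g0(1) DERIV_isCont[OF g[OF that]] by (cases "t = 0") auto
  have y: "0 < y" using xy by simp
  define G where "G x = c1 * g x + c2 * g y + c3 * g (x / y) + c4 * g (R x) + c5 * g (x * R x / y) + c6 * g (x * y)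
      + c7 * g (- (x * R x)) + c8 * g (- (R x / y)) + c9 * g (x * (R x)\<^sup>2 / y)" for x
  have "G x - h x = c2 * g y + c4 * g (1 - y) + c8 * g (- ((1 - y) / y))"
  proof (rule zero_derivative_imp_limit[OF _ xy(1,2)])
    fix t assume t: "0 < t" "t < y"
    have "(G has_real_derivative D t) (at t)"
      unfolding G_def[abs_def] by (rule DERIV_cong[OF combination_DERIV[where g = g and f = f, OF _ t xy(3) R] D[OF t]]) (rule g)
    from DERIV_diff[OF this h(1)[OF t]] show "((\<lambda>x. G x - h x) has_real_derivative 0) (at t)" by simp
  next
    have "(G \<longlongrightarrow> c1 * g 0 + c2 * g y + c3 * g 0 + c4 * g (1 - y) + c5 * g 0 + c6 * g 0 + c7 * g 0 + c8 * g (- ((1 - y) / y)) + c9 * g 0) (at_right 0)"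
      unfolding G_def[abs_def] by (rule combination_tendsto[OF c y xy(3) R])
    from tendsto_diff[OF this h(2)]
    show "((\<lambda>x. G x - h x) \<longlongrightarrow> c2 * g y + c4 * g (1 - y) + c8 * g (- ((1 - y) / y))) (at_right 0) \<or>
      ((\<lambda>x. G x - h x) \<longlongrightarrow> c2 * g y + c4 * g (1 - y) + c8 * g (- ((1 - y) / y))) (at_left y)" by (simp add: g0)
  qed
  then show ?thesis by (simp add: G_def)
qed

text \<open>
  For each argument \<open>U\<close>, the number \<open>1 - U\<close> factors into powers of \<open>y\<close>, \<open>1 - x\<close>, \<open>y - x\<close> and \<open>1 - x y\<close>. This is why the
  logarithms in the derivatives below cancel.
\<close>
lemma ratio_logs:
  fixes x y r :: real
  assumes xy: "0 < x" "x < y" "y < 1" and r: "r = (1 - y) / (1 - x)"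
  shows "ln (1 - x / y) = ln (y - x) - ln y"
    "ln (1 - r) = ln (y - x) - ln (1 - x)"
    "ln (1 - x * r / y) = ln (y - x) - ln y - ln (1 - x)"
    "ln (1 - - (x * r)) = ln (1 - x * y) - ln (1 - x)"
    "ln (1 - - (r / y)) = ln (1 - x * y) - ln y - ln (1 - x)"
    "ln (1 - x * r\<^sup>2 / y) = ln (y - x) + ln (1 - x * y) - ln y - 2 * ln (1 - x)"
    "x / y / (1 - x / y) = x / (y - x)"
    "r / (1 - r) = (1 - y) / (y - x)"
    "x * r / y / (1 - x * r / y) = x * (1 - y) / (y - x)"
    "- (x * r) / (1 - - (x * r)) = - (x * (1 - y) / (1 - x * y))"
    "- (r / y) / (1 - - (r / y)) = - ((1 - y) / (1 - x * y))"
    "x * r\<^sup>2 / y / (1 - x * r\<^sup>2 / y) = x * (1 - y)\<^sup>2 / ((y - x) * (1 - x * y))"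
proof -
  have p: "0 < y" "0 < 1 - x" "0 < y - x" "0 < 1 - x * y" using xy ratio_bounds(6)[OF xy r] by auto
  have e: "1 - x / y = (y - x) / y" "1 - r = (y - x) / (1 - x)" "1 - x * r / y = (y - x) / (y * (1 - x))"
    "1 - - (x * r) = (1 - x * y) / (1 - x)" "1 - - (r / y) = (1 - x * y) / (y * (1 - x))"
    using p unfolding r by (simp_all add: divide_simps) (simp_all add: algebra_simps)
  have e9: "1 - x * r\<^sup>2 / y = (y - x) * (1 - x * y) / (y * (1 - x)\<^sup>2)"
    using p unfolding r power_divide by (simp add: divide_simps) (simp add: algebra_simps power2_eq_square)
  show "ln (1 - x / y) = ln (y - x) - ln y" "ln (1 - r) = ln (y - x) - ln (1 - x)"
    "ln (1 - x * r / y) = ln (y - x) - ln y - ln (1 - x)" "ln (1 - - (x * r)) = ln (1 - x * y) - ln (1 - x)"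
    "ln (1 - - (r / y)) = ln (1 - x * y) - ln y - ln (1 - x)"
    unfolding e using p by (simp_all add: ln_div ln_mult)
  show "ln (1 - x * r\<^sup>2 / y) = ln (y - x) + ln (1 - x * y) - ln y - 2 * ln (1 - x)"
    unfolding e9 using p by (simp add: ln_div ln_mult ln_realpow)
  show "x / y / (1 - x / y) = x / (y - x)" "r / (1 - r) = (1 - y) / (y - x)"
    "x * r / y / (1 - x * r / y) = x * (1 - y) / (y - x)"
    unfolding e unfolding r using p by simp_all
  show "- (x * r) / (1 - - (x * r)) = - (x * (1 - y) / (1 - x * y))" "- (r / y) / (1 - - (r / y)) = - ((1 - y) / (1 - x * y))"
    unfolding e divide_minus_left unfolding r by (rule arg_cong[where f = uminus], use p in simp)+
  show "x * r\<^sup>2 / y / (1 - x * r\<^sup>2 / y) = x * (1 - y)\<^sup>2 / ((y - x) * (1 - x * y))"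
    unfolding e9 unfolding r power_divide using p by (simp add: power2_eq_square)
qed

text \<open>
  The sums \<open>A\<close> and \<open>S\<close> of \<open>derivative_equations\<close>, for \<open>f = Li 2\<close>: their \<open>x\<close>-derivatives vanish by \<open>ratio_logs\<close>, and
  \<open>Li2_Landen\<close> evaluates them at \<open>x = 0\<close>.
\<close>
lemma Li2_relations:
  assumes xy: "0 < x" "x < y" "y < 1" and R: "r = (1 - y) / (1 - x)"
  shows "2 * Li 2 x - Li 2 (x / y) + 2 * Li 2 (x * r / y) - Li 2 (x * y) + 2 * Li 2 (- (x * r)) - Li 2 (x * r\<^sup>2 / y) = 0"
    and "2 * (Li 2 r + Li 2 (x * r / y) + Li 2 (- (x * r)) + Li 2 (- (r / y)) - Li 2 (x * r\<^sup>2 / y)) = - (ln y)\<^sup>2"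
proof -
  define R where "R = (\<lambda>x. (1 - y) / (1 - x))"
  have Rr: "R x = r" by (simp add: R_def assms)
  have y: "0 < y" using xy by simp
  note v = combination_value[OF Li2_DERIV isCont_Li[OF zero_less_one] Li_0 xy R_def DERIV_const tendsto_const]
  have "2 * Li 2 x + 0 * Li 2 y + (- 1) * Li 2 (x / y) + 0 * Li 2 (R x) + 2 * Li 2 (x * R x / y) + (- 1) * Li 2 (x * y)
      + 2 * Li 2 (- (x * R x)) + 0 * Li 2 (- (R x / y)) + (- 1) * Li 2 (x * (R x)\<^sup>2 / y)
     = 0 * Li 2 y + 0 * Li 2 (1 - y) + 0 * Li 2 (- ((1 - y) / y)) + 0"
  proof (rule v)
    fix t assume t: "0 < t" "t < y"
    note L = ratio_logs[OF t xy(3) R_def[THEN fun_cong, of t]]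
    show "(2 * - ln (1 - t) + (- 1) * - ln (1 - t / y) + 2 * - ln (1 - t * R t / y) + (- 1) * - ln (1 - t * y) +
      2 * - ln (1 - - (t * R t)) + (- 1) * - ln (1 - t * (R t)\<^sup>2 / y)) / t +
     (0 * - ln (1 - R t) + 2 * - ln (1 - t * R t / y) + 2 * - ln (1 - - (t * R t)) + 0 * - ln (1 - - (R t / y)) +
      2 * (- 1) * - ln (1 - t * (R t)\<^sup>2 / y)) / (1 - t) = 0"
      unfolding L by simp
  qed simp
  then show "2 * Li 2 x - Li 2 (x / y) + 2 * Li 2 (x * r / y) - Li 2 (x * y) + 2 * Li 2 (- (x * r)) - Li 2 (x * r\<^sup>2 / y) = 0"
    unfolding Rr by simp
  have "0 * Li 2 x + 0 * Li 2 y + 0 * Li 2 (x / y) + 2 * Li 2 (R x) + 2 * Li 2 (x * R x / y) + 0 * Li 2 (x * y)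
      + 2 * Li 2 (- (x * R x)) + 2 * Li 2 (- (R x / y)) + (- 2) * Li 2 (x * (R x)\<^sup>2 / y)
     = 0 * Li 2 y + 2 * Li 2 (1 - y) + 2 * Li 2 (- ((1 - y) / y)) + 0"
  proof (rule v)
    fix t assume t: "0 < t" "t < y"
    note L = ratio_logs[OF t xy(3) R_def[THEN fun_cong, of t]]
    show "(0 * - ln (1 - t) + 0 * - ln (1 - t / y) + 2 * - ln (1 - t * R t / y) + 0 * - ln (1 - t * y) +
      2 * - ln (1 - - (t * R t)) + (- 2) * - ln (1 - t * (R t)\<^sup>2 / y)) / t +
     (2 * - ln (1 - R t) + 2 * - ln (1 - t * R t / y) + 2 * - ln (1 - - (t * R t)) + 2 * - ln (1 - - (R t / y)) +
      2 * (- 2) * - ln (1 - t * (R t)\<^sup>2 / y)) / (1 - t) = 0"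
      unfolding L by simp
  qed simp
  then show "2 * (Li 2 r + Li 2 (x * r / y) + Li 2 (- (x * r)) + Li 2 (- (r / y)) - Li 2 (x * r\<^sup>2 / y)) = - (ln y)\<^sup>2"
    unfolding Rr using Li2_Landen[OF y xy(3)] by simp
qed

lemma kummer_sum_Li3:
  assumes xy: "0 < x" "x < y" "y < 1"
  shows "kummer_sum (Li 3) x y = E3 x y"
proof -
  define R where "R = (\<lambda>x. (1 - y) / (1 - x))"
  have y: "0 < y" "x < 1" using xy by auto
  have "2 * Li 3 x + 2 * Li 3 y + (- 1) * Li 3 (x / y) + 2 * Li 3 (R x) + 2 * Li 3 (x * R x / y) + (- 1) * Li 3 (x * y)
      + 2 * Li 3 (- (x * R x)) + 2 * Li 3 (- (R x / y)) + (- 1) * Li 3 (x * (R x)\<^sup>2 / y)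
     = 2 * Li 3 y + 2 * Li 3 (1 - y) + 2 * Li 3 (- ((1 - y) / y)) + (ln y)\<^sup>2 * ln (1 - x)"
  proof (rule combination_value[OF Li3_DERIV isCont_Li[OF zero_less_one] Li_0 xy R_def])
    fix t assume t: "0 < t" "t < y"
    note L = Li2_relations[OF t xy(3) R_def[THEN fun_cong, of t]]
    show "((\<lambda>x. (ln y)\<^sup>2 * ln (1 - x)) has_real_derivative - (ln y)\<^sup>2 / (1 - t)) (at t)"
      using t xy by (auto intro!: derivative_eq_intros)
    show "(2 * Li 2 t + (- 1) * Li 2 (t / y) + 2 * Li 2 (t * R t / y) + (- 1) * Li 2 (t * y) +
      2 * Li 2 (- (t * R t)) + (- 1) * Li 2 (t * (R t)\<^sup>2 / y)) / t +
     (2 * Li 2 (R t) + 2 * Li 2 (t * R t / y) + 2 * Li 2 (- (t * R t)) + 2 * Li 2 (- (R t / y)) +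
      2 * (- 1) * Li 2 (t * (R t)\<^sup>2 / y)) / (1 - t) = - (ln y)\<^sup>2 / (1 - t)"
      unfolding L(2)[symmetric] using L(1) by (simp add: algebra_simps)
  next
    have "((\<lambda>x. (ln y)\<^sup>2 * ln (1 - x)) \<longlongrightarrow> (ln y)\<^sup>2 * ln (1 - 0)) (at_right (0::real))"
      by (intro tendsto_intros) auto
    then show "((\<lambda>x. (ln y)\<^sup>2 * ln (1 - x)) \<longlongrightarrow> 0) (at_right (0::real))" by simp
  qed simp_all
  also have "\<dots> = E3 x y"
    using Li3_Landen[OF y(1) xy(3)] y xy by (simp add: E3_def ln_div algebra_simps)
  finally show ?thesis
    using kummer_sum_ratio[of x y "R x" "Li 3"] y xy by (simp add: R_def)
qed

section \<open>The single-valued trilogarithm\<close>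

definition sv :: "real \<Rightarrow> real" where "sv x = sv_trilog (of_real x)"

lemma sv_trilog_real:
  assumes "x < 1"
  shows "sv x = Li 3 x - ln \<bar>x\<bar> * Li 2 x - (ln \<bar>x\<bar>)\<^sup>2 / 3 * ln (1 - x)"
proof (cases "x = 0")
  case False
  have "sv x = Li 3 x - ln \<bar>x\<bar> * Li 2 x + (ln \<bar>x\<bar>)\<^sup>2 / 3 * Li 1 x"
    using assms False by (simp add: sv_def sv_trilog_def Li_def del: One_nat_def of_real_power of_real_divide)
  then show ?thesis using Li_1[OF assms] by simp
qed (simp add: sv_def sv_trilog_def)

text \<open>
  The Euler derivative \<open>t d/dt\<close> of \<open>3 * sv\<close>. It is elementary because the terms with \<open>Li 2\<close> cancel.
\<close>
definition theta_sv :: "real \<Rightarrow> real" where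
  "theta_sv t = ln \<bar>t\<bar> * ln (1 - t) + t / (1 - t) * (ln \<bar>t\<bar>)\<^sup>2"

lemma ln_abs_DERIV:
  fixes t :: real
  assumes "t \<noteq> 0" shows "((\<lambda>x. ln \<bar>x\<bar>) has_real_derivative 1 / t) (at t)"
proof (cases "t > 0")
  case True
  have "(ln has_real_derivative 1 / t) (at t)" using True by (rule DERIV_ln_divide)
  then show ?thesis
    by (rule has_field_derivative_transform_within_open[of _ _ _ "{0<..}"]) (use True in auto)
next
  case False
  then have "((\<lambda>x. ln (- x)) has_real_derivative 1 / t) (at t)"
    using assms by (auto intro!: derivative_eq_intros)
  then show ?thesis
    by (rule has_field_derivative_transform_within_open[of _ _ _ "{..<0}"]) (use False assms in auto)
qed

lemma sv_DERIV:
  assumes t: "t < 1" "t \<noteq> 0"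
  shows "((\<lambda>t. 3 * sv t) has_real_derivative theta_sv t / t) (at t)"
proof -
  have "((\<lambda>x. 3 * (Li 3 x - ln \<bar>x\<bar> * Li 2 x - (ln \<bar>x\<bar>)\<^sup>2 / 3 * ln (1 - x))) has_real_derivative
     3 * (Li 2 t / t - (1 / t * Li 2 t + (- ln (1 - t)) / t * ln \<bar>t\<bar>)
       - (2 * ln \<bar>t\<bar> * (1 / t) / 3 * ln (1 - t) + (- 1 / (1 - t)) * ((ln \<bar>t\<bar>)\<^sup>2 / 3)))) (at t)"
  proof (intro DERIV_cmult DERIV_diff DERIV_mult DERIV_cdivide Li3_DERIV Li2_DERIV ln_abs_DERIV t)
    show "((\<lambda>x. (ln \<bar>x\<bar>)\<^sup>2) has_real_derivative 2 * ln \<bar>t\<bar> * (1 / t)) (at t)"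
      by (rule DERIV_cong[OF DERIV_power[OF ln_abs_DERIV[OF t(2)], of 2]]) simp
    show "((\<lambda>x. ln (1 - x)) has_real_derivative - 1 / (1 - t)) (at t)"
      using t by (auto intro!: derivative_eq_intros)
  qed
  then have "((\<lambda>x. 3 * (Li 3 x - ln \<bar>x\<bar> * Li 2 x - (ln \<bar>x\<bar>)\<^sup>2 / 3 * ln (1 - x))) has_real_derivative theta_sv t / t) (at t)"
    by (rule DERIV_cong) (use t in \<open>simp add: theta_sv_def field_simps\<close>)
  then show ?thesis
    by (rule has_field_derivative_transform_within_open[of _ _ _ "{..<1}"]) (use t sv_trilog_real in auto)
qed

lemma sv_0 [simp]: "sv 0 = 0" by (simp add: sv_def sv_trilog_def)

lemma isCont_sv_0: "isCont (\<lambda>x. sv x) 0"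
proof -
  obtain D where "(Li 2 has_real_derivative D) (at 0)" using Li_differentiable[of 0 2] by auto
  then have D: "((\<lambda>x. Li 2 x / x) \<longlongrightarrow> D) (at 0)" by (simp add: DERIV_def)
  have "((\<lambda>x. ln (1 - x)) has_real_derivative - 1) (at (0::real))" by (auto intro!: derivative_eq_intros)
  then have E: "((\<lambda>x. ln (1 - x) / x) \<longlongrightarrow> - 1) (at (0::real))" by (simp add: DERIV_def)
  have l: "((\<lambda>x::real. x * ln \<bar>x\<bar>) \<longlongrightarrow> 0) (at 0)" "((\<lambda>x::real. x * (ln \<bar>x\<bar>)\<^sup>2) \<longlongrightarrow> 0) (at 0)"
    by real_asymp+
  have "(Li 3 \<longlongrightarrow> 0) (at 0)" using isCont_Li[of 0 3] by (simp add: isCont_def)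
  from tendsto_diff[OF tendsto_diff[OF this tendsto_mult[OF l(1) D]] tendsto_mult[OF tendsto_divide[OF l(2) tendsto_const[of 3]] E]]
  have "((\<lambda>x. Li 3 x - x * ln \<bar>x\<bar> * (Li 2 x / x) - x * (ln \<bar>x\<bar>)\<^sup>2 / 3 * (ln (1 - x) / x)) \<longlongrightarrow> 0) (at 0)" by simp
  moreover have "\<forall>\<^sub>F x in at 0. Li 3 x - x * ln \<bar>x\<bar> * (Li 2 x / x) - x * (ln \<bar>x\<bar>)\<^sup>2 / 3 * (ln (1 - x) / x) = sv x"
  proof -
    have "\<forall>\<^sub>F x in at (0::real). x \<in> {..<1} - {0}" by (rule eventually_at_in_open) auto
    then show ?thesis by eventually_elim (simp add: sv_trilog_real)
  qed
  ultimately have "((\<lambda>x. sv x) \<longlongrightarrow> 0) (at 0)" by (rule Lim_transform_eventually)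
  then show ?thesis by (simp add: isCont_def)
qed

lemma isCont_sv: "x < 1 \<Longrightarrow> isCont (\<lambda>x. sv x) x"
proof (cases "x = 0")
  case False assume "x < 1"
  from DERIV_isCont[OF sv_DERIV[OF this False]] have "isCont (\<lambda>t. 1 / 3 * (3 * sv t)) x" by (rule continuous_mult[OF continuous_const])
  moreover have "(\<lambda>t. 1 / 3 * (3 * sv t)) = (\<lambda>t. sv t)" by simp
  ultimately show ?thesis by (simp only:)
qed (simp add: isCont_sv_0)

text \<open>
  The part of \<open>theta_sv_relation\<close> that is quadratic in the \<open>ln \<bar>U\<bar>\<close>, with \<open>l\<close>, \<open>b\<close>, \<open>\<rho>\<close> for the logarithms of \<open>x\<close>, \<open>y\<close>, \<open>r\<close>.
\<close>
lemma theta_sv_rational_identity: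
  fixes l b \<rho> x y :: real
  assumes "1 - x \<noteq> 0" "y - x \<noteq> 0" "1 - x * y \<noteq> 0"
  shows "2 * (l\<^sup>2 / (1 - x)) - (l - b)\<^sup>2 / (y - x) + 2 * ((1 - y) * (l + \<rho> - b)\<^sup>2 / (y - x)) - y * (l + b)\<^sup>2 / (1 - x * y)
     - 2 * ((1 - y) * (l + \<rho>)\<^sup>2 / (1 - x * y)) - (1 - y)\<^sup>2 * (l + 2 * \<rho> - b)\<^sup>2 / ((y - x) * (1 - x * y))
     + 2 * ((1 - y) * \<rho>\<^sup>2 / (y - x) + x * ((1 - y) * (l + \<rho> - b)\<^sup>2 / (y - x)) - x * ((1 - y) * (l + \<rho>)\<^sup>2 / (1 - x * y))
       - (1 - y) * (\<rho> - b)\<^sup>2 / (1 - x * y) - x * ((1 - y)\<^sup>2 * (l + 2 * \<rho> - b)\<^sup>2 / ((y - x) * (1 - x * y)))) / (1 - x)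
     = - 2 * b\<^sup>2 / (1 - x)"
  using assms by (simp add: divide_simps) (simp add: algebra_simps power2_eq_square)

text \<open>
  The products \<open>ln \<bar>U\<bar> * ln (1 - U)\<close> add up to \<open>2 * (ln y)^2 / (1 - t)\<close> by \<open>ratio_logs\<close>, and the squares of \<open>ln \<bar>U\<bar>\<close> to the
  opposite by \<open>theta_sv_rational_identity\<close>.
\<close>
lemma theta_sv_relation:
  assumes t: "0 < t" "t < y" "y < 1" and r: "r = (1 - y) / (1 - t)"
  shows "(2 * theta_sv t + (- 1) * theta_sv (t / y) + 2 * theta_sv (t * r / y) + (- 1) * theta_sv (t * y) +
      2 * theta_sv (- (t * r)) + (- 1) * theta_sv (t * r\<^sup>2 / y)) / t +
     (2 * theta_sv r + 2 * theta_sv (t * r / y) + 2 * theta_sv (- (t * r)) + 2 * theta_sv (- (r / y)) +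
      2 * (- 1) * theta_sv (t * r\<^sup>2 / y)) / (1 - t) = 0"
proof -
  define l b a c d e \<rho> where "l = ln t" and "b = ln y" and "a = ln (1 - t)" and "c = ln (1 - y)" and "d = ln (y - t)"
    and "e = ln (1 - t * y)" and "\<rho> = c - a"
  note L = ratio_logs[OF t r]
  note l = ratio_bounds[OF t r]
  have p: "0 < y" "0 < 1 - t" "0 < y - t" "0 < 1 - t * y" using t l(6) by auto
  have lr: "ln r = \<rho>" unfolding r \<rho>_def c_def a_def using p t by (simp add: ln_div)
  have A: "ln \<bar>t\<bar> = l" "ln \<bar>t / y\<bar> = l - b" "ln \<bar>r\<bar> = \<rho>" "ln \<bar>t * r / y\<bar> = l + \<rho> - b" "ln \<bar>t * y\<bar> = l + b"
    "ln \<bar>- (t * r)\<bar> = l + \<rho>" "ln \<bar>- (r / y)\<bar> = \<rho> - b" "ln \<bar>t * r\<^sup>2 / y\<bar> = l + 2 * \<rho> - b"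
    using p t l(1) lr by (simp_all add: abs_mult ln_div ln_mult l_def b_def ln_realpow)
  have T: "theta_sv t = l * a + t * (l\<^sup>2 / (1 - t))"
    "theta_sv (t / y) = (l - b) * (d - b) + t * ((l - b)\<^sup>2 / (y - t))"
    "theta_sv (t * r / y) = (l + \<rho> - b) * (d - b - a) + t * ((1 - y) * (l + \<rho> - b)\<^sup>2 / (y - t))"
    "theta_sv (t * y) = (l + b) * e + t * (y * (l + b)\<^sup>2 / (1 - t * y))"
    "theta_sv (- (t * r)) = (l + \<rho>) * (e - a) - t * ((1 - y) * (l + \<rho>)\<^sup>2 / (1 - t * y))"
    "theta_sv (t * r\<^sup>2 / y) = (l + 2 * \<rho> - b) * (d + e - b - 2 * a) + t * ((1 - y)\<^sup>2 * (l + 2 * \<rho> - b)\<^sup>2 / ((y - t) * (1 - t * y)))"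
    "theta_sv r = \<rho> * (d - a) + (1 - y) * \<rho>\<^sup>2 / (y - t)"
    "theta_sv (- (r / y)) = (\<rho> - b) * (e - b - a) - (1 - y) * (\<rho> - b)\<^sup>2 / (1 - t * y)"
    unfolding theta_sv_def A L unfolding a_def b_def d_def e_def by simp_all
  define q1 q3 q5 q6 q7 q9 q4 q8 where "q1 = l\<^sup>2 / (1 - t)" and "q3 = (l - b)\<^sup>2 / (y - t)" and "q5 = (1 - y) * (l + \<rho> - b)\<^sup>2 / (y - t)"
    and "q6 = y * (l + b)\<^sup>2 / (1 - t * y)" and "q7 = (1 - y) * (l + \<rho>)\<^sup>2 / (1 - t * y)"
    and "q9 = (1 - y)\<^sup>2 * (l + 2 * \<rho> - b)\<^sup>2 / ((y - t) * (1 - t * y))"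
    and "q4 = (1 - y) * \<rho>\<^sup>2 / (y - t)" and "q8 = (1 - y) * (\<rho> - b)\<^sup>2 / (1 - t * y)"
  have I: "2 * q1 - q3 + 2 * q5 - q6 - 2 * q7 - q9 + 2 * (q4 + t * q5 - t * q7 - q8 - t * q9) / (1 - t) = - 2 * b\<^sup>2 / (1 - t)"
    unfolding q1_def q3_def q5_def q6_def q7_def q9_def q4_def q8_def by (rule theta_sv_rational_identity) (use p in auto)
  have X: "2 * theta_sv t + (- 1) * theta_sv (t / y) + 2 * theta_sv (t * r / y) + (- 1) * theta_sv (t * y) +
      2 * theta_sv (- (t * r)) + (- 1) * theta_sv (t * r\<^sup>2 / y) = t * (2 * q1 - q3 + 2 * q5 - q6 - 2 * q7 - q9)"
    unfolding T q1_def[symmetric] q3_def[symmetric] q5_def[symmetric] q6_def[symmetric] q7_def[symmetric] q9_def[symmetric]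
    by algebra
  have Y: "2 * theta_sv r + 2 * theta_sv (t * r / y) + 2 * theta_sv (- (t * r)) + 2 * theta_sv (- (r / y)) +
      2 * (- 1) * theta_sv (t * r\<^sup>2 / y) = 2 * (q4 + t * q5 - t * q7 - q8 - t * q9) + 2 * b\<^sup>2"
    unfolding T q5_def[symmetric] q7_def[symmetric] q9_def[symmetric] q4_def[symmetric] q8_def[symmetric]
    by algebra
  show ?thesis unfolding X Y using I t by (simp add: add_divide_distrib)
qed

text \<open>
  Substitute the one-variable identities for \<open>Li 2\<close> and \<open>Li 3\<close>; all products of logarithms cancel.
\<close>
lemma sv_one_variable:
  assumes y: "0 < y" "y < 1"
  shows "sv y + sv (1 - y) + sv (- ((1 - y) / y)) = Li 3 1"
proof -
  define u v p where "u = ln y" and "v = ln (1 - y)" and "p = Li 2 (1 - y)"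
  have 1: "Li 2 y = pi\<^sup>2 / 6 - u * v - p" using Li2_reflection[OF y] by (simp add: u_def v_def p_def)
  have 2: "Li 2 (- ((1 - y) / y)) = - u\<^sup>2 / 2 - p" using Li2_Landen[OF y] by (simp add: u_def p_def)
  have 3: "Li 3 (- ((1 - y) / y)) = Li 3 1 - Li 3 y - Li 3 (1 - y) + u ^ 3 / 6 + pi\<^sup>2 / 6 * u - u\<^sup>2 * v / 2"
    using Li3_Landen[OF y] by (simp add: u_def v_def)
  have e: "\<bar>- ((1 - y) / y)\<bar> = (1 - y) / y" using y by simp
  have 4: "ln \<bar>- ((1 - y) / y)\<bar> = v - u" unfolding e using y by (simp add: ln_div u_def v_def)
  have 5: "ln (1 - - ((1 - y) / y)) = - u" unfolding reflection_map_DERIVs(4)[OF y] using y by (simp add: ln_div u_def)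
  have "sv y = Li 3 y - u * (pi\<^sup>2 / 6 - u * v - p) - u\<^sup>2 / 3 * v"
    using sv_trilog_real[OF y(2)] y 1 by (simp add: u_def v_def)
  moreover have "sv (1 - y) = Li 3 (1 - y) - v * p - v\<^sup>2 / 3 * u"
    using sv_trilog_real[of "1 - y"] y by (simp add: u_def v_def p_def)
  moreover have "sv (- ((1 - y) / y)) = Li 3 (- ((1 - y) / y)) - (v - u) * (- u\<^sup>2 / 2 - p) - (v - u)\<^sup>2 / 3 * (- u)"
    using sv_trilog_real[OF reflection_map_DERIVs(5)[OF y]] unfolding 2 4 5 .
  ultimately show ?thesis unfolding 3 by (simp add: field_simps power2_eq_square power3_eq_cube)
qed

lemma kummer_sum_sv:
  assumes xy: "0 < x" "x < y" "y < 1"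
  shows "kummer_sum (\<lambda>x. sv x) x y = 2 * Li 3 1"
proof -
  define R where "R = (\<lambda>x. (1 - y) / (1 - x))"
  have y: "0 < y" "x < 1" using xy by auto
  have "isCont (\<lambda>t. 3 * sv t) 0" by (intro continuous_intros isCont_sv_0)
  note v = combination_value[OF sv_DERIV this _ xy R_def DERIV_const tendsto_const]
  have "2 * (3 * sv x) + 2 * (3 * sv y) + (- 1) * (3 * sv (x / y)) + 2 * (3 * sv (R x)) + 2 * (3 * sv (x * R x / y)) + (- 1) * (3 * sv (x * y))
      + 2 * (3 * sv (- (x * R x))) + 2 * (3 * sv (- (R x / y))) + (- 1) * (3 * sv (x * (R x)\<^sup>2 / y))
     = 2 * (3 * sv y) + 2 * (3 * sv (1 - y)) + 2 * (3 * sv (- ((1 - y) / y))) + 0"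
    by (rule v) (use theta_sv_relation xy in \<open>auto simp: R_def\<close>)
  then show ?thesis
    using kummer_sum_ratio[of x y "R x" "\<lambda>x. sv x"] y xy sv_one_variable[OF y(1) xy(3)] by (simp add: R_def)
qed

text \<open>
  For small \<open>x > 0\<close> all three terms of \<open>sv x\<close> are nonnegative, and the last one is at least \<open>x * (ln x)^2 / 3\<close>.
\<close>
lemma sv_not_differentiable: "\<not> (\<lambda>x. sv x) differentiable (at 0)"
proof
  assume "(\<lambda>x. sv x) differentiable (at 0)"
  then obtain D where "((\<lambda>x. sv x) has_real_derivative D) (at 0)" using real_differentiable_def by blast
  then have "((\<lambda>x. sv x / x) \<longlongrightarrow> D) (at 0)" by (simp add: DERIV_def)
  then have lim: "((\<lambda>x. sv x / x) \<longlongrightarrow> D) (at_right 0)" by (rule tendsto_within_subset) simp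
  have "filterlim (\<lambda>x::real. (ln x)\<^sup>2 / 3) at_top (at_right 0)" by real_asymp
  moreover have "\<forall>\<^sub>F x in at_right 0. (ln x)\<^sup>2 / 3 \<le> sv x / x"
    using at_right_eventually[of 1, OF zero_less_one]
  proof eventually_elim
    case (elim x)
    have "x * ((ln x)\<^sup>2 / 3) \<le> - ln (1 - x) * ((ln x)\<^sup>2 / 3)"
      using ln_le_minus_one[of "1 - x"] elim by (intro mult_right_mono) auto
    moreover have "ln x * Li 2 x \<le> 0" using elim Li_nonneg[of x 2] by (simp add: mult_nonpos_nonneg)
    moreover have "0 \<le> Li 3 x" using elim Li_nonneg by simp
    moreover have "sv x = Li 3 x - ln x * Li 2 x + - ln (1 - x) * ((ln x)\<^sup>2 / 3)" using sv_trilog_real[of x] elim by simp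
    ultimately have "x * ((ln x)\<^sup>2 / 3) \<le> sv x" by linarith
    then show ?case using elim by (simp add: field_simps)
  qed
  ultimately have "filterlim (\<lambda>x. sv x / x) at_top (at_right 0)" by (rule filterlim_at_top_mono)
  then show False using not_tendsto_and_filterlim_at_infinity[OF _ lim] filterlim_at_top_imp_at_infinity
    by (metis trivial_limit_at_right_real)
qed

section \<open>The five-term relation\<close>

text \<open>
  The five arguments of the five-term relation in cyclic order: each is determined by its two neighbours.
\<close>
definition pentagon :: "real \<Rightarrow> real \<Rightarrow> real \<Rightarrow> real \<Rightarrow> real \<Rightarrow> bool" where
  "pentagon a b c d e \<longleftrightarrow> 0 < a \<and> a < 1 \<and> 0 < b \<and> b < 1 \<and> 0 < c \<and> c < 1 \<and> 0 < d \<and> d < 1 \<and> 0 < e \<and> e < 1 \<and>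
     1 - a * c = b \<and> 1 - b * d = c \<and> 1 - c * e = d \<and> 1 - d * a = e \<and> 1 - e * b = a"

lemma pentagonD:
  assumes "pentagon a b c d e"
  shows "0 < a" "a < 1" "0 < b" "b < 1" "0 < c" "c < 1" "0 < d" "d < 1" "0 < e" "e < 1"
    "1 - a * c = b" "1 - b * d = c" "1 - c * e = d" "1 - d * a = e" "1 - e * b = a"
  using assms unfolding pentagon_def by blast+

lemma pentagon_rotate: "pentagon a b c d e \<Longrightarrow> pentagon b c d e a"
  unfolding pentagon_def by blast

lemma pentagon_exists:
  assumes "0 < a" "a < 1" "0 < c" "c < 1"
  shows "pentagon a (1 - a * c) c ((1 - c) / (1 - a * c)) ((1 - a) / (1 - a * c))"
proof -
  have ac: "a * c < a" "a * c < c" "0 < a * c" using assms by auto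
  then have p: "0 < 1 - a * c" "1 - a * c < 1" using assms by linarith+
  have "(1 - c) / (1 - a * c) < 1" "(1 - a) / (1 - a * c) < 1" using ac p by (simp_all add: divide_less_eq)
  moreover have "0 < (1 - c) / (1 - a * c)" "0 < (1 - a) / (1 - a * c)" using assms p by auto
  moreover have "1 - (1 - a * c) * ((1 - c) / (1 - a * c)) = c" "1 - (1 - a) / (1 - a * c) * (1 - a * c) = a" using p by auto
  moreover have "1 - c * ((1 - a) / (1 - a * c)) = (1 - c) / (1 - a * c)" "1 - (1 - c) / (1 - a * c) * a = (1 - a) / (1 - a * c)"
    using p by (simp_all add: field_simps)
  ultimately show ?thesis unfolding pentagon_def using assms p by (intro conjI refl) assumption+
qed

text \<open>
  If two neighbours of an entry exceed \<open>\<phi>\<close>, the entry is less than \<open>1 - \<phi>^2 = \<phi>\<close>. So three consecutive entries never all exceed \<open>\<phi>\<close>,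
  whereas picking a large end point from each of the five diagonals would produce three consecutive ones.
\<close>
lemma pentagon_small_diagonal:
  fixes a :: real
  defines "\<phi> \<equiv> (sqrt 5 - 1) / 2"
  assumes "pentagon a b c d e"
  shows "a \<le> \<phi> \<and> c \<le> \<phi> \<or> b \<le> \<phi> \<and> d \<le> \<phi> \<or> c \<le> \<phi> \<and> e \<le> \<phi> \<or> d \<le> \<phi> \<and> a \<le> \<phi> \<or> e \<le> \<phi> \<and> b \<le> \<phi>"
proof -
  have mid: "v \<le> \<phi>" if "u > \<phi>" "w > \<phi>" "1 - u * w = v" for u v w
  proof -
    have "\<phi> > 0" "\<phi>\<^sup>2 = 1 - \<phi>" using golden_ratio by (auto simp: \<phi>_def)
    moreover have "\<phi> * \<phi> < u * w" using that \<open>\<phi> > 0\<close> by (intro mult_strict_mono) auto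
    ultimately show ?thesis using that by (simp add: power2_eq_square)
  qed
  have "b \<le> \<phi>" if "a > \<phi>" "c > \<phi>" using mid[OF that] pentagonD[OF assms(2)] by blast
  moreover have "c \<le> \<phi>" if "b > \<phi>" "d > \<phi>" using mid[OF that] pentagonD[OF assms(2)] by blast
  moreover have "d \<le> \<phi>" if "c > \<phi>" "e > \<phi>" using mid[OF that] pentagonD[OF assms(2)] by blast
  moreover have "e \<le> \<phi>" if "d > \<phi>" "a > \<phi>" using mid[OF that] pentagonD[OF assms(2)] by blast
  moreover have "a \<le> \<phi>" if "e > \<phi>" "b > \<phi>" using mid[OF that] pentagonD[OF assms(2)] by blast
  ultimately show ?thesis by (meson not_le_imp_less)
qed

text \<open>
  The situation after the defect in \<open>reflection_defect\<close> has been removed.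
\<close>
locale antireflective_kummer_solution = kummer_solution +
  assumes antireflective: "\<And>y. 0 < y \<Longrightarrow> y < 1 \<Longrightarrow> f (1 - y) = - f y"
begin

text \<open>
  For \<open>y = 1 / (1 + t) < e0\<close> this is \<open>reflection_deriv\<close>. Otherwise \<open>t < e0\<close>, and \<open>inversion\<close> leads to \<open>1 / t\<close>, for which
  \<open>y\<close> is replaced by \<open>1 - y\<close>.
\<close>
lemma f_neg:
  assumes t: "0 < t"
  shows "f (- t) = - f (t / (1 + t))"
proof -
  have main: "f (- t) = - f (t / (1 + t))" if t: "0 < t" "1 / (1 + t) < e0" for t
  proof -
    define y where "y = 1 / (1 + t)"
    have y: "0 < y" "y < e0" "1 - y = t / (1 + t)" "(1 - y) / y = t" using t by (auto simp: y_def field_simps)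
    have y1: "y < 1" using y e0_less by simp
    have "f (- t) = (1 - y) * f y - y * f (1 - y)" using reflection_deriv[OF y(1,2)] unfolding y(4) by simp
    also have "\<dots> = - f (1 - y)" using antireflective[OF y(1) y1] by (simp add: algebra_simps)
    finally show ?thesis unfolding y(3) .
  qed
  show ?thesis
  proof (cases "1 / (1 + t) < e0")
    case False
    have t1: "t < e0"
    proof -
      have "1 / (1 + t) \<ge> e0" using False by simp
      then have "e0 * (1 + t) \<le> 1" using t by (simp add: le_divide_eq)
      then have "e0 * t < e0 * e0" using e0_bounds(3) by (simp add: algebra_simps power2_eq_square)
      then show ?thesis using e0_bounds by simp
    qed
    have u: "0 < 1 / t" "1 / (1 + 1 / t) = t / (1 + t)" "(1 / t) / (1 + 1 / t) = 1 / (1 + t)" using t by (auto simp: field_simps)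
    have "t / (1 + t) \<le> t" using t by (simp add: divide_le_eq)
    then have "f (- (1 / t)) = - f (1 / (1 + t))" using main[OF u(1)] t1 unfolding u(2,3) by simp
    moreover have "f (- (1 / t)) = - f (- t)" by (rule inversion[OF t t1])
    moreover have "f (1 - t / (1 + t)) = - f (t / (1 + t))" by (rule antireflective) (use t in auto)
    moreover have "1 - t / (1 + t) = 1 / (1 + t)" using t by (simp add: field_simps)
    ultimately show ?thesis by simp
  qed (use main t in auto)
qed

text \<open>
  The five-term relation of the dilogarithm says that this expression vanishes.
\<close>
definition five_term :: "real \<Rightarrow> real \<Rightarrow> real" where
  "five_term a b = f a + f b - f (a * b) - f (a * (1 - b) / (1 - a * b)) - f (b * (1 - a) / (1 - a * b))"

lemma five_term_commute: "five_term a b = five_term b a"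
  by (simp add: five_term_def mult.commute)

text \<open>
  In the sum over a pentagon all five diagonals play the same part, hence the expression has the same value on each of
  them.
\<close>
lemma five_term_pentagon:
  assumes "pentagon a b c d e"
  shows "five_term a c = f a + f b + f c + f d + f e"
proof -
  have p: "0 < a" "a < 1" "0 < b" "b < 1" "0 < c" "c < 1" "0 < d" "d < 1" "0 < e" "e < 1"
    and r: "1 - a * c = b" "1 - b * d = c" "1 - c * e = d" "1 - d * a = e" "1 - e * b = a"
    using pentagonD[OF assms] by blast+
  have "1 - c = b * d" using r(2) by linarith
  then have "a * (1 - c) = a * (b * d)" by simp
  then have "a * (1 - c) / b = d * a" using p by simp
  then have 1: "a * (1 - c) / b = 1 - e" using r(4) by linarith
  have "1 - a = e * b" using r(5) by linarith
  then have "c * (1 - a) = c * (e * b)" by simp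
  then have "c * (1 - a) / b = c * e" using p by simp
  then have 2: "c * (1 - a) / b = 1 - d" using r(3) by linarith
  have 3: "a * c = 1 - b" using r(1) by simp
  show ?thesis unfolding five_term_def r(1) 1 2 unfolding 3 using antireflective p by simp
qed

text \<open>
  Write \<open>P\<close>, \<open>N\<close>, \<open>M\<close> for the values of the five-term expression at \<open>(x, y)\<close>, \<open>(y, x / y)\<close>, \<open>(a, b)\<close>. By \<open>f_neg\<close> the sums in
  \<open>derivative_equations\<close> are \<open>A = P - N + M\<close>, \<open>B = P + N - M\<close> and \<open>S = 2 M\<close>; the two equations are then solved for \<open>P\<close> and \<open>N\<close>.
\<close>
lemma five_term_relations:
  assumes xy: "0 < x" "x < y" "y < e0"
  defines "a \<equiv> (1 - y) / (1 - x)" and "b \<equiv> x * (1 - y) / (y * (1 - x))"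
  shows "five_term x y = (y - x) / ((1 - x) * (1 - y)) * five_term a b"
    and "five_term y (x / y) = (1 - x * y) / ((1 - x) * (1 - y)) * five_term a b"
proof -
  have y1: "y < 1" using xy e0_less by simp
  note l = ratio_bounds[OF xy(1,2) y1 a_def[THEN meta_eq_to_obj_eq]]
  have p: "0 < y" "0 < 1 - x" "0 < y - x" "0 < 1 - x * y" "0 < 1 - y" using xy y1 l(6) by auto
  have b: "x * a / y = b" by (simp add: a_def b_def mult.commute)
  have ab: "x * a\<^sup>2 / y = a * b" by (simp add: b[symmetric] power2_eq_square)
  define \<alpha> \<beta> where "\<alpha> = x * (1 - y) / (1 - x * y)" and "\<beta> = y * (1 - x) / (1 - x * y)"
  have s: "(1 - y) / (1 - x * y) = 1 - \<beta>" using p by (simp add: \<beta>_def field_simps)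
  have "0 < 1 - \<beta>" unfolding s[symmetric] using p by simp
  moreover have "0 < \<beta>" using p by (simp add: \<beta>_def)
  ultimately have f\<beta>: "f (1 - \<beta>) = - f \<beta>" by (intro antireflective) auto
  have fa: "f (- (x * a)) = - f \<alpha>"
  proof -
    have e: "1 + x * a = (1 - x * y) / (1 - x)" using p by (simp add: a_def field_simps)
    have "x * a / (1 + x * a) = \<alpha>" unfolding e using p by (simp add: a_def \<alpha>_def)
    then show ?thesis using f_neg[OF l(7)] by simp
  qed
  have fb: "f (- (a / y)) = f \<beta>"
  proof -
    have e: "1 + a / y = (1 - x * y) / (y * (1 - x))" using p by (simp add: a_def field_simps)
    have "a / y / (1 + a / y) = (1 - y) / (1 - x * y)" unfolding e using p by (simp add: a_def)
    also note s
    finally show ?thesis using f_neg[OF l(8)] f\<beta> by simp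
  qed
  define M P N where "M = five_term a b" and "P = five_term x y" and "N = five_term y (x / y)"
  have M: "M = f a + f b - f (a * b) + f \<beta> - f \<alpha>"
  proof -
    have e: "1 - a * b = (y - x) * (1 - x * y) / (y * (1 - x)\<^sup>2)"
      using p unfolding a_def b_def by (simp add: divide_simps) (simp add: algebra_simps power2_eq_square)
    have e1: "1 - b = (y - x) / (y * (1 - x))" using p unfolding b_def by (simp add: field_simps)
    have e2: "1 - a = (y - x) / (1 - x)" using p unfolding a_def by (simp add: field_simps)
    have "a * (1 - b) / (1 - a * b) = (1 - y) / (1 - x * y)"
      unfolding e e1 unfolding a_def using p by (simp add: power2_eq_square)
    also note s
    finally have 1: "a * (1 - b) / (1 - a * b) = 1 - \<beta>" .
    have 2: "b * (1 - a) / (1 - a * b) = \<alpha>"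
      unfolding e e2 unfolding b_def \<alpha>_def using p by (simp add: power2_eq_square)
    show ?thesis unfolding M_def five_term_def 1 2 f\<beta> by simp
  qed
  have P: "P = f x + f y - f (x * y) - f \<alpha> - f \<beta>"
    by (simp add: P_def five_term_def \<alpha>_def \<beta>_def)
  have N: "N = f y + f (x / y) - f x + f a - f b"
  proof -
    have 0: "y * (x / y) = x" using p by simp
    have 1: "y * (1 - x / y) / (1 - x) = 1 - a" using p by (simp add: a_def field_simps)
    have 2: "x / y * (1 - y) / (1 - x) = b" by (simp add: b_def)
    have "f (1 - a) = - f a" using l by (intro antireflective) auto
    then show ?thesis unfolding N_def five_term_def 0 1 2 by simp
  qed
  define A B S where "A = 2 * f x - f (x / y) + 2 * f b - f (x * y) + 2 * f (- (x * a)) - f (a * b)"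
    and "B = 2 * f y + f (x / y) - 2 * f b - f (x * y) - 2 * f (- (a / y)) + f (a * b)"
    and "S = 2 * (f a + f b + f (- (x * a)) + f (- (a / y)) - f (a * b))"
  have D: "A / x + S / (1 - x) = 0" "B / y - S / (1 - y) = 0"
    using derivative_equations[OF xy, of a] unfolding A_def B_def S_def b ab by (simp_all add: a_def)
  have ABS: "A = P - N + M" "B = P + N - M" "S = 2 * M"
    unfolding A_def B_def S_def fa fb M P N by simp_all
  have "A / x = - (S / (1 - x))" "B / y = S / (1 - y)" using D by linarith+
  then have "A = - (S / (1 - x)) * x" "B = S / (1 - y) * y" using xy p by (simp_all add: divide_eq_eq)
  then have "P - N + M = - 2 * M * (x / (1 - x))" "P + N - M = 2 * M * (y / (1 - y))"
    unfolding ABS by simp_all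
  moreover have "P = M * (Y - X)" "N = M * (1 + Y + X)" if "P - N + M = - 2 * M * X" "P + N - M = 2 * M * Y" for X Y
    using that by algebra+
  ultimately have "P = M * (y / (1 - y) - x / (1 - x))" "N = M * (1 + y / (1 - y) + x / (1 - x))" by blast+
  moreover have "y / (1 - y) - x / (1 - x) = (y - x) / ((1 - x) * (1 - y))"
    "1 + y / (1 - y) + x / (1 - x) = (1 - x * y) / ((1 - x) * (1 - y))"
    using p by (simp_all add: field_simps)
  ultimately show "five_term x y = (y - x) / ((1 - x) * (1 - y)) * five_term a b"
    "five_term y (x / y) = (1 - x * y) / ((1 - x) * (1 - y)) * five_term a b"
    unfolding P_def M_def N_def by (simp_all add: mult.commute)
qed

text \<open>
  Beyond \<open>e0\<close>, continuity comes from \<open>1 - t < e0\<close>.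
\<close>
lemma f_isCont: "0 < t \<Longrightarrow> t < 1 \<Longrightarrow> isCont f t"
proof (cases "t < e0")
  case False assume t: "0 < t" "t < 1"
  have "isCont f (1 - t)" by (rule DERIV_isCont[OF f_DERIV]) (use False e0_bounds t in auto)
  then have "isCont (\<lambda>s. - f (1 - s)) t" by (intro continuous_intros isCont_o2[of t "\<lambda>s. 1 - s" f]) auto
  moreover have "\<forall>\<^sub>F s in nhds t. - f (1 - s) = f s"
    using eventually_nhds_in_open[of "{0<..<1}" t] t by (auto elim!: eventually_mono simp: antireflective)
  ultimately show ?thesis by (simp cong: isCont_cong)
qed (auto intro: DERIV_isCont[OF f_DERIV])

lemma five_term_isCont:
  assumes "0 < a" "a < 1" "0 < b" "b < 1"
  shows "((\<lambda>x. five_term x b) \<longlongrightarrow> five_term a b) (at a)"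
proof -
  note c = isCont_tendsto_compose[OF f_isCont]
  have ab: "a * b < b" "a * b < a" "0 < a * b" using assms by auto
  then have p: "0 < 1 - a * b" "a * b < 1" using assms by linarith+
  have "a * (1 - b) < 1 - a * b" "b * (1 - a) < 1 - a * b" using assms by (simp_all add: algebra_simps)
  then have q: "a * (1 - b) / (1 - a * b) < 1" "b * (1 - a) / (1 - a * b) < 1" using p by (simp_all add: divide_less_eq)
  have q0: "0 < a * (1 - b) / (1 - a * b)" "0 < b * (1 - a) / (1 - a * b)" using assms p by auto
  have U: "((\<lambda>x. x * b) \<longlongrightarrow> a * b) (at a)" "((\<lambda>x. x * (1 - b) / (1 - x * b)) \<longlongrightarrow> a * (1 - b) / (1 - a * b)) (at a)"
    "((\<lambda>x. b * (1 - x) / (1 - x * b)) \<longlongrightarrow> b * (1 - a) / (1 - a * b)) (at a)"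
    using p by (auto intro!: tendsto_eq_intros)
  show ?thesis unfolding five_term_def
    by (intro tendsto_add tendsto_diff tendsto_const c[OF _ _ tendsto_ident_at] c[OF _ _ U(1)] c[OF _ _ U(2)] c[OF _ _ U(3)])
      (use assms ab p q q0 in simp_all)
qed

text \<open>
  By \<open>pentagon_small_diagonal\<close> every value is taken in the square \<open>[0, \<phi>]^2\<close>, which avoids the corner where \<open>1 - a b = 0\<close>. There
  the expression is continuous once \<open>f\<close> is extended by 0, so its absolute value attains a maximum; on the edges through the
  origin it is 0.
\<close>
lemma five_term_max:
  obtains x y where "0 < x" "x \<le> y" "y \<le> (sqrt 5 - 1) / 2"
    "\<And>a b. 0 < a \<Longrightarrow> a < 1 \<Longrightarrow> 0 < b \<Longrightarrow> b < 1 \<Longrightarrow> \<bar>five_term a b\<bar> \<le> \<bar>five_term x y\<bar>"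
  | "\<And>a b. 0 < a \<Longrightarrow> a < 1 \<Longrightarrow> 0 < b \<Longrightarrow> b < 1 \<Longrightarrow> five_term a b = 0"
proof -
  define \<phi> :: real where "\<phi> = (sqrt 5 - 1) / 2"
  have ph: "0 < \<phi>" "\<phi> < 1" "\<phi> < e0" "\<phi>\<^sup>2 = 1 - \<phi>" using golden_ratio e0_gt by (auto simp: \<phi>_def)
  define F where "F t = (if t \<le> 0 then 0 else f t)" for t
  have contF: "continuous_on {0..\<phi>} F"
    unfolding continuous_on_eq_continuous_within
  proof
    fix t assume t: "t \<in> {0..\<phi>}"
    show "continuous (at t within {0..\<phi>}) F"
    proof (cases "t = 0")
      case True
      have "(F \<longlongrightarrow> 0) (at_right 0)"
        by (rule Lim_transform_eventually[OF f_tendsto_0])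
          (use at_right_eventually[of 1] in \<open>auto simp: F_def elim!: eventually_mono\<close>)
      then show ?thesis using ph True by (simp add: continuous_within at_within_Icc_at_right F_def)
    next
      case False
      have "isCont f t" using t False ph by (intro f_isCont) auto
      moreover have "\<forall>\<^sub>F s in nhds t. F s = f s"
        using eventually_nhds_in_open[of "{0<..}" t] t False by (auto elim!: eventually_mono simp: F_def)
      ultimately have "isCont F t" by (simp cong: isCont_cong)
      then show ?thesis by (rule continuous_at_imp_continuous_at_within)
    qed
  qed
  define K where "K = {0..\<phi>} \<times> {0..\<phi>}"
  have K: "0 < 1 - fst p * snd p" "fst p * snd p \<le> \<phi>" "fst p * (1 - snd p) / (1 - fst p * snd p) \<le> \<phi>"
    "snd p * (1 - fst p) / (1 - fst p * snd p) \<le> \<phi>" "0 \<le> fst p * (1 - snd p) / (1 - fst p * snd p)"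
    "0 \<le> snd p * (1 - fst p) / (1 - fst p * snd p)" "0 \<le> fst p * snd p" if "p \<in> K" for p
  proof -
    have p: "0 \<le> fst p" "fst p \<le> \<phi>" "0 \<le> snd p" "snd p \<le> \<phi>" using that by (auto simp: K_def)
    have m: "fst p * snd p \<le> \<phi> * \<phi>" "0 \<le> fst p * snd p" using p ph by (auto intro: mult_mono)
    have "\<phi> * \<phi> < \<phi> * 1" using ph by (intro mult_strict_left_mono) auto
    then show "fst p * snd p \<le> \<phi>" "0 < 1 - fst p * snd p" "0 \<le> fst p * snd p" using m ph by linarith+
    have *: "u * (1 - v) / (1 - u * v) \<le> \<phi>" "0 \<le> u * (1 - v) / (1 - u * v)" if "0 \<le> u" "u \<le> \<phi>" "0 \<le> v" "v \<le> \<phi>" "0 < 1 - u * v" for u v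
    proof -
      have "1 - v \<le> 1 - u * v" using that ph by (simp add: mult_left_le_one_le)
      then have "u * (1 - v) \<le> u * (1 - u * v)" using that by (intro mult_left_mono) auto
      then have "u * (1 - v) / (1 - u * v) \<le> u" using that by (simp add: divide_le_eq)
      then show "u * (1 - v) / (1 - u * v) \<le> \<phi>" using that by simp
      show "0 \<le> u * (1 - v) / (1 - u * v)" using that ph by auto
    qed
    from *[of "fst p" "snd p"] *[of "snd p" "fst p"] p \<open>0 < 1 - fst p * snd p\<close>
    show "fst p * (1 - snd p) / (1 - fst p * snd p) \<le> \<phi>" "snd p * (1 - fst p) / (1 - fst p * snd p) \<le> \<phi>"
      "0 \<le> fst p * (1 - snd p) / (1 - fst p * snd p)" "0 \<le> snd p * (1 - fst p) / (1 - fst p * snd p)"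
      by (auto simp: mult.commute)
  qed
  define G where "G p = F (fst p) + F (snd p) - F (fst p * snd p) - F (fst p * (1 - snd p) / (1 - fst p * snd p))
    - F (snd p * (1 - fst p) / (1 - fst p * snd p))" for p
  have G: "G (a, b) = five_term a b" if "0 < a" "a \<le> \<phi>" "0 < b" "b \<le> \<phi>" for a b
  proof -
    have "0 < 1 - a * b" using K(1)[of "(a, b)"] that by (simp add: K_def)
    moreover have "0 < a * b" "0 < 1 - a" "0 < 1 - b" using that ph by auto
    ultimately have "0 < a * (1 - b) / (1 - a * b)" "0 < b * (1 - a) / (1 - a * b)"
      using that by (auto intro!: divide_pos_pos mult_pos_pos)
    then have F: "F a = f a" "F b = f b" "F (a * b) = f (a * b)" "F (a * (1 - b) / (1 - a * b)) = f (a * (1 - b) / (1 - a * b))"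
      "F (b * (1 - a) / (1 - a * b)) = f (b * (1 - a) / (1 - a * b))"
      using that \<open>0 < a * b\<close> unfolding F_def by (simp_all only: not_le[symmetric] if_False)
    show ?thesis unfolding G_def fst_conv snd_conv F five_term_def ..
  qed
  have contG: "continuous_on K G"
  proof -
    have c: "continuous_on K (\<lambda>p. F (h p))" if "continuous_on K h" "\<And>p. p \<in> K \<Longrightarrow> 0 \<le> h p" "\<And>p. p \<in> K \<Longrightarrow> h p \<le> \<phi>" for h
      by (rule continuous_on_compose2[OF contF that(1)]) (use that in auto)
    have nz: "1 - fst p * snd p \<noteq> 0" if "p \<in> K" for p using K(1)[OF that] by simp
    have k: "continuous_on K (\<lambda>p. fst p * snd p)" "continuous_on K (\<lambda>p. fst p * (1 - snd p) / (1 - fst p * snd p))"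
      "continuous_on K (\<lambda>p. snd p * (1 - fst p) / (1 - fst p * snd p))"
      by (intro continuous_intros ballI nz; assumption)+
    have "continuous_on K (\<lambda>p. F (fst p))" "continuous_on K (\<lambda>p. F (snd p))"
      by (rule c; auto intro: continuous_intros simp: K_def)+
    moreover note c[OF k(1) K(7) K(2)] c[OF k(2) K(5) K(3)] c[OF k(3) K(6) K(4)]
    ultimately show ?thesis unfolding G_def[abs_def] by (intro continuous_on_add continuous_on_diff)
  qed
  have "compact K" unfolding K_def by (intro compact_Times compact_Icc)
  moreover have "(0, 0) \<in> K" using ph by (simp add: K_def)
  moreover have "continuous_on K (\<lambda>p. \<bar>G p\<bar>)" by (intro continuous_intros contG)
  ultimately obtain p where p: "p \<in> K" "\<And>q. q \<in> K \<Longrightarrow> \<bar>G q\<bar> \<le> \<bar>G p\<bar>"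
    using continuous_attains_sup[of K "\<lambda>p. \<bar>G p\<bar>"] by blast
  have bound: "\<bar>five_term a b\<bar> \<le> \<bar>G p\<bar>" if ab: "0 < a" "a < 1" "0 < b" "b < 1" for a b
  proof -
    obtain v d e where pent: "pentagon a v b d e" using pentagon_exists[OF ab] by blast
    have pos: "0 < a" "0 < v" "0 < b" "0 < d" "0 < e" using pentagonD[OF pent] by blast+
    note p1 = pentagon_rotate[OF pent] note p2 = pentagon_rotate[OF p1] note p3 = pentagon_rotate[OF p2] note p4 = pentagon_rotate[OF p3]
    have s: "five_term v d = five_term a b" "five_term b e = five_term a b" "five_term d a = five_term a b" "five_term e v = five_term a b"
      unfolding five_term_pentagon[OF pent] five_term_pentagon[OF p1] five_term_pentagon[OF p2]
        five_term_pentagon[OF p3] five_term_pentagon[OF p4] by simp_all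
    have k: "\<bar>five_term u w\<bar> \<le> \<bar>G p\<bar>" if "0 < u" "u \<le> \<phi>" "0 < w" "w \<le> \<phi>" for u w
      using p(2)[of "(u, w)"] G[OF that] that by (simp add: K_def)
    show ?thesis
      using pentagon_small_diagonal[OF pent, folded \<phi>_def] k[of a b] k[of v d] k[of b e] k[of d a] k[of e v] pos unfolding s by blast
  qed
  obtain x y where xy: "p = (x, y)" by (cases p)
  have K2: "0 \<le> x" "x \<le> \<phi>" "0 \<le> y" "y \<le> \<phi>" using p(1) by (auto simp: xy K_def)
  show thesis
  proof (cases "x = 0 \<or> y = 0")
    case True
    then have "G p = 0" using K2 by (auto simp: xy G_def F_def)
    then have "five_term a b = 0" if "0 < a" "a < 1" "0 < b" "b < 1" for a b using bound[OF that] by simp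
    then show thesis by (rule that(2))
  next
    case False
    then have pos: "0 < x" "0 < y" using K2 by auto
    have eq: "G p = five_term x y" unfolding xy using G pos K2 by simp
    show thesis
    proof (cases "x \<le> y")
      case True
      show thesis by (rule that(1)[of x y]) (use pos True K2 bound eq in \<open>auto simp: \<phi>_def\<close>)
    next
      case False
      show thesis by (rule that(1)[of y x]) (use pos False K2 bound eq in \<open>auto simp: \<phi>_def five_term_commute[of y x]\<close>)
    qed
  qed
qed

text \<open>
  At a maximum \<open>(x, y)\<close> of the absolute value with \<open>x \<le> y \<le> \<phi>\<close>, the first of the \<open>five_term_relations\<close> has a factor less than 1
  unless \<open>y (2 - x) \<ge> 1\<close>. In that case \<open>x < 2/5\<close>, and the second one applies to the point whose \<open>(a, b)\<close> is another diagonal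
  of the same pentagon; it produces a larger value, as its factor exceeds 1. For \<open>x = y\<close> the first factor tends to 0.
\<close>
lemma five_term_eq_0:
  assumes "0 < a" "a < 1" "0 < b" "b < 1"
  shows "five_term a b = 0"
proof (rule five_term_max)
  fix x y assume x: "0 < x" "x \<le> y" "y \<le> (sqrt 5 - 1) / 2"
    and max: "\<And>a b. 0 < a \<Longrightarrow> a < 1 \<Longrightarrow> 0 < b \<Longrightarrow> b < 1 \<Longrightarrow> \<bar>five_term a b\<bar> \<le> \<bar>five_term x y\<bar>"
  define \<phi> :: real where "\<phi> = (sqrt 5 - 1) / 2"
  have ph: "\<phi>\<^sup>2 = 1 - \<phi>" "3/5 < \<phi>" "\<phi> < 31/50" using golden_ratio by (auto simp: \<phi>_def)
  define m where "m = \<bar>five_term x y\<bar>"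
  have y: "y < e0" "y < 1" "0 < y" "y < 31/50" "x < 1" using x e0_gt e0_less ph by (auto simp: \<phi>_def)
  have bnd: "\<bar>five_term ((1 - y) / (1 - x)) (x * (1 - y) / (y * (1 - x)))\<bar> \<le> m" if "0 < x" "x < y" "y < 1" for x y
  proof -
    note l = ratio_bounds[OF that refl]
    have e: "x * (1 - y) / (y * (1 - x)) = x * ((1 - y) / (1 - x)) / y" by (simp add: mult.commute)
    show ?thesis unfolding m_def e by (rule max) (fact l)+
  qed
  have first: "\<bar>five_term x' y\<bar> \<le> (y - x') / ((1 - x') * (1 - y)) * m" if "0 < x'" "x' < y" for x'
  proof -
    have k: "0 \<le> (y - x') / ((1 - x') * (1 - y))" using that y by simp
    show ?thesis unfolding five_term_relations(1)[OF that y(1)] abs_mult[of "_ / _"] abs_of_nonneg[OF k] using k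
      by (rule mult_left_mono[OF bnd[OF that y(2)]])
  qed
  have "m = 0"
  proof (rule ccontr)
    assume "m \<noteq> 0"
    then have m: "m > 0" by (simp add: m_def)
    consider "x = y" | "x < y" "y * (2 - x) < 1" | "x < y" "1 \<le> y * (2 - x)" using x by fastforce
    then show False
    proof cases
      case 1
      have "((\<lambda>x'. (y - x') / ((1 - x') * (1 - y)) * m) \<longlongrightarrow> (y - y) / ((1 - y) * (1 - y)) * m) (at_left y)"
        using y by (intro tendsto_intros) auto
      then have "((\<lambda>x'. (y - x') / ((1 - x') * (1 - y)) * m) \<longlongrightarrow> 0) (at_left y)" by simp
      moreover have "\<forall>\<^sub>F x' in at_left y. norm (five_term x' y) \<le> (y - x') / ((1 - x') * (1 - y)) * m"
        using eventually_at_left_real[OF y(3)] by eventually_elim (use first in auto)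
      ultimately have "((\<lambda>x'. five_term x' y) \<longlongrightarrow> 0) (at_left y)" by (rule Lim_null_comparison[rotated])
      moreover have "((\<lambda>x'. five_term x' y) \<longlongrightarrow> five_term y y) (at_left y)"
        by (rule tendsto_within_subset[OF five_term_isCont]) (use y in auto)
      ultimately have "five_term y y = 0" using tendsto_unique trivial_limit_at_left_real by blast
      then show False using m 1 by (simp add: m_def)
    next
      case 2
      have "y - x < (1 - x) * (1 - y)" using 2(2) by (simp add: algebra_simps)
      then have "(y - x) / ((1 - x) * (1 - y)) < 1" using y by (simp add: divide_less_eq)
      then have "(y - x) / ((1 - x) * (1 - y)) * m < 1 * m" using m by (intro mult_strict_right_mono)
      then show False using first[OF x(1) 2(1)] by (simp add: m_def)
    next
      case 3
      have "y * (2 - x) \<le> 31/50 * (2 - x)" using y by (intro mult_right_mono) auto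
      from order_trans[OF 3(2) this] have x4: "x < 2/5" by simp
      have "x * y < 2/5 * 1" using x4 y x by (intro mult_strict_mono) auto
      then have xy: "x * y < 2/5" "0 < 1 - x * y" "0 < x * y" using x y by auto
      \<comment> \<open>solves \<open>(1 - y') / (1 - x') = (1 - x) / (1 - x y)\<close> and \<open>x' (1 - y') / (y' (1 - x')) = y\<close>, a diagonal of the pentagon of \<open>(x, y)\<close>\<close>
      define x' y' where "x' = x * y / (1 - x)" and "y' = x / (1 - x * y)"
      have yx: "x' / y' = y * (1 - x * y) / (1 - x)" using x xy y by (simp add: x'_def y'_def)
      have pos: "0 < x'" "0 < y'" using x xy y by (auto simp: x'_def y'_def)
      have "x' < y'"
      proof -
        have "x * (1 + y) < 1" using x4 y x mult_strict_mono[of x "2/5" "1 + y" 2] by simp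
        then have "x * (1 + y) * (1 - y) < 1 * (1 - y)" using y by (intro mult_strict_right_mono) auto
        then have "y * (1 - x * y) < 1 - x" by (simp add: algebra_simps)
        then have "x * (y * (1 - x * y)) < x * (1 - x)" using x by (intro mult_strict_left_mono)
        then show ?thesis using y xy by (simp add: x'_def y'_def divide_simps mult.assoc)
      qed
      moreover have "y' < e0"
      proof -
        have "x * y < 2/5 * (31/50)" using x4 y x by (intro mult_strict_mono) auto
        then have "y' < 3/5" using x4 xy unfolding y'_def by (simp add: divide_less_eq)
        then show ?thesis using e0_bounds by simp
      qed
      ultimately have R: "five_term y' (x' / y') = (1 - x' * y') / ((1 - x') * (1 - y')) * five_term ((1 - y') / (1 - x')) (x' * (1 - y') / (y' * (1 - x')))"
        using five_term_relations(2) pos by blast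
      have y1: "y' < 1" using \<open>y' < e0\<close> e0_less by simp
      have nz: "1 - x - x * y > 0"
      proof -
        have "0 < 1 - y'" using y1 by simp
        also have "1 - y' = (1 - x - x * y) / (1 - x * y)" using xy by (simp add: y'_def field_simps)
        finally show ?thesis using xy by (simp add: zero_less_divide_iff)
      qed
      have e1: "1 - y' = (1 - x - x * y) / (1 - x * y)" "1 - x' = (1 - x - x * y) / (1 - x)"
        using xy y by (simp_all add: x'_def y'_def field_simps)
      have A: "(1 - y') / (1 - x') = (1 - x) / (1 - x * y)" unfolding e1 using nz xy y by simp
      have "x' * (1 - y') / (y' * (1 - x')) = (x' / y') * ((1 - y') / (1 - x'))" by simp
      also have "\<dots> = y" unfolding yx A using xy y by simp
      finally have B: "x' * (1 - y') / (y' * (1 - x')) = y" .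
      have pent: "pentagon x (1 - x * y) y ((1 - y) / (1 - x * y)) ((1 - x) / (1 - x * y))"
        by (rule pentagon_exists) (use x y in auto)
      have "five_term ((1 - x) / (1 - x * y)) y = five_term x y"
        unfolding five_term_commute[of "(1 - x) / (1 - x * y)" y]
        using five_term_pentagon[OF pent] five_term_pentagon[OF pentagon_rotate[OF pentagon_rotate[OF pent]]] by simp
      with R have R': "five_term y' (x' / y') = (1 - x' * y') / ((1 - x') * (1 - y')) * five_term x y" unfolding A B by simp
      have xy': "x' * y' < y'" "x' * y' < x'" using pos y1 \<open>x' < y'\<close> by auto
      have "0 < (1 - x') * (1 - y')" using y1 \<open>x' < y'\<close> by simp
      moreover have "(1 - x') * (1 - y') < 1 - x' * y'"
        using xy' by (simp add: algebra_simps)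
      ultimately have "1 < (1 - x' * y') / ((1 - x') * (1 - y'))" by (simp add: less_divide_eq)
      then have "1 * m < (1 - x' * y') / ((1 - x') * (1 - y')) * m" using m by (intro mult_strict_right_mono)
      also have "\<dots> = \<bar>five_term y' (x' / y')\<bar>"
      proof -
        have "k * \<bar>u\<bar> = \<bar>k * u\<bar>" if "1 < k" for k u :: real using that by (simp add: abs_mult)
        from this[OF \<open>1 < (1 - x' * y') / ((1 - x') * (1 - y'))\<close>] show ?thesis unfolding R' m_def .
      qed
      also have "\<dots> \<le> m"
        unfolding m_def by (rule max) (use pos y1 \<open>x' < y'\<close> in auto)
      finally show False by simp
    qed
  qed
  then show ?thesis using max[OF assms] by (simp add: m_def)
qed (use assms in auto)

definition scaled_f :: "real \<Rightarrow> real" where "scaled_f s = f (exp s) / exp s"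

lemma log_slow_f: "log_slow f"
proof (rule log_slowI[of e0 _ "\<lambda>t. t * deriv f t"])
  fix t assume "0 < t" "t < e0"
  then show "(f has_real_derivative t * deriv f t / t) (at t)" using f_DERIV by simp
qed (use theta_f_tendsto_0 e0_bounds in auto)

text \<open>
  The five-term relation to first order in its first argument.
\<close>
lemma five_term_at_0:
  assumes y: "0 < y" "y < e0"
  shows "((\<lambda>x. (f x - f (x * y) - f (x * (1 - y))) / x) \<longlongrightarrow> - (y * (1 - y) * deriv f y)) (at_right 0)"
proof -
  have y1: "y < 1" "0 < 1 - y" using y e0_less by auto
  have ev: "\<forall>\<^sub>F x in at_right 0. 0 < x \<and> x < (1/2::real)" by (rule at_right_eventually) simp
  have pos: "\<forall>\<^sub>F x in at_right (0::real). 0 < x" using ev by (auto elim: eventually_mono)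
  have b: "0 < x * y" "x * y \<le> x" "x * y \<le> 1/2" "0 < 1 - x * y" if "0 < x \<and> x < 1/2" for x
  proof -
    show "0 < x * y" using that y by simp
    show "x * y \<le> x" using that y1 y by (simp add: mult_left_le)
    then show "x * y \<le> 1/2" "0 < 1 - x * y" using that by linarith+
  qed
  have T: "((\<lambda>x. x * (1 - y) / (1 - x * y)) \<longlongrightarrow> 0) (at_right 0)" "((\<lambda>x. x * (1 - y)) \<longlongrightarrow> 0) (at_right 0)"
    by (auto intro!: tendsto_eq_intros)
  have P: "\<forall>\<^sub>F x in at_right 0. 0 < x * (1 - y) / (1 - x * y)" "\<forall>\<^sub>F x in at_right 0. 0 < x * (1 - y)"
    using y1 by (auto intro!: eventually_mono[OF ev] divide_pos_pos mult_pos_pos b)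
  have E1: "((\<lambda>x. (f (x * (1 - y) / (1 - x * y)) - f (x * (1 - y))) / x) \<longlongrightarrow> 0) (at_right 0)"
  proof (rule log_slow_diff[OF log_slow_f T(1) P(1) T(2) P(2) _ pos, of 2])
    show "\<forall>\<^sub>F x in at_right 0. \<bar>ln (x * (1 - y) / (1 - x * y)) - ln (x * (1 - y))\<bar> \<le> 2 * x" using ev
    proof eventually_elim
      case (elim x)
      have "0 < x * (1 - y)" using elim y1 by simp
      then have "ln (x * (1 - y) / (1 - x * y)) - ln (x * (1 - y)) = - ln (1 - x * y)"
        using ln_div[of "x * (1 - y)" "1 - x * y"] b[OF elim] y1 by simp
      then show ?case using abs_ln_one_minus[of "x * y"] b[OF elim] by linarith
    qed
  qed
  have "((\<lambda>x. y * (1 - x) / (1 - x * y)) has_real_derivative - (y * (1 - y))) (at 0)"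
    by (auto intro!: derivative_eq_intros simp: algebra_simps)
  moreover have "(f has_real_derivative deriv f y) (at (y * (1 - 0) / (1 - 0 * y)))" using f_DERIV[OF y] by simp
  ultimately have "((\<lambda>x. f (y * (1 - x) / (1 - x * y))) has_real_derivative deriv f y * - (y * (1 - y))) (at 0)"
    by (rule DERIV_chain2[rotated])
  from DERIV_quotient_at_right[OF this]
  have E2: "((\<lambda>x. (f (y * (1 - x) / (1 - x * y)) - f y) / x) \<longlongrightarrow> deriv f y * - (y * (1 - y))) (at_right 0)" by simp
  have "((\<lambda>x. (f (x * (1 - y) / (1 - x * y)) - f (x * (1 - y))) / x + (f (y * (1 - x) / (1 - x * y)) - f y) / x)
     \<longlongrightarrow> 0 + deriv f y * - (y * (1 - y))) (at_right 0)"
    by (intro tendsto_add E1 E2)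
  then have "((\<lambda>x. (f (x * (1 - y) / (1 - x * y)) - f (x * (1 - y))) / x + (f (y * (1 - x) / (1 - x * y)) - f y) / x)
     \<longlongrightarrow> - (y * (1 - y) * deriv f y)) (at_right 0)" by (simp add: mult.commute)
  then show ?thesis
  proof (rule Lim_transform_eventually)
    show "\<forall>\<^sub>F x in at_right 0. (f (x * (1 - y) / (1 - x * y)) - f (x * (1 - y))) / x + (f (y * (1 - x) / (1 - x * y)) - f y) / x
      = (f x - f (x * y) - f (x * (1 - y))) / x" using ev
    proof eventually_elim
      case (elim x)
      have "five_term x y = 0" by (rule five_term_eq_0) (use elim y y1 in auto)
      then show ?case unfolding five_term_def add_divide_distrib[symmetric] by (intro arg_cong[where f = "\<lambda>z. z / x"]) simp
    qed
  qed
qed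

lemma mix_scaled_f:
  assumes y: "0 < y" "y < e0"
  shows "((\<lambda>s. scaled_f s - mix y scaled_f s) \<longlongrightarrow> - (y * (1 - y) * deriv f y)) at_bot"
proof -
  have y1: "0 < y" "y < 1" using y e0_less by auto
  have "filterlim exp (at_right (0::real)) at_bot" by real_asymp
  from filterlim_compose[OF five_term_at_0[OF y] this]
  have "((\<lambda>s. (f (exp s) - f (exp s * y) - f (exp s * (1 - y))) / exp s) \<longlongrightarrow> - (y * (1 - y) * deriv f y)) at_bot" .
  moreover have "(f (exp s) - f (exp s * y) - f (exp s * (1 - y))) / exp s = scaled_f s - mix y scaled_f s" for s
  proof -
    have "y * scaled_f (s + ln y) = f (exp s * y) / exp s" "(1 - y) * scaled_f (s + ln (1 - y)) = f (exp s * (1 - y)) / exp s"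
      using y1 by (simp_all add: scaled_f_def exp_add)
    then show ?thesis by (simp add: mix_def scaled_f_def diff_divide_distrib)
  qed
  ultimately show ?thesis by simp
qed

text \<open>
  The limit in \<open>mix_scaled_f\<close> must be \<open>a * entropy y\<close>. A nonzero \<open>a\<close> would give \<open>f\<close> a derivative without zeros, but \<open>f\<close> vanishes at 0
  and, by antireflection, at 1/2.
\<close>
lemma f_eq_0_small: "0 < y \<Longrightarrow> y < e0 \<Longrightarrow> f y = 0"
proof -
  have half: "(0::real) < 1/2" "1/2 < e0" "1/2 < (1::real)" using e0_bounds by auto
  define L :: real where "L = ln 2"
  have L: "L > 0" by (simp add: L_def)
  have cont: "continuous_on {..-1} scaled_f"
    unfolding scaled_f_def[abs_def]
  proof (intro continuous_on_divide continuous_on_exp continuous_on_id)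
    show "continuous_on {..-1} (\<lambda>s. f (exp s))"
    proof (rule continuous_at_imp_continuous_on, rule ballI)
      fix s :: real assume "s \<in> {..-1}"
      then have "exp s < exp 0" by (subst exp_less_cancel_iff) simp
      then have "isCont f (exp s)" by (intro f_isCont) auto
      then show "isCont (\<lambda>s. f (exp s)) s" by (rule isCont_o2[OF isCont_exp])
    qed
  qed simp
  have m: "mix (1/2) h = (\<lambda>s. h (s - L))" for h :: "real \<Rightarrow> real"
    by (rule ext) (simp add: mix_def L_def ln_div)
  obtain a where q: "((\<lambda>s. scaled_f s / s) \<longlongrightarrow> a) at_bot"
    using first_difference_growth[OF L cont] mix_scaled_f[OF half(1,2)] unfolding m by blast
  have df: "y * (1 - y) * deriv f y = - a * entropy y" if y: "0 < y" "y < e0" for y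
    using mix_first_order_limit[OF y(1) _ q mix_scaled_f[OF y]] y e0_less by simp
  have f_half: "f (1/2) = 0" using antireflective[of "1/2"] by simp
  define F where "F t = (if t \<le> 0 then 0 else f t)" for t
  have "\<exists>z. 0 < z \<and> z < 1/2 \<and> (F has_real_derivative 0) (at z)"
  proof (rule Rolle)
    show "F 0 = F (1/2)" using f_half by (simp add: F_def)
    have DF: "(F has_real_derivative deriv f t) (at t)" if "0 < t" "t < e0" for t
      by (rule has_field_derivative_transform_within_open[OF f_DERIV[OF that], of "{0<..}"]) (use that in \<open>auto simp: F_def\<close>)
    show "continuous_on {0..1/2} F"
      unfolding continuous_on_eq_continuous_within
    proof
      fix t :: real assume t: "t \<in> {0..1/2}"
      show "continuous (at t within {0..1/2}) F"
      proof (cases "t = 0")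
        case True
        have "(F \<longlongrightarrow> 0) (at_right 0)"
          by (rule Lim_transform_eventually[OF f_tendsto_0])
            (use at_right_eventually[of 1] in \<open>auto simp: F_def elim!: eventually_mono\<close>)
        then show ?thesis using True by (simp add: continuous_within at_within_Icc_at_right F_def)
      next
        case False
        then show ?thesis using DERIV_isCont[OF DF[of t]] t half by (auto intro: continuous_at_imp_continuous_at_within)
      qed
    qed
    show "F differentiable (at t)" if "0 < t" "t < 1/2" for t
      using DF[of t] that half DERIV_imp_differentiable by auto
  qed simp
  then obtain z where z: "0 < z" "z < 1/2" "(F has_real_derivative 0) (at z)" by blast
  have "(f has_real_derivative 0) (at z)"
    by (rule has_field_derivative_transform_within_open[OF z(3), of "{0<..}"]) (use z in \<open>auto simp: F_def\<close>)
  then have "deriv f z = 0" by (rule DERIV_imp_deriv)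
  then have "a * entropy z = 0" using df[of z] z half by simp
  then have "a = 0" using entropy_pos[of z] z by simp
  then have "(f has_real_derivative 0) (at t)" if "0 < t" "t < e0" for t
    using df[OF that] f_DERIV[OF that] that e0_less by simp
  then show "0 < y \<Longrightarrow> y < e0 \<Longrightarrow> f y = 0"
    using zero_derivative_imp_limit[of 0 e0 f y 0] f_tendsto_0 by blast
qed

lemma f_eq_0: "t < 1 \<Longrightarrow> t \<noteq> 0 \<Longrightarrow> f t = 0"
proof -
  have pos: "f t = 0" if "0 < t" "t < 1" for t
  proof (cases "t < e0")
    case False
    then have "0 < 1 - t" "1 - t < e0" using that e0_bounds by auto
    from f_eq_0_small[OF this] show ?thesis using antireflective[OF that] by simp
  qed (use f_eq_0_small that in auto)
  show "t < 1 \<Longrightarrow> t \<noteq> 0 \<Longrightarrow> f t = 0"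
  proof (cases "t > 0")
    case False assume "t \<noteq> 0"
    then have "0 < - t" using False by simp
    from f_neg[OF this] show ?thesis using pos[of "- t / (1 + - t)"] \<open>0 < - t\<close> by (simp add: divide_simps)
  qed (use pos in auto)
qed

text \<open>
  As \<open>g\<close> is constant on either side of 0, \<open>reflection\<close> becomes \<open>9 * g 0 = 0\<close>.
\<close>
lemma vanishes: "t < 1 \<Longrightarrow> g t = 0"
proof -
  have d: "(g has_real_derivative 0) (at t)" if "t < 1" "t \<noteq> 0" for t
    using g_DERIV[OF that] f_eq_0[OF that] by simp
  have lim: "(g \<longlongrightarrow> g 0) (at_right 0)" "(g \<longlongrightarrow> g 0) (at_left 0)"
    using cont0 unfolding isCont_def by (auto intro: tendsto_within_subset)
  have const: "g t = g 0" if "t < 1" for t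
  proof -
    consider "t = 0" | "0 < t" | "t < 0" by linarith
    then show ?thesis
    proof cases
      case 2
      show ?thesis by (rule zero_derivative_imp_limit[of 0 1]) (use d 2 that lim in auto)
    next
      case 3
      show ?thesis by (rule zero_derivative_imp_limit[of "t - 1" 0]) (use d 3 lim in auto)
    qed simp
  qed
  have "g (1/2) = g 0" "g (1 - 1/2) = g 0" "g (- ((1 - 1/2) / (1/2))) = g 0" by (rule const, simp)+
  then have "g 0 = 0" using reflection[of "1/2"] e0_bounds by simp
  then show "t < 1 \<Longrightarrow> g t = 0" using const[of t] by simp
qed

end

section \<open>Classification of the solutions\<close>

lemma kummer_sum_linear:
  "kummer_sum (\<lambda>x. p x - c * (q x - d)) x y = kummer_sum p x y - c * (kummer_sum q x y - 9 * d)"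
  by (simp add: kummer_sum_def algebra_simps)

text \<open>
  The reflection defect of \<open>3 * sv\<close> has the form found in \<open>reflection_defect\<close>, with \<open>a = 1\<close>.
\<close>
lemma theta_sv_reflection:
  assumes "0 < y" "y < 1"
  shows "y * (1 - y) * (theta_sv y + theta_sv (1 - y)) = (entropy y)\<^sup>2"
  using assms by (simp add: theta_sv_def entropy_def field_simps power2_eq_square)

lemma measurable_left_ray:
  fixes h :: "real \<Rightarrow> real"
  assumes "\<And>t. t < 1 \<Longrightarrow> isCont h t"
  shows "h \<in> borel_measurable (lebesgue_on {..<1})"
proof (rule continuous_imp_measurable_on_sets_lebesgue)
  show "continuous_on {..<1} h" using assms by (auto intro: continuous_at_imp_continuous_on)
qed simp

theorem proposition4:
  fixes \<epsilon>0 :: real and F :: "real \<Rightarrow> real"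
  assumes "(sqrt 5 - 1) / 2 < \<epsilon>0" and "\<epsilon>0 < 1"
    and "F \<in> borel_measurable (lebesgue_on {..<1})"
    and "\<And>x y. 0 < x \<Longrightarrow> x < y \<Longrightarrow> y < \<epsilon>0 \<Longrightarrow>
           2 * F x + 2 * F y - F (x / y) + 2 * F ((1 - y) / (1 - x))
           + 2 * F (x * (1 - y) / (y * (1 - x))) - F (x * y)
           + 2 * F (x * (1 - y) / (x - 1)) + 2 * F ((1 - y) / (y * (x - 1)))
           - F (x * (1 - y)\<^sup>2 / (y * (1 - x)\<^sup>2)) = E3 x y"
  shows "(isCont F 0 \<longrightarrow>
            (\<exists>a. \<forall>x<1. F x = Li 3 x + a * (sv_trilog (of_real x) - 2 / 9 * Li 3 1)))
       \<and> (F differentiable (at 0) \<longrightarrow> (\<forall>x<1. F x = Li 3 x))"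
proof -
  have eq: "kummer_sum F x y = E3 x y" if "0 < x" "x < y" "y < \<epsilon>0" for x y
    unfolding kummer_sum_def by (rule assms(4)[OF that])
  have main: "\<exists>a. \<forall>x<1. F x = Li 3 x + a * (sv x - 2 / 9 * Li 3 1)" if cont: "isCont F 0"
  proof -
    \<comment> \<open>in the shape of \<open>kummer_sum_linear\<close>\<close>
    define g where "g x = F x - 1 * (Li 3 x - 0)" for x
    interpret G: kummer_solution g \<epsilon>0
    proof
      show "g \<in> borel_measurable (lebesgue_on {..<1})"
        unfolding g_def[abs_def] using assms(3) measurable_left_ray[of "Li 3"] isCont_Li by simp
      show "isCont g 0" unfolding g_def[abs_def] by (intro continuous_intros cont isCont_Li) simp
      show "kummer_sum g x y = 0" if "0 < x" "x < y" "y < \<epsilon>0" for x y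
        unfolding g_def[abs_def] kummer_sum_linear using eq[OF that] kummer_sum_Li3[of x y] that assms(2) by simp
    qed (rule assms)+
    obtain a where a: "\<And>y. 0 < y \<Longrightarrow> y < 1 \<Longrightarrow> y * (1 - y) * (G.f y + G.f (1 - y)) = a * (entropy y)\<^sup>2"
      using G.reflection_defect by blast
    \<comment> \<open>\<open>theta_sv\<close> belongs to \<open>3 * sv\<close>, and \<open>9 * 2/9 * Li 3 1\<close> is the value in \<open>kummer_sum_sv\<close>\<close>
    define h where "h x = g x - 3 * a * (sv x - 2 / 9 * Li 3 1)" for x
    interpret H: kummer_solution h \<epsilon>0
    proof
      show "h \<in> borel_measurable (lebesgue_on {..<1})"
        unfolding h_def[abs_def] using G.meas measurable_left_ray[of sv] isCont_sv by simp
      show "isCont h 0" unfolding h_def[abs_def] by (intro continuous_intros G.cont0 isCont_sv_0)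
      show "kummer_sum h x y = 0" if "0 < x" "x < y" "y < \<epsilon>0" for x y
        unfolding h_def[abs_def] kummer_sum_linear using G.equation[OF that] kummer_sum_sv[of x y] that assms(2) by simp
    qed (rule assms)+
    have theta: "H.f t = G.f t - a * theta_sv t" if t: "t < 1" "t \<noteq> 0" for t
    proof -
      have "((\<lambda>x. g x - a * (3 * sv x) + a * (2 / 3 * Li 3 1)) has_real_derivative G.f t / t - a * (theta_sv t / t) + 0) (at t)"
        by (intro DERIV_add DERIV_diff DERIV_cmult DERIV_const G.g_DERIV sv_DERIV t)
      moreover have "(\<lambda>x. g x - a * (3 * sv x) + a * (2 / 3 * Li 3 1)) = h"
        by (auto simp: h_def algebra_simps)
      ultimately have "(h has_real_derivative G.f t / t - a * (theta_sv t / t) + 0) (at t)" by simp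
      from DERIV_unique[OF this H.g_DERIV[OF t]] show ?thesis using t by (simp add: field_simps)
    qed
    interpret H: antireflective_kummer_solution h \<epsilon>0
    proof
      fix y :: real assume y: "0 < y" "y < 1"
      have "y * (1 - y) * (H.f y + H.f (1 - y)) = y * (1 - y) * (G.f y + G.f (1 - y)) - a * (y * (1 - y) * (theta_sv y + theta_sv (1 - y)))"
        using y by (simp add: theta algebra_simps)
      also have "\<dots> = 0" unfolding a[OF y] theta_sv_reflection[OF y] by simp
      finally show "H.f (1 - y) = - H.f y" using y by simp
    qed
    have "F x = Li 3 x + 3 * a * (sv x - 2 / 9 * Li 3 1)" if "x < 1" for x
      using H.vanishes[OF that] by (simp add: h_def g_def)
    then show ?thesis by blast
  qed
  have "F x = Li 3 x" if diff: "F differentiable (at 0)" and x: "x < 1" for x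
  proof -
    have "isCont F 0" using diff by (rule differentiable_imp_continuous_within)
    then obtain a where a: "\<And>x. x < 1 \<Longrightarrow> F x = Li 3 x + a * (sv x - 2 / 9 * Li 3 1)" using main by blast
    have "a = 0"
    proof (rule ccontr)
      assume a0: "a \<noteq> 0"
      obtain D1 where D1: "(F has_real_derivative D1) (at 0)" using diff real_differentiable_def by blast
      obtain D2 where D2: "(Li 3 has_real_derivative D2) (at 0)" using Li_differentiable[of 0 3] by auto
      have "((\<lambda>x. 1 / a * (F x - Li 3 x) + 2 / 9 * Li 3 1) has_real_derivative 1 / a * (D1 - D2) + 0) (at 0)"
        by (intro DERIV_add DERIV_diff DERIV_cmult DERIV_const D1 D2)
      then have "((\<lambda>x. sv x) has_real_derivative 1 / a * (D1 - D2) + 0) (at 0)"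
        by (rule has_field_derivative_transform_within_open[of _ _ _ "{..<1}"]) (use a a0 in auto)
      then show False using sv_not_differentiable DERIV_imp_differentiable by blast
    qed
    then show ?thesis using a[OF x] by simp
  qed
  then show ?thesis using main unfolding sv_def by blast
qed

end
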